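(* Assume that: (i) $K_n\to\infty$ and $\lim_{n\to\infty}\frac{\log^9 n}{K_n}=0$; (ii) there is an absolute constant $C>0$ such that $\|u^n\|+\|v^n\|\le C$ for all $n$; (iii) $\liminf_{n\to\infty}|\langle v^n,u^n\rangle|>1$; (iv) (sub-Gaussianity) there is an absolute constant $C'>0$ such that $\mathbb P(|A^n_{11}|\ge t)\le2\exp(-C't^2)$ for all $t\ge0$. Fix $\varepsilon\in\left(0,(\liminf_n|\langle v^n,u^n\rangle|-1)/2\right)$ and let $\sigma^+_\varepsilon(Y^n)=\sigma(Y^n)\cap\{z\in\mathbb C:|z|\ge1+\varepsilon\}$. When the event $\{|\sigma^+_\varepsilon(Y^n)|=1\}$ is realized, let $\lambda_{\max}(Y^n)$ be the unique eigenvalue of $Y^n$ with the largest modulus and let $\tilde u^n$ be a unit-norm right eigenvector of $Y^n$ corresponding to $\lambda_{\max}(Y^n)$; otherwise put $\tilde u^n=0_n$. Then $$\left|\left\langle\tilde u^n,\frac{u^n}{\|u^n\|}\right\rangle\right|^2-\left(1-\frac1{|\langle u^n,v^n\rangle|^2}\right)\to0\quad\text{in probability as } n\to\infty .$$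
   Context: Model. Let $\chi$ be a complex-valued random variable with $\mathbb{E}\chi=0$ and $\mathbb{E}|\chi|^2=1$. For each $n\ge1$, $A^n=(A^n_{ij})_{i,j=1}^n$ is a random matrix with i.i.d. entries distributed as $\chi$. $(K_n)$ is a sequence of positive integers with $K_n\le n$; $B^n=(B^n_{ij})$ is an $n\times n$ matrix with i.i.d. Bernoulli ($\{0,1\}$-valued) entries with $\mathbb P(B^n_{11}=1)=K_n/n$, independent of $A^n$. The matrix $X^n$ has entries $X^n_{ij}=\frac1{\sqrt{K_n}}B^n_{ij}A^n_{ij}$. Let $u^n,v^n\in\mathbb C^n$ be deterministic vectors, $E^n=u^n(v^n)^\star$ (rank-one deformation) and $Y^n=X^n+E^n$. Notation. $\star$ is conjugate transpose, $\langle u,v\rangle=u^\star v$, $\|\cdot\|$ is the Euclidean norm, $\sigma(M)$ is the spectrum of $M$, cardinalities $|\cdot|$ of sets of eigenvalues count (algebraic) multiplicities, and $0_n$ is the zero vector of $\mathbb C^n$. *)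

theory Defs
  imports "HOL-Probability.Probability" "Jordan_Normal_Form.Spectral_Radius"
begin

text \<open>
  \<open>Matrix.vec\<close> is the vector type whose dimension is a natural number, not the type-indexed
  \<open>vec\<close> of \<open>HOL-Analysis\<close>.  Indices run over \<open>0, \<dots>, n - 1\<close>.
\<close>

text \<open>Conjugate-linear in the first argument: \<open>herm_ip x y\<close> is the sum of \<open>cnj (x i) * y i\<close>.\<close>

definition herm_ip :: "complex Matrix.vec \<Rightarrow> complex Matrix.vec \<Rightarrow> complex" where
  "herm_ip x y = y \<bullet>c x"

definition eucl_norm :: "complex Matrix.vec \<Rightarrow> real" where
  "eucl_norm x = sqrt (\<Sum>i<dim_vec x. (cmod (vec_index x i))\<^sup>2)"

definition iid_entries ::
  "'a measure \<Rightarrow> nat \<Rightarrow> (nat \<Rightarrow> nat \<Rightarrow> 'a \<Rightarrow> 'b::topological_space) \<Rightarrow> 'b measure \<Rightarrow> bool" where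
  "iid_entries M n A L \<longleftrightarrow>
     prob_space.indep_vars M (\<lambda>_. borel) (\<lambda>(i, j). A i j) ({..<n} \<times> {..<n}) \<and>
     (\<forall>i<n. \<forall>j<n. distr M borel (A i j) = L)"

definition indep_matrices ::
  "'a measure \<Rightarrow> nat \<Rightarrow> (nat \<Rightarrow> nat \<Rightarrow> 'a \<Rightarrow> 'b::topological_space) \<Rightarrow>
     (nat \<Rightarrow> nat \<Rightarrow> 'a \<Rightarrow> 'b) \<Rightarrow> bool" where
  "indep_matrices M n A B \<longleftrightarrow>
     prob_space.indep_var M
       (\<Pi>\<^sub>M p\<in>{..<n} \<times> {..<n}. borel) (\<lambda>\<omega>. \<lambda>(i, j)\<in>{..<n} \<times> {..<n}. A i j \<omega>)
       (\<Pi>\<^sub>M p\<in>{..<n} \<times> {..<n}. borel) (\<lambda>\<omega>. \<lambda>(i, j)\<in>{..<n} \<times> {..<n}. B i j \<omega>)"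

text \<open>
  The law of a \<open>{0, 1}\<close>-valued Bernoulli variable, on the complex numbers because \<open>indep_var\<close>
  requires both variables to have the same type.
\<close>

definition bernoulli_law :: "real \<Rightarrow> complex measure" where
  "bernoulli_law p = distr (measure_pmf (bernoulli_pmf p)) borel of_bool"

definition sparse_mat ::
  "nat \<Rightarrow> nat \<Rightarrow> (nat \<Rightarrow> nat \<Rightarrow> complex) \<Rightarrow> (nat \<Rightarrow> nat \<Rightarrow> complex) \<Rightarrow> complex mat" where
  "sparse_mat n k b a = Matrix.mat n n (\<lambda>(i, j). of_real (1 / sqrt (real k)) * b i j * a i j)"

definition rank_one_mat ::
  "nat \<Rightarrow> complex Matrix.vec \<Rightarrow> complex Matrix.vec \<Rightarrow> complex mat" where
  "rank_one_mat n u v = Matrix.mat n n (\<lambda>(i, j). vec_index u i * cnj (vec_index v j))"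

text \<open>The elements of a set of eigenvalues are counted with algebraic multiplicity.\<close>

definition eig_count :: "complex mat \<Rightarrow> complex set \<Rightarrow> nat" where
  "eig_count Y S = (\<Sum>z\<in>S. Polynomial.order z (char_poly Y))"

definition outer_spectrum :: "real \<Rightarrow> complex mat \<Rightarrow> complex set" where
  "outer_spectrum \<epsilon> Y = spectrum Y \<inter> {z. cmod z \<ge> 1 + \<epsilon>}"

text \<open>Only used when there is exactly one eigenvalue of largest modulus.\<close>

definition lambda_max :: "complex mat \<Rightarrow> complex" where
  "lambda_max Y = (THE z. z \<in> spectrum Y \<and> (\<forall>w\<in>spectrum Y. w \<noteq> z \<longrightarrow> cmod w < cmod z))"

definition outlier_eigenvector :: "real \<Rightarrow> complex mat \<Rightarrow> complex Matrix.vec \<Rightarrow> bool" where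
  "outlier_eigenvector \<epsilon> Y x \<longleftrightarrow>
     (if eig_count Y (outer_spectrum \<epsilon> Y) = 1
      then eigenvector Y x (lambda_max Y) \<and> eucl_norm x = 1
      else x = 0\<^sub>v (dim_row Y))"

text \<open>
  The \<open>n\<close>-th variable lives on its own probability space \<open>M n\<close>; index \<open>0\<close> is ignored.
  Measurability has to be part of the notion, since \<open>measure\<close> is \<open>0\<close> on non-measurable sets.
\<close>

definition tendsto_in_probability ::
  "(nat \<Rightarrow> 'a measure) \<Rightarrow> (nat \<Rightarrow> 'a \<Rightarrow> 'b::metric_space) \<Rightarrow> 'b \<Rightarrow> bool" where
  "tendsto_in_probability M Z c \<longleftrightarrow>
     (\<forall>n\<ge>1. Z n \<in> borel_measurable (M n)) \<and>
     (\<forall>\<delta>>0. (\<lambda>n. measure (M n) {\<omega> \<in> space (M n). dist (Z n \<omega>) c > \<delta>}) \<longlonglongrightarrow> 0)"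

end

theory Submission
  imports Defs "HOL-Complex_Analysis.Complex_Analysis"
begin

text \<open>Write \<open>X\<close> for the sparse matrix and put \<open>q(z) = det (1 - z X)\<close>. A number \<open>z\<close> with \<open>q(z) \<noteq> 0\<close> is the inverse
  of an eigenvalue of \<open>Y = X + u v\<^sup>\<star>\<close> iff \<open>1 = z \<langle>v, (1 - z X)\<^bsup>-1\<^esup> u\<rangle>\<close>, and then \<open>(1 - z X)\<^bsup>-1\<^esup> u\<close> is an
  eigenvector.

  The coefficients of \<open>q\<close> have second moment at most 1, because distinct terms of their expansions are
  uncorrelated, and counting walks shows that the traces of the first powers of \<open>X\<close> are bounded in
  probability. Since \<open>q\<close> times the exponential of the first power sums is \<open>1 + O(z\<^sup>m)\<close>, the polynomial \<open>q\<close> is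
  bounded away from 0 on every disc of radius less than 1. Together with the same second moment bound for
  the adjugate applied to \<open>u\<close> this gives \<open>\<parallel>X\<^sup>k u\<parallel> \<le> M / r\<^sup>k\<close> for all \<open>k\<close> at once, with no estimate of the norm
  of \<open>X\<close>.

  For fixed \<open>k, l \<ge> 1\<close> counting walks also shows that \<open>\<langle>v, X\<^sup>k u\<rangle>\<close> and \<open>\<langle>u, X\<^sup>k u\<rangle>\<close> tend to 0 and that
  \<open>\<langle>X\<^sup>l u, X\<^sup>k u\<rangle>\<close> tends to \<open>\<parallel>u\<parallel>\<^sup>2\<close> or 0 according as \<open>k = l\<close> or not. So the outlier is close to \<open>\<langle>v, u\<rangle>\<close>, its
  eigenvector \<open>x = \<Sum>\<^sub>k z\<^sup>k X\<^sup>k u\<close> has \<open>\<langle>u, x\<rangle> \<approx> \<parallel>u\<parallel>\<^sup>2\<close> and \<open>\<parallel>x\<parallel>\<^sup>2 \<approx> \<parallel>u\<parallel>\<^sup>2 / (1 - \<bar>z\<bar>\<^sup>2)\<close>, and \<open>\<bar>z\<bar> \<approx> 1 / \<bar>\<langle>v, u\<rangle>\<bar>\<close>.\<close>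

section \<open>Moments of sparse random matrices\<close>

text \<open>For a non-normal \<open>X\<close> the spectral radius does not control the resolvent:
  besides excluding zeros of \<open>q\<close>, the vectors \<open>X ^ k u\<close> have to be
  bounded. Cramer's rule serves both ends, since the coefficients of \<open>q\<close> and of the
  adjugate applied to \<open>u\<close> are sums of square-free monomials, and only a lower bound for
  |q| has to be added. The exponential of finitely many power sums is used instead of log q because
  the latter would presuppose that \<open>q\<close> has no zeros.

  Walks are counted only for finitely many lengths, fixed before n, so the dependence of the
  constants on the length is harmless; the one exception is the number of leading closed walks,
  which enters a series over all lengths.

  Convergence in probability includes measurability of the overlap, although the unit eigenvectors
  are chosen arbitrarily for each outcome. Eigenvalue counts, the outlier and the overlap are
  therefore all described through the matrix entries, without selecting roots or
  eigenvectors.\<close>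

locale sparse_moments = prob_space M for M :: "'a measure" +
  fixes n K :: nat and x :: "nat \<times> nat \<Rightarrow> 'a \<Rightarrow> complex"
    and m :: "nat \<Rightarrow> nat \<Rightarrow> complex" and mu :: "nat \<Rightarrow> real"
  assumes K: "1 \<le> K" "K \<le> n"
    and x_meas: "\<And>e. e \<in> {..<n} \<times> {..<n} \<Longrightarrow> x e \<in> borel_measurable M"
    and mom_int: "\<And>J a b. J \<subseteq> {..<n} \<times> {..<n} \<Longrightarrow>
      integrable M (\<lambda>\<omega>. \<Prod>e\<in>J. x e \<omega> ^ a e * cnj (x e \<omega>) ^ b e)"
    and mom: "\<And>J a b. J \<subseteq> {..<n} \<times> {..<n} \<Longrightarrow>
      (\<integral>\<omega>. (\<Prod>e\<in>J. x e \<omega> ^ a e * cnj (x e \<omega>) ^ b e) \<partial>M) = (\<Prod>e\<in>J. m (a e) (b e))"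
    and m_mean: "m 1 0 = 0" "m 0 1 = 0"
    and m_var: "m 1 1 = 1 / of_nat n"
    and m_bound: "\<And>a b. 2 \<le> a + b \<Longrightarrow> cmod (m a b) \<le> mu (a + b) / (real n * sqrt (real K) ^ (a + b - 2))"
    and mu: "\<And>k. 1 \<le> mu k" "mu 2 = 1"
begin

lemma n_pos: "0 < n" "0 < real n"
  using K by auto

text \<open>Factors are indexed by \<open>Q\<close>, so that repetitions of an entry are the fibres
  of \<open>e\<close>; \<open>c\<close> marks the conjugated factors.\<close>

definition monomial :: "'p set \<Rightarrow> ('p \<Rightarrow> bool) \<Rightarrow> ('p \<Rightarrow> nat \<times> nat) \<Rightarrow> 'a \<Rightarrow> complex" where
  "monomial Q c e \<omega> = (\<Prod>q\<in>Q. if c q then cnj (x (e q) \<omega>) else x (e q) \<omega>)"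

definition fibre :: "'p set \<Rightarrow> ('p \<Rightarrow> 'e) \<Rightarrow> 'e \<Rightarrow> 'p set" where
  "fibre Q e d = {q \<in> Q. e q = d}"

lemma monomial_eq:
  assumes "finite Q"
  shows "monomial Q c e \<omega> =
    (\<Prod>d\<in>e ` Q. x d \<omega> ^ card {q \<in> fibre Q e d. \<not> c q} * cnj (x d \<omega>) ^ card {q \<in> fibre Q e d. c q})"
proof -
  have "monomial Q c e \<omega> =
      (\<Prod>d\<in>e ` Q. \<Prod>q\<in>fibre Q e d. if c q then cnj (x (e q) \<omega>) else x (e q) \<omega>)"
    unfolding monomial_def fibre_def using prod.image_gen[OF assms] by blast
  also have "\<dots> = (\<Prod>d\<in>e ` Q. \<Prod>q\<in>fibre Q e d. if c q then cnj (x d \<omega>) else x d \<omega>)"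
    by (intro prod.cong refl) (auto simp: fibre_def)
  also have "\<dots> = (\<Prod>d\<in>e ` Q. x d \<omega> ^ card {q \<in> fibre Q e d. \<not> c q} * cnj (x d \<omega>) ^ card {q \<in> fibre Q e d. c q})"
  proof (intro prod.cong refl)
    fix d
    have fin: "finite (fibre Q e d)" using assms by (auto simp: fibre_def)
    show "(\<Prod>q\<in>fibre Q e d. if c q then cnj (x d \<omega>) else x d \<omega>) =
       x d \<omega> ^ card {q \<in> fibre Q e d. \<not> c q} * cnj (x d \<omega>) ^ card {q \<in> fibre Q e d. c q}"
      by (subst prod.If_cases[OF fin]) (simp add: Int_def Collect_neg_eq[symmetric] mult.commute)
  qed
  finally show ?thesis .
qed

lemma monomial_integrable:
  assumes "finite Q" "e ` Q \<subseteq> {..<n} \<times> {..<n}"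
  shows "integrable M (monomial Q c e)"
  unfolding monomial_eq[OF assms(1), abs_def] by (rule mom_int[OF assms(2)])

lemma monomial_expectation:
  assumes "finite Q" "e ` Q \<subseteq> {..<n} \<times> {..<n}"
  shows "expectation (monomial Q c e) =
    (\<Prod>d\<in>e ` Q. m (card {q \<in> fibre Q e d. \<not> c q}) (card {q \<in> fibre Q e d. c q}))"
  unfolding monomial_eq[OF assms(1), abs_def] by (rule mom[OF assms(2)])

lemma card_fibre_split:
  assumes "finite Q"
  shows "card {q \<in> fibre Q e d. \<not> c q} + card {q \<in> fibre Q e d. c q} = card (fibre Q e d)"
proof -
  have fin: "finite (fibre Q e d)" using assms by (auto simp: fibre_def)
  show ?thesis
    by (subst card_Un_disjoint[symmetric]) (use fin in \<open>auto intro: arg_cong[where f=card]\<close>)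
qed

lemma sum_card_fibre:
  assumes "finite Q"
  shows "(\<Sum>d\<in>e ` Q. card (fibre Q e d)) = card Q"
  using sum.image_gen[OF assms, of "\<lambda>_. 1::nat" e] by (simp add: fibre_def)

text \<open>An entry that occurs in one factor only contributes its mean, plain or conjugated, and
  both means are 0.\<close>

lemma monomial_single_zero:
  assumes "finite Q" "e ` Q \<subseteq> {..<n} \<times> {..<n}" and q: "q \<in> Q" "card (fibre Q e (e q)) < 2"
  shows "expectation (monomial Q c e) = 0"
proof -
  have fin: "finite (fibre Q e (e q))" using assms by (auto simp: fibre_def)
  have "q \<in> fibre Q e (e q)" using q by (auto simp: fibre_def)
  then have "card (fibre Q e (e q)) = 1"
    using q(2) fin by (metis One_nat_def card_0_eq empty_iff less_2_cases)
  then have "m (card {q' \<in> fibre Q e (e q). \<not> c q'}) (card {q' \<in> fibre Q e (e q). c q'}) = 0"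
    using card_fibre_split[OF assms(1), where e=e and d="e q" and c=c] m_mean
    by (fastforce simp: add_is_1)
  then have "\<exists>d\<in>e ` Q. m (card {q \<in> fibre Q e d. \<not> c q}) (card {q \<in> fibre Q e d. c q}) = 0"
    using q(1) by blast
  then show ?thesis unfolding monomial_expectation[OF assms(1,2)]
    using assms(1) by (intro prod_zero finite_imageI)
qed

text \<open>Since every \<open>mu k\<close> is at least 1, the product dominates each of its
  factors; it stands in for a maximum.\<close>

definition Mu :: "nat \<Rightarrow> real" where "Mu N = (\<Prod>k\<le>N. mu k)"

lemma Mu_ge: "k \<le> N \<Longrightarrow> mu k \<le> Mu N" "1 \<le> Mu N"
proof -
  show one: "1 \<le> Mu N" for N unfolding Mu_def using mu(1) by (intro prod_ge_1) auto
  assume k: "k \<le> N"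
  have "Mu N = mu k * (\<Prod>j\<in>{..N} - {k}. mu j)"
    unfolding Mu_def using k by (subst prod.remove[of _ k]) auto
  moreover have "1 \<le> (\<Prod>j\<in>{..N} - {k}. mu j)" using mu(1) by (intro prod_ge_1) auto
  ultimately show "mu k \<le> Mu N" using mu(1)[of k]
    by (simp add: mult_le_cancel_left1)
qed

text \<open>Every distinct entry gives one factor 1/n, and every use of it beyond the second a
  factor 1 / sqrt K. The uses add up to \<open>card Q\<close>, so the exponents depend only on the
  number of distinct entries.\<close>

lemma monomial_bound_aux:
  assumes fin: "finite Q" and e: "e ` Q \<subseteq> {..<n} \<times> {..<n}"
    and two: "\<And>q. q \<in> Q \<Longrightarrow> 2 \<le> card (fibre Q e (e q))"
  shows "cmod (expectation (monomial Q c e)) \<le>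
     (\<Prod>d\<in>e ` Q. mu (card (fibre Q e d))) / (real n ^ card (e ` Q) * sqrt (real K) ^ (card Q - 2 * card (e ` Q)))"
    and "2 * card (e ` Q) \<le> card Q"
proof -
  have "(\<Sum>d\<in>e ` Q. card (fibre Q e d) - 2) = (\<Sum>d\<in>e ` Q. card (fibre Q e d)) - (\<Sum>d\<in>e ` Q. 2)"
    by (rule sum_subtractf_nat) (use two in auto)
  then have s: "(\<Sum>d\<in>e ` Q. card (fibre Q e d) - 2) = card Q - 2 * card (e ` Q)"
    unfolding sum_card_fibre[OF fin] by simp
  have "(\<Sum>d\<in>e ` Q. 2) \<le> (\<Sum>d\<in>e ` Q. card (fibre Q e d))"
    by (rule sum_mono) (use two in auto)
  then show "2 * card (e ` Q) \<le> card Q" unfolding sum_card_fibre[OF fin] by simp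
  have "cmod (expectation (monomial Q c e)) \<le>
      (\<Prod>d\<in>e ` Q. mu (card (fibre Q e d)) / (real n * sqrt (real K) ^ (card (fibre Q e d) - 2)))"
    unfolding monomial_expectation[OF fin e] prod_norm[symmetric]
  proof (rule prod_mono)
    fix d assume d: "d \<in> e ` Q"
    have "2 \<le> card (fibre Q e d)" using d two by auto
    then show "0 \<le> norm (m (card {q \<in> fibre Q e d. \<not> c q}) (card {q \<in> fibre Q e d. c q})) \<and>
      norm (m (card {q \<in> fibre Q e d. \<not> c q}) (card {q \<in> fibre Q e d. c q}))
         \<le> mu (card (fibre Q e d)) / (real n * sqrt (real K) ^ (card (fibre Q e d) - 2))"
      using m_bound[of "card {q \<in> fibre Q e d. \<not> c q}" "card {q \<in> fibre Q e d. c q}"]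
      unfolding card_fibre_split[OF fin] by simp
  qed
  also have "\<dots> = (\<Prod>d\<in>e ` Q. mu (card (fibre Q e d))) /
      (real n ^ card (e ` Q) * sqrt (real K) ^ (\<Sum>d\<in>e ` Q. card (fibre Q e d) - 2))"
    by (simp add: prod_dividef prod.distrib power_sum)
  finally show "cmod (expectation (monomial Q c e)) \<le>
     (\<Prod>d\<in>e ` Q. mu (card (fibre Q e d))) / (real n ^ card (e ` Q) * sqrt (real K) ^ (card Q - 2 * card (e ` Q)))"
    unfolding s .
qed

lemma monomial_bound:
  assumes fin: "finite Q" and e: "e ` Q \<subseteq> {..<n} \<times> {..<n}"
    and two: "\<And>q. q \<in> Q \<Longrightarrow> 2 \<le> card (fibre Q e (e q))"
  shows "cmod (expectation (monomial Q c e)) \<le>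
     Mu (card Q) ^ card Q / (real n ^ card (e ` Q) * sqrt (real K) ^ (card Q - 2 * card (e ` Q)))"
proof -
  have "(\<Prod>d\<in>e ` Q. mu (card (fibre Q e d))) \<le> (\<Prod>d\<in>e ` Q. Mu (card Q))"
  proof (rule prod_mono)
    fix d assume "d \<in> e ` Q"
    have "card (fibre Q e d) \<le> card Q" by (rule card_mono) (use fin in \<open>auto simp: fibre_def\<close>)
    then show "0 \<le> mu (card (fibre Q e d)) \<and> mu (card (fibre Q e d)) \<le> Mu (card Q)"
      using Mu_ge(1) mu(1) by (meson order_trans zero_le_one)
  qed
  also have "\<dots> = Mu (card Q) ^ card (e ` Q)" by simp
  also have "\<dots> \<le> Mu (card Q) ^ card Q"
    by (intro power_increasing Mu_ge card_image_le fin)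
  finally have "(\<Prod>d\<in>e ` Q. mu (card (fibre Q e d))) \<le> Mu (card Q) ^ card Q" .
  then show ?thesis using monomial_bound_aux(1)[OF fin e two, where c=c] n_pos K
    by (smt (verit) divide_right_mono mult_nonneg_nonneg of_nat_0_le_iff real_sqrt_ge_zero zero_le_power)
qed

text \<open>With all entries used exactly twice, the normalisation \<open>mu 2 = 1\<close> makes the
  constant 1. The sharp constant is what allows second moments to be compared with their
  limits.\<close>

lemma monomial_bound_exact:
  assumes fin: "finite Q" and e: "e ` Q \<subseteq> {..<n} \<times> {..<n}"
    and two: "\<And>q. q \<in> Q \<Longrightarrow> card (fibre Q e (e q)) = 2"
  shows "cmod (expectation (monomial Q c e)) \<le> 1 / real n ^ card (e ` Q)"
    and "2 * card (e ` Q) = card Q"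
proof -
  have "(\<Sum>d\<in>e ` Q. card (fibre Q e d)) = (\<Sum>d\<in>e ` Q. 2)"
    by (rule sum.cong) (use two in auto)
  then show *: "2 * card (e ` Q) = card Q" unfolding sum_card_fibre[OF fin] by simp
  have "(\<Prod>d\<in>e ` Q. mu (card (fibre Q e d))) = 1"
    by (intro prod.neutral) (use two mu in auto)
  then show "cmod (expectation (monomial Q c e)) \<le> 1 / real n ^ card (e ` Q)"
    using monomial_bound_aux(1)[OF fin e, where c=c] two * by (simp add: mult.commute)
qed

text \<open>An entry in the symmetric difference of \<open>S\<close> and \<open>T\<close> occurs
  once and has mean 0; for \<open>S = T\<close> every entry contributes its variance 1/n.\<close>

lemma orthogonal:
  assumes S: "S \<subseteq> {..<n} \<times> {..<n}" and T: "T \<subseteq> {..<n} \<times> {..<n}"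
  shows "expectation (\<lambda>\<omega>. (\<Prod>e\<in>S. x e \<omega>) * cnj (\<Prod>e\<in>T. x e \<omega>)) =
      (if S = T then 1 / of_nat n ^ card S else 0)"
    and "integrable M (\<lambda>\<omega>. (\<Prod>e\<in>S. x e \<omega>) * cnj (\<Prod>e\<in>T. x e \<omega>))"
proof -
  let ?a = "\<lambda>e. if e \<in> S then 1 else 0::nat" and ?b = "\<lambda>e. if e \<in> T then 1 else 0::nat"
  have fin: "finite S" "finite T" using S T by (auto intro: finite_subset)
  have eq: "(\<Prod>e\<in>S. x e \<omega>) * cnj (\<Prod>e\<in>T. x e \<omega>) =
      (\<Prod>e\<in>S \<union> T. x e \<omega> ^ ?a e * cnj (x e \<omega>) ^ ?b e)" for \<omega>
  proof -
    have "(\<Prod>e\<in>S. x e \<omega>) = (\<Prod>e\<in>S \<union> T. x e \<omega> ^ ?a e)"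
      by (rule prod.mono_neutral_cong_left) (use fin in auto)
    moreover have "(\<Prod>e\<in>T. cnj (x e \<omega>)) = (\<Prod>e\<in>S \<union> T. cnj (x e \<omega>) ^ ?b e)"
      by (rule prod.mono_neutral_cong_left) (use fin in auto)
    ultimately show ?thesis by (simp add: prod.distrib)
  qed
  have ST: "S \<union> T \<subseteq> {..<n} \<times> {..<n}" using S T by auto
  show "integrable M (\<lambda>\<omega>. (\<Prod>e\<in>S. x e \<omega>) * cnj (\<Prod>e\<in>T. x e \<omega>))"
    unfolding eq by (rule mom_int[OF ST])
  have E: "expectation (\<lambda>\<omega>. (\<Prod>e\<in>S. x e \<omega>) * cnj (\<Prod>e\<in>T. x e \<omega>)) = (\<Prod>e\<in>S \<union> T. m (?a e) (?b e))"
    unfolding eq by (rule mom[OF ST])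
  show "expectation (\<lambda>\<omega>. (\<Prod>e\<in>S. x e \<omega>) * cnj (\<Prod>e\<in>T. x e \<omega>)) =
      (if S = T then 1 / of_nat n ^ card S else 0)"
  proof (cases "S = T")
    case True
    then have "(\<Prod>e\<in>S \<union> T. m (?a e) (?b e)) = (\<Prod>e\<in>S. 1 / of_nat n)"
      by (intro prod.cong) (use m_var in auto)
    then show ?thesis using E True by (simp add: power_one_over)
  next
    case False
    then obtain e where e: "e \<in> S \<union> T" "\<not> (e \<in> S \<and> e \<in> T)" by blast
    then have "m (?a e) (?b e) = 0" using m_mean by auto
    then have "\<exists>e\<in>S \<union> T. m (?a e) (?b e) = 0" using e(1) by blast
    then have "(\<Prod>e\<in>S \<union> T. m (?a e) (?b e)) = 0"
      using fin by (intro prod_zero finite_UnI)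
    then show ?thesis using E False by simp
  qed
qed

text \<open>Pythagoras: as \<open>ed\<close> is injective, different terms have different edge sets
  and are orthogonal, whatever the coefficients.\<close>

lemma expectation_norm_sum_sq:
  assumes "finite T" and ed: "\<And>t. t \<in> T \<Longrightarrow> ed t \<subseteq> {..<n} \<times> {..<n}" "\<And>t. t \<in> T \<Longrightarrow> card (ed t) = k"
    and inj: "inj_on ed T"
  shows "expectation (\<lambda>\<omega>. (cmod (\<Sum>t\<in>T. c t * (\<Prod>e\<in>ed t. x e \<omega>)))\<^sup>2) = (\<Sum>t\<in>T. (cmod (c t))\<^sup>2) / real n ^ k"
    and "integrable M (\<lambda>\<omega>. (cmod (\<Sum>t\<in>T. c t * (\<Prod>e\<in>ed t. x e \<omega>)))\<^sup>2)"
proof -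
  let ?f = "\<lambda>\<omega>. \<Sum>t\<in>T. \<Sum>s\<in>T. c t * cnj (c s) * ((\<Prod>e\<in>ed t. x e \<omega>) * cnj (\<Prod>e\<in>ed s. x e \<omega>))"
  have eq: "complex_of_real ((cmod (\<Sum>t\<in>T. c t * (\<Prod>e\<in>ed t. x e \<omega>)))\<^sup>2) = ?f \<omega>" for \<omega>
    unfolding complex_norm_square
    by (simp add: sum_product mult_ac)
  have int: "integrable M ?f"
    by (intro Bochner_Integration.integrable_sum integrable_mult_right orthogonal ed)
  have "expectation ?f = (\<Sum>t\<in>T. \<Sum>s\<in>T. c t * cnj (c s) * (if ed t = ed s then 1 / of_nat n ^ card (ed t) else 0))"
    by (simp add: Bochner_Integration.integral_sum Bochner_Integration.integrable_sum
      integrable_mult_right orthogonal ed del: cnj_prod)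
  also have "\<dots> = (\<Sum>t\<in>T. \<Sum>s\<in>T. if t = s then c t * cnj (c s) / of_nat n ^ k else 0)"
    by (intro sum.cong refl) (use inj ed in \<open>auto simp: inj_on_def\<close>)
  also have "\<dots> = (\<Sum>t\<in>T. c t * cnj (c t) / of_nat n ^ k)"
    using assms(1) by (simp add: sum.delta)
  also have "\<dots> = complex_of_real ((\<Sum>t\<in>T. (cmod (c t))\<^sup>2) / real n ^ k)"
    by (simp add: complex_norm_square[symmetric] sum_divide_distrib)
  finally have E: "expectation ?f = complex_of_real ((\<Sum>t\<in>T. (cmod (c t))\<^sup>2) / real n ^ k)" .
  have "integrable M (\<lambda>\<omega>. complex_of_real ((cmod (\<Sum>t\<in>T. c t * (\<Prod>e\<in>ed t. x e \<omega>)))\<^sup>2))"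
    unfolding eq by (rule int)
  then show int2: "integrable M (\<lambda>\<omega>. (cmod (\<Sum>t\<in>T. c t * (\<Prod>e\<in>ed t. x e \<omega>)))\<^sup>2)"
    using complex_of_real_integrable_eq by blast
  have "complex_of_real (expectation (\<lambda>\<omega>. (cmod (\<Sum>t\<in>T. c t * (\<Prod>e\<in>ed t. x e \<omega>)))\<^sup>2)) = expectation ?f"
    unfolding eq[symmetric] by (rule integral_complex_of_real[symmetric])
  then show "expectation (\<lambda>\<omega>. (cmod (\<Sum>t\<in>T. c t * (\<Prod>e\<in>ed t. x e \<omega>)))\<^sup>2) = (\<Sum>t\<in>T. (cmod (c t))\<^sup>2) / real n ^ k"
    unfolding E of_real_eq_iff .
qed

end

section \<open>Walk sums\<close>

text \<open>A walk is a map \<open>w\<close> from positions \<open>P\<close> to indices. Each \<open>q \<in> Q\<close> contributes the matrix entry at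
  \<open>(w q, w (s q))\<close>, and the positions in \<open>R\<close> carry a coordinate of one of the deterministic vectors.\<close>

definition walk_shape :: "'p set \<Rightarrow> 'p set \<Rightarrow> ('p \<Rightarrow> 'p) \<Rightarrow> 'p set \<Rightarrow> bool" where
  "walk_shape P Q s R \<longleftrightarrow> finite P \<and> Q \<subseteq> P \<and> R \<subseteq> P \<and> s ` Q \<subseteq> P \<and> inj_on s Q \<and>
     P - Q \<subseteq> R \<and> P - Q \<subseteq> s ` Q"

definition step_edge :: "('p \<Rightarrow> 'p) \<Rightarrow> ('p \<Rightarrow> nat) \<Rightarrow> 'p \<Rightarrow> nat \<times> nat" where
  "step_edge s w q = (w q, w (s q))"

text \<open>Only the walks satisfying this survive in the limit: every entry is used exactly twice, no two
  different entries leave the same vertex, and the weighted positions are never left. All other walks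
  lose a factor \<open>sqrt K\<close>.\<close>

definition leading :: "'p set \<Rightarrow> ('p \<Rightarrow> 'p) \<Rightarrow> 'p set \<Rightarrow> ('p \<Rightarrow> nat) \<Rightarrow> bool" where
  "leading Q s R w \<longleftrightarrow> (\<forall>q\<in>Q. \<forall>q'\<in>Q. w q = w q' \<longrightarrow> w (s q) = w (s q')) \<and> (\<forall>p\<in>R. w p \<notin> w ` Q) \<and>
     (\<forall>q\<in>Q. card {q' \<in> Q. step_edge s w q' = step_edge s w q} = 2)"

text \<open>Encodes the partition of \<open>P\<close> into positions with the same vertex by sending
  each position to a representative. The choice depends only on the class as a predicate, so walks
  with the same coincidences have literally equal patterns.\<close>

definition pattern :: "'p set \<Rightarrow> ('p \<Rightarrow> nat) \<Rightarrow> 'p \<Rightarrow> 'p" where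
  "pattern P w = (\<lambda>p\<in>P. SOME p'. p' \<in> P \<and> w p' = w p)"

lemma pattern_in: "p \<in> P \<Longrightarrow> pattern P w p \<in> P" and pattern_val: "p \<in> P \<Longrightarrow> w (pattern P w p) = w p"
proof -
  assume p: "p \<in> P"
  then have "\<exists>p'. p' \<in> P \<and> w p' = w p" by blast
  from someI_ex[OF this] p show "pattern P w p \<in> P" "w (pattern P w p) = w p"
    by (auto simp: pattern_def)
qed

lemma pattern_eq_iff:
  assumes "p \<in> P" "p' \<in> P"
  shows "pattern P w p = pattern P w p' \<longleftrightarrow> w p = w p'"
proof
  assume "pattern P w p = pattern P w p'"
  then have "w (pattern P w p) = w (pattern P w p')" by simp
  then show "w p = w p'" unfolding pattern_val[OF assms(1)] pattern_val[OF assms(2)] .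
next
  assume "w p = w p'"
  then show "pattern P w p = pattern P w p'" using assms by (simp add: pattern_def)
qed

lemma pattern_cong:
  assumes "\<And>p p'. p \<in> P \<Longrightarrow> p' \<in> P \<Longrightarrow> w p = w p' \<longleftrightarrow> w' p = w' p'"
  shows "pattern P w = pattern P w'"
proof (rule ext)
  fix p
  show "pattern P w p = pattern P w' p"
  proof (cases "p \<in> P")
    case True
    then have "(\<lambda>p'. p' \<in> P \<and> w p' = w p) = (\<lambda>p'. p' \<in> P \<and> w' p' = w' p)"
      using assms by blast
    then show ?thesis using True by (simp add: pattern_def)
  qed (simp add: pattern_def)
qed

lemma pattern_PiE: "pattern P w \<in> P \<rightarrow>\<^sub>E P"
proof (rule PiE_I)
  fix p assume "p \<in> P"
  then show "pattern P w p \<in> P" by (rule pattern_in)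
qed (simp add: pattern_def)

lemma card_patterns:
  assumes "finite P"
  shows "finite (pattern P ` W)" "card (pattern P ` W) \<le> card P ^ card P"
proof -
  have fin: "finite (P \<rightarrow>\<^sub>E P)" using assms by (intro finite_PiE) auto
  have sub: "pattern P ` W \<subseteq> P \<rightarrow>\<^sub>E P" by (rule image_subsetI) (rule pattern_PiE)
  show "finite (pattern P ` W)" using finite_subset[OF sub fin] .
  show "card (pattern P ` W) \<le> card P ^ card P"
    using card_mono[OF fin sub] assms by (simp add: card_PiE)
qed

text \<open>A walk is determined by its pattern together with its values on the representatives, which
  decouples the sum over the classes of coinciding positions.\<close>

lemma sum_pattern_le:
  fixes a :: "'p \<Rightarrow> nat \<Rightarrow> real"
  assumes P: "finite P" and R: "R \<subseteq> P" and a: "\<And>p i. 0 \<le> a p i"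
    and W: "W \<subseteq> P \<rightarrow>\<^sub>E {..<n}" "\<And>w. w \<in> W \<Longrightarrow> pattern P w = \<rho>"
  shows "(\<Sum>w\<in>W. \<Prod>p\<in>R. a p (w p)) \<le> (\<Prod>c\<in>\<rho> ` P. \<Sum>i<n. \<Prod>p\<in>{p \<in> R. \<rho> p = c}. a p i)"
proof (cases "W = {}")
  case True
  then show ?thesis using a by (auto intro!: prod_nonneg sum_nonneg)
next
  case False
  then obtain w0 where w0: "w0 \<in> W" by blast
  have \<rho>P: "\<rho> ` P \<subseteq> P" using W(2)[OF w0] pattern_in[of _ P w0] by auto
  have finR: "finite R" using P R by (rule rev_finite_subset)
  let ?h = "\<lambda>w. restrict w (\<rho> ` P)"
  let ?F = "\<lambda>y. \<Prod>p\<in>R. a p (y (\<rho> p))"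
  have val: "w p = w (\<rho> p)" if "w \<in> W" "p \<in> P" for w p
    using pattern_val[OF that(2), of w] W(2)[OF that(1)] by simp
  have inj: "inj_on ?h W"
  proof (rule inj_onI)
    fix w w' assume w: "w \<in> W" "w' \<in> W" "?h w = ?h w'"
    show "w = w'"
    proof (rule PiE_ext[of _ P "\<lambda>_. {..<n}"])
      fix p assume p: "p \<in> P"
      have "w (\<rho> p) = w' (\<rho> p)" using fun_cong[OF w(3), of "\<rho> p"] p by simp
      then show "w p = w' p" using val w p by metis
    qed (use w W in auto)
  qed
  have "(\<Sum>w\<in>W. \<Prod>p\<in>R. a p (w p)) = (\<Sum>w\<in>W. ?F (?h w))"
  proof (intro sum.cong refl prod.cong)
    fix w p assume "w \<in> W" "p \<in> R"
    then show "a p (w p) = a p (?h w (\<rho> p))" using val[of w p] R by auto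
  qed
  also have "\<dots> = (\<Sum>y\<in>?h ` W. ?F y)" by (simp add: sum.reindex[OF inj])
  \<comment> \<open>Distinct classes may now share a vertex. This only adds nonnegative terms, and
    it makes the sums over the classes independent.\<close>
  also have "\<dots> \<le> (\<Sum>y\<in>\<rho> ` P \<rightarrow>\<^sub>E {..<n}. ?F y)"
  proof (rule sum_mono2)
    show "finite (\<rho> ` P \<rightarrow>\<^sub>E {..<n})" using P by (intro finite_PiE) auto
    show "?h ` W \<subseteq> \<rho> ` P \<rightarrow>\<^sub>E {..<n}" using W(1) \<rho>P by fastforce
  qed (auto intro!: prod_nonneg a)
  also have "\<dots> = (\<Sum>y\<in>\<rho> ` P \<rightarrow>\<^sub>E {..<n}. \<Prod>c\<in>\<rho> ` P. \<Prod>p\<in>{p \<in> R. \<rho> p = c}. a p (y c))"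
  proof (rule sum.cong[OF refl])
    fix y
    have "?F y = (\<Prod>c\<in>\<rho> ` P. \<Prod>p\<in>{p \<in> R. \<rho> p = c}. a p (y (\<rho> p)))"
      by (rule prod.group[symmetric]) (use P finR R in auto)
    also have "\<dots> = (\<Prod>c\<in>\<rho> ` P. \<Prod>p\<in>{p \<in> R. \<rho> p = c}. a p (y c))"
      by (intro prod.cong) auto
    finally show "?F y = (\<Prod>c\<in>\<rho> ` P. \<Prod>p\<in>{p \<in> R. \<rho> p = c}. a p (y c))" .
  qed
  also have "\<dots> = (\<Prod>c\<in>\<rho> ` P. \<Sum>i<n. \<Prod>p\<in>{p \<in> R. \<rho> p = c}. a p i)"
    by (rule prod_sum_PiE[symmetric]) (use P in auto)
  finally show ?thesis .
qed

text \<open>Growth of the sum over one free vertex at which \<open>r\<close> weights of bounded l2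
  norm sit: n without weight, sqrt n with one weight by Cauchy-Schwarz, bounded with two or
  more.\<close>

definition class_factor :: "nat \<Rightarrow> nat \<Rightarrow> real" where
  "class_factor n r = (if r = 0 then real n else if r = 1 then sqrt (real n) else 1)"

lemma class_sum_le:
  fixes a :: "'p \<Rightarrow> nat \<Rightarrow> real"
  assumes fin: "finite R" and a: "\<And>p i. 0 \<le> a p i" and C: "1 \<le> C"
    and l2: "\<And>p. p \<in> R \<Longrightarrow> (\<Sum>i<n. (a p i)\<^sup>2) \<le> C\<^sup>2"
  shows "(\<Sum>i<n. \<Prod>p\<in>R. a p i) \<le> C ^ card R * class_factor n (card R)"
proof -
  have l2': "L2_set (a p) {..<n} \<le> C" if "p \<in> R" for p
    using l2[OF that] C by (simp add: L2_set_def real_le_lsqrt sum_nonneg)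
  have ub: "a p i \<le> C" if "p \<in> R" "i < n" for p i
  proof -
    have "a p i \<le> L2_set (a p) {..<n}" using member_le_L2_set[of "{..<n}" i "a p"] that a by auto
    then show ?thesis using l2'[OF that(1)] by simp
  qed
  consider "card R = 0" | "card R = 1" | "2 \<le> card R" by linarith
  then show ?thesis
  proof cases
    case 1
    then show ?thesis using fin by (simp add: class_factor_def)
  next
    case 2
    then obtain p where R: "R = {p}" by (auto simp: card_1_singleton_iff)
    have "(\<Sum>i<n. a p i) = (\<Sum>i<n. \<bar>a p i\<bar> * \<bar>1\<bar>)" using a by simp
    also have "\<dots> \<le> L2_set (a p) {..<n} * L2_set (\<lambda>_. 1) {..<n}" by (rule L2_set_mult_ineq)
    also have "\<dots> \<le> C * sqrt (real n)"
      using l2'[of p] R by (simp add: L2_set_def mult_right_mono)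
    finally show ?thesis using R by (simp add: class_factor_def)
  next
    case 3
    then obtain p q where pq: "p \<in> R" "q \<in> R" "p \<noteq> q"
      by (metis One_nat_def Suc_1 card_le_Suc0_iff_eq fin not_less_eq_eq)
    \<comment> \<open>Two of the weights are kept for Cauchy-Schwarz; the others are bounded
      pointwise by their norm.\<close>
    have "(\<Sum>i<n. \<Prod>p\<in>R. a p i) \<le> (\<Sum>i<n. (a p i * a q i) * C ^ (card R - 2))"
    proof (rule sum_mono)
      fix i assume i: "i \<in> {..<n}"
      have "(\<Prod>p\<in>R. a p i) = a p i * (a q i * (\<Prod>r\<in>R - {p} - {q}. a r i))"
        using pq fin by (simp add: prod.remove[of R p] prod.remove[of "R - {p}" q])
      also have "\<dots> \<le> a p i * (a q i * (\<Prod>r\<in>R - {p} - {q}. C))"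
        by (intro mult_left_mono prod_mono a) (use ub i a in auto)
      also have "\<dots> = (a p i * a q i) * C ^ (card R - 2)"
        using pq fin by (simp add: card_Diff_singleton_if numeral_2_eq_2)
      finally show "(\<Prod>p\<in>R. a p i) \<le> (a p i * a q i) * C ^ (card R - 2)" .
    qed
    also have "\<dots> = (\<Sum>i<n. \<bar>a p i\<bar> * \<bar>a q i\<bar>) * C ^ (card R - 2)"
      using a by (simp add: sum_distrib_right)
    also have "\<dots> \<le> (L2_set (a p) {..<n} * L2_set (a q) {..<n}) * C ^ (card R - 2)"
      using C by (intro mult_right_mono L2_set_mult_ineq) auto
    also have "\<dots> \<le> (C * C) * C ^ (card R - 2)"
      using C l2' pq by (intro mult_right_mono mult_mono) (auto simp: L2_set_nonneg)
    also have "\<dots> = C ^ card R" using 3 by (metis le_add_diff_inverse power2_eq_square power_add)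
    finally show ?thesis using 3 by (simp add: class_factor_def)
  qed
qed

text \<open>A class without outgoing edge consists of terminal positions; since its incoming edge is used
  twice, it carries at least two weights and its sum is bounded.\<close>

lemma class_factor_prod:
  assumes sh: "walk_shape P Q s R" and n: "1 \<le> n" and \<rho>: "\<rho> = pattern P w"
    and two: "\<And>q. q \<in> Q \<Longrightarrow> 2 \<le> card {q' \<in> Q. step_edge s w q' = step_edge s w q}"
  shows "(\<Prod>c\<in>\<rho> ` P. class_factor n (card {p \<in> R. \<rho> p = c})) \<le> real n ^ card (w ` Q)"
    and "p \<in> R \<Longrightarrow> w p \<in> w ` Q \<Longrightarrow>
      (\<Prod>c\<in>\<rho> ` P. class_factor n (card {p \<in> R. \<rho> p = c})) \<le> real n ^ card (w ` Q) / sqrt (real n)"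
proof -
  have P: "finite P" "Q \<subseteq> P" "R \<subseteq> P" "s ` Q \<subseteq> P" "inj_on s Q" "P - Q \<subseteq> R" "P - Q \<subseteq> s ` Q"
    using sh by (auto simp: walk_shape_def)
  have fin: "finite R" "finite Q" using P by (auto intro: finite_subset)
  have iff: "\<rho> p = \<rho> p' \<longleftrightarrow> w p = w p'" if "p \<in> P" "p' \<in> P" for p p'
    unfolding \<rho> by (rule pattern_eq_iff[OF that])
  have card: "card (\<rho> ` Q) = card (w ` Q)"
  proof -
    have "bij_betw w (\<rho> ` Q) (w ` Q)"
      unfolding bij_betw_def
    proof
      show "inj_on w (\<rho> ` Q)"
        unfolding \<rho> using P(2) pattern_val[of _ P w] by (auto intro!: inj_onI simp: pattern_eq_iff subset_iff)
      show "w ` \<rho> ` Q = w ` Q"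
        unfolding \<rho> image_image using P(2) pattern_val[of _ P w] by (auto simp: image_iff subset_iff)
    qed
    then show ?thesis by (rule bij_betw_same_card)
  qed
  have sink: "class_factor n (card {p \<in> R. \<rho> p = c}) = 1" if c: "c \<in> \<rho> ` P - \<rho> ` Q" for c
  proof -
    obtain p where p: "p \<in> P" "c = \<rho> p" "p \<notin> Q" using c by blast
    then obtain q where q: "q \<in> Q" "p = s q" using P(7) by blast
    have "\<not> {q' \<in> Q. step_edge s w q' = step_edge s w q} \<subseteq> {q}"
    proof
      assume "{q' \<in> Q. step_edge s w q' = step_edge s w q} \<subseteq> {q}"
      then have "card {q' \<in> Q. step_edge s w q' = step_edge s w q} \<le> 1"
        by (metis card_mono card.empty card_insert_disjoint empty_iff finite.emptyI finite.insertI One_nat_def)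
      then show False using two[OF q(1)] by simp
    qed
    then obtain q' where q': "q' \<in> Q" "q' \<noteq> q" "step_edge s w q' = step_edge s w q" by auto
    \<comment> \<open>Injectivity of \<open>s\<close> turns the second use of the edge into a
      second, different position of the same class.\<close>
    then have sq: "s q' \<noteq> s q" "w (s q') = w (s q)"
      using P(5) q(1) by (auto simp: inj_on_def step_edge_def)
    have sP: "s q' \<in> P" "s q \<in> P" using P(4) q q' by auto
    have "\<rho> (s q') = c" using iff[OF sP] sq p q by simp
    moreover have "s q' \<notin> Q" using calculation c by blast
    ultimately have "{s q', s q} \<subseteq> {p \<in> R. \<rho> p = c}"
      using P(6) sP p q by auto
    moreover have "card {s q', s q} = 2" using sq by simp
    ultimately have "2 \<le> card {p \<in> R. \<rho> p = c}"
      using card_mono[of "{p \<in> R. \<rho> p = c}" "{s q', s q}"] fin by simp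
    then show ?thesis by (simp add: class_factor_def)
  qed
  have split: "(\<Prod>c\<in>\<rho> ` P. class_factor n (card {p \<in> R. \<rho> p = c})) =
      (\<Prod>c\<in>\<rho> ` Q. class_factor n (card {p \<in> R. \<rho> p = c}))"
    by (rule prod.mono_neutral_right) (use P sink in auto)
  have "real n * 1 \<le> real n * real n" using n by (intro mult_left_mono) auto
  then have sq: "sqrt (real n) \<le> real n"
    using real_le_lsqrt[of "real n" "real n"] by (simp add: power2_eq_square)
  have cf: "0 \<le> class_factor n r" "class_factor n r \<le> real n" for r
    using n sq by (auto simp: class_factor_def)
  have "(\<Prod>c\<in>\<rho> ` Q. class_factor n (card {p \<in> R. \<rho> p = c})) \<le> (\<Prod>c\<in>\<rho> ` Q. real n)"
    using cf by (intro prod_mono) auto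
  then show "(\<Prod>c\<in>\<rho> ` P. class_factor n (card {p \<in> R. \<rho> p = c})) \<le> real n ^ card (w ` Q)"
    unfolding split by (simp add: card)
  \<comment> \<open>A weight on a vertex that is left replaces the factor n of that class by sqrt
    n.\<close>
  assume p: "p \<in> R" "w p \<in> w ` Q"
  then obtain q where q: "q \<in> Q" "w p = w q" by blast
  then have \<rho>p: "\<rho> p = \<rho> q" using iff[of p q] P p by blast
  have "{p' \<in> R. \<rho> p' = \<rho> q} \<noteq> {}" using p \<rho>p by auto
  then have "card {p' \<in> R. \<rho> p' = \<rho> q} \<noteq> 0" using fin by (simp add: card_eq_0_iff)
  then have "class_factor n (card {p' \<in> R. \<rho> p' = \<rho> q}) \<le> sqrt (real n)"
    using n by (auto simp: class_factor_def)
  moreover have "(\<Prod>c\<in>\<rho> ` Q - {\<rho> q}. class_factor n (card {p \<in> R. \<rho> p = c})) \<le> (\<Prod>c\<in>\<rho> ` Q - {\<rho> q}. real n)"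
    using cf by (intro prod_mono) auto
  ultimately have "class_factor n (card {p' \<in> R. \<rho> p' = \<rho> q}) *
      (\<Prod>c\<in>\<rho> ` Q - {\<rho> q}. class_factor n (card {p \<in> R. \<rho> p = c})) \<le>
      sqrt (real n) * (\<Prod>c\<in>\<rho> ` Q - {\<rho> q}. real n)"
    using cf(1) by (intro mult_mono prod_nonneg) auto
  moreover have "(\<Prod>c\<in>\<rho> ` Q. class_factor n (card {p \<in> R. \<rho> p = c})) =
     class_factor n (card {p' \<in> R. \<rho> p' = \<rho> q}) * (\<Prod>c\<in>\<rho> ` Q - {\<rho> q}. class_factor n (card {p \<in> R. \<rho> p = c}))"
    using fin q by (intro prod.remove) auto
  ultimately have "(\<Prod>c\<in>\<rho> ` Q. class_factor n (card {p \<in> R. \<rho> p = c})) \<le>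
      sqrt (real n) * (\<Prod>c\<in>\<rho> ` Q - {\<rho> q}. real n)"
    by simp
  also have "\<dots> = sqrt (real n) * real n ^ (card (w ` Q) - 1)"
    using q fin by (simp add: card_Diff_singleton card[symmetric])
  also have "\<dots> = real n ^ card (w ` Q) / sqrt (real n)"
  proof -
    have "card (w ` Q) \<noteq> 0" using q fin by auto
    then obtain k where k: "card (w ` Q) = Suc k" using not0_implies_Suc by blast
    have "sqrt (real n) * sqrt (real n) = real n" by simp
    then show ?thesis using n unfolding k by (simp add: field_simps del: real_sqrt_mult_self)
  qed
  finally show "(\<Prod>c\<in>\<rho> ` P. class_factor n (card {p \<in> R. \<rho> p = c})) \<le> real n ^ card (w ` Q) / sqrt (real n)"
    unfolding split .
qed

lemma card_pattern_image:
  assumes "Q \<subseteq> P"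
  shows "card (pattern P w ` Q) = card (w ` Q)"
proof -
  have "bij_betw w (pattern P w ` Q) (w ` Q)"
    unfolding bij_betw_def
  proof
    show "inj_on w (pattern P w ` Q)"
      using assms pattern_val[of _ P w] by (auto intro!: inj_onI simp: pattern_eq_iff subset_iff)
    show "w ` pattern P w ` Q = w ` Q"
      unfolding image_image using assms pattern_val[of _ P w] by (auto simp: image_iff subset_iff)
  qed
  then show ?thesis by (rule bij_betw_same_card)
qed

section \<open>Non-leading walks\<close>

context sparse_moments
begin

lemma step_edge_in:
  assumes "walk_shape P Q s R" "w \<in> P \<rightarrow>\<^sub>E {..<n}"
  shows "step_edge s w ` Q \<subseteq> {..<n} \<times> {..<n}" "finite Q" "finite R" "finite P"
proof -
  have *: "finite P" "Q \<subseteq> P" "R \<subseteq> P" "s ` Q \<subseteq> P" using assms(1) by (auto simp: walk_shape_def)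
  then show "finite Q" "finite R" "finite P" by (auto intro: finite_subset)
  show "step_edge s w ` Q \<subseteq> {..<n} \<times> {..<n}"
  proof (rule image_subsetI)
    fix q assume "q \<in> Q"
    then have "q \<in> P" "s q \<in> P" using * by auto
    then show "step_edge s w q \<in> {..<n} \<times> {..<n}"
      using PiE_mem[OF assms(2)] by (simp add: step_edge_def)
  qed
qed

lemma sqrt_K: "1 \<le> sqrt (real K)" "sqrt (real K) \<le> sqrt (real n)" "sqrt (real K) \<le> real n"
proof -
  show 1: "1 \<le> sqrt (real K)" "sqrt (real K) \<le> sqrt (real n)" using K by auto
  have "real n * 1 \<le> real n * real n" using K by (intro mult_left_mono) auto
  then have "sqrt (real n) \<le> real n"
    using real_le_lsqrt[of "real n" "real n"] by (simp add: power2_eq_square)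
  then show "sqrt (real K) \<le> real n" using 1 by linarith
qed

text \<open>The \<open>?E\<close> distinct entries give n^-E, and the classes give at most n^N,
  where N \<le> E is the number of vertices that are left. Each violation of \<open>leading\<close>
  leaves a spare factor of at least sqrt K: two entries leaving one vertex make N < E, a weight on a
  vertex that is left turns an n into sqrt n, and a third use of an entry brings a further 1 / sqrt
  K.\<close>

lemma nonleading_term_bound:
  assumes sh: "walk_shape P Q s R" and w: "w \<in> P \<rightarrow>\<^sub>E {..<n}" and nl: "\<not> leading Q s R w"
    and two: "\<And>q. q \<in> Q \<Longrightarrow> 2 \<le> card {q' \<in> Q. step_edge s w q' = step_edge s w q}"
  shows "cmod (expectation (monomial Q c (step_edge s w))) *
      (\<Prod>d\<in>pattern P w ` P. class_factor n (card {p \<in> R. pattern P w p = d}))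
    \<le> Mu (card Q) ^ card Q / sqrt (real K)"
proof -
  note fin = step_edge_in[OF sh w]
  let ?E = "card (step_edge s w ` Q)" and ?N = "card (w ` Q)" and ?T = "Mu (card Q) ^ card Q"
  let ?\<Phi> = "\<Prod>d\<in>pattern P w ` P. class_factor n (card {p \<in> R. pattern P w p = d})"
  let ?j = "card Q - 2 * ?E"
  have n1: "1 \<le> n" using n_pos by simp
  have two': "2 \<le> card (fibre Q (step_edge s w) (step_edge s w q))" if "q \<in> Q" for q
    using two[OF that] by (simp add: fibre_def)
  have b: "cmod (expectation (monomial Q c (step_edge s w))) \<le> ?T / (real n ^ ?E * sqrt (real K) ^ ?j)"
    and E2: "2 * ?E \<le> card Q"
    using monomial_bound[OF fin(2,1) two', where c=c] monomial_bound_aux(2)[OF fin(2,1) two'] by auto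
  have fst: "w ` Q = fst ` step_edge s w ` Q" by (simp add: image_image step_edge_def)
  have NE: "?N \<le> ?E" unfolding fst using fin(2) by (intro card_image_le) auto
  have T: "0 \<le> ?T" using Mu_ge(2)[of "card Q"] by simp
  have \<Phi>0: "0 \<le> ?\<Phi>" by (intro prod_nonneg) (auto simp: class_factor_def)
  have pw: "1 \<le> sqrt (real K) ^ ?j" using sqrt_K by (intro one_le_power) auto
  have nE: "real n ^ ?N \<le> real n ^ ?E" using n1 NE by (intro power_increasing) auto
  have "?\<Phi> * sqrt (real K) \<le> real n ^ ?E * sqrt (real K) ^ ?j"
  proof -
    consider (i) "\<exists>q\<in>Q. \<exists>q'\<in>Q. w q = w q' \<and> w (s q) \<noteq> w (s q')"
      | (ii) "\<exists>p\<in>R. w p \<in> w ` Q"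
      | (iii) "\<exists>q\<in>Q. card {q' \<in> Q. step_edge s w q' = step_edge s w q} \<noteq> 2"
      using nl unfolding leading_def by blast
    then show ?thesis
    proof cases
      case i
      then obtain q q' where q: "q \<in> Q" "q' \<in> Q" "w q = w q'" "w (s q) \<noteq> w (s q')" by blast
      have "?N \<noteq> ?E"
      proof
        assume "?N = ?E"
        then have "inj_on fst (step_edge s w ` Q)" unfolding fst using fin(2) by (intro eq_card_imp_inj_on) auto
        from inj_onD[OF this _ imageI[OF q(1)] imageI[OF q(2)]] q(3)
        have "step_edge s w q = step_edge s w q'" by (simp add: step_edge_def)
        then show False using q by (simp add: step_edge_def)
      qed
      then have "Suc ?N \<le> ?E" using NE by simp
      then have "real n ^ Suc ?N \<le> real n ^ ?E" using n1 by (intro power_increasing) auto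
      have "?\<Phi> * sqrt (real K) \<le> real n ^ ?N * real n"
        using class_factor_prod(1)[OF sh n1 refl two] sqrt_K by (intro mult_mono) auto
      also have "\<dots> \<le> real n ^ ?E * 1" using \<open>real n ^ Suc ?N \<le> real n ^ ?E\<close> by (simp add: mult.commute)
      also have "\<dots> \<le> real n ^ ?E * sqrt (real K) ^ ?j" using pw by (intro mult_left_mono) auto
      finally show ?thesis .
    next
      case ii
      then obtain p where p: "p \<in> R" "w p \<in> w ` Q" by blast
      have "?\<Phi> * sqrt (real K) \<le> (real n ^ ?N / sqrt (real n)) * sqrt (real n)"
        using class_factor_prod(2)[OF sh n1 refl two p] sqrt_K by (intro mult_mono) auto
      also have "\<dots> = real n ^ ?N" using n_pos by simp
      also have "\<dots> \<le> real n ^ ?E * 1" using nE by simp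
      also have "\<dots> \<le> real n ^ ?E * sqrt (real K) ^ ?j" using pw by (intro mult_left_mono) auto
      finally show ?thesis .
    next
      case iii
      have "2 * ?E \<noteq> card Q"
      proof
        assume eq: "2 * ?E = card Q"
        let ?f = "\<lambda>d. card (fibre Q (step_edge s w) d)"
        have "(\<Sum>d\<in>step_edge s w ` Q. ?f d) = (\<Sum>d\<in>step_edge s w ` Q. 2)"
          unfolding sum_card_fibre[OF fin(2)] using eq by simp
        then have "\<And>d. d \<in> step_edge s w ` Q \<Longrightarrow> 2 = ?f d"
          using fin(2) two' by (intro sum_mono_inv[of "\<lambda>_. 2" _ ?f]) auto
        then show False using iii by (auto simp: fibre_def)
      qed
      then have "1 \<le> ?j" using E2 by simp
      then have "sqrt (real K) ^ 1 \<le> sqrt (real K) ^ ?j" using sqrt_K by (intro power_increasing) auto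
      then have "?\<Phi> * sqrt (real K) \<le> real n ^ ?E * sqrt (real K) ^ ?j"
        using class_factor_prod(1)[OF sh n1 refl two] nE by (intro mult_mono) auto
      then show ?thesis .
    qed
  qed
  moreover have pos: "0 < real n ^ ?E * sqrt (real K) ^ ?j" using n_pos K by simp
  ultimately have le: "?\<Phi> / (real n ^ ?E * sqrt (real K) ^ ?j) \<le> 1 / sqrt (real K)"
    using K by (simp add: field_simps)
  have "cmod (expectation (monomial Q c (step_edge s w))) * ?\<Phi> \<le> ?T / (real n ^ ?E * sqrt (real K) ^ ?j) * ?\<Phi>"
    using b \<Phi>0 by (rule mult_right_mono)
  also have "\<dots> = ?T * (?\<Phi> / (real n ^ ?E * sqrt (real K) ^ ?j))" by simp
  also have "\<dots> \<le> ?T * (1 / sqrt (real K))" using le T by (rule mult_left_mono)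
  finally show ?thesis by simp
qed

text \<open>\<open>p ^ p\<close> bounds the number of patterns, the other factors bound the moments
  of \<open>q\<close> entries and the norms of \<open>r\<close> weights. Neither n nor
  \<open>K\<close> enters, so \<open>K\<close> can be taken large after these constants are
  fixed.\<close>

definition walk_const :: "nat \<Rightarrow> nat \<Rightarrow> nat \<Rightarrow> real \<Rightarrow> real" where
  "walk_const p q r C = real (p ^ p) * (Mu q ^ q * C ^ r)"

text \<open>Walks that use some entry only once have expectation 0. The others are grouped by
  pattern: the weights within a pattern sum to at most the product of the class factors, which the
  bound for a single term has already absorbed, and the number of patterns does not depend on
  n.\<close>

lemma nonleading_sum_bound:
  fixes a :: "'p \<Rightarrow> nat \<Rightarrow> real"
  assumes sh: "walk_shape P Q s R" and a: "\<And>p i. 0 \<le> a p i" and C: "1 \<le> C"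
    and l2: "\<And>p. p \<in> R \<Longrightarrow> (\<Sum>i<n. (a p i)\<^sup>2) \<le> C\<^sup>2"
  shows "(\<Sum>w\<in>{w \<in> P \<rightarrow>\<^sub>E {..<n}. \<not> leading Q s R w}.
      cmod (expectation (monomial Q c (step_edge s w))) * (\<Prod>p\<in>R. a p (w p)))
    \<le> walk_const (card P) (card Q) (card R) C / sqrt (real K)"
proof -
  let ?F = "\<lambda>w. cmod (expectation (monomial Q c (step_edge s w))) * (\<Prod>p\<in>R. a p (w p))"
  let ?two = "\<lambda>w. \<forall>q\<in>Q. 2 \<le> card {q' \<in> Q. step_edge s w q' = step_edge s w q}"
  define W where "W = {w \<in> P \<rightarrow>\<^sub>E {..<n}. \<not> leading Q s R w \<and> ?two w}"
  let ?\<Phi> = "\<lambda>\<rho>. \<Prod>d\<in>\<rho> ` P. class_factor n (card {p \<in> R. \<rho> p = d})"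
  let ?T = "Mu (card Q) ^ card Q"
  have P: "finite P" "R \<subseteq> P" "finite R" using sh by (auto simp: walk_shape_def intro: finite_subset)
  have finU: "finite (P \<rightarrow>\<^sub>E {..<n})" using P by (intro finite_PiE) auto
  have finW: "finite W" unfolding W_def using finU by simp
  have "(\<Sum>w\<in>{w \<in> P \<rightarrow>\<^sub>E {..<n}. \<not> leading Q s R w}. ?F w) = (\<Sum>w\<in>W. ?F w)"
  proof (rule sum.mono_neutral_right)
    show "\<forall>w\<in>{w \<in> P \<rightarrow>\<^sub>E {..<n}. \<not> leading Q s R w} - W. ?F w = 0"
    proof
      fix w assume w: "w \<in> {w \<in> P \<rightarrow>\<^sub>E {..<n}. \<not> leading Q s R w} - W"
      then have wP: "w \<in> P \<rightarrow>\<^sub>E {..<n}" by blast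
      have "\<not> ?two w" using w unfolding W_def by blast
      then obtain q where "q \<in> Q" "card {q' \<in> Q. step_edge s w q' = step_edge s w q} < 2"
        by (meson linorder_not_le)
      then have "expectation (monomial Q c (step_edge s w)) = 0"
        using step_edge_in[OF sh wP] by (intro monomial_single_zero[of Q _ q]) (auto simp: fibre_def)
      then show "?F w = 0" by simp
    qed
  qed (use finU in \<open>auto simp: W_def\<close>)
  also have "\<dots> = (\<Sum>\<rho>\<in>pattern P ` W. \<Sum>w\<in>{w \<in> W. pattern P w = \<rho>}. ?F w)"
    by (rule sum.image_gen[OF finW])
  also have "\<dots> \<le> (\<Sum>\<rho>\<in>pattern P ` W. ?T * C ^ card R / sqrt (real K))"
  proof (rule sum_mono)
    fix \<rho> assume "\<rho> \<in> pattern P ` W"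
    let ?W = "{w \<in> W. pattern P w = \<rho>}"
    have \<Phi>: "0 < ?\<Phi> \<rho>" using n_pos by (intro prod_pos) (auto simp: class_factor_def)
    have "(\<Sum>w\<in>?W. ?F w) \<le> (\<Sum>w\<in>?W. ?T / sqrt (real K) / ?\<Phi> \<rho> * (\<Prod>p\<in>R. a p (w p)))"
    proof (rule sum_mono)
      fix w assume w: "w \<in> ?W"
      then have "cmod (expectation (monomial Q c (step_edge s w))) * ?\<Phi> \<rho> \<le> ?T / sqrt (real K)"
        using nonleading_term_bound[OF sh, of w c] by (auto simp: W_def)
      then have "cmod (expectation (monomial Q c (step_edge s w))) \<le> ?T / sqrt (real K) / ?\<Phi> \<rho>"
        unfolding pos_le_divide_eq[OF \<Phi>] .
      then show "?F w \<le> ?T / sqrt (real K) / ?\<Phi> \<rho> * (\<Prod>p\<in>R. a p (w p))"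
        by (rule mult_right_mono) (intro prod_nonneg a ballI)
    qed
    also have "\<dots> = ?T / sqrt (real K) / ?\<Phi> \<rho> * (\<Sum>w\<in>?W. \<Prod>p\<in>R. a p (w p))"
      by (simp add: sum_distrib_left)
    also have "\<dots> \<le> ?T / sqrt (real K) / ?\<Phi> \<rho> * (C ^ card R * ?\<Phi> \<rho>)"
    proof (rule mult_left_mono)
      have "(\<Sum>w\<in>?W. \<Prod>p\<in>R. a p (w p)) \<le> (\<Prod>d\<in>\<rho> ` P. \<Sum>i<n. \<Prod>p\<in>{p \<in> R. \<rho> p = d}. a p i)"
        by (rule sum_pattern_le[OF P(1,2) a]) (auto simp: W_def)
      also have "\<dots> \<le> (\<Prod>d\<in>\<rho> ` P. C ^ card {p \<in> R. \<rho> p = d} * class_factor n (card {p \<in> R. \<rho> p = d}))"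
        by (intro prod_mono conjI sum_nonneg prod_nonneg class_sum_le) (use P a C l2 in auto)
      also have "\<dots> = (\<Prod>d\<in>\<rho> ` P. C ^ card {p \<in> R. \<rho> p = d}) * ?\<Phi> \<rho>" by (rule prod.distrib)
      also have "(\<Prod>d\<in>\<rho> ` P. C ^ card {p \<in> R. \<rho> p = d}) = C ^ (\<Sum>d\<in>\<rho> ` P. card {p \<in> R. \<rho> p = d})"
        by (simp add: power_sum)
      also have "(\<Sum>d\<in>\<rho> ` P. card {p \<in> R. \<rho> p = d}) = card R"
        using sum.group[of R "\<rho> ` P" \<rho> "\<lambda>_. 1::nat"] P by (simp add: image_mono)
      finally show "(\<Sum>w\<in>?W. \<Prod>p\<in>R. a p (w p)) \<le> C ^ card R * ?\<Phi> \<rho>" .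
      show "0 \<le> ?T / sqrt (real K) / ?\<Phi> \<rho>" using \<Phi> Mu_ge(2)[of "card Q"] by simp
    qed
    also have "\<dots> = ?T * C ^ card R / sqrt (real K)" using \<Phi> by simp
    finally show "(\<Sum>w\<in>?W. ?F w) \<le> ?T * C ^ card R / sqrt (real K)" .
  qed
  also have "\<dots> = real (card (pattern P ` W)) * (?T * C ^ card R / sqrt (real K))" by simp
  also have "\<dots> \<le> real (card P ^ card P) * (?T * C ^ card R / sqrt (real K))"
    using card_patterns(2)[OF P(1), of W] Mu_ge(2)[of "card Q"] C
    by (intro mult_right_mono) (auto simp del: of_nat_power)
  finally show ?thesis by (simp add: walk_const_def)
qed

text \<open>In a leading walk an entry is determined by its first vertex, so as many vertices are
  left as there are entries; as each entry is used twice, this is half the number of steps.\<close>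

lemma leading_edges:
  assumes "walk_shape P Q s R" "w \<in> P \<rightarrow>\<^sub>E {..<n}" "leading Q s R w" "card Q = 2 * h"
  shows "card (step_edge s w ` Q) = h" "card (w ` Q) = h"
    "cmod (expectation (monomial Q c (step_edge s w))) \<le> 1 / real n ^ h"
proof -
  note fin = step_edge_in[OF assms(1,2)]
  have two: "card (fibre Q (step_edge s w) (step_edge s w q)) = 2" if "q \<in> Q" for q
    using assms(3) that by (auto simp: leading_def fibre_def)
  show h: "card (step_edge s w ` Q) = h"
    using monomial_bound_exact(2)[OF fin(2,1) two] assms(4) by simp
  show "cmod (expectation (monomial Q c (step_edge s w))) \<le> 1 / real n ^ h"
    using monomial_bound_exact(1)[OF fin(2,1) two] h by simp
  have "w ` Q = fst ` step_edge s w ` Q" by (simp add: image_image step_edge_def)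
  moreover have "inj_on fst (step_edge s w ` Q)"
  proof (rule inj_onI)
    fix d d' assume d: "d \<in> step_edge s w ` Q" "d' \<in> step_edge s w ` Q" "fst d = fst d'"
    then obtain q q' where q: "q \<in> Q" "q' \<in> Q" "d = step_edge s w q" "d' = step_edge s w q'" by blast
    then have "w q = w q'" using d(3) by (simp add: step_edge_def)
    then have "w (s q) = w (s q')" using assms(3) q(1,2) unfolding leading_def by blast
    then show "d = d'" using q \<open>w q = w q'\<close> by (simp add: step_edge_def)
  qed
  ultimately show "card (w ` Q) = h" using h by (simp add: card_image)
qed

text \<open>Without weights every class of coincident positions is a free vertex. A leading walk has
  \<open>h\<close> of them, hence there are at most \<open>n ^ h\<close> walks for each
  pattern.\<close>

lemma card_leading:
  assumes sh: "walk_shape Q Q s {}" and h: "card Q = 2 * h"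
  defines "W \<equiv> {w \<in> Q \<rightarrow>\<^sub>E {..<n}. leading Q s {} w}"
  shows "card W \<le> card (pattern Q ` W) * n ^ h"
proof -
  have fin: "finite Q" using sh by (simp add: walk_shape_def)
  have finW: "finite W" unfolding W_def using fin by (simp add: finite_PiE)
  have "card W = (\<Sum>\<rho>\<in>pattern Q ` W. card {w \<in> W. pattern Q w = \<rho>})"
    using sum.image_gen[OF finW, of "\<lambda>_. 1::nat" "pattern Q"] by simp
  also have "\<dots> \<le> (\<Sum>\<rho>\<in>pattern Q ` W. n ^ h)"
  proof (rule sum_mono)
    fix \<rho> assume "\<rho> \<in> pattern Q ` W"
    then obtain w where w: "w \<in> W" "\<rho> = pattern Q w" by blast
    have "{w \<in> W. pattern Q w = \<rho>} \<subseteq> Q \<rightarrow>\<^sub>E {..<n}" by (auto simp: W_def)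
    from sum_pattern_le[OF fin, where R="{}" and a="\<lambda>_ _. 1" and \<rho>=\<rho>, OF _ _ this]
    have "real (card {w \<in> W. pattern Q w = \<rho>}) \<le> real n ^ card (\<rho> ` Q)" by simp
    also have "card (\<rho> ` Q) = h"
      unfolding w(2) card_pattern_image[OF order.refl]
      by (rule leading_edges(2)[OF sh _ _ h]) (use w in \<open>auto simp: W_def\<close>)
    finally show "card {w \<in> W. pattern Q w = \<rho>} \<le> n ^ h" by (simp flip: of_nat_power)
  qed
  finally show ?thesis by simp
qed

end

section \<open>Second moments by doubling a walk\<close>

definition double_weight :: "'p set \<Rightarrow> (('p \<Rightarrow> nat) \<Rightarrow> complex) \<Rightarrow> (bool \<times> 'p \<Rightarrow> nat) \<Rightarrow> complex" where
  "double_weight P g w = g (\<lambda>p\<in>P. w (False, p)) * cnj (g (\<lambda>p\<in>P. w (True, p)))"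

abbreviation double_succ :: "('p \<Rightarrow> 'p) \<Rightarrow> bool \<times> 'p \<Rightarrow> bool \<times> 'p" where
  "double_succ s \<equiv> map_prod id s"

lemma walk_shape_double:
  assumes "walk_shape P Q s R"
  shows "walk_shape (UNIV \<times> P) (UNIV \<times> Q) (double_succ s) (UNIV \<times> R)"
proof -
  have P: "finite P" "Q \<subseteq> P" "R \<subseteq> P" "s ` Q \<subseteq> P" "inj_on s Q" "P - Q \<subseteq> R" "P - Q \<subseteq> s ` Q"
    using assms by (auto simp: walk_shape_def)
  have "inj_on (double_succ s) (UNIV \<times> Q)"
    using P(5) by (auto simp: inj_on_def)
  moreover have "double_succ s ` (UNIV \<times> Q) = UNIV \<times> s ` Q"
    by (auto simp: image_iff)
  ultimately show ?thesis
    using P unfolding walk_shape_def by (auto simp: finite_cartesian_product)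
qed

lemma card_UNIV_bool_times: "card ((UNIV :: bool set) \<times> A) = 2 * card A"
  by (simp add: card_cartesian_product)

context sparse_moments
begin

definition walk_poly :: "'p set \<Rightarrow> 'p set \<Rightarrow> ('p \<Rightarrow> 'p) \<Rightarrow> ('p \<Rightarrow> bool) \<Rightarrow> (('p \<Rightarrow> nat) \<Rightarrow> complex) \<Rightarrow> 'a \<Rightarrow> complex" where
  "walk_poly P Q s c g \<omega> = (\<Sum>w\<in>P \<rightarrow>\<^sub>E {..<n}. g w * monomial Q c (step_edge s w) \<omega>)"

lemma walk_poly_integrable:
  assumes "walk_shape P Q s R"
  shows "integrable M (walk_poly P Q s c g)"
  unfolding walk_poly_def[abs_def]
  by (intro Bochner_Integration.integrable_sum integrable_mult_right monomial_integrable
      step_edge_in[OF assms])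

lemma walk_poly_expectation:
  assumes "walk_shape P Q s R"
  shows "expectation (walk_poly P Q s c g) = (\<Sum>w\<in>P \<rightarrow>\<^sub>E {..<n}. g w * expectation (monomial Q c (step_edge s w)))"
proof -
  have "integrable M (\<lambda>\<omega>. g w * monomial Q c (step_edge s w) \<omega>)" if "w \<in> P \<rightarrow>\<^sub>E {..<n}" for w
    by (intro integrable_mult_right monomial_integrable step_edge_in[OF assms that])
  then show ?thesis unfolding walk_poly_def[abs_def]
    by (subst Bochner_Integration.integral_sum) auto
qed

text \<open>Keeping \<open>g w \<noteq> 0\<close> in the description of the leading walks preserves
  constraints that are encoded in the weight, such as a common start of two paths.\<close>

lemma walk_poly_split:
  fixes a :: "'p \<Rightarrow> nat \<Rightarrow> real"
  assumes sh: "walk_shape P Q s R" and a: "\<And>p i. 0 \<le> a p i" and C: "1 \<le> C"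
    and l2: "\<And>p. p \<in> R \<Longrightarrow> (\<Sum>i<n. (a p i)\<^sup>2) \<le> C\<^sup>2"
    and g: "\<And>w. w \<in> P \<rightarrow>\<^sub>E {..<n} \<Longrightarrow> cmod (g w) \<le> (\<Prod>p\<in>R. a p (w p))"
  shows "cmod (expectation (walk_poly P Q s c g) -
      (\<Sum>w\<in>{w \<in> P \<rightarrow>\<^sub>E {..<n}. leading Q s R w \<and> g w \<noteq> 0}. g w * expectation (monomial Q c (step_edge s w))))
    \<le> walk_const (card P) (card Q) (card R) C / sqrt (real K)"
proof -
  let ?W = "P \<rightarrow>\<^sub>E {..<n}" and ?t = "\<lambda>w. g w * expectation (monomial Q c (step_edge s w))"
  have fin: "finite ?W" using step_edge_in(4)[OF sh] sh by (auto simp: walk_shape_def intro!: finite_PiE)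
  have "(\<Sum>w\<in>?W. ?t w) = (\<Sum>w\<in>{w \<in> ?W. leading Q s R w}. ?t w) + (\<Sum>w\<in>{w \<in> ?W. \<not> leading Q s R w}. ?t w)"
    by (subst sum.union_disjoint[symmetric]) (use fin in \<open>auto intro!: sum.cong\<close>)
  moreover have "(\<Sum>w\<in>{w \<in> ?W. leading Q s R w}. ?t w) = (\<Sum>w\<in>{w \<in> ?W. leading Q s R w \<and> g w \<noteq> 0}. ?t w)"
    by (rule sum.mono_neutral_right) (use fin in auto)
  ultimately have "expectation (walk_poly P Q s c g) - (\<Sum>w\<in>{w \<in> ?W. leading Q s R w \<and> g w \<noteq> 0}. ?t w)
      = (\<Sum>w\<in>{w \<in> ?W. \<not> leading Q s R w}. ?t w)"
    unfolding walk_poly_expectation[OF sh] by simp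
  also have "cmod \<dots> \<le> (\<Sum>w\<in>{w \<in> ?W. \<not> leading Q s R w}.
      cmod (expectation (monomial Q c (step_edge s w))) * (\<Prod>p\<in>R. a p (w p)))"
  proof (rule sum_norm_le)
    fix w assume "w \<in> {w \<in> ?W. \<not> leading Q s R w}"
    then show "cmod (?t w) \<le> cmod (expectation (monomial Q c (step_edge s w))) * (\<Prod>p\<in>R. a p (w p))"
      using mult_right_mono[OF g[of w], of "cmod (expectation (monomial Q c (step_edge s w)))"]
      by (simp add: norm_mult mult.commute)
  qed
  also have "\<dots> \<le> walk_const (card P) (card Q) (card R) C / sqrt (real K)"
    by (rule nonleading_sum_bound[OF sh a C l2])
  finally show ?thesis .
qed

text \<open>The squared modulus of a walk sum is a walk sum over two tagged copies of the positions.
  The copy tagged \<open>True\<close> belongs to the conjugate, so its conjugation marks are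
  flipped. Estimates of means thereby give second moments.\<close>

lemma walk_poly_double:
  assumes sh: "walk_shape P Q s R"
  shows "walk_poly P Q s c g \<omega> * cnj (walk_poly P Q s c g \<omega>) =
    walk_poly (UNIV \<times> P) (UNIV \<times> Q) (double_succ s) (\<lambda>(b, p). c p \<noteq> b) (double_weight P g) \<omega>"
proof -
  let ?W = "P \<rightarrow>\<^sub>E {..<n}" and ?W2 = "((UNIV :: bool set) \<times> P) \<rightarrow>\<^sub>E {..<n}"
  let ?f = "\<lambda>w. g w * monomial Q c (step_edge s w) \<omega>"
  let ?i = "\<lambda>(w, w'). \<lambda>(b, p)\<in>UNIV \<times> P. if b then w' p else (w p :: nat)"
  let ?j = "\<lambda>w2. (\<lambda>p\<in>P. w2 (False, p), \<lambda>p\<in>P. w2 (True, p))"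
  have P: "finite P" "Q \<subseteq> P" "s ` Q \<subseteq> P" "finite Q" using sh by (auto simp: walk_shape_def intro: finite_subset)
  have mono: "monomial (UNIV \<times> Q) (\<lambda>(b, p). c p \<noteq> b) (step_edge (double_succ s) w2) \<omega> =
      monomial Q c (step_edge s (\<lambda>p\<in>P. w2 (False, p))) \<omega> * cnj (monomial Q c (step_edge s (\<lambda>p\<in>P. w2 (True, p))) \<omega>)" for w2
  proof -
    have "monomial (UNIV \<times> Q) (\<lambda>(b, p). c p \<noteq> b) (step_edge (double_succ s) w2) \<omega> =
       (\<Prod>b\<in>UNIV. \<Prod>q\<in>Q. if c q \<noteq> b then cnj (x (w2 (b, q), w2 (b, s q)) \<omega>) else x (w2 (b, q), w2 (b, s q)) \<omega>)"
      unfolding monomial_def step_edge_def by (subst prod.cartesian_product) (auto intro!: prod.cong)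
    also have "\<dots> = (\<Prod>q\<in>Q. if c q then cnj (x (w2 (False, q), w2 (False, s q)) \<omega>) else x (w2 (False, q), w2 (False, s q)) \<omega>) *
       (\<Prod>q\<in>Q. if c q then x (w2 (True, q), w2 (True, s q)) \<omega> else cnj (x (w2 (True, q), w2 (True, s q)) \<omega>))"
      unfolding UNIV_bool by (auto intro!: prod.cong)
    also have "(\<Prod>q\<in>Q. if c q then cnj (x (w2 (False, q), w2 (False, s q)) \<omega>) else x (w2 (False, q), w2 (False, s q)) \<omega>) =
       monomial Q c (step_edge s (\<lambda>p\<in>P. w2 (False, p))) \<omega>"
      unfolding monomial_def step_edge_def by (intro prod.cong) (use P in auto)
    also have "(\<Prod>q\<in>Q. if c q then x (w2 (True, q), w2 (True, s q)) \<omega> else cnj (x (w2 (True, q), w2 (True, s q)) \<omega>)) =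
       cnj (monomial Q c (step_edge s (\<lambda>p\<in>P. w2 (True, p))) \<omega>)"
      unfolding monomial_def step_edge_def cnj_prod by (intro prod.cong) (use P in auto)
    finally show ?thesis .
  qed
  have "walk_poly P Q s c g \<omega> * cnj (walk_poly P Q s c g \<omega>) = (\<Sum>(w, w')\<in>?W \<times> ?W. ?f w * cnj (?f w'))"
    unfolding walk_poly_def cnj_sum by (simp add: sum_product sum.cartesian_product)
  also have "\<dots> = (\<Sum>w2\<in>?W2. ?f (fst (?j w2)) * cnj (?f (snd (?j w2))))"
  proof (rule sum.reindex_bij_witness[of _ ?j ?i])
    fix ww assume "ww \<in> ?W \<times> ?W"
    then obtain w w' where ww: "ww = (w, w')" "w \<in> ?W" "w' \<in> ?W" by blast
    have "(\<lambda>p\<in>P. ?i ww (False, p)) = w" "(\<lambda>p\<in>P. ?i ww (True, p)) = w'"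
      using ww by (auto simp: fun_eq_iff PiE_def extensional_def)
    then show j: "?j (?i ww) = ww" unfolding ww(1) by simp
    show "?f (fst (?j (?i ww))) * cnj (?f (snd (?j (?i ww)))) = (case ww of (w, w') \<Rightarrow> ?f w * cnj (?f w'))"
      unfolding j by (simp add: case_prod_beta)
    show "?i ww \<in> ?W2" using ww by (auto simp: PiE_def Pi_def extensional_def)
  next
    fix w2 assume w2: "w2 \<in> ?W2"
    then show "?j w2 \<in> ?W \<times> ?W" by auto
    show "?i (?j w2) = w2"
    proof
      fix bp
      show "?i (?j w2) bp = w2 bp"
        using w2 by (cases bp; cases "fst bp") (auto simp: PiE_def extensional_def)
    qed
  qed
  also have "\<dots> = walk_poly (UNIV \<times> P) (UNIV \<times> Q) (double_succ s) (\<lambda>(b, p). c p \<noteq> b) (double_weight P g) \<omega>"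
    unfolding walk_poly_def by (intro sum.cong refl) (simp only: mono double_weight_def fst_conv snd_conv complex_cnj_mult mult_ac)
  finally show ?thesis .
qed

lemma walk_poly_second_moment:
  fixes a :: "'p \<Rightarrow> nat \<Rightarrow> real"
  assumes sh: "walk_shape P Q s R" and a: "\<And>p i. 0 \<le> a p i" and C: "1 \<le> C"
    and l2: "\<And>p. p \<in> R \<Longrightarrow> (\<Sum>i<n. (a p i)\<^sup>2) \<le> C\<^sup>2"
    and g: "\<And>w. w \<in> P \<rightarrow>\<^sub>E {..<n} \<Longrightarrow> cmod (g w) \<le> (\<Prod>p\<in>R. a p (w p))"
  shows "integrable M (\<lambda>\<omega>. (cmod (walk_poly P Q s c g \<omega>))\<^sup>2)"
    and "expectation (\<lambda>\<omega>. (cmod (walk_poly P Q s c g \<omega>))\<^sup>2) \<le>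
      (\<Sum>w\<in>{w \<in> (UNIV \<times> P) \<rightarrow>\<^sub>E {..<n}. leading (UNIV \<times> Q) (double_succ s) (UNIV \<times> R) w \<and> double_weight P g w \<noteq> 0}.
          cmod (double_weight P g w) / real n ^ card Q)
      + walk_const (2 * card P) (2 * card Q) (2 * card R) C / sqrt (real K)"
proof -
  note sh2 = walk_shape_double[OF sh]
  let ?c = "\<lambda>(b, p). c p \<noteq> b" and ?g = "double_weight P g" and ?P = "(UNIV :: bool set) \<times> P"
    and ?Q = "(UNIV :: bool set) \<times> Q" and ?R = "(UNIV :: bool set) \<times> R"
  let ?\<Phi> = "walk_poly ?P ?Q (double_succ s) ?c ?g"
  have sq: "complex_of_real ((cmod (walk_poly P Q s c g \<omega>))\<^sup>2) = ?\<Phi> \<omega>" for \<omega>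
    unfolding complex_norm_square by (rule walk_poly_double[OF sh])
  have R: "finite R" "R \<subseteq> P" using sh by (auto simp: walk_shape_def intro: finite_subset)
  have g2: "cmod (?g w) \<le> (\<Prod>p\<in>?R. a (snd p) (w p))" if w: "w \<in> ?P \<rightarrow>\<^sub>E {..<n}" for w
  proof -
    have b: "cmod (g (\<lambda>p\<in>P. w (b, p))) \<le> (\<Prod>p\<in>R. a p (w (b, p)))" for b
    proof -
      have "(\<lambda>p\<in>P. w (b, p)) \<in> P \<rightarrow>\<^sub>E {..<n}" using w by auto
      from g[OF this] have "cmod (g (\<lambda>p\<in>P. w (b, p))) \<le> (\<Prod>p\<in>R. a p ((\<lambda>p\<in>P. w (b, p)) p))" .
      also have "\<dots> = (\<Prod>p\<in>R. a p (w (b, p)))" by (intro prod.cong) (use R in auto)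
      finally show ?thesis .
    qed
    have "cmod (?g w) \<le> (\<Prod>p\<in>R. a p (w (False, p))) * (\<Prod>p\<in>R. a p (w (True, p)))"
      unfolding double_weight_def norm_mult complex_mod_cnj
      by (intro mult_mono b prod_nonneg) (use a in auto)
    also have "\<dots> = (\<Prod>b\<in>UNIV. \<Prod>p\<in>R. a p (w (b, p)))" by (simp add: UNIV_bool mult.commute)
    also have "\<dots> = (\<Prod>p\<in>?R. a (snd p) (w p))" by (subst prod.cartesian_product) (auto intro!: prod.cong)
    finally show ?thesis .
  qed
  have "integrable M (\<lambda>\<omega>. complex_of_real ((cmod (walk_poly P Q s c g \<omega>))\<^sup>2))"
    unfolding sq by (rule walk_poly_integrable[OF sh2])
  then show "integrable M (\<lambda>\<omega>. (cmod (walk_poly P Q s c g \<omega>))\<^sup>2)"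
    using complex_of_real_integrable_eq by blast
  let ?S = "{w \<in> ?P \<rightarrow>\<^sub>E {..<n}. leading ?Q (double_succ s) ?R w \<and> ?g w \<noteq> 0}"
  let ?L = "\<Sum>w\<in>?S. ?g w * expectation (monomial ?Q ?c (step_edge (double_succ s) w))"
  have "complex_of_real (expectation (\<lambda>\<omega>. (cmod (walk_poly P Q s c g \<omega>))\<^sup>2)) = expectation ?\<Phi>"
    unfolding sq[symmetric] by (rule integral_complex_of_real[symmetric])
  then have "expectation (\<lambda>\<omega>. (cmod (walk_poly P Q s c g \<omega>))\<^sup>2) \<le> cmod (expectation ?\<Phi>)"
    using complex_Re_le_cmod[of "expectation ?\<Phi>"] by (metis Re_complex_of_real)
  also have "\<dots> \<le> cmod ?L + cmod (expectation ?\<Phi> - ?L)"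
    by (rule norm_triangle_sub)
  also have "cmod (expectation ?\<Phi> - ?L) \<le> walk_const (card ?P) (card ?Q) (card ?R) C / sqrt (real K)"
    by (rule walk_poly_split[OF sh2 a C l2 g2]) auto
  \<comment> \<open>The doubled walk has twice \<open>card Q\<close> steps, hence
    \<open>card Q\<close> distinct entries when it is leading.\<close>
  also have "cmod ?L \<le> (\<Sum>w\<in>?S. cmod (?g w) / real n ^ card Q)"
  proof (rule sum_norm_le)
    fix w assume w: "w \<in> ?S"
    then have "cmod (expectation (monomial ?Q ?c (step_edge (double_succ s) w))) \<le> 1 / real n ^ card Q"
      by (intro leading_edges(3)[OF sh2]) (auto simp: card_UNIV_bool_times)
    then show "cmod (?g w * expectation (monomial ?Q ?c (step_edge (double_succ s) w))) \<le> cmod (?g w) / real n ^ card Q"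
      unfolding norm_mult using mult_left_mono[of _ "1 / real n ^ card Q" "cmod (?g w)"] by fastforce
  qed
  finally show "expectation (\<lambda>\<omega>. (cmod (walk_poly P Q s c g \<omega>))\<^sup>2) \<le>
      (\<Sum>w\<in>?S. cmod (?g w) / real n ^ card Q) + walk_const (2 * card P) (2 * card Q) (2 * card R) C / sqrt (real K)"
    by (simp add: card_UNIV_bool_times)
qed

end

section \<open>Bilinear forms of matrix powers and traces\<close>

text \<open>Coordinates of \<open>X ^ k u\<close>, with matrices and vectors as bare functions, so
  that unfolding produces sums over paths.\<close>

fun mat_iter :: "nat \<Rightarrow> (nat \<times> nat \<Rightarrow> complex) \<Rightarrow> (nat \<Rightarrow> complex) \<Rightarrow> nat \<Rightarrow> nat \<Rightarrow> complex" where
  "mat_iter n X u 0 i = u i"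
| "mat_iter n X u (Suc k) i = (\<Sum>j<n. X (i, j) * mat_iter n X u k j)"

lemma mat_iter_shift: "mat_iter n X u (Suc k) i = mat_iter n X (mat_iter n X u (Suc 0)) k i"
  by (induction k arbitrary: i) auto

lemma sum_PiE_atMost_Suc:
  "(\<Sum>p\<in>{..Suc k} \<rightarrow>\<^sub>E {..<n::nat}. f p) = (\<Sum>p\<in>{..k} \<rightarrow>\<^sub>E {..<n}. \<Sum>j<n. f (p(Suc k := j)))"
proof -
  have "{..Suc k} \<rightarrow>\<^sub>E {..<n} = (\<lambda>(j, p). p(Suc k := j)) ` ({..<n} \<times> ({..k} \<rightarrow>\<^sub>E {..<n}))"
    by (subst PiE_insert_eq[symmetric]) (auto simp: atMost_Suc)
  moreover have "inj_on (\<lambda>(j, p). p(Suc k := j)) ({..<n} \<times> ({..k} \<rightarrow>\<^sub>E {..<n}))"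
    by (rule inj_combinator) auto
  ultimately have "(\<Sum>p\<in>{..Suc k} \<rightarrow>\<^sub>E {..<n}. f p) = (\<Sum>(j, p)\<in>{..<n} \<times> ({..k} \<rightarrow>\<^sub>E {..<n}). f (p(Suc k := j)))"
    by (simp add: sum.reindex case_prod_unfold comp_def)
  also have "\<dots> = (\<Sum>j<n. \<Sum>p\<in>{..k} \<rightarrow>\<^sub>E {..<n}. f (p(Suc k := j)))"
    by (simp add: sum.cartesian_product)
  also have "\<dots> = (\<Sum>p\<in>{..k} \<rightarrow>\<^sub>E {..<n}. \<Sum>j<n. f (p(Suc k := j)))" by (rule sum.swap)
  finally show ?thesis .
qed

lemma sum_PiE_atMost_0: "(\<Sum>p\<in>{..0::nat} \<rightarrow>\<^sub>E {..<n::nat}. f (p 0)) = (\<Sum>i<n. f i)"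
  by (rule sum.reindex_bij_witness[of _ "\<lambda>i. \<lambda>t\<in>{..0}. i" "\<lambda>p. p 0"])
     (auto simp: PiE_def extensional_def fun_eq_iff)

text \<open>Induction with \<open>u\<close> arbitrary: peeling off the last step of the path
  replaces \<open>u\<close> by \<open>X u\<close>.\<close>

lemma mat_iter_path_sum:
  "(\<Sum>i<n. h i * mat_iter n X u k i) =
     (\<Sum>p\<in>{..k} \<rightarrow>\<^sub>E {..<n}. h (p 0) * u (p k) * (\<Prod>t<k. X (p t, p (Suc t))))"
proof (induction k arbitrary: u)
  case 0
  show ?case using sum_PiE_atMost_0[of "\<lambda>i. h i * u i" n] by (simp del: atMost_0)
next
  case (Suc k)
  have "(\<Sum>i<n. h i * mat_iter n X u (Suc k) i) = (\<Sum>i<n. h i * mat_iter n X (mat_iter n X u (Suc 0)) k i)"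
    by (simp only: mat_iter_shift[of n X u k])
  also have "\<dots> = (\<Sum>p\<in>{..k} \<rightarrow>\<^sub>E {..<n}. h (p 0) * mat_iter n X u (Suc 0) (p k) * (\<Prod>t<k. X (p t, p (Suc t))))"
    by (rule Suc.IH)
  also have "\<dots> = (\<Sum>p\<in>{..k} \<rightarrow>\<^sub>E {..<n}. \<Sum>j<n. h (p 0) * u j * (X (p k, j) * (\<Prod>t<k. X (p t, p (Suc t)))))"
    by (simp add: sum_distrib_left sum_distrib_right mult_ac)
  also have "\<dots> = (\<Sum>p\<in>{..k} \<rightarrow>\<^sub>E {..<n}. \<Sum>j<n. h ((p(Suc k := j)) 0) * u ((p(Suc k := j)) (Suc k)) *
      (\<Prod>t<Suc k. X ((p(Suc k := j)) t, (p(Suc k := j)) (Suc t))))"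
    by (intro sum.cong refl) (simp add: lessThan_Suc)
  also have "\<dots> = (\<Sum>p\<in>{..Suc k} \<rightarrow>\<^sub>E {..<n}. h (p 0) * u (p (Suc k)) * (\<Prod>t<Suc k. X (p t, p (Suc t))))"
    by (rule sum_PiE_atMost_Suc[symmetric])
  finally show ?case .
qed

lemma mat_iter_eq_path_sum:
  assumes "i < n"
  shows "mat_iter n X u k i =
     (\<Sum>p\<in>{..k} \<rightarrow>\<^sub>E {..<n}. (if p 0 = i then 1 else 0) * u (p k) * (\<Prod>t<k. X (p t, p (Suc t))))"
proof -
  have "mat_iter n X u k i = (\<Sum>j<n. (if j = i then 1 else 0) * mat_iter n X u k j)"
    using assms by (simp add: if_distrib[where f="\<lambda>c. c * _"] sum.delta cong: if_cong)
  then show ?thesis by (simp only: mat_iter_path_sum)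
qed

definition pair_positions :: "nat \<Rightarrow> nat \<Rightarrow> (bool \<times> nat) set" where
  "pair_positions k l = {False} \<times> {..k} \<union> {True} \<times> {..l}"

text \<open>The common start of the two paths is imposed by the weight and not by identifying
  positions, because each position of a walk has one successor. Only the two ends carry coordinates
  of \<open>u\<close>.\<close>

definition pair_weight :: "(nat \<Rightarrow> complex) \<Rightarrow> nat \<Rightarrow> nat \<Rightarrow> (bool \<times> nat \<Rightarrow> nat) \<Rightarrow> complex" where
  "pair_weight u k l w = (if w (False, 0) = w (True, 0) then u (w (False, k)) * cnj (u (w (True, l))) else 0)"

lemma mat_iter_inner_path_sum:
  "(\<Sum>i<n. cnj (mat_iter n X u l i) * mat_iter n X u k i) =
     (\<Sum>w\<in>pair_positions k l \<rightarrow>\<^sub>E {..<n}. pair_weight u k l w *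
        ((\<Prod>t<k. X (w (False, t), w (False, Suc t))) * cnj (\<Prod>t<l. X (w (True, t), w (True, Suc t)))))"
proof -
  let ?W = "\<lambda>k. {..k} \<rightarrow>\<^sub>E {..<n}" and ?P = "pair_positions k l"
  let ?\<Pi> = "\<lambda>k p. \<Prod>t<k. X (p t, p (Suc t))"
  let ?f = "\<lambda>(p, q). (if q 0 = p 0 then 1 else 0) * (u (p k) * cnj (u (q l))) * (?\<Pi> k p * cnj (?\<Pi> l q))"
  let ?i = "\<lambda>(p, q). \<lambda>(b, t)\<in>?P. if b then q t else (p t :: nat)"
  let ?j = "\<lambda>w. (\<lambda>t\<in>{..k}. w (False, t), \<lambda>t\<in>{..l}. w (True, t))"
  have "(\<Sum>i<n. cnj (mat_iter n X u l i) * mat_iter n X u k i) =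
      (\<Sum>p\<in>?W k. cnj (mat_iter n X u l (p 0)) * u (p k) * ?\<Pi> k p)"
    by (rule mat_iter_path_sum)
  also have "\<dots> = (\<Sum>p\<in>?W k. \<Sum>q\<in>?W l. ?f (p, q))"
  proof (rule sum.cong[OF refl])
    fix p assume "p \<in> ?W k"
    then have "p 0 < n" by (auto simp: PiE_iff)
    then show "cnj (mat_iter n X u l (p 0)) * u (p k) * ?\<Pi> k p = (\<Sum>q\<in>?W l. ?f (p, q))"
      unfolding mat_iter_eq_path_sum[OF \<open>p 0 < n\<close>] cnj_sum sum_distrib_right
      by (intro sum.cong refl) auto
  qed
  also have "\<dots> = (\<Sum>pq\<in>?W k \<times> ?W l. ?f pq)" by (simp add: sum.cartesian_product case_prod_beta)
  also have "\<dots> = (\<Sum>w\<in>?P \<rightarrow>\<^sub>E {..<n}. ?f (?j w))"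
  proof (rule sum.reindex_bij_witness[of _ ?j ?i])
    fix pq assume "pq \<in> ?W k \<times> ?W l"
    then obtain p q where pq: "pq = (p, q)" "p \<in> ?W k" "q \<in> ?W l" by blast
    have "(\<lambda>t\<in>{..k}. ?i pq (False, t)) = p" "(\<lambda>t\<in>{..l}. ?i pq (True, t)) = q"
      using pq by (auto simp: fun_eq_iff PiE_def extensional_def pair_positions_def)
    then show j: "?j (?i pq) = pq" unfolding pq(1) by simp
    show "?f (?j (?i pq)) = ?f pq" unfolding j ..
    show "?i pq \<in> ?P \<rightarrow>\<^sub>E {..<n}" using pq by (auto simp: PiE_def Pi_def extensional_def pair_positions_def)
  next
    fix w assume w: "w \<in> ?P \<rightarrow>\<^sub>E {..<n}"
    then show "?j w \<in> ?W k \<times> ?W l" by (auto simp: pair_positions_def)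
    show "?i (?j w) = w"
    proof
      fix bt
      show "?i (?j w) bt = w bt"
        using w by (cases bt; cases "fst bt") (auto simp: PiE_def extensional_def pair_positions_def)
    qed
  qed
  also have "\<dots> = (\<Sum>w\<in>?P \<rightarrow>\<^sub>E {..<n}. pair_weight u k l w *
        ((\<Prod>t<k. X (w (False, t), w (False, Suc t))) * cnj (\<Prod>t<l. X (w (True, t), w (True, Suc t)))))"
    by (intro sum.cong refl) (auto simp: pair_weight_def)
  finally show ?thesis .
qed

lemma sum_PiE_last:
  fixes f :: "nat \<Rightarrow> real"
  assumes "finite T" "k \<in> T"
  shows "(\<Sum>p\<in>T \<rightarrow>\<^sub>E {..<n::nat}. f (p k)) = real n ^ (card T - 1) * (\<Sum>i<n. f i)"
proof -
  have "(\<Sum>p\<in>T \<rightarrow>\<^sub>E {..<n}. f (p k)) = (\<Sum>p\<in>T \<rightarrow>\<^sub>E {..<n}. \<Prod>t\<in>T. if t = k then f (p t) else 1)"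
    using assms by (intro sum.cong refl) (simp add: prod.delta)
  also have "\<dots> = (\<Prod>t\<in>T. \<Sum>i<n. if t = k then f i else 1)"
    by (rule prod_sum_PiE[symmetric]) (use assms in auto)
  also have "\<dots> = (\<Sum>i<n. f i) * (\<Prod>t\<in>T - {k}. \<Sum>i<n. if t = k then f i else 1)"
    using assms by (subst prod.remove[of T k]) auto
  also have "(\<Prod>t\<in>T - {k}. \<Sum>i<n. if t = k then f i else 1) = (\<Prod>t\<in>T - {k}. real n)"
    by (intro prod.cong) auto
  finally show ?thesis using assms by (simp add: card_Diff_singleton mult.commute)
qed

lemma sum_UNION_le_nonneg:
  fixes f :: "'b \<Rightarrow> real"
  assumes "finite D" "\<And>d. d \<in> D \<Longrightarrow> finite (A d)" "\<And>x. 0 \<le> f x"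
  shows "(\<Sum>x\<in>(\<Union>d\<in>D. A d). f x) \<le> (\<Sum>d\<in>D. \<Sum>x\<in>A d. f x)"
  using assms(1,2)
proof (induction rule: finite_induct)
  case (insert d D)
  have "(\<Sum>x\<in>A d \<union> (\<Union>d\<in>D. A d). f x) \<le> (\<Sum>x\<in>A d. f x) + (\<Sum>x\<in>(\<Union>d\<in>D. A d). f x)"
    using insert assms(3) by (subst sum_Un) (auto intro: sum_nonneg)
  then show ?case using insert by simp
qed simp

text \<open>A coincidence \<open>p a = p b\<close> with a < b \<le> k makes position
  \<open>a\<close> redundant. It is never the weighted position \<open>k\<close>, so a full factor n
  is lost; there are at most (k + 1)^2 such pairs.\<close>

lemma sum_non_injective_paths:
  fixes f :: "nat \<Rightarrow> real"
  assumes f: "\<And>i. 0 \<le> f i" and n: "1 \<le> n"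
  shows "(\<Sum>p\<in>{p \<in> {..k} \<rightarrow>\<^sub>E {..<n}. \<not> inj_on p {..k}}. f (p k)) * real n \<le> real ((k + 1)\<^sup>2) * (real n ^ k * (\<Sum>i<n. f i))"
proof -
  let ?W = "{..k} \<rightarrow>\<^sub>E {..<n}"
  let ?D = "{(a, b). a < b \<and> b \<le> k}"
  have finW: "finite ?W" by (intro finite_PiE) auto
  have D: "?D \<subseteq> {..k} \<times> {..k}" by auto
  then have finD: "finite ?D" by (rule finite_subset) auto
  have cD: "card ?D \<le> (k + 1)\<^sup>2"
    using card_mono[OF _ D] by (simp add: card_cartesian_product power2_eq_square)
  have sub: "{p \<in> ?W. \<not> inj_on p {..k}} \<subseteq> (\<Union>d\<in>?D. {p \<in> ?W. p (fst d) = p (snd d)})"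
  proof
    fix p assume p: "p \<in> {p \<in> ?W. \<not> inj_on p {..k}}"
    then obtain a b where ab: "a \<le> k" "b \<le> k" "a \<noteq> b" "p a = p b" by (auto simp: inj_on_def)
    then have "(min a b, max a b) \<in> ?D" "p (min a b) = p (max a b)" by (auto simp: min_def max_def)
    then show "p \<in> (\<Union>d\<in>?D. {p \<in> ?W. p (fst d) = p (snd d)})" using p by fastforce
  qed
  have one: "(\<Sum>p\<in>{p \<in> ?W. p a = p b}. f (p k)) * real n \<le> real n ^ k * (\<Sum>i<n. f i)"
    if ab: "a < b" "b \<le> k" for a b
  proof -
    let ?T = "{..k} - {a}"
    let ?r = "\<lambda>p. restrict p ?T"
    have inj: "inj_on ?r {p \<in> ?W. p a = p b}"
    proof (rule inj_onI)
      fix p q assume pq: "p \<in> {p \<in> ?W. p a = p b}" "q \<in> {p \<in> ?W. p a = p b}" "?r p = ?r q"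
      have eq: "p t = q t" if "t \<in> ?T" for t using fun_cong[OF pq(3), of t] that by simp
      have "p b = q b" using eq[of b] ab by simp
      then have "p a = q a" using pq by simp
      show "p = q"
      proof (rule PiE_ext[of p "{..k}" "\<lambda>_. {..<n}" q])
        fix t assume "t \<in> {..k}"
        then show "p t = q t" using eq[of t] \<open>p a = q a\<close> by (cases "t = a") auto
      qed (use pq in auto)
    qed
    have "(\<Sum>p\<in>{p \<in> ?W. p a = p b}. f (p k)) = (\<Sum>p\<in>{p \<in> ?W. p a = p b}. f (?r p k))"
      using ab by (intro sum.cong) auto
    also have "\<dots> = (\<Sum>p\<in>?r ` {p \<in> ?W. p a = p b}. f (p k))" by (simp add: sum.reindex[OF inj])
    also have "\<dots> \<le> (\<Sum>p\<in>?T \<rightarrow>\<^sub>E {..<n}. f (p k))"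
    proof (rule sum_mono2)
      show "?r ` {p \<in> ?W. p a = p b} \<subseteq> ?T \<rightarrow>\<^sub>E {..<n}"
      proof (rule image_subsetI)
        fix p assume "p \<in> {p \<in> ?W. p a = p b}"
        then show "?r p \<in> ?T \<rightarrow>\<^sub>E {..<n}" by (simp add: restrict_PiE_iff PiE_iff)
      qed
    qed (use f in \<open>auto intro!: finite_PiE\<close>)
    also have "\<dots> = real n ^ (card ?T - 1) * (\<Sum>i<n. f i)" by (rule sum_PiE_last) (use ab in auto)
    also have "card ?T - 1 = k - 1" using ab by simp
    finally have "(\<Sum>p\<in>{p \<in> ?W. p a = p b}. f (p k)) * real n \<le> real n ^ (k - 1) * (\<Sum>i<n. f i) * real n"
      by (rule mult_right_mono) simp
    also have "\<dots> = real n ^ Suc (k - 1) * (\<Sum>i<n. f i)" by simp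
    also have "Suc (k - 1) = k" using ab by simp
    finally show ?thesis .
  qed
  have "(\<Sum>p\<in>{p \<in> ?W. \<not> inj_on p {..k}}. f (p k)) \<le> (\<Sum>p\<in>(\<Union>d\<in>?D. {p \<in> ?W. p (fst d) = p (snd d)}). f (p k))"
    by (rule sum_mono2[OF _ sub]) (use finD finW f in auto)
  also have "\<dots> \<le> (\<Sum>d\<in>?D. \<Sum>p\<in>{p \<in> ?W. p (fst d) = p (snd d)}. f (p k))"
    by (rule sum_UNION_le_nonneg) (use finD finW f in auto)
  finally have "(\<Sum>p\<in>{p \<in> ?W. \<not> inj_on p {..k}}. f (p k)) * real n \<le>
      (\<Sum>d\<in>?D. (\<Sum>p\<in>{p \<in> ?W. p (fst d) = p (snd d)}. f (p k)) * real n)"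
    unfolding sum_distrib_right[symmetric] by (rule mult_right_mono) simp
  also have "\<dots> \<le> (\<Sum>d\<in>?D. real n ^ k * (\<Sum>i<n. f i))"
    by (intro sum_mono) (use one in auto)
  also have "\<dots> = real (card ?D) * (real n ^ k * (\<Sum>i<n. f i))" by simp
  also have "\<dots> \<le> real ((k + 1)\<^sup>2) * (real n ^ k * (\<Sum>i<n. f i))"
    using cD f by (intro mult_right_mono mult_nonneg_nonneg sum_nonneg) (simp_all del: of_nat_power)
  finally show ?thesis .
qed

text \<open>Under the first condition of \<open>leading\<close> a vertex determines the next one, so
  two trajectories that start together stay together.\<close>

lemma flow_eq:
  assumes "\<And>q q'. q \<in> Q \<Longrightarrow> q' \<in> Q \<Longrightarrow> w q = w q' \<Longrightarrow> w (s q) = w (s q')"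
    and "\<And>t. t < j \<Longrightarrow> a t \<in> Q \<and> b t \<in> Q \<and> a (Suc t) = s (a t) \<and> b (Suc t) = s (b t)"
    and "w (a 0) = w (b 0)" and "t \<le> j"
  shows "w (a t) = w (b t)"
  using assms(4)
proof (induction t)
  case (Suc t)
  then have "w (a t) = w (b t)" "t < j" by auto
  then show ?case using assms(1)[of "a t" "b t"] assms(2)[of t] by simp
qed (use assms(3) in simp)

definition pair_steps :: "nat \<Rightarrow> nat \<Rightarrow> (bool \<times> nat) set" where
  "pair_steps k l = {False} \<times> {..<k} \<union> {True} \<times> {..<l}"

definition pair_ends :: "nat \<Rightarrow> nat \<Rightarrow> (bool \<times> nat) set" where
  "pair_ends k l = {(False, k), (True, l)}"

lemma walk_shape_path:
  assumes "1 \<le> k"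
  shows "walk_shape {..k} {..<k} Suc {0, k}"
proof -
  have "{..k} - {..<k} = {k}" by auto
  moreover have "k \<in> Suc ` {..<k}" using assms by (intro image_eqI[of _ _ "k - 1"]) auto
  moreover have "finite {..k}" "{..<k} \<subseteq> {..k}" "{0, k} \<subseteq> {..k}" "Suc ` {..<k} \<subseteq> {..k}" "inj_on Suc {..<k}"
    by auto
  ultimately show ?thesis unfolding walk_shape_def by simp
qed

lemma walk_shape_pair:
  assumes "1 \<le> k" "1 \<le> l"
  shows "walk_shape (pair_positions k l) (pair_steps k l) (map_prod id Suc) (pair_ends k l)"
proof -
  let ?s = "map_prod id Suc :: bool \<times> nat \<Rightarrow> bool \<times> nat"
  have "(False, k) \<in> ?s ` pair_steps k l" 
    by (rule image_eqI[of _ _ "(False, k - 1)"]) (use assms in \<open>auto simp: pair_steps_def\<close>)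
  moreover have "(True, l) \<in> ?s ` pair_steps k l"
    by (rule image_eqI[of _ _ "(True, l - 1)"]) (use assms in \<open>auto simp: pair_steps_def\<close>)
  moreover have "pair_positions k l - pair_steps k l = {(False, k), (True, l)}"
    by (auto simp: pair_positions_def pair_steps_def)
  ultimately have "pair_positions k l - pair_steps k l \<subseteq> ?s ` pair_steps k l" by simp
  moreover have "finite (pair_positions k l)" "pair_steps k l \<subseteq> pair_positions k l" "pair_ends k l \<subseteq> pair_positions k l"
    "?s ` pair_steps k l \<subseteq> pair_positions k l"
    by (auto simp: pair_positions_def pair_steps_def pair_ends_def)
  moreover have "inj_on ?s (pair_steps k l)" by (auto simp: inj_on_def)
  moreover have "pair_positions k l - pair_steps k l \<subseteq> pair_ends k l"
    by (auto simp: pair_positions_def pair_steps_def pair_ends_def)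
  ultimately show ?thesis unfolding walk_shape_def by simp
qed

lemma card_pair:
  "card (pair_positions k l) = k + l + 2" "card (pair_steps k l) = k + l" "card (pair_ends k l) = 2"
  unfolding pair_positions_def pair_steps_def pair_ends_def
  by (subst card_Un_disjoint; force simp: card_cartesian_product)+ simp

section \<open>Bilinear forms and Gram matrix of the iterates\<close>

context sparse_moments
begin

abbreviation iter :: "(nat \<Rightarrow> complex) \<Rightarrow> nat \<Rightarrow> 'a \<Rightarrow> nat \<Rightarrow> complex" where
  "iter u k \<omega> \<equiv> mat_iter n (\<lambda>e. x e \<omega>) u k"

text \<open>The start carries a coordinate of \<open>v\<close> and is left by the first step, which
  a leading walk forbids. So the doubled walk has no leading part, and all that remains is of order
  1 / sqrt K.\<close>

lemma bilinear_second_moment: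
  fixes u v :: "nat \<Rightarrow> complex"
  assumes k: "1 \<le> k" and C: "1 \<le> C" and u: "(\<Sum>i<n. (cmod (u i))\<^sup>2) \<le> C\<^sup>2" and v: "(\<Sum>i<n. (cmod (v i))\<^sup>2) \<le> C\<^sup>2"
  shows "integrable M (\<lambda>\<omega>. (cmod (\<Sum>i<n. cnj (v i) * iter u k \<omega> i))\<^sup>2)"
    and "expectation (\<lambda>\<omega>. (cmod (\<Sum>i<n. cnj (v i) * iter u k \<omega> i))\<^sup>2) \<le>
      walk_const (2 * (k + 1)) (2 * k) 4 C / sqrt (real K)"
proof -
  let ?g = "\<lambda>w. cnj (v (w 0)) * u (w k)" and ?a = "\<lambda>p i. if p = 0 then cmod (v i) else cmod (u i)"
  have eq: "(\<Sum>i<n. cnj (v i) * iter u k \<omega> i) = walk_poly {..k} {..<k} Suc (\<lambda>_. False) ?g \<omega>" for \<omega>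
    unfolding mat_iter_path_sum walk_poly_def monomial_def step_edge_def by simp
  note sh = walk_shape_path[OF k]
  have l2: "(\<Sum>i<n. (?a p i)\<^sup>2) \<le> C\<^sup>2" for p using u v by (cases "p = 0") auto
  have g: "cmod (?g w) \<le> (\<Prod>p\<in>{0, k}. ?a p (w p))" for w
    using k by (simp add: norm_mult)
  have no: "{w \<in> (UNIV \<times> {..k}) \<rightarrow>\<^sub>E {..<n}. leading (UNIV \<times> {..<k}) (double_succ Suc) (UNIV \<times> {0, k}) w \<and> P w} = {}" for P
  proof -
    have "\<not> leading (UNIV \<times> {..<k}) (double_succ Suc) (UNIV \<times> {0, k}) w" for w
    proof
      assume "leading (UNIV \<times> {..<k}) (double_succ Suc) (UNIV \<times> {0, k}) w"
      moreover have "(False, 0) \<in> UNIV \<times> {0, k}" "(False, 0) \<in> UNIV \<times> {..<k}" using k by auto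
      ultimately show False unfolding leading_def by blast
    qed
    then show ?thesis by blast
  qed
  note * = walk_poly_second_moment[OF sh, where a="?a" and g="?g" and c="\<lambda>_. False", OF _ C l2 g]
  show "integrable M (\<lambda>\<omega>. (cmod (\<Sum>i<n. cnj (v i) * iter u k \<omega> i))\<^sup>2)"
    unfolding eq by (rule *(1)) auto
  have "card {0, k} = 2" using k by simp
  then show "expectation (\<lambda>\<omega>. (cmod (\<Sum>i<n. cnj (v i) * iter u k \<omega> i))\<^sup>2) \<le>
      walk_const (2 * (k + 1)) (2 * k) 4 C / sqrt (real K)"
    unfolding eq using *(2) unfolding no by simp
qed

lemma inner_walk_poly:
  "(\<Sum>i<n. cnj (iter u l \<omega> i) * iter u k \<omega> i) =
    walk_poly (pair_positions k l) (pair_steps k l) (map_prod id Suc) fst (pair_weight u k l) \<omega>"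
proof -
  have "monomial (pair_steps k l) fst (step_edge (map_prod id Suc) w) \<omega> =
      (\<Prod>t<k. x (w (False, t), w (False, Suc t)) \<omega>) * cnj (\<Prod>t<l. x (w (True, t), w (True, Suc t)) \<omega>)" for w
  proof -
    have "monomial (pair_steps k l) fst (step_edge (map_prod id Suc) w) \<omega> =
       (\<Prod>(b, t)\<in>{False} \<times> {..<k}. x (w (b, t), w (b, Suc t)) \<omega>) *
       (\<Prod>(b, t)\<in>{True} \<times> {..<l}. cnj (x (w (b, t), w (b, Suc t)) \<omega>))"
      unfolding monomial_def pair_steps_def step_edge_def
      by (subst prod.union_disjoint) (auto intro!: arg_cong2[of _ _ _ _ "(*)"] prod.cong)
    then show ?thesis by (simp flip: prod.cartesian_product)
  qed
  then show ?thesis unfolding mat_iter_inner_path_sum walk_poly_def by simp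
qed

lemma pair_weight_bound:
  "cmod (pair_weight u k l w) \<le> (\<Prod>p\<in>pair_ends k l. cmod (u (w p)))"
  by (auto simp: pair_weight_def pair_ends_def norm_mult)

lemma double_pair_weight_nonzero:
  assumes "double_weight (pair_positions k l) (pair_weight u k l) w \<noteq> 0"
  shows "w (b, (False, 0)) = w (b, (True, 0))"
    and "cmod (double_weight (pair_positions k l) (pair_weight u k l) w) =
      (cmod (u (w (False, (False, k)))) * cmod (u (w (False, (True, l))))) *
      (cmod (u (w (True, (False, k)))) * cmod (u (w (True, (True, l)))))"
proof -
  have nz: "pair_weight u k l (\<lambda>p\<in>pair_positions k l. w (False, p)) \<noteq> 0"
    "pair_weight u k l (\<lambda>p\<in>pair_positions k l. w (True, p)) \<noteq> 0"
    using assms by (auto simp: double_weight_def)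
  have mem: "(False, 0) \<in> pair_positions k l" "(True, 0) \<in> pair_positions k l" "(False, k) \<in> pair_positions k l"
    "(True, l) \<in> pair_positions k l" by (auto simp: pair_positions_def)
  have st: "w (False, (False, 0)) = w (False, (True, 0))" "w (True, (False, 0)) = w (True, (True, 0))"
    using nz mem by (auto simp: pair_weight_def split: if_splits)
  then show "w (b, (False, 0)) = w (b, (True, 0))" by (cases b) auto
  show "cmod (double_weight (pair_positions k l) (pair_weight u k l) w) =
      (cmod (u (w (False, (False, k)))) * cmod (u (w (False, (True, l))))) *
      (cmod (u (w (True, (False, k)))) * cmod (u (w (True, (True, l)))))"
    using st mem by (simp add: double_weight_def pair_weight_def norm_mult)
qed

text \<open>In a leading doubled walk the two paths of each copy have a common start and hence
  coalesce. If one of them is shorter, its weighted end is a vertex that the longer one leaves, a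
  contradiction. If the lengths agree, each copy amounts to a single path, and the sum over all
  pairs of paths gives the square of n^k \<parallel>u\<parallel>^2.\<close>

lemma inner_second_moment:
  fixes u :: "nat \<Rightarrow> complex"
  assumes kl: "1 \<le> k" "1 \<le> l" and C: "1 \<le> C" and u: "(\<Sum>i<n. (cmod (u i))\<^sup>2) \<le> C\<^sup>2"
  shows "integrable M (\<lambda>\<omega>. (cmod (\<Sum>i<n. cnj (iter u l \<omega> i) * iter u k \<omega> i))\<^sup>2)"
    and "expectation (\<lambda>\<omega>. (cmod (\<Sum>i<n. cnj (iter u l \<omega> i) * iter u k \<omega> i))\<^sup>2) \<le>
      (if k = l then (\<Sum>i<n. (cmod (u i))\<^sup>2)\<^sup>2 else 0) +
      walk_const (2 * (k + l + 2)) (2 * (k + l)) 4 C / sqrt (real K)"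
proof -
  let ?P = "pair_positions k l" and ?Q = "pair_steps k l" and ?R = "pair_ends k l" and ?g = "pair_weight u k l"
  let ?s = "map_prod id Suc :: bool \<times> nat \<Rightarrow> bool \<times> nat"
  let ?P2 = "(UNIV :: bool set) \<times> ?P" and ?Q2 = "(UNIV :: bool set) \<times> ?Q" and ?R2 = "(UNIV :: bool set) \<times> ?R"
  let ?S = "{w \<in> ?P2 \<rightarrow>\<^sub>E {..<n}. leading ?Q2 (double_succ ?s) ?R2 w \<and> double_weight ?P ?g w \<noteq> 0}"
  note sh = walk_shape_pair[OF kl]
  note * = walk_poly_second_moment[OF sh, where a="\<lambda>p i. cmod (u i)" and g="?g" and c=fst, OF _ C u pair_weight_bound]
  show "integrable M (\<lambda>\<omega>. (cmod (\<Sum>i<n. cnj (iter u l \<omega> i) * iter u k \<omega> i))\<^sup>2)"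
    unfolding inner_walk_poly by (rule *(1)) auto
  have coal: "w (b, (False, t)) = w (b, (True, t))" if w: "w \<in> ?S" and t: "t \<le> min k l" for w b t
  proof (rule flow_eq[where Q="?Q2" and w=w and s="double_succ ?s" and a="\<lambda>t. (b, (False, t))" and b="\<lambda>t. (b, (True, t))" and j="min k l"])
    show "w (b, (False, 0)) = w (b, (True, 0))" using w double_pair_weight_nonzero(1) by blast
    show "w (double_succ ?s q) = w (double_succ ?s q')" if "q \<in> ?Q2" "q' \<in> ?Q2" "w q = w q'" for q q'
      using w that unfolding leading_def by blast
  qed (use t in \<open>auto simp: pair_steps_def\<close>)
  have "(\<Sum>w\<in>?S. cmod (double_weight ?P ?g w) / real n ^ card ?Q) \<le> (if k = l then (\<Sum>i<n. (cmod (u i))\<^sup>2)\<^sup>2 else 0)"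
  proof (cases "k = l")
    case False
    have "?S = {}"
    proof (rule ccontr)
      assume "?S \<noteq> {}"
      then obtain w where w: "w \<in> ?S" by blast
      have noR: "w p \<notin> w ` ?Q2" if "p \<in> ?R2" for p using w that unfolding leading_def by blast
      show False
      proof (cases "l < k")
        case True
        then have "(False, (False, l)) \<in> ?Q2" "(False, (True, l)) \<in> ?R2" by (auto simp: pair_steps_def pair_ends_def)
        then show False using noR[of "(False, (True, l))"] coal[OF w, of l False] True
          by (metis image_eqI min.strict_order_iff order.strict_implies_order min.commute order_refl)
      next
        case lk: False
        then have "(False, (True, k)) \<in> ?Q2" "(False, (False, k)) \<in> ?R2" using False by (auto simp: pair_steps_def pair_ends_def)
        then show False using noR[of "(False, (False, k))"] coal[OF w, of k False] lk
          by (metis image_eqI min_def not_le_imp_less order.strict_implies_order order_refl)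
      qed
    qed
    then show ?thesis using False by simp
  next
    case True
    let ?W = "{..k} \<rightarrow>\<^sub>E {..<n}"
    let ?h = "\<lambda>w :: bool \<times> bool \<times> nat \<Rightarrow> nat. (\<lambda>t\<in>{..k}. w (False, (False, t)), \<lambda>t\<in>{..k}. w (True, (False, t)))"
    let ?f = "\<lambda>(p, q). (cmod (u (p k)))\<^sup>2 * (cmod (u (q k)))\<^sup>2"
    have inj: "inj_on ?h ?S"
    proof (rule inj_onI)
      fix w w' assume w: "w \<in> ?S" "w' \<in> ?S" and h: "?h w = ?h w'"
      have eq: "w (b, (False, t)) = w' (b, (False, t))" if "t \<le> k" for b t
        using fun_cong[OF arg_cong[OF h, of fst], of t] fun_cong[OF arg_cong[OF h, of snd], of t] that
        by (cases b) auto
      show "w = w'"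
      proof (rule PiE_ext[of w ?P2 "\<lambda>_. {..<n}" w'])
        fix p assume "p \<in> ?P2"
        then obtain b b' t where p: "p = (b, (b', t))" "t \<le> k" using True by (auto simp: pair_positions_def)
        have "w (b, (False, t)) = w (b, (True, t))" "w' (b, (False, t)) = w' (b, (True, t))"
          using coal[OF w(1), of t b] coal[OF w(2), of t b] p(2) True by auto
        then show "w p = w' p" using eq[OF p(2), of b] p(1) by (cases b') auto
      qed (use w in auto)
    qed
    have "(\<Sum>w\<in>?S. cmod (double_weight ?P ?g w)) = (\<Sum>w\<in>?S. ?f (?h w))"
    proof (rule sum.cong[OF refl])
      fix w assume w: "w \<in> ?S"
      have e: "w (b, (True, k)) = w (b, (False, k))" for b using coal[OF w, of k b] True by simp
      show "cmod (double_weight ?P ?g w) = ?f (?h w)"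
        using double_pair_weight_nonzero(2)[of k l u w] w e True by (simp add: power2_eq_square)
    qed
    also have "\<dots> = (\<Sum>pq\<in>?h ` ?S. ?f pq)" by (simp add: sum.reindex[OF inj])
    also have "\<dots> \<le> (\<Sum>pq\<in>?W \<times> ?W. ?f pq)"
    proof (rule sum_mono2)
      show "finite (?W \<times> ?W)" by (intro finite_cartesian_product finite_PiE) auto
      show "?h ` ?S \<subseteq> ?W \<times> ?W"
      proof (rule image_subsetI)
        fix w assume "w \<in> ?S"
        then have w: "w \<in> ?P2 \<rightarrow>\<^sub>E {..<n}" by blast
        have "w (b, (False, t)) < n" if "t \<le> k" for b t
          using PiE_mem[OF w, of "(b, (False, t))"] that by (simp add: pair_positions_def)
        then show "?h w \<in> ?W \<times> ?W" by simp
      qed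
    qed auto
    also have "\<dots> = (\<Sum>p\<in>?W. (cmod (u (p k)))\<^sup>2) * (\<Sum>q\<in>?W. (cmod (u (q k)))\<^sup>2)"
      by (simp add: sum_product sum.cartesian_product)
    also have "(\<Sum>p\<in>?W. (cmod (u (p k)))\<^sup>2) = real n ^ k * (\<Sum>i<n. (cmod (u i))\<^sup>2)"
      using sum_PiE_last[of "{..k}" k "\<lambda>i. (cmod (u i))\<^sup>2" n] by simp
    finally have "(\<Sum>w\<in>?S. cmod (double_weight ?P ?g w)) \<le>
        (real n ^ k * (\<Sum>i<n. (cmod (u i))\<^sup>2)) * (real n ^ k * (\<Sum>i<n. (cmod (u i))\<^sup>2))" .
    then have "(\<Sum>w\<in>?S. cmod (double_weight ?P ?g w)) \<le> (real n ^ k * (\<Sum>i<n. (cmod (u i))\<^sup>2))\<^sup>2"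
      unfolding power2_eq_square[of "real n ^ k * (\<Sum>i<n. (cmod (u i))\<^sup>2)"] .
    then have "(\<Sum>w\<in>?S. cmod (double_weight ?P ?g w)) / real n ^ (2 * k) \<le> (real n ^ k * (\<Sum>i<n. (cmod (u i))\<^sup>2))\<^sup>2 / real n ^ (2 * k)"
      by (rule divide_right_mono) simp
    also have "\<dots> = (\<Sum>i<n. (cmod (u i))\<^sup>2)\<^sup>2"
      using n_pos by (simp add: power_mult_distrib power_mult[symmetric] mult.commute)
    finally show ?thesis using True by (simp add: card_pair sum_divide_distrib mult_2)
  qed
  then show "expectation (\<lambda>\<omega>. (cmod (\<Sum>i<n. cnj (iter u l \<omega> i) * iter u k \<omega> i))\<^sup>2) \<le>
      (if k = l then (\<Sum>i<n. (cmod (u i))\<^sup>2)\<^sup>2 else 0) +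
      walk_const (2 * (k + l + 2)) (2 * (k + l)) 4 C / sqrt (real K)"
    unfolding inner_walk_poly using *(2) by (simp add: card_pair)
qed

text \<open>A lower bound for the mean suffices, because the upper bound for the second moment
  already has the right limit. Injective paths, each taken in both copies, give leading walks whose
  contributions add up to \<open>S\<close>, except for the share of the non-injective paths, which
  is of order 1/n.\<close>

lemma inner_mean_lower:
  fixes u :: "nat \<Rightarrow> complex"
  assumes k: "1 \<le> k" and C: "1 \<le> C" and u: "(\<Sum>i<n. (cmod (u i))\<^sup>2) \<le> C\<^sup>2"
  defines "S \<equiv> (\<Sum>i<n. (cmod (u i))\<^sup>2)"
  shows "S - (C\<^sup>2 * real ((k + 1)\<^sup>2) + walk_const (2 * k + 2) (2 * k) 2 C) / sqrt (real K)
      \<le> Re (expectation (\<lambda>\<omega>. \<Sum>i<n. cnj (iter u k \<omega> i) * iter u k \<omega> i))"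
proof -
  let ?P = "pair_positions k k" and ?Q = "pair_steps k k" and ?R = "pair_ends k k" and ?g = "pair_weight u k k"
  let ?s = "map_prod id Suc :: bool \<times> nat \<Rightarrow> bool \<times> nat"
  let ?S = "{w \<in> ?P \<rightarrow>\<^sub>E {..<n}. leading ?Q ?s ?R w \<and> ?g w \<noteq> 0}"
  let ?L = "\<Sum>w\<in>?S. ?g w * expectation (monomial ?Q fst (step_edge ?s w))"
  let ?f = "\<lambda>w. (cmod (u (w (False, k))))\<^sup>2"
  let ?W = "{..k} \<rightarrow>\<^sub>E {..<n}" and ?h = "\<lambda>p. \<lambda>(b, t)\<in>?P. p t :: nat"
  note sh = walk_shape_pair[OF k k]
  have finP: "finite (?P \<rightarrow>\<^sub>E {..<n})" by (intro finite_PiE) (auto simp: pair_positions_def)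
  have finS: "finite ?S" using finP by simp
  have term_eq: "?g w * expectation (monomial ?Q fst (step_edge ?s w)) = complex_of_real (?f w / real n ^ k)"
    if w: "w \<in> ?S" for w
  proof -
    have lead: "leading ?Q ?s ?R w" and wP: "w \<in> ?P \<rightarrow>\<^sub>E {..<n}" and g0: "?g w \<noteq> 0" using w by auto
    have coal: "w (False, t) = w (True, t)" if "t \<le> k" for t
    proof (rule flow_eq[where Q="?Q" and w=w and s="?s" and a="\<lambda>t. (False, t)" and b="\<lambda>t. (True, t)" and j=k])
      show "w (False, 0) = w (True, 0)" using g0 by (auto simp: pair_weight_def split: if_splits)
      show "w (?s q) = w (?s q')" if "q \<in> ?Q" "q' \<in> ?Q" "w q = w q'" for q q'
        using lead that unfolding leading_def by blast
    qed (use that in \<open>auto simp: pair_steps_def\<close>)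
    have g: "?g w = complex_of_real (?f w)"
      using coal[of 0] coal[of k] by (simp add: pair_weight_def complex_norm_square[symmetric])
    let ?e = "step_edge ?s w"
    \<comment> \<open>The two copies run along the same vertices, so each entry occurs once plain
      and once conjugated. Its moment is the variance \<open>m 1 1\<close>; the moment
      \<open>m 2 0\<close>, about which nothing is known beyond its size, does not arise.\<close>
    have half: "card {q \<in> fibre ?Q ?e d. \<not> fst q} = 1 \<and> card {q \<in> fibre ?Q ?e d. fst q} = 1" if d: "d \<in> ?e ` ?Q" for d
    proof -
      have flip: "?e (\<not> b, t) = ?e (b, t)" if "t < k" for b t
        using coal[of t] coal[of "Suc t"] that by (cases b) (auto simp: step_edge_def)
      have "bij_betw (\<lambda>(b, t). (\<not> b, t)) {q \<in> fibre ?Q ?e d. \<not> fst q} {q \<in> fibre ?Q ?e d. fst q}"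
        by (rule bij_betw_byWitness[where f'="\<lambda>(b, t). (\<not> b, t)"])
          (use flip flip[of _ False] flip[of _ True] in \<open>auto simp: fibre_def pair_steps_def\<close>)
      then have "card {q \<in> fibre ?Q ?e d. \<not> fst q} = card {q \<in> fibre ?Q ?e d. fst q}"
        by (rule bij_betw_same_card)
      moreover have "card (fibre ?Q ?e d) = 2"
        using d lead unfolding leading_def fibre_def by auto
      ultimately show ?thesis
        using card_fibre_split[OF step_edge_in(2)[OF sh wP], of ?e d fst] by simp
    qed
    have "expectation (monomial ?Q fst ?e) = (\<Prod>d\<in>?e ` ?Q. 1 / of_nat n)"
      unfolding monomial_expectation[OF step_edge_in(2,1)[OF sh wP]]
      by (rule prod.cong[OF refl]) (use half m_var in auto)
    also have "\<dots> = 1 / of_nat n ^ k"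
      using leading_edges(1)[OF sh wP lead, of k] by (simp add: card_pair power_one_over)
    finally show ?thesis unfolding g by simp
  qed
  have L: "?L = complex_of_real ((\<Sum>w\<in>?S. ?f w) / real n ^ k)"
  proof -
    have "?L = (\<Sum>w\<in>?S. complex_of_real (?f w / real n ^ k))" by (rule sum.cong[OF refl term_eq])
    then show ?thesis by (simp add: sum_divide_distrib)
  qed
  have "cmod (expectation (walk_poly ?P ?Q ?s fst ?g) - ?L) \<le>
      walk_const (card ?P) (card ?Q) (card ?R) C / sqrt (real K)"
    by (rule walk_poly_split[OF sh _ C u pair_weight_bound]) auto
  then have 1: "Re ?L - walk_const (2 * k + 2) (2 * k) 2 C / sqrt (real K) \<le> Re (expectation (walk_poly ?P ?Q ?s fst ?g))"
    using abs_Re_le_cmod[of "expectation (walk_poly ?P ?Q ?s fst ?g) - ?L"] by (simp add: card_pair mult_2)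
  \<comment> \<open>An injective path, followed by both copies, is leading: the only coincidences
    are those between the copies at equal times.\<close>
  have path_lead: "?h p \<in> ?S" if p: "p \<in> ?W" "inj_on p {..k}" "u (p k) \<noteq> 0" for p
  proof -
    have mem: "?h p (b, t) = p t" if "t \<le> k" for b t using that by (cases b) (auto simp: pair_positions_def)
    have "?h p \<in> ?P \<rightarrow>\<^sub>E {..<n}" using p(1) by (auto simp: pair_positions_def)
    moreover have "?g (?h p) \<noteq> 0" unfolding pair_weight_def using p(3) mem[of 0] mem[of k] by simp
    moreover have "leading ?Q ?s ?R (?h p)"
    proof -
      have inj: "t = t'" if "?h p (b, t) = ?h p (b', t')" "t \<le> k" "t' \<le> k" for b t b' t'
        using that mem inj_onD[OF p(2), of t t'] by simp
      have i: "?h p (?s q) = ?h p (?s q')" if q: "q \<in> ?Q" "q' \<in> ?Q" "?h p q = ?h p q'" for q q'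
      proof -
        obtain b t b' t' where qq: "q = (b, t)" "q' = (b', t')" "t < k" "t' < k"
          using q(1,2) unfolding pair_steps_def by auto
        have "t = t'" using inj[of b t b' t'] q(3) qq by simp
        then show ?thesis using qq mem[of "Suc t"] by simp
      qed
      have ii: "?h p r \<notin> ?h p ` ?Q" if r: "r \<in> ?R" for r
      proof
        assume "?h p r \<in> ?h p ` ?Q"
        then obtain q where q0: "q \<in> ?Q" "?h p r = ?h p q" by (rule imageE)
        obtain b t where "q = (b, t)" by (cases q)
        with q0 have q: "(b, t) \<in> ?Q" "?h p r = ?h p (b, t)" by simp_all
        obtain b' where r': "r = (b', k)" using r by (auto simp: pair_ends_def)
        have "t < k" using q(1) by (auto simp: pair_steps_def)
        then show False using inj[of b' k b t] q(2) r' by simp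
      qed
      have iii: "card {q' \<in> ?Q. step_edge ?s (?h p) q' = step_edge ?s (?h p) q} = 2" if q: "q \<in> ?Q" for q
      proof -
        obtain b t where qq: "q = (b, t)" "t < k" using q unfolding pair_steps_def by auto
        have "{q' \<in> ?Q. step_edge ?s (?h p) q' = step_edge ?s (?h p) q} = {(False, t), (True, t)}"
        proof (intro equalityI subsetI)
          fix q' assume q': "q' \<in> {q' \<in> ?Q. step_edge ?s (?h p) q' = step_edge ?s (?h p) q}"
          obtain b' t' where qq': "q' = (b', t')" "t' < k" using q' unfolding pair_steps_def by auto
          have "t' = t" using q' qq qq' inj[of b' t' b t] by (simp add: step_edge_def)
          then show "q' \<in> {(False, t), (True, t)}" using qq' by (cases b') auto
        next
          fix q' assume "q' \<in> {(False, t), (True, t)}"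
          then obtain b' where qq': "q' = (b', t)" by blast
          then have "step_edge ?s (?h p) q' = step_edge ?s (?h p) q"
            using qq mem[of t] mem[of "Suc t"] by (simp add: step_edge_def)
          moreover have "q' \<in> ?Q" using qq' qq by (cases b') (auto simp: pair_steps_def)
          ultimately show "q' \<in> {q' \<in> ?Q. step_edge ?s (?h p) q' = step_edge ?s (?h p) q}" by blast
        qed
        then show ?thesis by simp
      qed
      show ?thesis unfolding leading_def using i ii iii by blast
    qed
    ultimately show ?thesis by blast
  qed
  let ?I = "{p \<in> ?W. inj_on p {..k} \<and> u (p k) \<noteq> 0}"
  have finW: "finite ?W" by (intro finite_PiE) auto
  have injh: "inj_on ?h ?I"
  proof (rule inj_onI)
    fix p q assume pq: "p \<in> ?I" "q \<in> ?I" "?h p = ?h q"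
    show "p = q"
    proof (rule PiE_ext[of p "{..k}" "\<lambda>_. {..<n}" q])
      fix t assume "t \<in> {..k}"
      then show "p t = q t" using fun_cong[OF pq(3), of "(False, t)"] by (simp add: pair_positions_def)
    qed (use pq in auto)
  qed
  have "(\<Sum>p\<in>?I. (cmod (u (p k)))\<^sup>2) = (\<Sum>p\<in>?I. ?f (?h p))"
    by (intro sum.cong) (auto simp: pair_positions_def)
  also have "\<dots> = (\<Sum>w\<in>?h ` ?I. ?f w)" by (simp only: sum.reindex[OF injh] comp_def)
  also have "\<dots> \<le> (\<Sum>w\<in>?S. ?f w)"
  proof (rule sum_mono2[OF finS])
    show "?h ` ?I \<subseteq> ?S"
    proof (rule image_subsetI)
      fix p assume "p \<in> ?I"
      then show "?h p \<in> ?S" by (intro path_lead) auto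
    qed
  qed simp
  finally have A: "(\<Sum>p\<in>?I. (cmod (u (p k)))\<^sup>2) \<le> (\<Sum>w\<in>?S. ?f w)" .
  let ?N = "{p \<in> ?W. \<not> inj_on p {..k}}"
  have "real n ^ k * S = (\<Sum>p\<in>?W. (cmod (u (p k)))\<^sup>2)"
    using sum_PiE_last[of "{..k}" k "\<lambda>i. (cmod (u i))\<^sup>2" n] by (simp add: S_def)
  also have "\<dots> = (\<Sum>p\<in>{p \<in> ?W. inj_on p {..k}}. (cmod (u (p k)))\<^sup>2) + (\<Sum>p\<in>?N. (cmod (u (p k)))\<^sup>2)"
    by (subst sum.union_disjoint[symmetric]) (use finW in \<open>auto intro!: sum.cong\<close>)
  also have "(\<Sum>p\<in>{p \<in> ?W. inj_on p {..k}}. (cmod (u (p k)))\<^sup>2) = (\<Sum>p\<in>?I. (cmod (u (p k)))\<^sup>2)"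
    by (rule sum.mono_neutral_right) (use finW in auto)
  finally have B: "real n ^ k * S \<le> (\<Sum>w\<in>?S. ?f w) + (\<Sum>p\<in>?N. (cmod (u (p k)))\<^sup>2)" using A by simp
  have "(\<Sum>p\<in>?N. (cmod (u (p k)))\<^sup>2) * real n \<le> real ((k + 1)\<^sup>2) * (real n ^ k * S)"
    unfolding S_def by (rule sum_non_injective_paths) (use n_pos in auto)
  also have "\<dots> \<le> real ((k + 1)\<^sup>2) * (real n ^ k * C\<^sup>2)"
    using u by (intro mult_left_mono) (auto simp: S_def)
  finally have "(\<Sum>p\<in>?N. (cmod (u (p k)))\<^sup>2) \<le> real ((k + 1)\<^sup>2) * (real n ^ k * C\<^sup>2) / real n"
    using n_pos by (simp add: pos_le_divide_eq)
  \<comment> \<open>The rate 1/n is weakened to 1 / sqrt K, the common scale of all errors.\<close>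
  also have "\<dots> \<le> real ((k + 1)\<^sup>2) * (real n ^ k * C\<^sup>2) / sqrt (real K)"
    using sqrt_K n_pos K by (intro divide_left_mono) auto
  finally have "real n ^ k * S \<le> (\<Sum>w\<in>?S. ?f w) + real ((k + 1)\<^sup>2) * (real n ^ k * C\<^sup>2) / sqrt (real K)" using B by simp
  then have "real n ^ k * S / real n ^ k \<le> ((\<Sum>w\<in>?S. ?f w) + real ((k + 1)\<^sup>2) * (real n ^ k * C\<^sup>2) / sqrt (real K)) / real n ^ k"
    by (rule divide_right_mono) simp
  then have "S \<le> Re ?L + C\<^sup>2 * real ((k + 1)\<^sup>2) / sqrt (real K)"
    unfolding L Re_complex_of_real using n_pos by (simp add: add_divide_distrib mult.commute)
  then show ?thesis using 1 unfolding inner_walk_poly by (simp add: add_divide_distrib)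
qed

text \<open>Expanding the square around \<open>S\<close>, the bounds E|F|^2 \<le> S^2 + a and Re (E
  F) \<ge> S - b give at most a + 2 S b. The terms S^2 cancel, which is why the leading constants
  have to be exact.\<close>

lemma norm_sq_variance:
  fixes u :: "nat \<Rightarrow> complex"
  assumes k: "1 \<le> k" and C: "1 \<le> C" and u: "(\<Sum>i<n. (cmod (u i))\<^sup>2) \<le> C\<^sup>2"
  defines "S \<equiv> (\<Sum>i<n. (cmod (u i))\<^sup>2)"
  shows "integrable M (\<lambda>\<omega>. (cmod ((\<Sum>i<n. cnj (iter u k \<omega> i) * iter u k \<omega> i) - of_real S))\<^sup>2)"
    and "expectation (\<lambda>\<omega>. (cmod ((\<Sum>i<n. cnj (iter u k \<omega> i) * iter u k \<omega> i) - of_real S))\<^sup>2) \<le>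
      (walk_const (2 * (k + k + 2)) (2 * (k + k)) 4 C +
        2 * C\<^sup>2 * (C\<^sup>2 * real ((k + 1)\<^sup>2) + walk_const (2 * k + 2) (2 * k) 2 C)) / sqrt (real K)"
proof -
  let ?F = "\<lambda>\<omega>. \<Sum>i<n. cnj (iter u k \<omega> i) * iter u k \<omega> i"
  have eq: "(cmod (?F \<omega> - of_real S))\<^sup>2 = (cmod (?F \<omega>))\<^sup>2 - 2 * S * Re (?F \<omega>) + S\<^sup>2" for \<omega>
    unfolding cmod_power2 by (simp add: power2_diff algebra_simps)
  have intF: "integrable M ?F" unfolding inner_walk_poly by (rule walk_poly_integrable[OF walk_shape_pair[OF k k]])
  then have intR: "integrable M (\<lambda>\<omega>. Re (?F \<omega>))" by (rule integrable_Re)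
  note int2 = inner_second_moment(1)[OF k k C u]
  show "integrable M (\<lambda>\<omega>. (cmod (?F \<omega> - of_real S))\<^sup>2)"
    unfolding eq by (intro Bochner_Integration.integrable_add Bochner_Integration.integrable_diff int2 integrable_mult_right intR) simp
  let ?a = "walk_const (2 * (k + k + 2)) (2 * (k + k)) 4 C / sqrt (real K)"
  let ?b = "(C\<^sup>2 * real ((k + 1)\<^sup>2) + walk_const (2 * k + 2) (2 * k) 2 C) / sqrt (real K)"
  have S0: "0 \<le> S" "S \<le> C\<^sup>2" using u by (auto simp: S_def intro: sum_nonneg)
  have b0: "0 \<le> ?b" using C Mu_ge(2)[of "2 * k"] unfolding walk_const_def
    by (intro divide_nonneg_nonneg add_nonneg_nonneg mult_nonneg_nonneg) auto
  have "expectation (\<lambda>\<omega>. (cmod (?F \<omega> - of_real S))\<^sup>2) =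
      expectation (\<lambda>\<omega>. (cmod (?F \<omega>))\<^sup>2) - 2 * S * Re (expectation ?F) + S\<^sup>2"
    unfolding eq using int2 intR integral_Re[OF intF] by (simp add: prob_space)
  also have "\<dots> \<le> (S\<^sup>2 + ?a) - 2 * S * (S - ?b) + S\<^sup>2"
  proof -
    have "expectation (\<lambda>\<omega>. (cmod (?F \<omega>))\<^sup>2) \<le> S\<^sup>2 + ?a"
      using inner_second_moment(2)[OF k k C u] by (simp add: S_def)
    moreover have "2 * S * (S - ?b) \<le> 2 * S * Re (expectation ?F)"
      using inner_mean_lower[OF k C u] S0 by (intro mult_left_mono) (auto simp: S_def)
    ultimately show ?thesis by linarith
  qed
  also have "\<dots> = ?a + 2 * S * ?b" by (simp add: power2_eq_square algebra_simps)
  also have "\<dots> \<le> ?a + 2 * C\<^sup>2 * ?b" using S0 b0 by (intro add_left_mono mult_right_mono) auto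
  also have "\<dots> = (walk_const (2 * (k + k + 2)) (2 * (k + k)) 4 C +
        2 * C\<^sup>2 * (C\<^sup>2 * real ((k + 1)\<^sup>2) + walk_const (2 * k + 2) (2 * k) 2 C)) / sqrt (real K)"
  proof -
    have "a / s + 2 * c * (b / s) = (a + 2 * c * b) / s" for a b c s :: real by (simp add: add_divide_distrib)
    then show ?thesis .
  qed
  finally show "expectation (\<lambda>\<omega>. (cmod (?F \<omega> - of_real S))\<^sup>2) \<le>
      (walk_const (2 * (k + k + 2)) (2 * (k + k)) 4 C +
        2 * C\<^sup>2 * (C\<^sup>2 * real ((k + 1)\<^sup>2) + walk_const (2 * k + 2) (2 * k) 2 C)) / sqrt (real K)" .
qed

end

section \<open>Traces of powers and closed walks\<close>

definition mat_trace_power :: "nat \<Rightarrow> (nat \<times> nat \<Rightarrow> complex) \<Rightarrow> nat \<Rightarrow> complex" where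
  "mat_trace_power n X k = (\<Sum>i<n. mat_iter n X (\<lambda>j. if j = i then 1 else 0) k i)"

lemma mat_trace_power_path_sum:
  assumes k: "1 \<le> k"
  shows "mat_trace_power n X k = (\<Sum>p\<in>{..<k} \<rightarrow>\<^sub>E {..<n}. \<Prod>t<k. X (p t, p (Suc t mod k)))"
proof -
  let ?W = "{..k} \<rightarrow>\<^sub>E {..<n}"
  have finW: "finite ?W" by (intro finite_PiE) auto
  have "mat_trace_power n X k = (\<Sum>i<n. \<Sum>p\<in>?W. (if p 0 = i then 1 else 0) * (if p k = i then 1 else 0) * (\<Prod>t<k. X (p t, p (Suc t))))"
    unfolding mat_trace_power_def by (intro sum.cong refl) (simp add: mat_iter_eq_path_sum)
  also have "\<dots> = (\<Sum>p\<in>?W. \<Sum>i<n. (if p 0 = i then 1 else 0) * (if p k = i then 1 else 0) * (\<Prod>t<k. X (p t, p (Suc t))))"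
    by (rule sum.swap)
  also have "\<dots> = (\<Sum>p\<in>?W. if p 0 = p k then \<Prod>t<k. X (p t, p (Suc t)) else 0)"
  proof (rule sum.cong[OF refl])
    fix p assume "p \<in> ?W"
    then have p0: "p 0 < n" by (auto simp: PiE_iff)
    have "(\<Sum>i<n. (if p 0 = i then 1 else 0) * (if p k = i then 1 else 0) * (\<Prod>t<k. X (p t, p (Suc t)))) =
       (\<Sum>i<n. if i = p 0 then (if p k = p 0 then \<Prod>t<k. X (p t, p (Suc t)) else 0) else 0)"
      by (intro sum.cong refl) auto
    then show "(\<Sum>i<n. (if p 0 = i then 1 else 0) * (if p k = i then 1 else 0) * (\<Prod>t<k. X (p t, p (Suc t)))) =
       (if p 0 = p k then \<Prod>t<k. X (p t, p (Suc t)) else 0)"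
      using p0 by auto
  qed
  also have "\<dots> = (\<Sum>p\<in>{p \<in> ?W. p 0 = p k}. \<Prod>t<k. X (p t, p (Suc t)))"
    using finW by (simp add: sum.inter_filter)
  also have "\<dots> = (\<Sum>p\<in>{..<k} \<rightarrow>\<^sub>E {..<n}. \<Prod>t<k. X (p t, p (Suc t mod k)))"
  proof (rule sum.reindex_bij_witness[of _ "\<lambda>p. p(k := p 0)" "\<lambda>p. restrict p {..<k}"])
    fix p assume p: "p \<in> {p \<in> ?W. p 0 = p k}"
    show "(restrict p {..<k})(k := restrict p {..<k} 0) = p"
    proof (rule ext)
      fix t
      consider "t < k" | "t = k" | "k < t" by linarith
      then show "((restrict p {..<k})(k := restrict p {..<k} 0)) t = p t"
        using p k by cases (auto simp: PiE_def extensional_def)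
    qed
    show "restrict p {..<k} \<in> {..<k} \<rightarrow>\<^sub>E {..<n}" using p by (auto simp: PiE_iff)
    show "(\<Prod>t<k. X (restrict p {..<k} t, restrict p {..<k} (Suc t mod k))) = (\<Prod>t<k. X (p t, p (Suc t)))"
    proof (rule prod.cong[OF refl])
      fix t assume t: "t \<in> {..<k}"
      show "X (restrict p {..<k} t, restrict p {..<k} (Suc t mod k)) = X (p t, p (Suc t))"
      proof (cases "Suc t = k")
        case True
        then show ?thesis using p t k by auto
      next
        case False
        then show ?thesis using t by auto
      qed
    qed
  next
    fix p assume p: "p \<in> {..<k} \<rightarrow>\<^sub>E {..<n}"
    show "restrict (p(k := p 0)) {..<k} = p"
      using p by (auto simp: fun_eq_iff PiE_def extensional_def)
    have "p 0 < n" using p k by (auto simp: PiE_iff)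
    then show "p(k := p 0) \<in> {p \<in> ?W. p 0 = p k}"
      using p k by (auto simp: PiE_iff extensional_def)
  qed
  finally show ?thesis .
qed

definition cycle_succ :: "nat \<Rightarrow> nat \<Rightarrow> nat" where "cycle_succ k t = Suc t mod k"

lemma cycle_succ_less: "t < k \<Longrightarrow> cycle_succ k t < k"
  by (simp add: cycle_succ_def)

lemma inj_on_cycle_succ: "inj_on (cycle_succ k) {..<k}"
proof (rule inj_onI)
  fix s t assume st: "s \<in> {..<k}" "t \<in> {..<k}" "cycle_succ k s = cycle_succ k t"
  show "s = t"
    using st by (cases "Suc s = k"; cases "Suc t = k"; simp add: cycle_succ_def)
qed

lemma walk_shape_cycle: "walk_shape {..<k} {..<k} (cycle_succ k) {}"
  unfolding walk_shape_def using inj_on_cycle_succ[of k] cycle_succ_less by auto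

lemma card_image_le_of_factor:
  assumes "finite W" and "\<And>w w'. w \<in> W \<Longrightarrow> w' \<in> W \<Longrightarrow> f w = f w' \<Longrightarrow> h w = h w'"
  shows "card (h ` W) \<le> card (f ` W)"
proof -
  have "h ` W \<subseteq> (\<lambda>y. h (inv_into W f y)) ` f ` W"
  proof (rule image_subsetI)
    fix w assume w: "w \<in> W"
    then have "inv_into W f (f w) \<in> W" "f (inv_into W f (f w)) = f w"
      by (auto intro: inv_into_into f_inv_into_f)
    then have "h (inv_into W f (f w)) = h w" using assms(2) w by blast
    then show "h w \<in> (\<lambda>y. h (inv_into W f y)) ` f ` W" using w by force
  qed
  then show ?thesis using assms(1) surj_card_le by (metis finite_imageI)
qed

text \<open>In a leading pair of closed walks every vertex is visited exactly twice, and the matching of the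
  two visits commutes with the successor; it is therefore determined by its value at one position of
  each walk.\<close>

lemma card_leading_cycle_patterns:
  assumes k: "1 \<le> k"
  defines "Q \<equiv> (UNIV :: bool set) \<times> {..<k}" and "s \<equiv> double_succ (cycle_succ k)"
  shows "card (pattern Q ` {w \<in> Q \<rightarrow>\<^sub>E {..<n}. leading Q s {} w}) \<le> (2 * k)\<^sup>2"
proof -
  let ?W = "{w \<in> Q \<rightarrow>\<^sub>E {..<n}. leading Q s {} w}"
  \<comment> \<open>The other visit to the vertex at position \<open>q\<close>.\<close>
  define pr where "pr w q = (SOME q'. q' \<in> Q \<and> q' \<noteq> q \<and> w q' = w q)" for w :: "bool \<times> nat \<Rightarrow> nat" and q
  have sQ: "s q \<in> Q" if "q \<in> Q" for q 
    using that cycle_succ_less[of "snd q" k] by (cases q) (simp add: Q_def s_def)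
  have injs: "inj_on s Q" using walk_shape_double[OF walk_shape_cycle[of k]] by (simp add: Q_def s_def walk_shape_def)
  have finQ: "finite Q" by (simp add: Q_def)
  have lead: "leading Q s {} w" if "w \<in> ?W" for w using that by blast
  \<comment> \<open>An entry is used twice and is determined by its first vertex, so each vertex is
    visited twice.\<close>
  have two: "card {q' \<in> Q. w q' = w q} = 2" if w: "w \<in> ?W" and q: "q \<in> Q" for w q
  proof -
    have "w (s q') = w (s q)" if "q' \<in> Q" "w q' = w q" for q'
      using lead[OF w] that q unfolding leading_def by blast
    then have "{q' \<in> Q. step_edge s w q' = step_edge s w q} = {q' \<in> Q. w q' = w q}"
      by (auto simp: step_edge_def)
    then show ?thesis using lead[OF w] q unfolding leading_def by auto
  qed
  have pr: "pr w q \<in> Q \<and> pr w q \<noteq> q \<and> w (pr w q) = w q" if w: "w \<in> ?W" and q: "q \<in> Q" for w q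
  proof -
    have "\<exists>q'. q' \<in> Q \<and> q' \<noteq> q \<and> w q' = w q"
    proof (rule ccontr)
      assume "\<nexists>q'. q' \<in> Q \<and> q' \<noteq> q \<and> w q' = w q"
      then have "{q' \<in> Q. w q' = w q} \<subseteq> {q}" by blast
      then have "card {q' \<in> Q. w q' = w q} \<le> card {q}" by (intro card_mono) auto
      then show False using two[OF w q] by simp
    qed
    from someI_ex[OF this] show ?thesis by (simp add: pr_def)
  qed
  have cls: "q' = q \<or> q' = pr w q" if w: "w \<in> ?W" and q: "q \<in> Q" "q' \<in> Q" "w q' = w q" for w q q'
  proof -
    have "{q, pr w q} \<subseteq> {q' \<in> Q. w q' = w q}" using pr[OF w q(1)] q by auto
    moreover have "card {q, pr w q} = 2" using pr[OF w q(1)] by (metis card_2_iff)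
    ultimately have "{q, pr w q} = {q' \<in> Q. w q' = w q}"
      using two[OF w q(1)] finQ by (intro card_subset_eq) auto
    then show ?thesis using q by blast
  qed
  have step: "pr w (s q) = s (pr w q)" if w: "w \<in> ?W" and q: "q \<in> Q" for w q
  proof -
    note p = pr[OF w q]
    have "w (s (pr w q)) = w (s q)" using w p q unfolding leading_def by blast
    moreover have "s (pr w q) \<noteq> s q" using inj_onD[OF injs, of "pr w q" q] p q by blast
    ultimately show ?thesis using cls[OF w sQ[OF q] sQ[OF conjunct1[OF p]]] by simp
  qed
  let ?f = "\<lambda>w. (pr w (False, 0), pr w (True, 0))"
  have finW: "finite ?W" using finQ by (simp add: finite_PiE)
  have "card (pattern Q ` ?W) \<le> card (?f ` ?W)"
  proof (rule card_image_le_of_factor[OF finW])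
    fix w w' assume w: "w \<in> ?W" "w' \<in> ?W" and f: "?f w = ?f w'"
    have "pr w (b, t) = pr w' (b, t)" if "t < k" for b t
      using that
    proof (induction t)
      case 0
      then show ?case using f by (cases b) auto
    next
      case (Suc t)
      then have "(b, t) \<in> Q" "(b, Suc t) = s (b, t)" by (auto simp: Q_def s_def cycle_succ_def)
      then show ?case using step[OF w(1), of "(b, t)"] step[OF w(2), of "(b, t)"] Suc by simp
    qed
    then have preq: "pr w q = pr w' q" if "q \<in> Q" for q using that by (cases q) (auto simp: Q_def)
    show "pattern Q w = pattern Q w'"
    proof (rule pattern_cong)
      fix p p' assume p: "p \<in> Q" "p' \<in> Q"
      show "w p = w p' \<longleftrightarrow> w' p = w' p'"
        using cls[OF w(1) p(2,1)] cls[OF w(2) p(2,1)] pr[OF w(1) p(2)] pr[OF w(2) p(2)] preq[OF p(2)] by auto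
    qed
  qed
  also have "\<dots> \<le> card (Q \<times> Q)"
  proof (rule card_mono)
    have "(False, 0) \<in> Q" "(True, 0) \<in> Q" using k by (auto simp: Q_def)
    then show "?f ` ?W \<subseteq> Q \<times> Q" using pr by (intro image_subsetI) blast
  qed (use finQ in simp)
  also have "\<dots> = (2 * k)\<^sup>2" by (simp add: card_cartesian_product Q_def power2_eq_square)
  finally show ?thesis .
qed

context sparse_moments
begin

text \<open>Closed walks carry no weights, so leading pairs do contribute: n^k walks for each
  pattern against n^-k from the variances, which leaves the number of patterns. That this number is
  polynomial in \<open>k\<close> matters: the traces summed against powers of a radius below 1 must
  have a bound independent of how many are used, since their number is chosen only after that
  bound.\<close>

lemma trace_second_moment:
  assumes k: "1 \<le> k"
  shows "integrable M (\<lambda>\<omega>. (cmod (mat_trace_power n (\<lambda>e. x e \<omega>) k))\<^sup>2)"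
    and "expectation (\<lambda>\<omega>. (cmod (mat_trace_power n (\<lambda>e. x e \<omega>) k))\<^sup>2) \<le>
      real ((2 * k)\<^sup>2) + walk_const (2 * k) (2 * k) 0 1 / sqrt (real K)"
proof -
  have eq: "mat_trace_power n (\<lambda>e. x e \<omega>) k = walk_poly {..<k} {..<k} (cycle_succ k) (\<lambda>_. False) (\<lambda>_. 1) \<omega>" for \<omega>
    unfolding mat_trace_power_path_sum[OF k] walk_poly_def monomial_def step_edge_def cycle_succ_def by simp
  note sh = walk_shape_cycle[of k]
  let ?Q = "(UNIV :: bool set) \<times> {..<k}"
  note * = walk_poly_second_moment[OF sh, where a="\<lambda>_ _. 0" and g="\<lambda>_. 1" and C=1 and c="\<lambda>_. False"]
  show "integrable M (\<lambda>\<omega>. (cmod (mat_trace_power n (\<lambda>e. x e \<omega>) k))\<^sup>2)"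
    unfolding eq by (rule *(1)) simp_all
  let ?W = "{w \<in> ?Q \<rightarrow>\<^sub>E {..<n}. leading ?Q (double_succ (cycle_succ k)) {} w}"
  have dw: "double_weight {..<k} (\<lambda>_. 1) w = 1" for w by (simp add: double_weight_def)
  have sh2: "walk_shape ?Q ?Q (double_succ (cycle_succ k)) {}"
    using walk_shape_double[OF sh] by simp
  have "card ?W \<le> card (pattern ?Q ` ?W) * n ^ k"
    by (rule card_leading[OF sh2]) (simp add: card_UNIV_bool_times)
  also have "\<dots> \<le> (2 * k)\<^sup>2 * n ^ k"
    by (rule mult_right_mono[OF card_leading_cycle_patterns[OF k]]) simp
  finally have "real (card ?W) \<le> real ((2 * k)\<^sup>2 * n ^ k)"
    by (rule of_nat_mono)
  then have "real (card ?W) \<le> real ((2 * k)\<^sup>2) * real n ^ k"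
    by simp
  then have "real (card ?W) / real n ^ k \<le> real ((2 * k)\<^sup>2)"
    using n_pos by (simp add: pos_divide_le_eq)
  then show "expectation (\<lambda>\<omega>. (cmod (mat_trace_power n (\<lambda>e. x e \<omega>) k))\<^sup>2) \<le>
      real ((2 * k)\<^sup>2) + walk_const (2 * k) (2 * k) 0 1 / sqrt (real K)"
  proof -
    have "expectation (\<lambda>\<omega>. (cmod (walk_poly {..<k} {..<k} (cycle_succ k) (\<lambda>_. False) (\<lambda>_. 1) \<omega>))\<^sup>2) \<le>
        (\<Sum>w\<in>{w \<in> ?Q \<rightarrow>\<^sub>E {..<n}. leading ?Q (double_succ (cycle_succ k)) (UNIV \<times> {}) w \<and> double_weight {..<k} (\<lambda>_. 1) w \<noteq> 0}.
          cmod (double_weight {..<k} (\<lambda>_. 1) w) / real n ^ card {..<k}) +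
        walk_const (2 * card {..<k}) (2 * card {..<k}) (2 * card ({} :: nat set)) 1 / sqrt (real K)"
      by (rule *(2)) simp_all
    then show ?thesis
      using \<open>real (card ?W) / real n ^ k \<le> real ((2 * k)\<^sup>2)\<close> unfolding eq dw by simp
  qed
qed

end

section \<open>Coefficients of the reversed characteristic polynomial\<close>

definition res_mat :: "nat \<Rightarrow> (nat \<times> nat \<Rightarrow> complex) \<Rightarrow> complex \<Rightarrow> complex mat" where
  "res_mat n X z = Matrix.mat n n (\<lambda>(i, j). (if i = j then 1 else 0) - z * X (i, j))"

definition graph_on :: "(nat \<Rightarrow> nat) \<Rightarrow> nat set \<Rightarrow> (nat \<times> nat) set" where
  "graph_on p S = (\<lambda>i. (i, p i)) ` S"

lemma graph_on_simps:
  "fst ` graph_on p S = S" "card (graph_on p S) = card S" "(\<Prod>e\<in>graph_on p S. f e) = (\<Prod>i\<in>S. f (i, p i))"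
proof -
  have inj: "inj_on (\<lambda>i. (i, p i)) S" by (auto simp: inj_on_def)
  show "fst ` graph_on p S = S" by (simp add: graph_on_def image_image)
  show "card (graph_on p S) = card S" unfolding graph_on_def by (rule card_image[OF inj])
  show "(\<Prod>e\<in>graph_on p S. f e) = (\<Prod>i\<in>S. f (i, p i))" unfolding graph_on_def by (simp add: prod.reindex[OF inj])
qed

lemma graph_on_eq_iff: "graph_on p S = graph_on p' S' \<longleftrightarrow> S = S' \<and> (\<forall>i\<in>S. p i = p' i)"
proof
  assume eq: "graph_on p S = graph_on p' S'"
  have S: "S = S'" using arg_cong[OF eq, of "image fst"] by (simp add: graph_on_simps)
  have "p i = p' i" if "i \<in> S" for i
  proof -
    have "(i, p i) \<in> graph_on p' S'" using that unfolding eq[symmetric] by (auto simp: graph_on_def)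
    then show ?thesis by (auto simp: graph_on_def)
  qed
  with S show "S = S' \<and> (\<forall>i\<in>S. p i = p' i)" by blast
qed (auto simp: graph_on_def)

text \<open>Terms of the expanded det (1 - z X): \<open>S\<close> is the set of rows in which -z X
  is taken, and outside \<open>S\<close> the permutation has to be the identity.\<close>

definition det_index :: "nat \<Rightarrow> nat \<Rightarrow> (nat set \<times> (nat \<Rightarrow> nat)) set" where
  "det_index n k = (SIGMA S:{S. S \<subseteq> {..<n} \<and> card S = k}. {p. p permutes S})"

definition det_coeff :: "nat \<Rightarrow> (nat \<times> nat \<Rightarrow> complex) \<Rightarrow> nat \<Rightarrow> complex" where
  "det_coeff n X k = (\<Sum>t\<in>det_index n k. signof (snd t) * (-1) ^ k * (\<Prod>e\<in>graph_on (snd t) (fst t). X e))"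

text \<open>By Cramer's rule, coordinate i of the adjugate of 1 - z X applied to \<open>u\<close> is
  the determinant with column i replaced by \<open>u\<close>. In a term, \<open>b\<close> is the row
  that takes its factor from this column, and \<open>S\<close> is the set of rows that take a factor
  from X.\<close>

definition adj_index :: "nat \<Rightarrow> nat \<Rightarrow> (nat \<times> nat set \<times> (nat \<Rightarrow> nat)) set" where
  "adj_index n k = (SIGMA b:{..<n}. SIGMA S:{S. S \<subseteq> {..<n} - {b} \<and> card S = k}. {p. p permutes insert b S})"

definition adj_coeff :: "nat \<Rightarrow> (nat \<times> nat \<Rightarrow> complex) \<Rightarrow> (nat \<Rightarrow> complex) \<Rightarrow> nat \<Rightarrow> nat \<Rightarrow> complex" where
  "adj_coeff n X u k i = (\<Sum>t\<in>{(b, S, p) \<in> adj_index n k. p b = i}.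
     (case t of (b, S, p) \<Rightarrow> u b * signof p * (-1) ^ k) * (case t of (b, S, p) \<Rightarrow> \<Prod>e\<in>graph_on p S. X e))"

lemma finite_det_index: "finite (det_index n k)"
  unfolding det_index_def
  by (intro finite_SigmaI finite_permutations) (auto intro: finite_subset[of _ "{..<n}"])

lemma finite_adj_index: "finite (adj_index n k)"
  unfolding adj_index_def
  by (intro finite_SigmaI finite_permutations) (auto intro: finite_subset[of _ "{..<n}"])

lemma prod_res_expand:
  fixes X :: "nat \<times> nat \<Rightarrow> complex"
  assumes "finite A"
  shows "(\<Prod>i\<in>A. (if i = p i then 1 else 0) - z * X (i, p i)) =
    (\<Sum>S\<in>Pow A. if \<forall>i\<in>A - S. p i = i then (-z) ^ card S * (\<Prod>i\<in>S. X (i, p i)) else 0)"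
proof -
  have "(\<Prod>i\<in>A. (if i = p i then 1 else 0) - z * X (i, p i)) =
      (\<Prod>i\<in>A. - z * X (i, p i) + (if i = p i then 1 else 0))" by (intro prod.cong) auto
  also have "\<dots> = (\<Sum>S\<in>Pow A. (\<Prod>i\<in>S. - z * X (i, p i)) * (\<Prod>i\<in>A - S. if i = p i then 1 else 0))"
    by (rule prod_add[OF assms])
  also have "\<dots> = (\<Sum>S\<in>Pow A. if \<forall>i\<in>A - S. p i = i then (-z) ^ card S * (\<Prod>i\<in>S. X (i, p i)) else 0)"
  proof (rule sum.cong[OF refl])
    fix S assume "S \<in> Pow A"
    have fin: "finite (A - S)" using assms by simp
    have "(\<Prod>i\<in>A - S. if i = p i then 1 else 0) = (if \<forall>i\<in>A - S. p i = i then 1 else 0 :: complex)"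
    proof (cases "\<forall>i\<in>A - S. p i = i")
      case False
      then obtain i where "i \<in> A - S" "i \<noteq> p i" by auto
      then have "\<exists>i\<in>A - S. (if i = p i then 1 else 0 :: complex) = 0" by force
      then have "(\<Prod>i\<in>A - S. if i = p i then 1 else 0 :: complex) = 0" by (rule prod_zero[OF fin])
      then show ?thesis unfolding if_not_P[OF False] .
    qed (auto intro!: prod.neutral)
    then show "(\<Prod>i\<in>S. - z * X (i, p i)) * (\<Prod>i\<in>A - S. if i = p i then 1 else 0) =
        (if \<forall>i\<in>A - S. p i = i then (-z) ^ card S * (\<Prod>i\<in>S. X (i, p i)) else 0)"
      by (simp only: prod.distrib prod_constant) simp
  qed
  finally show ?thesis .
qed

lemma permutes_restrict_iff:
  assumes "S \<subseteq> I"
  shows "p permutes I \<and> (\<forall>i\<in>I - S. p i = i) \<longleftrightarrow> p permutes S"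
  using permutes_subset[OF _ assms] permutes_superset[of p I S] permutes_not_in[of p S] by auto

lemma det_res_mat: "Determinant.det (res_mat n X z) = (\<Sum>k\<le>n. det_coeff n X k * z ^ k)"
proof -
  let ?I = "{..<n}" and ?P = "{p. p permutes {..<n}}"
  have C: "res_mat n X z \<in> carrier_mat n n" by (simp add: res_mat_def)
  let ?t = "\<lambda>S p. signof p * ((-z) ^ card S * (\<Prod>i\<in>S. X (i, p i)))"
  have "Determinant.det (res_mat n X z) = (\<Sum>p\<in>?P. signof p * (\<Prod>i\<in>?I. (if i = p i then 1 else 0) - z * X (i, p i)))"
    unfolding det_def'[OF C] atLeast0LessThan
  proof (intro sum.cong refl arg_cong2[of _ _ _ _ "(*)"] prod.cong)
    fix p i assume "p \<in> ?P" "i \<in> ?I"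
    then have "p i < n" using permutes_in_image[of p ?I i] by auto
    then show "res_mat n X z $$ (i, p i) = (if i = p i then 1 else 0) - z * X (i, p i)"
      using \<open>i \<in> ?I\<close> by (simp add: res_mat_def)
  qed
  also have "\<dots> = (\<Sum>p\<in>?P. \<Sum>S\<in>Pow ?I. if \<forall>i\<in>?I - S. p i = i then ?t S p else 0)"
    by (intro sum.cong refl, simp only: prod_res_expand[OF finite_lessThan] sum_distrib_left, intro sum.cong refl, simp)
  also have "\<dots> = (\<Sum>S\<in>Pow ?I. \<Sum>p\<in>?P. if \<forall>i\<in>?I - S. p i = i then ?t S p else 0)" by (rule sum.swap)
  also have "\<dots> = (\<Sum>S\<in>Pow ?I. \<Sum>p\<in>{p. p permutes S}. ?t S p)"
  proof (rule sum.cong[OF refl])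
    fix S assume S: "S \<in> Pow ?I"
    have "(\<Sum>p\<in>?P. if \<forall>i\<in>?I - S. p i = i then ?t S p else 0) = (\<Sum>p\<in>{p \<in> ?P. \<forall>i\<in>?I - S. p i = i}. ?t S p)"
      by (rule sum.inter_filter[symmetric]) (simp add: finite_permutations)
    also have "{p \<in> ?P. \<forall>i\<in>?I - S. p i = i} = {p. p permutes S}"
      using permutes_restrict_iff[of S ?I] S by auto
    finally show "(\<Sum>p\<in>?P. if \<forall>i\<in>?I - S. p i = i then ?t S p else 0) = (\<Sum>p\<in>{p. p permutes S}. ?t S p)" .
  qed
  also have "\<dots> = (\<Sum>k\<in>{..n}. \<Sum>S\<in>{S \<in> Pow ?I. card S = k}. \<Sum>p\<in>{p. p permutes S}. ?t S p)"
  proof (rule sum.group[symmetric])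
    show "card ` Pow ?I \<subseteq> {..n}"
      using card_mono[of ?I] by auto
  qed auto
  also have "\<dots> = (\<Sum>k\<le>n. det_coeff n X k * z ^ k)"
  proof (rule sum.cong[OF refl])
    fix k
    have eq: "{S \<in> Pow ?I. card S = k} = {S. S \<subseteq> ?I \<and> card S = k}" by auto
    have fin: "finite {S. S \<subseteq> ?I \<and> card S = k}" by simp
    have "(\<Sum>S\<in>{S \<in> Pow ?I. card S = k}. \<Sum>p\<in>{p. p permutes S}. ?t S p) = (\<Sum>(S, p)\<in>det_index n k. ?t S p)"
      unfolding eq det_index_def
      by (rule sum.Sigma[OF fin]) (auto intro!: finite_permutations finite_subset[of _ ?I])
    also have "\<dots> = (\<Sum>t\<in>det_index n k. signof (snd t) * (-1) ^ k * (\<Prod>e\<in>graph_on (snd t) (fst t). X e) * z ^ k)"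
    proof (rule sum.cong[OF refl])
      fix t assume "t \<in> det_index n k"
      then obtain S p where t: "t = (S, p)" "card S = k" by (auto simp: det_index_def)
      have "(- z) ^ k = (-1) ^ k * z ^ k" by (rule power_minus)
      then show "(case t of (S, p) \<Rightarrow> ?t S p) = signof (snd t) * (-1) ^ k * (\<Prod>e\<in>graph_on (snd t) (fst t). X e) * z ^ k"
        using t by (simp add: graph_on_simps)
    qed
    finally show "(\<Sum>S\<in>{S \<in> Pow ?I. card S = k}. \<Sum>p\<in>{p. p permutes S}. ?t S p) = det_coeff n X k * z ^ k"
      by (simp add: det_coeff_def sum_distrib_right)
  qed
  finally show ?thesis .
qed

lemma det_replace_col_res_mat:
  assumes i: "i < n"
  shows "Determinant.det (replace_col (res_mat n X z) (Matrix.vec n u) i) = (\<Sum>k\<le>n. adj_coeff n X u k i * z ^ k)"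
proof -
  let ?I = "{..<n}" and ?P = "{p. p permutes {..<n}}" and ?A = "replace_col (res_mat n X z) (Matrix.vec n u) i"
  have C: "?A \<in> carrier_mat n n" by (simp add: res_mat_def replace_col_def)
  let ?t = "\<lambda>b S p. u b * signof p * ((-z) ^ card S * (\<Prod>i\<in>S. X (i, p i)))"
  have "Determinant.det ?A = (\<Sum>p\<in>?P. \<Sum>b\<in>?I. if p b = i then
      u b * signof p * (\<Prod>a\<in>?I - {b}. (if a = p a then 1 else 0) - z * X (a, p a)) else 0)"
    unfolding det_def'[OF C] atLeast0LessThan
  proof (rule sum.cong[OF refl])
    fix p assume p: "p \<in> ?P"
    then have pI: "p a < n" if "a < n" for a using that permutes_in_image[of p ?I a] by auto
    have inj: "inj p" using p permutes_inj by auto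
    obtain b where b: "b < n" "p b = i" using p i permutes_image[of p ?I] by (metis imageE lessThan_iff mem_Collect_eq)
    have one: "p a = i \<longleftrightarrow> a = b" for a using b(2) inj by (auto simp: inj_def)
    have "(\<Prod>a\<in>?I. ?A $$ (a, p a)) = ?A $$ (b, p b) * (\<Prod>a\<in>?I - {b}. ?A $$ (a, p a))"
      using b by (intro prod.remove) auto
    also have "?A $$ (b, p b) = u b" using b i by (simp add: replace_col_def res_mat_def)
    also have "(\<Prod>a\<in>?I - {b}. ?A $$ (a, p a)) = (\<Prod>a\<in>?I - {b}. (if a = p a then 1 else 0) - z * X (a, p a))"
      by (intro prod.cong refl) (use pI one in \<open>auto simp: replace_col_def res_mat_def\<close>)
    finally have pr: "(\<Prod>a\<in>?I. ?A $$ (a, p a)) = u b * (\<Prod>a\<in>?I - {b}. (if a = p a then 1 else 0) - z * X (a, p a))" .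
    show "signof p * (\<Prod>a\<in>?I. ?A $$ (a, p a)) = (\<Sum>b\<in>?I. if p b = i then
      u b * signof p * (\<Prod>a\<in>?I - {b}. (if a = p a then 1 else 0) - z * X (a, p a)) else 0)"
      unfolding pr one using b by (simp add: sum.delta mult_ac)
  qed
  also have "\<dots> = (\<Sum>b\<in>?I. \<Sum>p\<in>?P. if p b = i then
      u b * signof p * (\<Prod>a\<in>?I - {b}. (if a = p a then 1 else 0) - z * X (a, p a)) else 0)" by (rule sum.swap)
  also have "\<dots> = (\<Sum>b\<in>?I. \<Sum>p\<in>?P. \<Sum>S\<in>Pow (?I - {b}). if p b = i \<and> (\<forall>a\<in>?I - {b} - S. p a = a) then ?t b S p else 0)"
    by (intro sum.cong refl, simp only: prod_res_expand[OF finite_Diff[OF finite_lessThan]] sum_distrib_left)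
      (auto intro!: sum.cong)
  also have "\<dots> = (\<Sum>b\<in>?I. \<Sum>S\<in>Pow (?I - {b}). \<Sum>p\<in>?P. if p b = i \<and> (\<forall>a\<in>?I - {b} - S. p a = a) then ?t b S p else 0)"
    by (intro sum.cong refl sum.swap)
  also have "\<dots> = (\<Sum>b\<in>?I. \<Sum>S\<in>Pow (?I - {b}). \<Sum>p\<in>{p. p permutes insert b S}. if p b = i then ?t b S p else 0)"
  proof (rule sum.cong[OF refl], rule sum.cong[OF refl])
    fix b S assume b: "b \<in> ?I" and S: "S \<in> Pow (?I - {b})"
    have "(\<Sum>p\<in>?P. if p b = i \<and> (\<forall>a\<in>?I - {b} - S. p a = a) then ?t b S p else 0) =
        (\<Sum>p\<in>?P. if \<forall>a\<in>?I - {b} - S. p a = a then (if p b = i then ?t b S p else 0) else 0)"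
      by (intro sum.cong refl) auto
    also have "\<dots> = (\<Sum>p\<in>{p \<in> ?P. \<forall>a\<in>?I - {b} - S. p a = a}. if p b = i then ?t b S p else 0)"
      by (rule sum.inter_filter[symmetric]) (simp add: finite_permutations)
    also have "{p \<in> ?P. \<forall>a\<in>?I - {b} - S. p a = a} = {p. p permutes insert b S}"
    proof -
      have "insert b S \<subseteq> ?I" "?I - {b} - S = ?I - insert b S" using b S by auto
      then show ?thesis using permutes_restrict_iff[of "insert b S" ?I] by simp
    qed
    finally show "(\<Sum>p\<in>?P. if p b = i \<and> (\<forall>a\<in>?I - {b} - S. p a = a) then ?t b S p else 0) =
      (\<Sum>p\<in>{p. p permutes insert b S}. if p b = i then ?t b S p else 0)" .
  qed
  also have "\<dots> = (\<Sum>b\<in>?I. \<Sum>k\<in>{..n}. \<Sum>S\<in>{S \<in> Pow (?I - {b}). card S = k}. \<Sum>p\<in>{p. p permutes insert b S}. if p b = i then ?t b S p else 0)"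
  proof (rule sum.cong[OF refl])
    fix b
    have "card S \<le> n" if "S \<subseteq> ?I - {b}" for S using card_mono[of ?I S] that by auto
    then show "(\<Sum>S\<in>Pow (?I - {b}). \<Sum>p\<in>{p. p permutes insert b S}. if p b = i then ?t b S p else 0) =
       (\<Sum>k\<in>{..n}. \<Sum>S\<in>{S \<in> Pow (?I - {b}). card S = k}. \<Sum>p\<in>{p. p permutes insert b S}. if p b = i then ?t b S p else 0)"
      by (intro sum.group[symmetric]) auto
  qed
  also have "\<dots> = (\<Sum>k\<le>n. \<Sum>b\<in>?I. \<Sum>S\<in>{S \<in> Pow (?I - {b}). card S = k}. \<Sum>p\<in>{p. p permutes insert b S}. if p b = i then ?t b S p else 0)"
    by (rule sum.swap)
  also have "\<dots> = (\<Sum>k\<le>n. adj_coeff n X u k i * z ^ k)"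
  proof (rule sum.cong[OF refl])
    fix k
    have eq: "{S \<in> Pow (?I - {b}). card S = k} = {S. S \<subseteq> ?I - {b} \<and> card S = k}" for b by auto
    have fin: "finite {S. S \<subseteq> ?I - {b} \<and> card S = k}" for b by (rule finite_subset[of _ "Pow ?I"]) auto
    have finp: "finite {p. p permutes insert b S}" if "S \<subseteq> ?I - {b}" for b S
      using that by (intro finite_permutations finite.insertI) (rule finite_subset[of _ ?I], auto)
    have "(\<Sum>b\<in>?I. \<Sum>S\<in>{S \<in> Pow (?I - {b}). card S = k}. \<Sum>p\<in>{p. p permutes insert b S}. if p b = i then ?t b S p else 0)
        = (\<Sum>b\<in>?I. \<Sum>(S, p)\<in>(SIGMA S:{S. S \<subseteq> ?I - {b} \<and> card S = k}. {p. p permutes insert b S}). if p b = i then ?t b S p else 0)"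
      unfolding eq by (intro sum.cong refl sum.Sigma fin) (use finp in auto)
    also have "\<dots> = (\<Sum>(b, S, p)\<in>adj_index n k. if p b = i then ?t b S p else 0)"
      unfolding adj_index_def
      by (subst sum.Sigma) (auto intro!: finite_SigmaI fin finp sum.cong)
    also have "\<dots> = (\<Sum>t\<in>{(b, S, p) \<in> adj_index n k. p b = i}. (case t of (b, S, p) \<Rightarrow> ?t b S p))"
      by (subst sum.mono_neutral_cong_right[OF finite_adj_index, of "{(b, S, p) \<in> adj_index n k. p b = i}"]) (auto split: if_splits)
    also have "\<dots> = (\<Sum>t\<in>{(b, S, p) \<in> adj_index n k. p b = i}.
       (case t of (b, S, p) \<Rightarrow> u b * signof p * (-1) ^ k) * (case t of (b, S, p) \<Rightarrow> \<Prod>e\<in>graph_on p S. X e) * z ^ k)"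
    proof (rule sum.cong[OF refl])
      fix t assume "t \<in> {(b, S, p) \<in> adj_index n k. p b = i}"
      then obtain b S p where t: "t = (b, S, p)" "card S = k" by (auto simp: adj_index_def)
      have "(- z) ^ k = (-1) ^ k * z ^ k" by (rule power_minus)
      then show "(case t of (b, S, p) \<Rightarrow> ?t b S p) = (case t of (b, S, p) \<Rightarrow> u b * signof p * (-1) ^ k) *
          (case t of (b, S, p) \<Rightarrow> \<Prod>e\<in>graph_on p S. X e) * z ^ k"
        using t by (simp add: graph_on_simps)
    qed
    finally show "(\<Sum>b\<in>?I. \<Sum>S\<in>{S \<in> Pow (?I - {b}). card S = k}. \<Sum>p\<in>{p. p permutes insert b S}. if p b = i then ?t b S p else 0)
        = adj_coeff n X u k i * z ^ k"
      by (simp add: adj_coeff_def sum_distrib_right)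
  qed
  finally show ?thesis .
qed

text \<open>Cramer's rule without division: A times its adjugate is det A. The identity holds at
  singular A as well, so for A = 1 - z X it can be read as one between polynomials in z.\<close>

lemma adj_mult_eq_det_replace_col:
  fixes A :: "complex mat"
  assumes A: "A \<in> carrier_mat n n" and i: "i < n"
  shows "(\<Sum>j<n. A $$ (i, j) * Determinant.det (replace_col A (Matrix.vec n u) j)) = Determinant.det A * u i"
proof -
  let ?b = "Matrix.vec n u"
  have rep: "Determinant.det (replace_col A ?b j) = (adj_mat A *\<^sub>v ?b) $ j" if j: "j < n" for j
  proof -
    have Ab: "replace_col A ?b j \<in> carrier_mat n n" using A by (auto simp: replace_col_def)
    have "(adj_mat A *\<^sub>v ?b) $ j = row (adj_mat A) j \<bullet> ?b" using adj_mat(1)[OF A] j by auto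
    also have "\<dots> = Determinant.det (replace_col A ?b j)" unfolding scalar_prod_def using j A
      by (subst laplace_expansion_column[OF Ab j], auto intro!: sum.cong arg_cong[of _ _ Determinant.det]
        arg_cong[of _ _ "\<lambda> x. _ * x"] eq_matI
        simp: replace_col_def adj_mat_def Matrix.row_def cofactor_def mat_delete_def ac_simps)
    finally show ?thesis by simp
  qed
  have "A *\<^sub>v (adj_mat A *\<^sub>v ?b) = (A * adj_mat A) *\<^sub>v ?b"
    by (rule assoc_mult_mat_vec[symmetric, OF A adj_mat(1)[OF A]]) simp
  also have "\<dots> = Determinant.det A \<cdot>\<^sub>v ?b"
  proof -
    have "(Determinant.det A \<cdot>\<^sub>m 1\<^sub>m n) *\<^sub>v ?b = Determinant.det A \<cdot>\<^sub>v (1\<^sub>m n *\<^sub>v ?b)" by auto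
    then show ?thesis unfolding adj_mat(2)[OF A] by simp
  qed
  finally have "(A *\<^sub>v (adj_mat A *\<^sub>v ?b)) $ i = Determinant.det A * u i" using i by simp
  moreover have "(A *\<^sub>v (adj_mat A *\<^sub>v ?b)) $ i = (\<Sum>j<n. A $$ (i, j) * (adj_mat A *\<^sub>v ?b) $ j)"
    using A adj_mat(1)[OF A] i by (simp add: scalar_prod_def atLeast0LessThan)
  ultimately show ?thesis using rep by simp
qed

text \<open>Comparison of coefficients in (1 - z X) adj (1 - z X) u = det (1 - z X) u.\<close>

lemma adj_coeff_recursion:
  assumes i: "i < n"
  shows "adj_coeff n X u 0 i = det_coeff n X 0 * u i"
    and "adj_coeff n X u (Suc k) i = (\<Sum>j<n. X (i, j) * adj_coeff n X u k j) + det_coeff n X (Suc k) * u i"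
proof -
  have zero: "adj_coeff n X u k j = 0" "det_coeff n X k = 0" if "n < k" for k j
  proof -
    have "card S \<le> n" if "S \<subseteq> {..<n}" for S using card_mono[OF _ that] by simp
    moreover have "S \<subseteq> {..<n} - {b} \<Longrightarrow> S \<subseteq> {..<n}" for S b by blast
    ultimately have "adj_index n k = {}" "det_index n k = {}"
      using that unfolding adj_index_def det_index_def by (auto simp: not_le[symmetric])
    then show "adj_coeff n X u k j = 0" "det_coeff n X k = 0"
      unfolding adj_coeff_def det_coeff_def by (auto intro!: sum.neutral)
  qed
  \<comment> \<open>Any \<open>N\<close> above the degree serves as summation bound, the higher
    coefficients being 0; this reaches every index k.\<close>
  have main: "\<forall>k\<le>N. (if k = 0 then adj_coeff n X u 0 i else adj_coeff n X u k i - (\<Sum>j<n. X (i, j) * adj_coeff n X u (k - 1) j))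
      = det_coeff n X k * u i" if N: "n + 1 \<le> N" for N
  proof (rule iffD1[OF polyfun_eq_coeffs], rule allI)
    fix z :: complex
    let ?w = "\<lambda>j. \<Sum>k\<le>n. adj_coeff n X u k j * z ^ k"
    have ext: "(\<Sum>k\<le>n. f k * z ^ k) = (\<Sum>k\<le>M. f k * z ^ k)" if "n \<le> M" "\<And>k. n < k \<Longrightarrow> f k = 0" for f M
      by (rule sum.mono_neutral_left) (use that in auto)
    obtain N' where N': "N = Suc N'" "n \<le> N'" using N by (cases N) auto
    have C: "res_mat n X z \<in> carrier_mat n n" by (simp add: res_mat_def)
    have "(\<Sum>k\<le>N. (det_coeff n X k * u i) * z ^ k) = Determinant.det (res_mat n X z) * u i"
    proof -
      have "(\<Sum>k\<le>n. det_coeff n X k * z ^ k) = (\<Sum>k\<le>N. det_coeff n X k * z ^ k)"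
        by (rule ext) (use N zero in auto)
      then show ?thesis unfolding det_res_mat by (simp add: sum_distrib_left mult_ac)
    qed
    also have "\<dots> = (\<Sum>j<n. res_mat n X z $$ (i, j) * ?w j)"
      unfolding adj_mult_eq_det_replace_col[OF C i, symmetric] by (intro sum.cong refl) (simp add: det_replace_col_res_mat)
    also have "\<dots> = (\<Sum>j<n. (if i = j then ?w j else 0) - z * (X (i, j) * ?w j))"
      by (intro sum.cong refl) (use i in \<open>simp add: res_mat_def left_diff_distrib\<close>)
    also have "\<dots> = ?w i - z * (\<Sum>j<n. X (i, j) * ?w j)"
      using i by (simp add: sum_subtractf sum_distrib_left)
    also have "(\<Sum>j<n. X (i, j) * ?w j) = (\<Sum>k\<le>n. (\<Sum>j<n. X (i, j) * adj_coeff n X u k j) * z ^ k)"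
      unfolding sum_distrib_left sum_distrib_right by (subst sum.swap) (simp add: mult_ac)
    also have "\<dots> = (\<Sum>k\<le>N'. (\<Sum>j<n. X (i, j) * adj_coeff n X u k j) * z ^ k)"
      by (rule ext) (use N' zero in auto)
    also have "z * \<dots> = (\<Sum>k\<le>N'. (\<Sum>j<n. X (i, j) * adj_coeff n X u k j) * z ^ Suc k)"
      by (simp add: sum_distrib_left mult_ac)
    also have "?w i = (\<Sum>k\<le>N. adj_coeff n X u k i * z ^ k)" by (rule ext) (use N zero in auto)
    also have "\<dots> = adj_coeff n X u 0 i + (\<Sum>k\<le>N'. adj_coeff n X u (Suc k) i * z ^ Suc k)"
      unfolding N' by (subst sum.atMost_Suc_shift) simp
    finally have "(\<Sum>k\<le>N. (det_coeff n X k * u i) * z ^ k) = adj_coeff n X u 0 i +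
       (\<Sum>k\<le>N'. (adj_coeff n X u (Suc k) i - (\<Sum>j<n. X (i, j) * adj_coeff n X u k j)) * z ^ Suc k)"
      by (simp add: sum_subtractf left_diff_distrib)
    also have "\<dots> = (\<Sum>k\<le>N. (if k = 0 then adj_coeff n X u 0 i else adj_coeff n X u k i - (\<Sum>j<n. X (i, j) * adj_coeff n X u (k - 1) j)) * z ^ k)"
      unfolding N' by (subst sum.atMost_Suc_shift) simp
    finally show "(\<Sum>k\<le>N. (if k = 0 then adj_coeff n X u 0 i else adj_coeff n X u k i - (\<Sum>j<n. X (i, j) * adj_coeff n X u (k - 1) j)) * z ^ k)
      = (\<Sum>k\<le>N. (det_coeff n X k * u i) * z ^ k)" by simp
  qed
  show "adj_coeff n X u 0 i = det_coeff n X 0 * u i" using main[of "n + 1"] by force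
  have "(if Suc k = 0 then adj_coeff n X u 0 i else adj_coeff n X u (Suc k) i - (\<Sum>j<n. X (i, j) * adj_coeff n X u (Suc k - 1) j))
      = det_coeff n X (Suc k) * u i"
    using main[of "n + 1 + Suc k"] by (meson le_add1 le_add2)
  then show "adj_coeff n X u (Suc k) i = (\<Sum>j<n. X (i, j) * adj_coeff n X u k j) + det_coeff n X (Suc k) * u i"
    by (simp add: algebra_simps)
qed

text \<open>As formal power series, the adjugate applied to \<open>u\<close> is the determinant
  times the series of the iterates. The recursion gives this coefficient by coefficient, with no
  question of convergence.\<close>

lemma adj_coeff_eq_convolution:
  assumes "i < n"
  shows "adj_coeff n X u k i = (\<Sum>j\<le>k. det_coeff n X j * mat_iter n X u (k - j) i)"
  using assms
proof (induction k arbitrary: i)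
  case 0
  then show ?case by (simp add: adj_coeff_recursion(1))
next
  case (Suc k)
  have "(\<Sum>j<n. X (i, j) * adj_coeff n X u k j) = (\<Sum>j<n. \<Sum>l\<le>k. det_coeff n X l * (X (i, j) * mat_iter n X u (k - l) j))"
    by (intro sum.cong refl) (simp add: Suc.IH sum_distrib_left mult_ac)
  also have "\<dots> = (\<Sum>l\<le>k. \<Sum>j<n. det_coeff n X l * (X (i, j) * mat_iter n X u (k - l) j))" by (rule sum.swap)
  also have "\<dots> = (\<Sum>l\<le>k. det_coeff n X l * mat_iter n X u (Suc k - l) i)"
    by (intro sum.cong refl) (simp add: sum_distrib_left Suc_diff_le)
  finally show ?case using adj_coeff_recursion(2)[OF Suc.prems, of X u k] by simp
qed

lemma binomial_fact_le: "real (n choose k) * fact k \<le> real n ^ k"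
  using of_nat_mono[OF binomial_fact_pow[of n k], where 'a=real] by simp

section \<open>Second moments of the determinant and adjugate coefficients\<close>

context sparse_moments
begin

text \<open>A term is recovered from its edges: they show \<open>S\<close> and the permutation on
  it, which is the identity elsewhere. There are (n choose k) k! \<le> n^k terms, each of second
  moment n^-k.\<close>

lemma det_coeff_second_moment:
  shows "integrable M (\<lambda>\<omega>. (cmod (det_coeff n (\<lambda>e. x e \<omega>) k))\<^sup>2)"
    and "expectation (\<lambda>\<omega>. (cmod (det_coeff n (\<lambda>e. x e \<omega>) k))\<^sup>2) \<le> 1"
proof -
  let ?T = "det_index n k" and ?ed = "\<lambda>t :: nat set \<times> (nat \<Rightarrow> nat). graph_on (snd t) (fst t)"
  have sub: "?ed t \<subseteq> {..<n} \<times> {..<n}" and card: "card (?ed t) = k" if "t \<in> ?T" for t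
  proof -
    obtain S p where t: "t = (S, p)" "S \<subseteq> {..<n}" "card S = k" "p permutes S"
      using \<open>t \<in> ?T\<close> by (auto simp: det_index_def)
    then show "card (?ed t) = k" by (simp add: graph_on_simps)
    have "(a, p a) \<in> {..<n} \<times> {..<n}" if "a \<in> S" for a
      using t(2) that permutes_in_image[OF t(4), of a] by auto
    then show "?ed t \<subseteq> {..<n} \<times> {..<n}" using t by (auto simp: graph_on_def)
  qed
  have inj: "inj_on ?ed ?T"
  proof (rule inj_onI)
    fix t t' assume t: "t \<in> ?T" "t' \<in> ?T" "?ed t = ?ed t'"
    obtain S p S' p' where tt: "t = (S, p)" "t' = (S', p')" by (meson surj_pair)
    have p: "p permutes S" "p' permutes S'" using t tt by (auto simp: det_index_def)
    have S: "S = S'" "\<forall>i\<in>S. p i = p' i" using t(3) tt by (auto simp: graph_on_eq_iff)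
    have "p = p'"
    proof
      fix i show "p i = p' i" using S p permutes_not_in[of p S i] permutes_not_in[of p' S' i] by (cases "i \<in> S") auto
    qed
    then show "t = t'" using S tt by simp
  qed
  note * = expectation_norm_sum_sq[OF finite_det_index sub card inj, of "\<lambda>t. signof (snd t) * (-1) ^ k"]
  show "integrable M (\<lambda>\<omega>. (cmod (det_coeff n (\<lambda>e. x e \<omega>) k))\<^sup>2)"
    unfolding det_coeff_def by (rule *(2))
  have one: "cmod (signof p * (-1) ^ k) = 1" for p
    by (simp add: norm_mult norm_power sign_def)
  have "card ?T = (\<Sum>S\<in>{S. S \<subseteq> {..<n} \<and> card S = k}. card {p. p permutes S})"
    unfolding det_index_def by (rule card_SigmaI) (auto intro!: finite_permutations finite_subset[of _ "{..<n}"])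
  also have "\<dots> = (\<Sum>S\<in>{S. S \<subseteq> {..<n} \<and> card S = k}. fact k)"
    by (intro sum.cong refl) (auto intro!: card_permutations finite_subset[of _ "{..<n}"])
  also have "\<dots> = (n choose k) * fact k" by (simp add: n_subsets)
  finally have "real (card ?T) \<le> real n ^ k" using binomial_fact_le[of n k] by simp
  moreover have "expectation (\<lambda>\<omega>. (cmod (det_coeff n (\<lambda>e. x e \<omega>) k))\<^sup>2) =
      (\<Sum>t\<in>?T. (cmod (signof (snd t) * (-1) ^ k))\<^sup>2) / real n ^ k"
    unfolding det_coeff_def by (rule *(1))
  ultimately show "expectation (\<lambda>\<omega>. (cmod (det_coeff n (\<lambda>e. x e \<omega>) k))\<^sup>2) \<le> 1"
    unfolding one using n_pos by simp
qed

text \<open>For fixed i the edges determine the term, so the terms are orthogonal. Summing over i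
  counts all triples (b, S, p): for each b there are (n - 1 choose k) (k + 1)! \<le> (k + 1) n^k,
  each weighing |u b|^2 n^-k. The factor k + 1 is harmless against powers of a radius below
  1.\<close>

lemma adj_coeff_second_moment:
  shows "i < n \<Longrightarrow> integrable M (\<lambda>\<omega>. (cmod (adj_coeff n (\<lambda>e. x e \<omega>) u k i))\<^sup>2)"
    and "(\<Sum>i<n. expectation (\<lambda>\<omega>. (cmod (adj_coeff n (\<lambda>e. x e \<omega>) u k i))\<^sup>2)) \<le> real (k + 1) * (\<Sum>i<n. (cmod (u i))\<^sup>2)"
proof -
  let ?T = "\<lambda>i. {(b, S, p) \<in> adj_index n k. p b = i}"
  let ?ed = "\<lambda>t :: nat \<times> nat set \<times> (nat \<Rightarrow> nat). case t of (b, S, p) \<Rightarrow> graph_on p S"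
  have finT: "finite (?T i)" for i by (rule finite_subset[OF _ finite_adj_index]) auto
  have sub: "?ed t \<subseteq> {..<n} \<times> {..<n}" and card: "card (?ed t) = k" if "t \<in> ?T i" for t i
  proof -
    obtain b S p where t: "t = (b, S, p)" "b < n" "S \<subseteq> {..<n}" "card S = k" "p permutes insert b S"
      using \<open>t \<in> ?T i\<close> by (auto simp: adj_index_def)
    then show "card (?ed t) = k" by (simp add: graph_on_simps)
    have "(a, p a) \<in> {..<n} \<times> {..<n}" if "a \<in> S" for a
      using t(2,3) that permutes_in_image[OF t(5), of a] by auto
    then show "?ed t \<subseteq> {..<n} \<times> {..<n}" using t by (auto simp: graph_on_def)
  qed
  have inj: "inj_on ?ed (?T i)" for i
  proof (rule inj_onI)
    fix t t' assume t: "t \<in> ?T i" "t' \<in> ?T i" "?ed t = ?ed t'"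
    obtain b S p where t1: "t = (b, S, p)" by (cases t)
    obtain b' S' p' where t2: "t' = (b', S', p')" by (cases t')
    note tt = t1 t2
    have p: "p permutes insert b S" "p' permutes insert b' S'" "b \<notin> S" "b' \<notin> S'" "p b = i" "p' b' = i"
      using t tt by (auto simp: adj_index_def)
    have S: "S = S'" "\<forall>a\<in>S. p a = p' a" using t(3) tt by (auto simp: graph_on_eq_iff)
    \<comment> \<open>A permutation of \<open>insert b S\<close> has that set as its image, so
      \<open>b\<close> is recovered although no edge starts there.\<close>
    have "insert b S = insert i (p ` S)" "insert b' S' = insert i (p' ` S')"
      using permutes_image[OF p(1)] permutes_image[OF p(2)] p(5,6) by auto
    moreover have "p ` S = p' ` S'" using S by auto
    ultimately have "insert b S = insert b' S'" by simp
    then have b: "b = b'" using p(3,4) S by auto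
    have "p = p'"
    proof
      fix a
      consider "a \<in> S" | "a = b" | "a \<notin> insert b S" by blast
      then show "p a = p' a"
      proof cases
        case 3
        then show ?thesis using permutes_not_in[OF p(1), of a] permutes_not_in[OF p(2), of a] S b by simp
      qed (use S b p in auto)
    qed
    then show "t = t'" using S b tt by simp
  qed
  note * = expectation_norm_sum_sq[OF finT sub card inj, where c="\<lambda>t. case t of (b, S, p) \<Rightarrow> u b * signof p * (-1) ^ k"]
  have eq: "adj_coeff n (\<lambda>e. x e \<omega>) u k i = (\<Sum>t\<in>?T i. (case t of (b, S, p) \<Rightarrow> u b * signof p * (-1) ^ k) * (\<Prod>e\<in>?ed t. x e \<omega>))" for i \<omega>
    unfolding adj_coeff_def by (intro sum.cong refl) (auto split: prod.splits)
  show "integrable M (\<lambda>\<omega>. (cmod (adj_coeff n (\<lambda>e. x e \<omega>) u k i))\<^sup>2)" if "i < n"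
    unfolding eq by (rule *(2))
  have one: "(cmod (case t of (b, S, p) \<Rightarrow> u b * signof p * (-1) ^ k))\<^sup>2 = (cmod (u (fst t)))\<^sup>2"
    for t :: "nat \<times> nat set \<times> (nat \<Rightarrow> nat)"
    by (cases t) (simp add: norm_mult norm_power sign_def)
  have "(\<Sum>i<n. expectation (\<lambda>\<omega>. (cmod (adj_coeff n (\<lambda>e. x e \<omega>) u k i))\<^sup>2)) =
      (\<Sum>i<n. \<Sum>t\<in>?T i. (cmod (u (fst t)))\<^sup>2) / real n ^ k"
  proof -
    have "expectation (\<lambda>\<omega>. (cmod (adj_coeff n (\<lambda>e. x e \<omega>) u k i))\<^sup>2) = (\<Sum>t\<in>?T i. (cmod (u (fst t)))\<^sup>2) / real n ^ k" for i
      unfolding eq one[symmetric] by (rule *(1))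
    then show ?thesis by (simp add: sum_divide_distrib)
  qed
  also have "(\<Sum>i<n. \<Sum>t\<in>?T i. (cmod (u (fst t)))\<^sup>2) = (\<Sum>t\<in>adj_index n k. (cmod (u (fst t)))\<^sup>2)"
  proof -
    have T: "?T i = {t \<in> adj_index n k. (case t of (b, S, p) \<Rightarrow> p b) = i}" for i by auto
    show ?thesis unfolding T
    proof (rule sum.group[OF finite_adj_index])
      show "(\<lambda>t. case t of (b, S, p) \<Rightarrow> p b) ` adj_index n k \<subseteq> {..<n}"
      proof (rule image_subsetI)
        fix t assume "t \<in> adj_index n k"
        then obtain b S p where t: "t = (b, S, p)" "b < n" "S \<subseteq> {..<n}" "p permutes insert b S"
          by (auto simp: adj_index_def)
        then have "p b \<in> insert b S" using permutes_in_image[OF t(4), of b] by simp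
        then show "(case t of (b, S, p) \<Rightarrow> p b) \<in> {..<n}" using t by auto
      qed
    qed simp
  qed
  also have "\<dots> = (\<Sum>b<n. real (card (SIGMA S:{S. S \<subseteq> {..<n} - {b} \<and> card S = k}. {p. p permutes insert b S})) * (cmod (u b))\<^sup>2)"
  proof -
    have fin: "finite (SIGMA S:{S. S \<subseteq> {..<n} - {b} \<and> card S = k}. {p. p permutes insert b S})" for b
      by (intro finite_SigmaI finite_permutations finite.insertI) (auto intro: finite_subset[of _ "{..<n}"])
    have "(\<Sum>t\<in>adj_index n k. (cmod (u (fst t)))\<^sup>2) =
       (\<Sum>b<n. \<Sum>t\<in>(SIGMA S:{S. S \<subseteq> {..<n} - {b} \<and> card S = k}. {p. p permutes insert b S}). (cmod (u b))\<^sup>2)"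
      unfolding adj_index_def by (subst sum.Sigma) (use fin in \<open>auto intro!: sum.cong\<close>)
    then show ?thesis by simp
  qed
  also have "\<dots> \<le> (\<Sum>b<n. (real (k + 1) * real n ^ k) * (cmod (u b))\<^sup>2)"
  proof (intro sum_mono mult_right_mono)
    fix b assume b: "b \<in> {..<n}"
    have fS: "finite S" "b \<notin> S" if "S \<subseteq> {..<n} - {b}" for S using that by (auto intro: finite_subset[of _ "{..<n}"])
    have "card (SIGMA S:{S. S \<subseteq> {..<n} - {b} \<and> card S = k}. {p. p permutes insert b S}) =
        (\<Sum>S\<in>{S. S \<subseteq> {..<n} - {b} \<and> card S = k}. card {p. p permutes insert b S})"
      by (rule card_SigmaI) (use fS in \<open>auto intro!: finite_permutations\<close>)
    also have "\<dots> = (\<Sum>S\<in>{S. S \<subseteq> {..<n} - {b} \<and> card S = k}. fact (Suc k))"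
      by (intro sum.cong refl card_permutations) (use fS in auto)
    also have "\<dots> = ((n - 1) choose k) * fact (Suc k)" using b by (simp add: n_subsets)
    also have "real \<dots> = real (k + 1) * (real ((n - 1) choose k) * fact k)"
      by (simp add: algebra_simps)
    also have "\<dots> \<le> real (k + 1) * real (n - 1) ^ k" by (intro mult_left_mono binomial_fact_le) simp
    also have "\<dots> \<le> real (k + 1) * real n ^ k" by (intro mult_left_mono power_mono) auto
    finally show "real (card (SIGMA S:{S. S \<subseteq> {..<n} - {b} \<and> card S = k}. {p. p permutes insert b S})) \<le> real (k + 1) * real n ^ k" by simp
  qed simp
  also have "\<dots> = real (k + 1) * (\<Sum>i<n. (cmod (u i))\<^sup>2) * real n ^ k" by (simp add: sum_distrib_left mult_ac)
  finally show "(\<Sum>i<n. expectation (\<lambda>\<omega>. (cmod (adj_coeff n (\<lambda>e. x e \<omega>) u k i))\<^sup>2)) \<le> real (k + 1) * (\<Sum>i<n. (cmod (u i))\<^sup>2)"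
    using n_pos by (simp add: divide_right_mono pos_divide_le_eq)
qed

end

section \<open>A lower bound on the reversed characteristic polynomial\<close>

lemma mat_iter_eq_pow:
  fixes X :: "nat \<times> nat \<Rightarrow> complex" and n :: nat
  defines "A \<equiv> Matrix.mat n n X"
  assumes i: "i < n"
  shows "mat_iter n X u k i = (A ^\<^sub>m k *\<^sub>v Matrix.vec n u) $ i"
proof (induction k arbitrary: u)
  case 0
  then show ?case using i by (simp add: A_def)
next
  case (Suc k)
  have A: "A \<in> carrier_mat n n" by (simp add: A_def)
  have v: "Matrix.vec n (mat_iter n X u (Suc 0)) = A *\<^sub>v Matrix.vec n u"
    by (rule eq_vecI) (auto simp: A_def scalar_prod_def atLeast0LessThan)
  have "mat_iter n X u (Suc k) i = (A ^\<^sub>m k *\<^sub>v (A *\<^sub>v Matrix.vec n u)) $ i"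
    unfolding mat_iter_shift[of n X u k] Suc.IH v ..
  also have "\<dots> = (A ^\<^sub>m Suc k *\<^sub>v Matrix.vec n u) $ i"
    using assoc_mult_mat_vec[OF pow_carrier_mat[OF A] A, of "Matrix.vec n u" k] by simp
  finally show ?case .
qed

definition mat_trace :: "complex mat \<Rightarrow> complex" where
  "mat_trace A = (\<Sum>i<dim_row A. A $$ (i, i))"

lemma mat_trace_mult_commute:
  assumes "A \<in> carrier_mat n n" "B \<in> carrier_mat n n"
  shows "mat_trace (A * B) = mat_trace (B * A)"
proof -
  have *: "mat_trace (C * D) = (\<Sum>i<n. \<Sum>j<n. C $$ (i, j) * D $$ (j, i))"
    if "C \<in> carrier_mat n n" "D \<in> carrier_mat n n" for C D
    using that by (simp add: mat_trace_def scalar_prod_def atLeast0LessThan)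
  show ?thesis unfolding *[OF assms] *[OF assms(2,1)] by (subst sum.swap) (simp add: mult.commute)
qed

lemma mat_trace_similar:
  assumes "A \<in> carrier_mat n n" "similar_mat_wit A B P Q"
  shows "mat_trace A = mat_trace B"
proof -
  note w = similar_mat_witD2[OF assms]
  have "mat_trace A = mat_trace (P * (B * Q))" using w by (simp add: assoc_mult_mat[of P n n B n Q n])
  also have "\<dots> = mat_trace ((B * Q) * P)" by (rule mat_trace_mult_commute[of _ n]) (use w in auto)
  also have "(B * Q) * P = B" using w by (simp add: assoc_mult_mat[of B n n Q n P n])
  finally show ?thesis .
qed

lemma upper_triangular_pow:
  assumes B: "(B :: complex mat) \<in> carrier_mat n n" and ut: "upper_triangular B"
  shows "upper_triangular (B ^\<^sub>m k) \<and> (\<forall>i<n. (B ^\<^sub>m k) $$ (i, i) = (B $$ (i, i)) ^ k)"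
proof (induction k)
  case 0
  then show ?case using B by (auto simp: upper_triangular_def)
next
  case (Suc k)
  let ?C = "B ^\<^sub>m k"
  have C: "?C \<in> carrier_mat n n" using B by (rule pow_carrier_mat)
  have e: "(?C * B) $$ (i, j) = (\<Sum>l<n. ?C $$ (i, l) * B $$ (l, j))" if "i < n" "j < n" for i j
    using B C that by (simp add: scalar_prod_def atLeast0LessThan)
  have z: "?C $$ (i, l) * B $$ (l, j) = 0" if "i < n" "l < n" "j \<le> i" "\<not> (l = i \<and> j = i)" for i j l
  proof (cases "l < i")
    case True
    then show ?thesis using Suc C that carrier_matD(1)[OF B] by (simp add: upper_triangular_def)
  next
    case False
    then show ?thesis using ut B that by (auto simp: upper_triangular_def)
  qed
  have "(?C * B) $$ (i, j) = 0" if "i < n" "j < i" for i j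
  proof -
    have "(?C * B) $$ (i, j) = (\<Sum>l<n. ?C $$ (i, l) * B $$ (l, j))" by (rule e) (use that in auto)
    also have "\<dots> = 0" by (intro sum.neutral ballI z) (use that in auto)
    finally show ?thesis .
  qed
  moreover have "(?C * B) $$ (i, i) = (B $$ (i, i)) ^ Suc k" if "i < n" for i
  proof -
    have "(?C * B) $$ (i, i) = (\<Sum>l<n. if l = i then ?C $$ (i, i) * B $$ (i, i) else 0)"
      unfolding e[OF that that] by (intro sum.cong refl) (use z[OF that] in auto)
    then show ?thesis using that Suc by simp
  qed
  ultimately show ?case using B C by (auto simp: upper_triangular_def)
qed

text \<open>Schur triangularisation provides a single list of eigenvalues that serves the
  determinant and the traces of all powers.\<close>

lemma mat_trace_power_eigenvalues:
  fixes X :: "nat \<times> nat \<Rightarrow> complex"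
  shows "\<exists>as. (\<forall>z. Determinant.det (res_mat n X z) = (\<Prod>a\<leftarrow>as. 1 - z * a)) \<and>
     (\<forall>k. mat_trace_power n X k = (\<Sum>a\<leftarrow>as. a ^ k))"
proof -
  define A where "A = Matrix.mat n n X"
  have A: "A \<in> carrier_mat n n" by (simp add: A_def)
  obtain as where as: "char_poly A = (\<Prod>a\<leftarrow>as. [:- a, 1:])" "length as = n"
    using char_poly_factorized[OF A] by blast
  have det: "Determinant.det (res_mat n X z) = (\<Prod>a\<leftarrow>as. 1 - z * a)" for z
  proof (cases "z = 0")
    case True
    have "res_mat n X 0 = 1\<^sub>m n" by (rule eq_matI) (auto simp: res_mat_def)
    then show ?thesis using True by (simp add: map_replicate_const)
  next
    case False
    have "res_mat n X z = z \<cdot>\<^sub>m (- (char_matrix A (1 / z)))"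
      by (rule eq_matI) (use False in \<open>auto simp: res_mat_def char_matrix_def A_def right_diff_distrib algebra_simps\<close>)
    then have "Determinant.det (res_mat n X z) = z ^ n * poly (char_poly A) (1 / z)"
      using char_matrix_closed[OF A, of "1 / z"] by (simp add: char_poly_matrix[OF A])
    also have "\<dots> = (\<Prod>a\<leftarrow>as. z) * (\<Prod>a\<leftarrow>as. 1 / z - a)"
      unfolding as(1) poly_prod_list by (simp add: as(2) prod_list_replicate map_replicate_const comp_def)
    also have "\<dots> = (\<Prod>a\<leftarrow>as. 1 - z * a)"
      using False by (induction as) (auto simp: field_simps)
    finally show ?thesis .
  qed
  obtain B P Q where schur: "schur_decomposition A as = (B, P, Q)" by (cases "schur_decomposition A as") auto
  from schur_decomposition[OF A as(1) schur]
  have sim: "similar_mat_wit A B P Q" and ut: "upper_triangular B" and dB: "diag_mat B = as" by auto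
  note w = similar_mat_witD2[OF A sim]
  have tr: "mat_trace_power n X k = (\<Sum>a\<leftarrow>as. a ^ k)" for k
  proof -
    have "mat_trace_power n X k = mat_trace (A ^\<^sub>m k)"
    proof -
      have "mat_iter n X (\<lambda>j. if j = i then 1 else 0) k i = (A ^\<^sub>m k) $$ (i, i)" if i: "i < n" for i
      proof -
        have "mat_iter n X (\<lambda>j. if j = i then 1 else 0) k i = (\<Sum>j<n. (A ^\<^sub>m k) $$ (i, j) * (if j = i then 1 else 0))"
          unfolding mat_iter_eq_pow[OF i] A_def[symmetric] using i carrier_matD[OF pow_carrier_mat[OF A, of k]]
          by (simp add: index_mult_mat_vec scalar_prod_def atLeast0LessThan del: pow_mat_dim)
        then show ?thesis using i by (simp add: if_distrib[of "(*) _"] cong: if_cong)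
      qed
      then show ?thesis using A by (simp add: mat_trace_power_def mat_trace_def)
    qed
    also have "\<dots> = mat_trace (B ^\<^sub>m k)"
      by (rule mat_trace_similar[OF pow_carrier_mat[OF A] similar_mat_wit_pow[OF sim]])
    also have "\<dots> = (\<Sum>i<n. (B $$ (i, i)) ^ k)"
      using upper_triangular_pow[OF w(5) ut, of k] w(5) by (simp add: mat_trace_def)
    also have "\<dots> = (\<Sum>a\<leftarrow>diag_mat B. a ^ k)"
      using w(5) by (simp add: diag_mat_def comp_def interv_sum_list_conv_sum_set_nat atLeast0LessThan)
    finally show ?thesis unfolding dB .
  qed
  show ?thesis using det tr by blast
qed

lemma holomorphic_prod_list_linear: "(\<lambda>z. \<Prod>a\<leftarrow>as. 1 - z * a :: complex) holomorphic_on S"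
  by (induction as) (auto intro!: holomorphic_intros)

text \<open>The logarithmic derivative of Q is minus the generating series of the power sums.
  Multiplying by Q keeps the truncated statement meaningful at the zeros of Q. Each new factor 1 - z
  a contributes a geometric sum whose remainder is divisible by \<open>z ^ m\<close>.\<close>

lemma log_derivative_remainder:
  "\<exists>S. S holomorphic_on UNIV \<and> (\<forall>z. deriv (\<lambda>z. \<Prod>a\<leftarrow>as. 1 - z * a) z +
      (\<Prod>a\<leftarrow>as. 1 - z * a) * (\<Sum>k<m. (\<Sum>a\<leftarrow>as. a ^ Suc k) * z ^ k) = z ^ m * S (z :: complex))"
proof (induction as)
  case Nil
  then show ?case by (intro exI[of _ "\<lambda>_. 0"]) auto
next
  case (Cons a as)
  let ?Q = "\<lambda>z. \<Prod>a\<leftarrow>as. 1 - z * a" and ?T = "\<lambda>z. \<Sum>k<m. (\<Sum>a\<leftarrow>as. a ^ Suc k) * z ^ k"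
  have Qhol: "?Q holomorphic_on UNIV" by (rule holomorphic_prod_list_linear)
  obtain S where S: "S holomorphic_on UNIV" "\<And>z. deriv ?Q z + ?Q z * ?T z = z ^ m * S z" using Cons by blast
  show ?case
  proof (intro exI[of _ "\<lambda>z. (1 - z * a) * S z - ?Q z * a ^ Suc m"] conjI allI)
    show "(\<lambda>z. (1 - z * a) * S z - ?Q z * a ^ Suc m) holomorphic_on UNIV"
      by (intro holomorphic_intros S Qhol)
    fix z
    have "deriv (\<lambda>z. (1 - z * a) * ?Q z) z = - a * ?Q z + (1 - z * a) * deriv ?Q z"
    proof (rule DERIV_imp_deriv)
      have "(?Q has_field_derivative deriv ?Q z) (at z)"
        using Qhol by (meson UNIV_I holomorphic_derivI open_UNIV)
      then show "((\<lambda>z. (1 - z * a) * ?Q z) has_field_derivative (- a * ?Q z + (1 - z * a) * deriv ?Q z)) (at z)"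
        by (auto intro!: derivative_eq_intros simp: algebra_simps)
    qed
    moreover have "(\<Sum>k<m. (a ^ Suc k + (\<Sum>a\<leftarrow>as. a ^ Suc k)) * z ^ k) = (\<Sum>k<m. a ^ Suc k * z ^ k) + ?T z"
      by (simp add: distrib_right sum.distrib)
    moreover have geo: "(1 - z * a) * (\<Sum>k<m. a ^ Suc k * z ^ k) = a - a * (z * a) ^ m"
    proof -
      have "(\<Sum>k<m. a ^ Suc k * z ^ k) = a * (\<Sum>k<m. (z * a) ^ k)"
        by (simp add: sum_distrib_left power_mult_distrib mult_ac)
      then have "(1 - z * a) * (\<Sum>k<m. a ^ Suc k * z ^ k) = a * ((1 - z * a) * (\<Sum>k<m. (z * a) ^ k))" by simp
      also have "\<dots> = a * (1 - (z * a) ^ m)" by (simp only: one_diff_power_eq)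
      finally show ?thesis by (simp add: right_diff_distrib)
    qed
    ultimately have "deriv (\<lambda>z. \<Prod>a\<leftarrow>a # as. 1 - z * a) z +
        (\<Prod>a\<leftarrow>a # as. 1 - z * a) * (\<Sum>k<m. (\<Sum>a\<leftarrow>a # as. a ^ Suc k) * z ^ k) =
        (1 - z * a) * (deriv ?Q z + ?Q z * ?T z) + ?Q z * ((1 - z * a) * (\<Sum>k<m. a ^ Suc k * z ^ k) - a)"
      by (simp add: algebra_simps)
    also have "\<dots> = z ^ m * ((1 - z * a) * S z - ?Q z * a ^ Suc m)"
      unfolding S(2) geo by (simp add: algebra_simps power_mult_distrib)
    finally show "deriv (\<lambda>z. \<Prod>a\<leftarrow>a # as. 1 - z * a) z +
        (\<Prod>a\<leftarrow>a # as. 1 - z * a) * (\<Sum>k<m. (\<Sum>a\<leftarrow>a # as. a ^ Suc k) * z ^ k) =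
        z ^ m * ((1 - z * a) * S z - ?Q z * a ^ Suc m)" .
  qed
qed

text \<open>Multiplied by the exponential of the first power sums, the reversed characteristic polynomial is
  \<open>1 + O(z ^ Suc m)\<close>; Cauchy's inequality then bounds the remainder.\<close>

lemma reversed_char_poly_lower_bound:
  fixes as :: "complex list"
  assumes r: "0 < r" "r < R" and M: "\<And>z. cmod z \<le> R \<Longrightarrow> cmod (\<Prod>a\<leftarrow>as. 1 - z * a) \<le> M"
    and T: "(\<Sum>k<m. cmod (\<Sum>a\<leftarrow>as. a ^ Suc k) * R ^ Suc k / real (Suc k)) \<le> T"
    and small: "M * exp T * (r / R) ^ Suc m / (1 - r / R) \<le> 1 / 2"
    and z: "cmod z \<le> r"
  shows "exp (- T) / 2 \<le> cmod (\<Prod>a\<leftarrow>as. 1 - z * a)"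
proof -
  let ?Q = "\<lambda>z. \<Prod>a\<leftarrow>as. 1 - z * a" and ?t = "\<lambda>k. \<Sum>a\<leftarrow>as. a ^ Suc k"
  let ?E = "\<lambda>z. \<Sum>k<m. ?t k / of_nat (Suc k) * z ^ Suc k"
  let ?G = "\<lambda>z. ?Q z * exp (?E z)"
  obtain S where S: "S holomorphic_on UNIV" "\<And>z. deriv ?Q z + ?Q z * (\<Sum>k<m. ?t k * z ^ k) = z ^ m * S z"
    using log_derivative_remainder[of as m] by blast
  have Qhol: "?Q holomorphic_on UNIV" by (rule holomorphic_prod_list_linear)
  have Ehol: "?E holomorphic_on UNIV" by (intro holomorphic_intros)
  have Ghol: "?G holomorphic_on UNIV" by (intro holomorphic_intros Qhol Ehol)
  \<comment> \<open>The exponent is the truncated series of -log Q, so the derivative of the product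
    has no powers of w below m.\<close>
  have dG: "deriv ?G = (\<lambda>w. w ^ m * (S w * exp (?E w)))"
  proof
    fix w
    have q: "(?Q has_field_derivative deriv ?Q w) (at w)"
      using Qhol by (meson UNIV_I holomorphic_derivI open_UNIV)
    have "((\<lambda>z. ?t k / of_nat (Suc k) * z ^ Suc k) has_field_derivative ?t k * w ^ k) (at w)" for k
    proof -
      have "((\<lambda>z. ?t k / of_nat (Suc k) * z ^ Suc k) has_field_derivative ?t k / of_nat (Suc k) * (of_nat (Suc k) * w ^ k)) (at w)"
        using DERIV_cmult[OF DERIV_power[OF DERIV_ident, of "Suc k" w UNIV], of "?t k / of_nat (Suc k)"]
        by (simp del: of_nat_Suc power_Suc)
      then show ?thesis by (simp del: of_nat_Suc)
    qed
    then have "(?E has_field_derivative (\<Sum>k<m. ?t k * w ^ k)) (at w)"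
      by (intro DERIV_sum) auto
    then have "(?G has_field_derivative (?Q w * (exp (?E w) * (\<Sum>k<m. ?t k * w ^ k)) + deriv ?Q w * exp (?E w))) (at w)"
      using q by (intro DERIV_mult' DERIV_chain2[OF DERIV_exp]) auto
    moreover have "?Q w * (exp (?E w) * (\<Sum>k<m. ?t k * w ^ k)) + deriv ?Q w * exp (?E w) = w ^ m * (S w * exp (?E w))"
    proof -
      have gen: "a * (e * t) + d * e = (d + a * t) * e" for a e t d :: complex by (simp add: algebra_simps)
      have S2: "deriv ?Q w + ?Q w * (\<Sum>k<m. ?t k * w ^ k) = w ^ m * S w" by (rule S(2))
      have "?Q w * (exp (?E w) * (\<Sum>k<m. ?t k * w ^ k)) + deriv ?Q w * exp (?E w)
          = (deriv ?Q w + ?Q w * (\<Sum>k<m. ?t k * w ^ k)) * exp (?E w)" by (rule gen)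
      also have "\<dots> = w ^ m * S w * exp (?E w)" by (simp only: S2)
      finally show ?thesis by (simp only: mult.assoc)
    qed
    ultimately show "deriv ?G w = w ^ m * (S w * exp (?E w))" by (simp add: DERIV_imp_deriv)
  qed
  have G0: "?G 0 = 1" by (simp add: map_replicate_const)
  \<comment> \<open>By Leibniz every term contains a derivative of \<open>w ^ m\<close> of order
    below m, which vanishes at 0.\<close>
  have van: "(deriv ^^ k) ?G 0 = 0" if k: "1 \<le> k" "k \<le> m" for k
  proof -
    obtain j where j: "k = Suc j" "j < m" using k by (cases k) auto
    have "(deriv ^^ k) ?G 0 = (deriv ^^ j) (deriv ?G) 0" by (simp add: j(1) funpow_swap1)
    also have "\<dots> = (\<Sum>i = 0..j. of_nat (j choose i) * (deriv ^^ i) (\<lambda>w. w ^ m) 0 * (deriv ^^ (j - i)) (\<lambda>w. S w * exp (?E w)) 0)"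
      unfolding dG by (rule higher_deriv_mult[where S=UNIV]) (auto intro!: holomorphic_intros S Ehol)
    also have "\<dots> = 0"
    proof (intro sum.neutral ballI)
      fix i assume i: "i \<in> {0..j}"
      have "(deriv ^^ i) (\<lambda>w. (w - 0) ^ m) 0 = pochhammer (of_nat (Suc m - i)) i * ((0 :: complex) - 0) ^ (m - i)"
        by (rule higher_deriv_power)
      then show "of_nat (j choose i) * (deriv ^^ i) (\<lambda>w. w ^ m) 0 * (deriv ^^ (j - i)) (\<lambda>w. S w * exp (?E w)) 0 = 0"
        using i j by simp
    qed
    finally show ?thesis .
  qed
  have E: "cmod (?E w) \<le> T" if "cmod w \<le> R" for w
  proof -
    have "cmod (?E w) \<le> (\<Sum>k<m. cmod (?t k / of_nat (Suc k) * w ^ Suc k))" by (rule norm_sum)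
    also have "\<dots> \<le> (\<Sum>k<m. cmod (?t k) * R ^ Suc k / real (Suc k))"
    proof (rule sum_mono)
      fix k
      have "cmod w ^ Suc k \<le> R ^ Suc k" using that by (intro power_mono) auto
      then show "cmod (?t k / of_nat (Suc k) * w ^ Suc k) \<le> cmod (?t k) * R ^ Suc k / real (Suc k)"
        unfolding norm_mult norm_divide norm_power norm_of_nat by (simp add: divide_right_mono mult_left_mono del: power_Suc of_nat_Suc)
    qed
    finally show ?thesis using T by linarith
  qed
  have expb: "cmod (exp (?E w)) \<le> exp T" if "cmod w \<le> R" for w
    using E[OF that] complex_Re_le_cmod[of "?E w"] by simp
  have M0: "0 \<le> M" using order_trans[OF norm_ge_zero M[of 0]] r by simp
  have Gb: "cmod (?G w) \<le> M * exp T" if "cmod w \<le> R" for w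
    unfolding norm_mult using M[OF that] expb[OF that] M0 by (intro mult_mono) auto
  have coef: "cmod ((deriv ^^ k) ?G 0 / fact k) \<le> M * exp T / R ^ k" for k
  proof -
    have "cmod ((deriv ^^ k) ?G 0) \<le> fact k * (M * exp T) / R ^ k"
    proof (rule Cauchy_inequality)
      show "?G holomorphic_on ball 0 R" using Ghol by (rule holomorphic_on_subset) simp
      show "continuous_on (cball 0 R) ?G" using holomorphic_on_imp_continuous_on[OF Ghol] by (rule continuous_on_subset) simp
      show "cmod (?G w) \<le> M * exp T" if "cmod (0 - w) = R" for w using Gb[of w] that by simp
    qed (use r in auto)
    then have "cmod ((deriv ^^ k) ?G 0) / fact k \<le> fact k * (M * exp T) / R ^ k / fact k"
      by (rule divide_right_mono) simp
    also have "\<dots> = M * exp T / R ^ k" by simp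
    finally show ?thesis unfolding norm_divide norm_fact .
  qed
  have sums: "(\<lambda>k. (deriv ^^ k) ?G 0 / fact k * z ^ k) sums ?G z"
    using holomorphic_power_series[of ?G 0 R z] Ghol z r by (auto intro: holomorphic_on_subset)
  have q1: "0 \<le> r / R" "r / R < 1" using r by auto
  have "(\<lambda>k. (deriv ^^ (k + Suc m)) ?G 0 / fact (k + Suc m) * z ^ (k + Suc m)) sums
      (?G z - (\<Sum>k<Suc m. (deriv ^^ k) ?G 0 / fact k * z ^ k))"
    using sums by (subst sums_iff_shift) simp
  also have "(\<Sum>k<Suc m. (deriv ^^ k) ?G 0 / fact k * z ^ k) = (\<Sum>k<Suc m. if k = 0 then 1 else 0)"
  proof (intro sum.cong refl)
    fix k assume "k \<in> {..<Suc m}"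
    then show "(deriv ^^ k) ?G 0 / fact k * z ^ k = (if k = 0 then 1 else 0)"
      using van[of k] G0 by (cases "k = 0") auto
  qed
  also have "\<dots> = 1" by simp
  finally have s2: "(\<lambda>k. (deriv ^^ (k + Suc m)) ?G 0 / fact (k + Suc m) * z ^ (k + Suc m)) sums (?G z - 1)" .
  have tb: "cmod ((deriv ^^ (k + Suc m)) ?G 0 / fact (k + Suc m) * z ^ (k + Suc m)) \<le> M * exp T * (r / R) ^ Suc m * (r / R) ^ k" for k
  proof -
    have "cmod z ^ (k + Suc m) \<le> r ^ (k + Suc m)" using z by (intro power_mono) auto
    then have "cmod ((deriv ^^ (k + Suc m)) ?G 0 / fact (k + Suc m)) * cmod z ^ (k + Suc m) \<le> (M * exp T / R ^ (k + Suc m)) * r ^ (k + Suc m)"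
      using M0 r by (intro mult_mono[OF coef]) (auto simp del: power_Suc)
    also have "\<dots> = M * exp T * (r / R) ^ Suc m * (r / R) ^ k"
      by (simp add: power_add power_divide mult_ac)
    finally show ?thesis by (simp only: norm_mult norm_power)
  qed
  have gs: "(\<lambda>k. M * exp T * (r / R) ^ Suc m * (r / R) ^ k) sums (M * exp T * (r / R) ^ Suc m * (1 / (1 - r / R)))"
    using q1 by (intro sums_mult geometric_sums) auto
  have "cmod (?G z - 1) \<le> M * exp T * (r / R) ^ Suc m * (1 / (1 - r / R))"
    by (rule norm_sums_le[OF s2 gs tb])
  then have "cmod (?G z - 1) \<le> 1 / 2" using small by (simp only: times_divide_eq_right mult_1_right)
  then have "1 / 2 \<le> cmod (?G z)" using norm_triangle_ineq2[of 1 "1 - ?G z"] by (simp add: norm_minus_commute)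
  \<comment> \<open>The lower bound 1/2 passes from G to Q, since the exponential factor is at most
    \<open>exp T\<close>.\<close>
  also have "\<dots> \<le> cmod (?Q z) * exp T"
    unfolding norm_mult using expb[of z] z r by (intro mult_left_mono) auto
  finally show ?thesis by (simp add: exp_minus field_simps)
qed

section \<open>Growth of the iterates\<close>

definition l2norm :: "nat \<Rightarrow> (nat \<Rightarrow> complex) \<Rightarrow> real" where
  "l2norm n f = L2_set (\<lambda>i. cmod (f i)) {..<n}"

lemma l2norm_nonneg: "0 \<le> l2norm n f"
  by (simp add: l2norm_def L2_set_nonneg)

lemma l2norm_sq: "(l2norm n f)\<^sup>2 = (\<Sum>i<n. (cmod (f i))\<^sup>2)"
  by (simp add: l2norm_def L2_set_def sum_nonneg)

lemma component_le_l2norm: "i < n \<Longrightarrow> cmod (f i) \<le> l2norm n f"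
  unfolding l2norm_def using member_le_L2_set[of "{..<n}" i "\<lambda>i. cmod (f i)"] by simp

lemma l2norm_triangle: "l2norm n (\<lambda>i. f i + g i) \<le> l2norm n f + l2norm n g"
proof -
  have "l2norm n (\<lambda>i. f i + g i) \<le> L2_set (\<lambda>i. cmod (f i) + cmod (g i)) {..<n}"
    unfolding l2norm_def by (rule L2_set_mono) (auto intro: norm_triangle_ineq)
  also have "\<dots> \<le> l2norm n f + l2norm n g" unfolding l2norm_def by (rule L2_set_triangle_ineq)
  finally show ?thesis .
qed

lemma l2norm_scale: "l2norm n (\<lambda>i. c * f i) = cmod c * l2norm n f"
  by (simp add: l2norm_def norm_mult L2_set_right_distrib)

lemma l2norm_sum: "finite J \<Longrightarrow> l2norm n (\<lambda>i. \<Sum>j\<in>J. f j i) \<le> (\<Sum>j\<in>J. l2norm n (f j))"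
proof (induction rule: finite_induct)
  case empty
  then show ?case by (simp add: l2norm_def L2_set_def)
next
  case (insert j J)
  then show ?case using l2norm_triangle[of n "f j" "\<lambda>i. \<Sum>j\<in>J. f j i"] by simp
qed

lemma inner_le_l2norm: "cmod (\<Sum>i<n. cnj (f i) * g i) \<le> l2norm n f * l2norm n g"
proof -
  have "cmod (\<Sum>i<n. cnj (f i) * g i) \<le> (\<Sum>i<n. \<bar>cmod (f i)\<bar> * \<bar>cmod (g i)\<bar>)"
    by (rule order_trans[OF norm_sum]) (simp add: norm_mult)
  also have "\<dots> \<le> l2norm n f * l2norm n g" unfolding l2norm_def by (rule L2_set_mult_ineq)
  finally show ?thesis .
qed

lemma det_adj_coeff_zero:
  assumes "n < k"
  shows "det_coeff n X k = 0" "adj_coeff n X u k i = 0"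
proof -
  have "card S \<le> n" if "S \<subseteq> {..<n}" for S using card_mono[OF _ that] by simp
  moreover have "S \<subseteq> {..<n} - {b} \<Longrightarrow> S \<subseteq> {..<n}" for S b by blast
  ultimately have "adj_index n k = {}" "det_index n k = {}"
    using assms unfolding adj_index_def det_index_def by (auto simp: not_le[symmetric])
  then show "det_coeff n X k = 0" "adj_coeff n X u k i = 0"
    unfolding adj_coeff_def det_coeff_def by (auto intro!: sum.neutral)
qed

lemma det_res_mat_0: "Determinant.det (res_mat n X 0) = 1"
proof -
  have "res_mat n X 0 = 1\<^sub>m n" by (rule eq_matI) (auto simp: res_mat_def)
  then show ?thesis by simp
qed

lemma holomorphic_det_res_mat: "(\<lambda>z. Determinant.det (res_mat n X z)) holomorphic_on S"
  unfolding det_res_mat by (intro holomorphic_intros)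

text \<open>The iterates are the convolution of the adjugate coefficients with the Taylor coefficients of the
  reciprocal determinant, which Cauchy's inequality controls.\<close>

lemma mat_iter_norm_bound:
  assumes r: "0 < r" and \<delta>: "0 < \<delta>" and q: "\<And>z. cmod z \<le> r \<Longrightarrow> \<delta> \<le> cmod (Determinant.det (res_mat n X z))"
    and M: "(\<Sum>j\<le>n. r ^ j * l2norm n (adj_coeff n X u j)) \<le> M"
  shows "l2norm n (mat_iter n X u k) \<le> M / \<delta> / r ^ k"
proof -
  let ?q = "\<lambda>z. Determinant.det (res_mat n X z)"
  define F where "F = (\<Sum>k\<le>n. fps_const (det_coeff n X k) * fps_X ^ k)"
  have Fn: "fps_nth F k = det_coeff n X k" for k
  proof -
    have "fps_nth (fps_const c * fps_X ^ j) k = (if j = k then c else 0)" for c :: complex and j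
      by (simp add: fps_X_power_nth)
    then have "fps_nth F k = (\<Sum>j\<le>n. if j = k then det_coeff n X j else 0)"
      unfolding F_def fps_sum_nth by simp
    then show ?thesis using det_adj_coeff_zero(1)[of n k X] by (cases "k \<le> n") auto
  qed
  have Fexp: "?q has_fps_expansion F"
    unfolding det_res_mat F_def by (intro fps_expansion_intros)
  have c0: "det_coeff n X 0 = 1"
    using det_res_mat_0[of n X] unfolding det_res_mat by (simp add: power_0_left if_distrib cong: if_cong)
  have F0: "fps_nth F 0 \<noteq> 0" unfolding Fn c0 by simp
  define P where "P = inverse F"
  have Pexp: "(\<lambda>z. inverse (?q z)) has_fps_expansion P"
    unfolding P_def by (rule has_fps_expansion_inverse[OF Fexp F0])
  have nz: "?q z \<noteq> 0" if "cmod z \<le> r" for z using q[OF that] \<delta> by auto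
  have Pb: "cmod (fps_nth P k) \<le> 1 / \<delta> / r ^ k" for k
  proof -
    have "cmod ((deriv ^^ k) (\<lambda>z. inverse (?q z)) 0) \<le> fact k * (1 / \<delta>) / r ^ k"
    proof (rule Cauchy_inequality[OF _ _ r])
      show "(\<lambda>z. inverse (?q z)) holomorphic_on ball 0 r"
        by (intro holomorphic_intros holomorphic_det_res_mat) (use nz in auto)
      show "continuous_on (cball 0 r) (\<lambda>z. inverse (?q z))"
        by (intro continuous_on_inverse holomorphic_on_imp_continuous_on holomorphic_det_res_mat) (use nz in auto)
      show "cmod (inverse (?q z)) \<le> 1 / \<delta>" if "cmod (0 - z) = r" for z
        using le_imp_inverse_le[OF q[of z] \<delta>] that by (simp add: norm_inverse divide_inverse)
    qed
    then have "cmod ((deriv ^^ k) (\<lambda>z. inverse (?q z)) 0) / fact k \<le> fact k * (1 / \<delta>) / r ^ k / fact k"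
      by (rule divide_right_mono) simp
    then show ?thesis unfolding fps_nth_fps_expansion[OF Pexp] norm_divide norm_fact by simp
  qed
  have conv: "mat_iter n X u k i = (\<Sum>j\<le>k. fps_nth P (k - j) * adj_coeff n X u j i)" if i: "i < n" for i
  proof -
    define U where "U = Abs_fps (\<lambda>k. mat_iter n X u k i)"
    define W where "W = Abs_fps (\<lambda>k. adj_coeff n X u k i)"
    have "W = F * U"
    proof (rule fps_ext)
      fix k
      show "fps_nth W k = fps_nth (F * U) k"
        unfolding W_def U_def fps_mult_nth by (simp add: Fn adj_coeff_eq_convolution[OF i] atMost_atLeast0)
    qed
    then have "P * W = U" unfolding P_def using inverse_mult_eq_1[OF F0] by (simp add: mult.assoc[symmetric])
    then have "fps_nth U k = fps_nth (W * P) k" by (simp add: mult.commute)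
    then show ?thesis unfolding fps_mult_nth U_def W_def by (simp add: atMost_atLeast0 mult.commute)
  qed
  have "l2norm n (mat_iter n X u k) = l2norm n (\<lambda>i. \<Sum>j\<le>k. fps_nth P (k - j) * adj_coeff n X u j i)"
    unfolding l2norm_def by (intro L2_set_cong refl) (use conv in simp)
  also have "\<dots> \<le> (\<Sum>j\<le>k. l2norm n (\<lambda>i. fps_nth P (k - j) * adj_coeff n X u j i))" by (rule l2norm_sum) simp
  also have "\<dots> = (\<Sum>j\<le>k. cmod (fps_nth P (k - j)) * l2norm n (adj_coeff n X u j))" by (simp add: l2norm_scale)
  also have "\<dots> \<le> (\<Sum>j\<le>k. 1 / \<delta> / r ^ k * (r ^ j * l2norm n (adj_coeff n X u j)))"
  proof (rule sum_mono)
    fix j assume "j \<in> {..k}"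
    \<comment> \<open>The decay r^-(k-j) of the reciprocal is r^-k times the weight r^j, so one
      weighted sum of adjugate coefficients bounds the iterates of all orders.\<close>
    then have "r ^ k = r ^ (k - j) * r ^ j" by (simp flip: power_add)
    then have e: "1 / \<delta> / r ^ (k - j) = 1 / \<delta> / r ^ k * r ^ j" using r by simp
    have "cmod (fps_nth P (k - j)) * l2norm n (adj_coeff n X u j) \<le> (1 / \<delta> / r ^ (k - j)) * l2norm n (adj_coeff n X u j)"
      by (rule mult_right_mono[OF Pb l2norm_nonneg])
    then show "cmod (fps_nth P (k - j)) * l2norm n (adj_coeff n X u j) \<le> 1 / \<delta> / r ^ k * (r ^ j * l2norm n (adj_coeff n X u j))"
      unfolding e by (simp add: mult.assoc)
  qed
  also have "\<dots> = 1 / \<delta> / r ^ k * (\<Sum>j\<le>k. r ^ j * l2norm n (adj_coeff n X u j))" by (simp add: sum_distrib_left)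
  finally have fin: "l2norm n (mat_iter n X u k) \<le> 1 / \<delta> / r ^ k * (\<Sum>j\<le>k. r ^ j * l2norm n (adj_coeff n X u j))" .
  have "(\<Sum>j\<le>k. r ^ j * l2norm n (adj_coeff n X u j)) \<le> (\<Sum>j\<le>k + n. r ^ j * l2norm n (adj_coeff n X u j))"
    using r by (intro sum_mono2) (auto simp: l2norm_nonneg)
  also have "\<dots> = (\<Sum>j\<le>n. r ^ j * l2norm n (adj_coeff n X u j))"
  proof (rule sum.mono_neutral_right)
    show "\<forall>j\<in>{..k + n} - {..n}. r ^ j * l2norm n (adj_coeff n X u j) = 0"
      using det_adj_coeff_zero(2)[of n _ X u] by (auto simp: l2norm_def L2_set_def)
  qed auto
  also have "\<dots> \<le> M" by (rule M)
  finally have "1 / \<delta> / r ^ k * (\<Sum>j\<le>k. r ^ j * l2norm n (adj_coeff n X u j)) \<le> 1 / \<delta> / r ^ k * M"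
    using r \<delta> by (intro mult_left_mono) auto
  with fin show ?thesis by simp
qed

text \<open>Matrix determinant lemma, with a solution \<open>x\<close> of A x = a in the place of
  the inverse applied to a. The bordered matrix \<open>?D\<close> is reduced once by eliminating its
  last row and once by factoring out \<open>x\<close>; comparing determinants gives the
  claim.\<close>

lemma det_rank_one_update:
  fixes A :: "complex mat"
  assumes A: "A \<in> carrier_mat n n" and x: "\<And>i. i < n \<Longrightarrow> (\<Sum>j<n. A $$ (i, j) * x j) = a i"
  shows "Determinant.det (Matrix.mat n n (\<lambda>(i, j). A $$ (i, j) - a i * b j)) = Determinant.det A * (1 - (\<Sum>i<n. b i * x i))"
proof -
  let ?a = "Matrix.mat n 1 (\<lambda>(i, j). a i)" and ?b = "Matrix.mat 1 n (\<lambda>(i, j). b j)" and ?x = "Matrix.mat n 1 (\<lambda>(i, j). x i)"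
  let ?s = "\<Sum>i<n. b i * x i"
  let ?S = "Matrix.mat 1 1 (\<lambda>_. 1 - ?s)"
  let ?C = "Matrix.mat n n (\<lambda>(i, j). A $$ (i, j) - a i * b j)"
  let ?D = "four_block_mat A ?a ?b (1\<^sub>m 1)"
  have D: "?D \<in> carrier_mat (n + 1) (n + 1)" using A by auto
  let ?L = "four_block_mat (1\<^sub>m n) (0\<^sub>m n 1) (- ?b) (1\<^sub>m 1)"
  have L: "?L \<in> carrier_mat (n + 1) (n + 1)" by auto
  have detL: "Determinant.det ?L = 1"
    by (subst det_four_block_mat_upper_right_zero[of _ n _ 1]) auto
  have e1: "A * 1\<^sub>m n + ?a * - ?b = ?C"
    by (rule eq_matI) (use A in \<open>auto simp: scalar_prod_def\<close>)
  have e2: "A * 0\<^sub>m n 1 + ?a * 1\<^sub>m 1 = ?a" using A by auto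
  have e3: "?b * 1\<^sub>m n + 1\<^sub>m 1 * - ?b = 0\<^sub>m 1 n" by (rule eq_matI) auto
  have e4: "?b * 0\<^sub>m n 1 + 1\<^sub>m 1 * 1\<^sub>m 1 = 1\<^sub>m 1" by (rule eq_matI) auto
  have "?D * ?L = four_block_mat (A * 1\<^sub>m n + ?a * - ?b) (A * 0\<^sub>m n 1 + ?a * 1\<^sub>m 1) (?b * 1\<^sub>m n + 1\<^sub>m 1 * - ?b) (?b * 0\<^sub>m n 1 + 1\<^sub>m 1 * 1\<^sub>m 1)"
    by (rule mult_four_block_mat) (use A in auto)
  then have "?D * ?L = four_block_mat ?C ?a (0\<^sub>m 1 n) (1\<^sub>m 1)" unfolding e1 e2 e3 e4 .
  then have 1: "Determinant.det (?D * ?L) = Determinant.det ?C"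
    by (simp add: det_four_block_mat_lower_left_zero[of _ n _ 1])
  let ?T = "four_block_mat A (0\<^sub>m n 1) ?b ?S" and ?U = "four_block_mat (1\<^sub>m n) ?x (0\<^sub>m 1 n) (1\<^sub>m 1)"
  have TU: "?T \<in> carrier_mat (n + 1) (n + 1)" "?U \<in> carrier_mat (n + 1) (n + 1)" using A by auto
  have f1: "A * 1\<^sub>m n + 0\<^sub>m n 1 * 0\<^sub>m 1 n = A" using A by auto
  have f2: "A * ?x + 0\<^sub>m n 1 * 1\<^sub>m 1 = ?a"
    by (rule eq_matI) (use A x in \<open>auto simp: scalar_prod_def atLeast0LessThan\<close>)
  have f3: "?b * 1\<^sub>m n + ?S * 0\<^sub>m 1 n = ?b" by (rule eq_matI) auto
  have f4: "?b * ?x + ?S * 1\<^sub>m 1 = 1\<^sub>m 1"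
    by (rule eq_matI) (auto simp: scalar_prod_def atLeast0LessThan)
  have "?T * ?U = four_block_mat (A * 1\<^sub>m n + 0\<^sub>m n 1 * 0\<^sub>m 1 n) (A * ?x + 0\<^sub>m n 1 * 1\<^sub>m 1) (?b * 1\<^sub>m n + ?S * 0\<^sub>m 1 n) (?b * ?x + ?S * 1\<^sub>m 1)"
    by (rule mult_four_block_mat) (use A in auto)
  then have "?T * ?U = ?D" unfolding f1 f2 f3 f4 .
  then have "Determinant.det ?D = Determinant.det ?T * Determinant.det ?U" using det_mult[OF TU] by simp
  also have "Determinant.det ?U = 1"
    by (subst det_four_block_mat_lower_left_zero[of _ n _ 1]) auto
  also have "Determinant.det ?T = Determinant.det A * Determinant.det ?S"
    by (rule det_four_block_mat_upper_right_zero[OF A]) auto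
  also have "Determinant.det ?S = 1 - ?s" by (simp add: det_single)
  finally have "Determinant.det ?D = Determinant.det A * (1 - ?s)" by simp
  then show ?thesis using 1 det_mult[OF D L] detL by simp
qed

section \<open>Outlier and overlap of a fixed matrix\<close>

definition mat_bilinear :: "nat \<Rightarrow> (nat \<times> nat \<Rightarrow> complex) \<Rightarrow> (nat \<Rightarrow> complex) \<Rightarrow> (nat \<Rightarrow> complex) \<Rightarrow> nat \<Rightarrow> complex" where
  "mat_bilinear n X v u k = (\<Sum>i<n. cnj (v i) * mat_iter n X u k i)"

text \<open>The series of (1 - z X)^-1 u, which converges once the growth of the iterates is
  bounded.\<close>

definition mat_resolvent :: "nat \<Rightarrow> (nat \<times> nat \<Rightarrow> complex) \<Rightarrow> (nat \<Rightarrow> complex) \<Rightarrow> complex \<Rightarrow> nat \<Rightarrow> complex" where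
  "mat_resolvent n X u z i = (\<Sum>k. z ^ k * mat_iter n X u k i)"

lemma norm_power_diff_le:
  fixes z w :: complex
  assumes "cmod z \<le> r" "cmod w \<le> r" "0 < r"
  shows "cmod (z ^ Suc k - w ^ Suc k) \<le> real (Suc k) * r ^ k * cmod (z - w)"
proof -
  have "cmod (z ^ Suc k - w ^ Suc k) = cmod (z - w) * cmod (\<Sum>p<Suc k. z ^ p * w ^ (k - p))"
    by (subst diff_power_eq_sum) (simp add: norm_mult)
  also have "\<dots> \<le> cmod (z - w) * (\<Sum>p<Suc k. r ^ k)"
  proof (intro mult_left_mono)
  show "cmod (\<Sum>p<Suc k. z ^ p * w ^ (k - p)) \<le> (\<Sum>p<Suc k. r ^ k)"
  proof (rule sum_norm_le)
    fix p assume "p \<in> {..<Suc k}"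
    then have "r ^ k = r ^ p * r ^ (k - p)" by (simp flip: power_add)
    then show "cmod (z ^ p * w ^ (k - p)) \<le> r ^ k"
      using assms by (simp add: norm_mult norm_power mult_mono power_mono)
  qed
  qed simp
  finally show ?thesis by (simp add: mult.commute)
qed

lemma summable_linear_geometric:
  fixes \<rho> :: real
  assumes "0 \<le> \<rho>" "\<rho> < 1"
  shows "summable (\<lambda>k. real (k + 2) * \<rho> ^ (k + 1))"
proof -
  have "(\<lambda>k. real (Suc k) * \<rho> ^ k) sums (1 / (1 - \<rho>)\<^sup>2)"
    using geometric_deriv_sums[of \<rho>] assms by simp
  then have "summable (\<lambda>k. real (Suc (k + 1)) * \<rho> ^ (k + 1))"
    by (intro summable_ignore_initial_segment) (rule sums_summable)
  then show ?thesis by simp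
qed

text \<open>Split at \<open>m\<close>: the first \<open>m\<close> coefficients are small by
  \<theta>, the others are controlled by the geometric bound alone. Convergence of finitely many
  coefficients thus controls the whole series, up to a tail that a large \<open>m\<close> makes
  small.\<close>

lemma weighted_sum_bound:
  fixes c :: "nat \<Rightarrow> complex"
  assumes r: "0 < r0" "r0 < r" and A: "\<And>k. cmod (c k) \<le> A / r ^ k"
    and \<theta>: "\<And>k. 1 \<le> k \<Longrightarrow> k \<le> m \<Longrightarrow> cmod (c k) \<le> \<theta>" and r1: "r \<le> 1"
  shows "summable (\<lambda>k. real (k + 2) * r0 ^ (k + 1) * cmod (c (k + 1)))"
    and "(\<Sum>k. real (k + 2) * r0 ^ (k + 1) * cmod (c (k + 1))) \<le>
      \<theta> * (\<Sum>k<m. real (k + 2)) + A * (\<Sum>k. real (k + m + 2) * (r0 / r) ^ (k + m + 1))"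
proof -
  let ?t = "\<lambda>k. real (k + 2) * r0 ^ (k + 1) * cmod (c (k + 1))" and ?g = "\<lambda>k. real (k + 2) * (r0 / r) ^ (k + 1)"
  have rho: "0 \<le> r0 / r" "r0 / r < 1" using r by auto
  have g: "summable ?g" by (rule summable_linear_geometric[OF rho])
  have le: "?t k \<le> A * ?g k" for k
  proof -
    have "?t k \<le> real (k + 2) * r0 ^ (k + 1) * (A / r ^ (k + 1))"
      using r by (intro mult_left_mono A) auto
    then show ?thesis using r by (simp add: power_divide mult_ac del: power_Suc)
  qed
  have t0: "0 \<le> ?t k" for k using r by simp
  show t: "summable ?t"
    by (rule summable_comparison_test'[OF summable_mult[OF g, of A], of 0]) (use le t0 in auto)
  have "(\<Sum>k. ?t k) = (\<Sum>k. ?t (k + m)) + (\<Sum>k<m. ?t k)" by (rule suminf_split_initial_segment[OF t])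
  also have "(\<Sum>k. ?t (k + m)) \<le> (\<Sum>k. A * ?g (k + m))"
    by (intro suminf_le le summable_ignore_initial_segment t summable_mult g)
  also have "\<dots> = A * (\<Sum>k. ?g (k + m))"
    by (intro suminf_mult summable_ignore_initial_segment g)
  also have "(\<Sum>k<m. ?t k) \<le> (\<Sum>k<m. \<theta> * real (k + 2))"
  proof (rule sum_mono)
    fix k assume "k \<in> {..<m}"
    then have "cmod (c (k + 1)) \<le> \<theta>" by (intro \<theta>) auto
    moreover have "r0 ^ (k + 1) \<le> 1" using r r1 by (intro power_le_one) auto
    ultimately have "real (k + 2) * (r0 ^ (k + 1) * cmod (c (k + 1))) \<le> real (k + 2) * (1 * \<theta>)"
      using r by (intro mult_left_mono mult_mono) auto
    then show "?t k \<le> \<theta> * real (k + 2)" by (simp add: mult_ac)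
  qed
  finally show "(\<Sum>k. ?t k) \<le> \<theta> * (\<Sum>k<m. real (k + 2)) + A * (\<Sum>k. real (k + m + 2) * (r0 / r) ^ (k + m + 1))"
    by (simp add: sum_distrib_left algebra_simps)
qed

text \<open>The weight (k + 2) r0^(k+1) is the derivative of z^(k+2) at \<open>r0\<close>, so \<eta>
  bounds both the nonlinear part of z \<langle>v, (1 - z X)^-1 u\<rangle> and its Lipschitz
  constant. The condition \<open>ell\<close> keeps the reciprocal of the outlier in the disc of
  radius \<open>r0\<close>.\<close>

locale outlier_setting =
  fixes n :: nat and X :: "nat \<times> nat \<Rightarrow> complex" and u v :: "nat \<Rightarrow> complex" and r0 r M \<eta> :: real
  assumes r0: "0 < r0" "r0 < r" "r \<le> 1"
    and nz: "\<And>z. cmod z \<le> r0 \<Longrightarrow> Determinant.det (res_mat n X z) \<noteq> 0"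
    and iter_bound: "\<And>k. l2norm n (mat_iter n X u k) \<le> M / r ^ k"
    and eta: "0 \<le> \<eta>" "(\<Sum>k. real (k + 2) * r0 ^ (k + 1) * cmod (mat_bilinear n X v u (k + 1))) \<le> \<eta>"
    and ell: "1 + \<eta> \<le> r0 * cmod (mat_bilinear n X v u 0)"
begin

abbreviation "b \<equiv> mat_bilinear n X v u"
abbreviation "f \<equiv> mat_resolvent n X u"
abbreviation "q z \<equiv> Determinant.det (res_mat n X z)"

lemma M_nonneg: "0 \<le> M"
  using iter_bound[of 0] l2norm_nonneg[of n "mat_iter n X u 0"] by simp

lemma rho: "0 \<le> r0 / r" "r0 / r < 1"
  using r0 by auto

lemma component_bound: "i < n \<Longrightarrow> cmod (mat_iter n X u k i) \<le> M / r ^ k"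
  using component_le_l2norm[of i n "mat_iter n X u k"] iter_bound[of k] by linarith

lemma bilinear_bound: "cmod (b k) \<le> l2norm n v * M / r ^ k"
proof -
  have "cmod (b k) \<le> l2norm n v * l2norm n (mat_iter n X u k)"
    unfolding mat_bilinear_def by (rule inner_le_l2norm)
  also have "\<dots> \<le> l2norm n v * (M / r ^ k)" by (intro mult_left_mono iter_bound l2norm_nonneg)
  finally show ?thesis by simp
qed

lemma summable_powers: "summable (\<lambda>k. c * (r0 / r) ^ k)"
  using rho by (intro summable_mult summable_geometric) simp

lemma power_term_bound:
  assumes "cmod z \<le> r0" "cmod y \<le> c / r ^ k"
  shows "norm (z ^ k * y) \<le> c * (r0 / r) ^ k"
proof -
  have "norm (z ^ k * y) = cmod z ^ k * cmod y" by (simp add: norm_mult norm_power)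
  also have "\<dots> \<le> r0 ^ k * (c / r ^ k)" using assms r0 by (intro mult_mono power_mono) auto
  finally show ?thesis by (simp add: power_divide mult.commute)
qed

lemma resolvent_sums:
  assumes "cmod z \<le> r0" "i < n"
  shows "(\<lambda>k. z ^ k * mat_iter n X u k i) sums f z i"
proof -
  have "summable (\<lambda>k. z ^ k * mat_iter n X u k i)"
    by (rule summable_comparison_test'[OF summable_powers[of M], of 0])
      (rule power_term_bound[OF assms(1) component_bound[OF assms(2)]])
  then show ?thesis unfolding mat_resolvent_def by (rule summable_sums)
qed

lemma resolvent_eq:
  assumes z: "cmod z \<le> r0" and i: "i < n"
  shows "f z i = u i + z * (\<Sum>j<n. X (i, j) * f z j)"
proof -
  have "(\<lambda>k. \<Sum>j<n. X (i, j) * (z ^ k * mat_iter n X u k j)) sums (\<Sum>j<n. X (i, j) * f z j)"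
    by (intro sums_sum sums_mult resolvent_sums[OF z]) auto
  then have "(\<lambda>k. z * (\<Sum>j<n. X (i, j) * (z ^ k * mat_iter n X u k j))) sums (z * (\<Sum>j<n. X (i, j) * f z j))"
    by (rule sums_mult)
  moreover have "z * (\<Sum>j<n. X (i, j) * (z ^ k * mat_iter n X u k j)) = z ^ Suc k * mat_iter n X u (Suc k) i" for k
    by (simp add: sum_distrib_left mult_ac)
  ultimately have "(\<lambda>k. z ^ Suc k * mat_iter n X u (Suc k) i) sums (z * (\<Sum>j<n. X (i, j) * f z j))" by simp
  then have "(\<lambda>k. z ^ k * mat_iter n X u k i) sums (z * (\<Sum>j<n. X (i, j) * f z j) + z ^ 0 * mat_iter n X u 0 i)"
    by (rule sums_Suc)
  from sums_unique2[OF this resolvent_sums[OF z i]] show ?thesis by (simp add: add.commute)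
qed

text \<open>The difference of the two sides lies in the kernel of 1 - z X, which is trivial because
  the determinant does not vanish on the disc. The factor \<open>c\<close> is left free, as
  eigenvectors are determined only up to scaling.\<close>

lemma resolvent_unique:
  assumes z: "cmod z \<le> r0" and y: "\<And>i. i < n \<Longrightarrow> y i - z * (\<Sum>j<n. X (i, j) * y j) = c * u i" and i: "i < n"
  shows "y i = c * f z i"
proof (rule ccontr)
  assume ne: "y i \<noteq> c * f z i"
  let ?d = "Matrix.vec n (\<lambda>i. y i - c * f z i)"
  have C: "res_mat n X z \<in> carrier_mat n n" by (simp add: res_mat_def)
  have "res_mat n X z *\<^sub>v ?d = 0\<^sub>v n"
  proof (rule eq_vecI)
    fix k assume "k < dim_vec (0\<^sub>v n :: complex Matrix.vec)"
    then have k: "k < n" by simp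
    have "(res_mat n X z *\<^sub>v ?d) $ k = (\<Sum>j<n. ((if k = j then 1 else 0) - z * X (k, j)) * (y j - c * f z j))"
      using k by (simp add: res_mat_def scalar_prod_def atLeast0LessThan)
    also have "\<dots> = (\<Sum>j<n. if k = j then y j - c * f z j else 0) - z * (\<Sum>j<n. X (k, j) * (y j - c * f z j))"
      unfolding sum_distrib_left sum_subtractf[symmetric] by (intro sum.cong refl) (simp add: left_diff_distrib mult.assoc)
    also have "\<dots> = (y k - z * (\<Sum>j<n. X (k, j) * y j)) - c * (f z k - z * (\<Sum>j<n. X (k, j) * f z j))"
      using k by (simp add: right_diff_distrib sum_subtractf sum_distrib_left mult_ac)
    also have "\<dots> = 0" unfolding y[OF k] using resolvent_eq[OF z k] by simp
    finally show "(res_mat n X z *\<^sub>v ?d) $ k = 0\<^sub>v n $ k" using k by simp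
  qed (simp add: res_mat_def)
  moreover have "?d \<noteq> 0\<^sub>v n"
  proof
    assume "?d = 0\<^sub>v n"
    then have "?d $ i = 0\<^sub>v n $ i" by simp
    then show False using ne i by simp
  qed
  ultimately have "q z = 0" using det_0_iff_vec_prod_zero[OF C] by (metis vec_carrier)
  then show False using nz[OF z] by simp
qed

text \<open>1 - z g z is the secular function; \<open>e\<close> is what z g z contains beyond its
  linear term.\<close>

definition "g z = (\<Sum>i<n. cnj (v i) * f z i)"
definition "e z = (\<Sum>k. z ^ Suc (Suc k) * b (Suc k))"

lemma g_sums: "cmod z \<le> r0 \<Longrightarrow> (\<lambda>k. z ^ k * b k) sums g z"
proof -
  assume z: "cmod z \<le> r0"
  have "(\<lambda>k. \<Sum>i<n. cnj (v i) * (z ^ k * mat_iter n X u k i)) sums g z"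
    unfolding g_def by (intro sums_sum sums_mult resolvent_sums[OF z]) auto
  then show ?thesis unfolding mat_bilinear_def by (simp add: sum_distrib_left mult_ac)
qed

lemma summable_weighted: "summable (\<lambda>k. real (k + 2) * r0 ^ (k + 1) * cmod (b (k + 1)))"
  by (rule weighted_sum_bound(1)[where m=0, OF r0(1,2) bilinear_bound _ r0(3)]) simp

lemma e_summable:
  assumes z: "cmod z \<le> r0"
  shows "summable (\<lambda>k. z ^ Suc (Suc k) * b (Suc k))" and "cmod (e z) \<le> \<eta>"
proof -
  have bd: "norm (z ^ Suc (Suc k) * b (Suc k)) \<le> real (k + 2) * r0 ^ (k + 1) * cmod (b (k + 1))" for k
  proof -
    have "cmod z ^ Suc (Suc k) \<le> r0 ^ Suc (Suc k)" using z by (intro power_mono) auto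
    also have "\<dots> \<le> r0 ^ (k + 1)" using r0 by (intro power_decreasing) auto
    also have "\<dots> \<le> real (k + 2) * r0 ^ (k + 1)" using r0 by simp
    finally show ?thesis unfolding norm_mult norm_power by (simp add: mult_right_mono del: power_Suc)
  qed
  show s: "summable (\<lambda>k. z ^ Suc (Suc k) * b (Suc k))"
    by (rule summable_comparison_test'[OF summable_weighted, of 0]) (rule bd)
  show "cmod (e z) \<le> \<eta>"
    unfolding e_def by (rule order_trans[OF norm_suminf_le[OF bd summable_weighted] eta(2)])
qed

lemma zg_eq: "cmod z \<le> r0 \<Longrightarrow> z * g z = z * b 0 + e z"
proof -
  assume z: "cmod z \<le> r0"
  have "(\<lambda>k. z * (z ^ Suc k * b (Suc k))) sums e z"
    using summable_sums[OF e_summable(1)[OF z]] unfolding e_def by (simp add: mult_ac)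
  then have "(\<lambda>k. z * (z ^ k * b k)) sums (e z + z * (z ^ 0 * b 0))" by (rule sums_Suc)
  from sums_unique2[OF sums_mult[OF g_sums[OF z], of z] this] show ?thesis by simp
qed

lemma e_lipschitz:
  assumes "cmod z \<le> r0" "cmod w \<le> r0"
  shows "cmod (e z - e w) \<le> \<eta> * cmod (z - w)"
proof -
  have d: "(\<lambda>k. (z ^ Suc (Suc k) - w ^ Suc (Suc k)) * b (Suc k)) sums (e z - e w)"
    using sums_diff[OF summable_sums[OF e_summable(1)[OF assms(1)]] summable_sums[OF e_summable(1)[OF assms(2)]]]
    unfolding e_def by (simp only: left_diff_distrib)
  have bd: "norm ((z ^ Suc (Suc k) - w ^ Suc (Suc k)) * b (Suc k)) \<le> real (k + 2) * r0 ^ (k + 1) * cmod (b (k + 1)) * cmod (z - w)" for k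
  proof -
    have "cmod (z ^ Suc (Suc k) - w ^ Suc (Suc k)) * cmod (b (Suc k)) \<le> (real (Suc (Suc k)) * r0 ^ Suc k * cmod (z - w)) * cmod (b (Suc k))"
      by (intro mult_right_mono norm_power_diff_le assms r0) auto
    then show ?thesis unfolding norm_mult by (simp add: mult_ac)
  qed
  have "cmod (e z - e w) \<le> (\<Sum>k. real (k + 2) * r0 ^ (k + 1) * cmod (b (k + 1))) * cmod (z - w)"
    by (rule norm_sums_le[OF d sums_mult2[OF summable_sums[OF summable_weighted]] bd])
  also have "\<dots> \<le> \<eta> * cmod (z - w)" by (rule mult_right_mono[OF eta(2)]) simp
  finally show ?thesis .
qed

lemma ell_bounds: "\<eta> < cmod (b 0)" "1 + \<eta> \<le> cmod (b 0)" "b 0 \<noteq> 0"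
proof -
  have "r0 * cmod (b 0) \<le> 1 * cmod (b 0)" using r0 by (intro mult_right_mono) auto
  then show "1 + \<eta> \<le> cmod (b 0)" using ell by simp
  then show "\<eta> < cmod (b 0)" by simp
  then show "b 0 \<noteq> 0" using eta(1) by auto
qed

text \<open>The equation is the fixed point problem z = (1 - e z) / b 0. By \<open>ell\<close> the
  map sends the disc into itself, and its Lipschitz constant \<eta> / |b 0| is below 1.\<close>

lemma outlier_exists: "\<exists>!z. cmod z \<le> r0 \<and> 1 = z * g z"
proof -
  let ?F = "\<lambda>z. (1 - e z) / b 0"
  have ex: "\<exists>!z. z \<in> cball 0 r0 \<and> ?F z = z"
  proof (rule Banach_fix[where c="\<eta> / cmod (b 0)"])
    show "uniform_space_class.complete (cball (0 :: complex) r0)" by (intro compact_imp_complete) simp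
    show "cball (0 :: complex) r0 \<noteq> {}" using r0 by (auto intro!: exI[of _ 0])
    show "0 \<le> \<eta> / cmod (b 0)" "\<eta> / cmod (b 0) < 1" using eta(1) ell_bounds by auto
    show "?F ` cball 0 r0 \<subseteq> cball 0 r0"
    proof (rule image_subsetI)
      fix z :: complex assume z: "z \<in> cball 0 r0"
      then have "cmod (1 - e z) \<le> 1 + \<eta>"
        using norm_triangle_ineq4[of 1 "e z"] e_summable(2)[of z] by simp
      also have "\<dots> \<le> r0 * cmod (b 0)" by (rule ell)
      finally show "?F z \<in> cball 0 r0" using ell_bounds(3) by (simp add: norm_divide pos_divide_le_eq)
    qed
    fix z w :: complex assume zw: "z \<in> cball 0 r0" "w \<in> cball 0 r0"
    have "dist (?F z) (?F w) = cmod (e w - e z) / cmod (b 0)"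
      unfolding dist_norm by (simp add: norm_divide diff_divide_distrib[symmetric])
    also have "\<dots> \<le> \<eta> * cmod (w - z) / cmod (b 0)"
      using zw by (intro divide_right_mono e_lipschitz) auto
    finally show "dist (?F z) (?F w) \<le> \<eta> / cmod (b 0) * dist z w"
      by (simp add: dist_norm norm_minus_commute)
  qed
  have iff: "(z \<in> cball 0 r0 \<and> ?F z = z) \<longleftrightarrow> (cmod z \<le> r0 \<and> 1 = z * g z)" for z
    using zg_eq[of z] ell_bounds(3) by (auto simp: field_simps)
  show ?thesis using ex unfolding iff .
qed

text \<open>Eigenvalues of \<open>Y\<close> outside the disc are the reciprocals of the solutions of \<open>1 = z * g z\<close> with
  \<open>cmod z \<le> r0\<close>.\<close>

definition "z0 = (THE z. cmod z \<le> r0 \<and> 1 = z * g z)"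

lemma z0: "cmod z0 \<le> r0" "1 = z0 * g z0" "z0 \<noteq> 0"
  and z0_unique: "cmod z \<le> r0 \<Longrightarrow> 1 = z * g z \<Longrightarrow> z = z0"
proof -
  show *: "cmod z0 \<le> r0" "1 = z0 * g z0" using theI'[OF outlier_exists] by (auto simp: z0_def)
  show "z0 \<noteq> 0" using *(2) by auto
  show "cmod z \<le> r0 \<Longrightarrow> 1 = z * g z \<Longrightarrow> z = z0" using outlier_exists * by blast
qed

lemma z0_close: "cmod (z0 - 1 / b 0) \<le> \<eta>"
proof -
  have "z0 - 1 / b 0 = - (e z0 / b 0)"
  proof -
    have "z0 * b 0 = 1 - e z0" using zg_eq[OF z0(1)] z0(2) by (simp add: eq_diff_eq)
    then have "z0 = (1 - e z0) / b 0" using ell_bounds(3) by (simp add: eq_divide_eq)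
    then have "z0 - 1 / b 0 = (1 - e z0) / b 0 - 1 / b 0" by (rule arg_cong)
    also have "\<dots> = - (e z0 / b 0)" by (simp add: diff_divide_distrib)
    finally show ?thesis .
  qed
  then have "cmod (z0 - 1 / b 0) = cmod (e z0) / cmod (b 0)" by (simp add: norm_divide)
  also have "\<dots> \<le> \<eta> / 1" using e_summable(2)[OF z0(1)] ell_bounds eta(1) by (intro frac_le) auto
  finally show ?thesis by simp
qed

text \<open>Simplicity of the zero \<open>z0\<close> in a quantitative form that avoids derivatives.
  It is what excludes algebraic multiplicity 2.\<close>

lemma secular_lower_bound:
  assumes z: "cmod z \<le> r0"
  shows "(cmod (b 0) - \<eta>) * cmod (z - z0) \<le> cmod (1 - z * g z)"
proof -
  let ?d = "(z0 - z) * b 0" and ?c = "e z0 - e z"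
  have eq: "1 - z * g z = ?d + ?c"
  proof -
    have "1 = z0 * b 0 + e z0" using zg_eq[OF z0(1)] z0(2) by simp
    then show ?thesis using zg_eq[OF z] by (simp add: left_diff_distrib)
  qed
  have "cmod ?d - cmod ?c \<le> cmod (?d + ?c)"
    by (rule norm_diff_ineq)
  moreover have "cmod ?c \<le> \<eta> * cmod (z - z0)"
    using e_lipschitz[OF z0(1) z] by (simp only: norm_minus_commute[of z0 z])
  moreover have "cmod ?d = cmod (b 0) * cmod (z - z0)"
    by (simp add: norm_mult norm_minus_commute mult.commute)
  ultimately show ?thesis unfolding eq left_diff_distrib by linarith
qed

section \<open>Eigenvalues of the deformed matrix outside the disc\<close>

definition "Y = Matrix.mat n n (\<lambda>(i, j). X (i, j) + u i * cnj (v j))"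

lemma Y_carrier: "Y \<in> carrier_mat n n"
  by (simp add: Y_def)

lemma Y_mult:
  fixes x :: "complex Matrix.vec"
  assumes "x \<in> carrier_vec n" "i < n"
  shows "(Y *\<^sub>v x) $ i = (\<Sum>j<n. X (i, j) * x $ j) + u i * (\<Sum>j<n. cnj (v j) * x $ j)"
proof -
  have "(Y *\<^sub>v x) $ i = (\<Sum>j<n. (X (i, j) + u i * cnj (v j)) * x $ j)"
    using assms by (simp add: Y_def scalar_prod_def atLeast0LessThan)
  then show ?thesis by (simp add: distrib_right sum.distrib sum_distrib_left mult.assoc)
qed

text \<open>With z = 1 / \<mu> the eigenvalue equation reads (1 - z X) x = z \<langle>v, x\<rangle>
  u, so x is a multiple of the resolvent. Pairing with \<open>v\<close> and cancelling \<langle>v,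
  x\<rangle>, which is non-zero because x is, gives the secular equation.\<close>

lemma eigenvector_shape:
  fixes x :: "complex Matrix.vec"
  assumes x: "eigenvector Y x \<mu>" and mu: "\<mu> \<noteq> 0" "cmod (1 / \<mu>) \<le> r0"
  shows "\<exists>c. c \<noteq> 0 \<and> (\<forall>i<n. x $ i = c * f (1 / \<mu>) i)" and "1 = (1 / \<mu>) * g (1 / \<mu>)"
proof -
  have xc: "x \<in> carrier_vec n" "x \<noteq> 0\<^sub>v n" and eig: "Y *\<^sub>v x = \<mu> \<cdot>\<^sub>v x"
    using x Y_carrier by (auto simp: eigenvector_def)
  define s where "s = (\<Sum>j<n. cnj (v j) * x $ j)"
  let ?z = "1 / \<mu>"
  have eq: "x $ i - ?z * (\<Sum>j<n. X (i, j) * x $ j) = (?z * s) * u i" if i: "i < n" for i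
  proof -
    have "\<mu> * x $ i = (\<Sum>j<n. X (i, j) * x $ j) + u i * s"
      using arg_cong[OF eig, of "\<lambda>y. Matrix.vec_index y i"] Y_mult[OF xc(1) i] xc(1) i by (simp add: s_def)
    then have "x $ i = ?z * ((\<Sum>j<n. X (i, j) * x $ j) + u i * s)" using mu(1) by (simp add: field_simps)
    then show ?thesis by (simp add: algebra_simps)
  qed
  have xf: "x $ i = (?z * s) * f ?z i" if "i < n" for i
    using resolvent_unique[OF mu(2), of "\<lambda>i. x $ i" "?z * s" i] eq that by blast
  have c0: "?z * s \<noteq> 0"
  proof
    assume "?z * s = 0"
    then have "x = 0\<^sub>v n" using xf xc(1) by (intro eq_vecI) auto
    then show False using xc(2) by simp
  qed
  then show "\<exists>c. c \<noteq> 0 \<and> (\<forall>i<n. x $ i = c * f ?z i)" using xf by blast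
  have sg: "s = (?z * s) * g ?z"
  proof -
    have "(\<Sum>j<n. cnj (v j) * x $ j) = (\<Sum>j<n. cnj (v j) * ((?z * s) * f ?z j))"
      by (rule sum.cong[OF refl]) (simp add: xf)
    then have "s = (\<Sum>j<n. cnj (v j) * ((?z * s) * f ?z j))" by (simp only: s_def[symmetric])
    then show ?thesis unfolding g_def by (simp add: sum_distrib_left mult_ac)
  qed
  have "s * (?z * g ?z) = (?z * s) * g ?z" by (simp only: mult_ac)
  also have "\<dots> = s * 1" using sg[symmetric] by (simp only: mult_1_right)
  finally have eq1: "s * (?z * g ?z) = s * 1" .
  have s0: "s \<noteq> 0" using c0 by auto
  show "1 = ?z * g ?z" by (rule iffD1[OF mult_left_cancel[OF s0] eq1, symmetric])
qed

lemma eigenvalue_z0: "1 / z0 \<in> spectrum Y"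
proof -
  let ?x = "Matrix.vec n (f z0)"
  have x: "?x \<in> carrier_vec n" by simp
  have "(Y *\<^sub>v ?x) $ i = (1 / z0) * f z0 i" if i: "i < n" for i
  proof -
    have "(Y *\<^sub>v ?x) $ i = (\<Sum>j<n. X (i, j) * f z0 j) + u i * g z0"
      unfolding Y_mult[OF x i] g_def by simp
    moreover have "f z0 i = u i + z0 * (\<Sum>j<n. X (i, j) * f z0 j)" by (rule resolvent_eq[OF z0(1) i])
    moreover have "g z0 = 1 / z0" using z0(2,3) by (simp add: field_simps)
    ultimately show ?thesis using z0(3) by (simp add: field_simps)
  qed
  then have eig: "Y *\<^sub>v ?x = (1 / z0) \<cdot>\<^sub>v ?x" by (intro eq_vecI) (use Y_carrier in auto)
  have "?x \<noteq> 0\<^sub>v n"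
  proof
    assume "?x = 0\<^sub>v n"
    then have "f z0 i = 0" if "i < n" for i using that by (metis index_vec index_zero_vec(1))
    then have "g z0 = 0" unfolding g_def by simp
    then show False using z0(2) by simp
  qed
  then have "eigenvector Y ?x (1 / z0)" unfolding eigenvector_def using eig Y_carrier by auto
  then show ?thesis by (auto simp: spectrum_def eigenvalue_def)
qed

lemma outer_eigenvalue:
  assumes "\<mu> \<in> spectrum Y" "1 / r0 \<le> cmod \<mu>"
  shows "\<mu> = 1 / z0"
proof -
  obtain x where x: "eigenvector Y x \<mu>" using assms(1) by (auto simp: spectrum_def eigenvalue_def)
  have "0 < cmod \<mu>" using assms(2) r0 by (meson less_le_trans zero_less_divide_1_iff)
  then have "\<mu> \<noteq> 0" by auto
  have "1 \<le> cmod \<mu> * r0" using assms(2) r0 by (simp add: pos_divide_le_eq)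
  then have le: "cmod (1 / \<mu>) \<le> r0" using \<open>0 < cmod \<mu>\<close> by (simp add: norm_divide pos_divide_le_eq mult.commute)
  then have "1 / \<mu> = z0" by (rule z0_unique) (rule eigenvector_shape(2)[OF x \<open>\<mu> \<noteq> 0\<close> le])
  from arg_cong[OF this, of "\<lambda>t. 1 / t"] show ?thesis by simp
qed

lemma cmod_outlier: "1 / r0 \<le> cmod (1 / z0)"
  using z0(1,3) r0 by (simp add: norm_divide frac_le)

lemma res_mat_entry_mult:
  "i < n \<Longrightarrow> j < n \<Longrightarrow> res_mat n X w $$ (i, j) * y = (if i = j then y else 0) - w * (X (i, j) * y)"
  by (simp add: res_mat_def left_diff_distrib)

text \<open>Matrix determinant lemma, with the resolvent as the solution of the linear
  system.\<close>

lemma char_poly_Y: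
  assumes mu: "\<mu> \<noteq> 0" and z: "cmod (1 / \<mu>) \<le> r0"
  shows "poly (char_poly Y) \<mu> = \<mu> ^ n * (q (1 / \<mu>) * (1 - (1 / \<mu>) * g (1 / \<mu>)))"
proof -
  let ?z = "1 / \<mu>"
  let ?C = "Matrix.mat n n (\<lambda>(i, j). res_mat n X ?z $$ (i, j) - ?z * u i * cnj (v j))"
  have R: "res_mat n X ?z \<in> carrier_mat n n" by (simp add: res_mat_def)
  have "- (char_matrix Y \<mu>) = \<mu> \<cdot>\<^sub>m ?C"
    by (rule eq_matI) (use mu in \<open>auto simp: char_matrix_def Y_def res_mat_def field_simps\<close>)
  then have "poly (char_poly Y) \<mu> = \<mu> ^ n * Determinant.det ?C"
    using char_poly_matrix[OF Y_carrier, of \<mu>] by simp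
  also have "Determinant.det ?C = q ?z * (1 - (\<Sum>i<n. cnj (v i) * (?z * f ?z i)))"
  proof (rule det_rank_one_update[OF R])
    fix i assume i: "i < n"
    have "(\<Sum>j<n. res_mat n X ?z $$ (i, j) * (?z * f ?z j)) =
        (\<Sum>j<n. if i = j then ?z * f ?z j else 0) - ?z * (\<Sum>j<n. X (i, j) * (?z * f ?z j))"
      unfolding sum_distrib_left sum_subtractf[symmetric]
      by (intro sum.cong refl res_mat_entry_mult i) simp
    also have "\<dots> = ?z * (f ?z i - ?z * (\<Sum>j<n. X (i, j) * f ?z j))"
      using i by (simp add: sum_distrib_left right_diff_distrib mult_ac)
    also have "\<dots> = ?z * u i" using resolvent_eq[OF z i] by simp
    finally show "(\<Sum>j<n. res_mat n X ?z $$ (i, j) * (?z * f ?z j)) = ?z * u i" .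
  qed
  also have "(\<Sum>i<n. cnj (v i) * (?z * f ?z i)) = ?z * g ?z" unfolding g_def by (simp add: sum_distrib_left mult_ac)
  finally show ?thesis .
qed

text \<open>The outlier \<mu> is approached radially from outside by \<mu> (1 + t) with t tending to
  0. The reciprocals stay in the disc, where the secular bound makes the characteristic polynomial
  at least of order t, whereas a multiple root would make it of order t^2.\<close>

lemma order_outlier: "Polynomial.order (1 / z0) (char_poly Y) = 1"
proof -
  let ?p = "char_poly Y" and ?\<mu> = "1 / z0"
  have p0: "?p \<noteq> 0" using degree_monic_char_poly[OF Y_carrier] by auto
  have "poly ?p ?\<mu> = 0" using eigenvalue_z0 spectrum_root_char_poly[OF Y_carrier] by simp
  then have "Polynomial.order ?\<mu> ?p \<noteq> 0" using p0 order_root by blast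
  moreover have "\<not> 2 \<le> Polynomial.order ?\<mu> ?p"
  proof
    assume "2 \<le> Polynomial.order ?\<mu> ?p"
    then have "[:- ?\<mu>, 1:] ^ 2 dvd ?p" using order_divides by blast
    then obtain s where s: "?p = [:- ?\<mu>, 1:] ^ 2 * s" by (elim dvdE)
    define t where "t = (\<lambda>k. inverse (real (Suc k)))"
    have t: "0 < t k" for k by (simp add: t_def)
    have t1: "0 < 1 + t k" for k using t[of k] by linarith
    have tnz: "complex_of_real (1 + t k) \<noteq> 0" for k using t1[of k] by (simp only: of_real_eq_0_iff)
    let ?m = "\<lambda>k. ?\<mu> * complex_of_real (1 + t k)"
    let ?c = "(cmod (b 0) - \<eta>) * cmod z0"
    have bound: "cmod (?m k) ^ n * cmod (q (1 / ?m k)) * ?c / (1 + t k) \<le> t k * ((cmod ?\<mu>)\<^sup>2 * cmod (poly s (?m k)))" for k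
    proof -
      have m0: "?m k \<noteq> 0" using z0(3) tnz[of k] by (simp del: of_real_add)
      have zk: "1 / ?m k = z0 / complex_of_real (1 + t k)" by simp
      have "cmod (1 / ?m k) = cmod z0 / (1 + t k)"
        unfolding zk norm_divide norm_of_real using t1[of k] by simp
      also have "\<dots> \<le> cmod z0 / 1" using t[of k] t1[of k] by (intro divide_left_mono) auto
      finally have le: "cmod (1 / ?m k) \<le> r0" using z0(1) by simp
      have "1 / ?m k - z0 = - (z0 * complex_of_real (t k / (1 + t k)))"
      proof -
        have "z0 / complex_of_real (1 + t k) - z0 = (z0 - z0 * complex_of_real (1 + t k)) / complex_of_real (1 + t k)"
          using tnz[of k] by (simp add: diff_divide_distrib del: of_real_add)
        also have "z0 - z0 * complex_of_real (1 + t k) = - (z0 * complex_of_real (t k))" by (simp add: distrib_left)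
        finally show ?thesis unfolding zk by (simp del: of_real_add)
      qed
      then have "cmod (1 / ?m k - z0) = cmod z0 * (t k / (1 + t k))"
        using t[of k] t1[of k] by (simp only: norm_minus_cancel norm_mult norm_of_real) simp
      then have sec: "?c * (t k / (1 + t k)) \<le> cmod (1 - (1 / ?m k) * g (1 / ?m k))"
        using secular_lower_bound[OF le] by (simp only: mult.assoc)
      have "cmod (?m k) ^ n * cmod (q (1 / ?m k)) * (?c * (t k / (1 + t k))) \<le> cmod (poly ?p (?m k))"
        unfolding char_poly_Y[OF m0 le] norm_mult norm_power mult.assoc
        using sec[unfolded norm_mult mult.assoc] by (intro mult_left_mono) auto
      also have "\<dots> = (cmod (?m k - ?\<mu>))\<^sup>2 * cmod (poly s (?m k))"
        unfolding s by (simp add: norm_mult norm_power del: of_real_add)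
      also have "?m k - ?\<mu> = ?\<mu> * complex_of_real (t k)" by (simp add: distrib_left)
      also have "(cmod \<dots>)\<^sup>2 = (cmod ?\<mu>)\<^sup>2 * (t k * t k)"
        unfolding norm_mult norm_of_real power_mult_distrib by (simp only: power2_eq_square abs_mult_self_eq power2_abs)
      finally have "t k * (cmod (?m k) ^ n * cmod (q (1 / ?m k)) * ?c / (1 + t k)) \<le> t k * (t k * ((cmod ?\<mu>)\<^sup>2 * cmod (poly s (?m k))))"
        by (simp only: times_divide_eq_right times_divide_eq_left mult_ac)
      then show ?thesis using t[of k] by (simp only: mult_le_cancel_left_pos)
    qed
    have t0: "t \<longlonglongrightarrow> 0" unfolding t_def by (rule LIMSEQ_inverse_real_of_nat)
    have m: "?m \<longlonglongrightarrow> ?\<mu>"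
      using tendsto_mult[OF tendsto_const[of ?\<mu>] tendsto_of_real[OF tendsto_add[OF tendsto_const[of 1] t0]]] by simp
    have mi: "(\<lambda>k. 1 / ?m k) \<longlonglongrightarrow> z0"
      using tendsto_divide[OF tendsto_const[of 1] m] z0(3) by simp
    have qc: "continuous_on UNIV (\<lambda>z. q z)" by (intro holomorphic_on_imp_continuous_on holomorphic_det_res_mat)
    have qm: "(\<lambda>k. q (1 / ?m k)) \<longlonglongrightarrow> q z0"
      by (rule continuous_on_tendsto_compose[OF qc mi]) auto
    have L: "(\<lambda>k. cmod (?m k) ^ n * cmod (q (1 / ?m k)) * ?c / (1 + t k)) \<longlonglongrightarrow> cmod ?\<mu> ^ n * cmod (q z0) * ?c / (1 + 0)"
      by (intro tendsto_intros m qm t0) simp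
    have R: "(\<lambda>k. t k * ((cmod ?\<mu>)\<^sup>2 * cmod (poly s (?m k)))) \<longlonglongrightarrow> 0 * ((cmod ?\<mu>)\<^sup>2 * cmod (poly s ?\<mu>))"
      by (intro tendsto_intros m t0)
    have "cmod ?\<mu> ^ n * cmod (q z0) * ?c / (1 + 0) \<le> 0 * ((cmod ?\<mu>)\<^sup>2 * cmod (poly s ?\<mu>))"
      by (rule LIMSEQ_le[OF L R]) (use bound in blast)
    moreover have "0 < cmod ?\<mu> ^ n * cmod (q z0) * ?c / (1 + 0)"
      using z0(3) nz[OF z0(1)] ell_bounds(1) by simp
    ultimately show False by simp
  qed
  ultimately show ?thesis by linarith
qed

lemma outlier_spectrum:
  assumes eps: "1 + \<epsilon> = 1 / r0"
  shows "outer_spectrum \<epsilon> Y = {1 / z0}" "eig_count Y (outer_spectrum \<epsilon> Y) = 1" "lambda_max Y = 1 / z0"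
proof -
  show o: "outer_spectrum \<epsilon> Y = {1 / z0}"
  proof (rule equalityI)
    show "outer_spectrum \<epsilon> Y \<subseteq> {1 / z0}"
    proof
      fix w assume "w \<in> outer_spectrum \<epsilon> Y"
      then have "w \<in> spectrum Y" "1 / r0 \<le> cmod w" using eps by (simp_all add: outer_spectrum_def)
      then show "w \<in> {1 / z0}" using outer_eigenvalue by simp
    qed
    have "1 + \<epsilon> \<le> cmod (1 / z0)" unfolding eps by (rule cmod_outlier)
    then show "{1 / z0} \<subseteq> outer_spectrum \<epsilon> Y" using eigenvalue_z0 by (simp add: outer_spectrum_def)
  qed
  show "eig_count Y (outer_spectrum \<epsilon> Y) = 1" unfolding o eig_count_def by (simp add: order_outlier)
  have less: "cmod w < cmod (1 / z0)" if "w \<in> spectrum Y" "w \<noteq> 1 / z0" for w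
    using outer_eigenvalue[OF that(1)] that(2) cmod_outlier by force
  show "lambda_max Y = 1 / z0"
    unfolding lambda_max_def
  proof (rule the_equality)
    show "1 / z0 \<in> spectrum Y \<and> (\<forall>w\<in>spectrum Y. w \<noteq> 1 / z0 \<longrightarrow> cmod w < cmod (1 / z0))"
      using eigenvalue_z0 less by blast
    fix z assume z: "z \<in> spectrum Y \<and> (\<forall>w\<in>spectrum Y. w \<noteq> z \<longrightarrow> cmod w < cmod z)"
    show "z = 1 / z0"
    proof (rule ccontr)
      assume "z \<noteq> 1 / z0"
      then have "cmod (1 / z0) < cmod z" "cmod z < cmod (1 / z0)" using z eigenvalue_z0 less by auto
      then show False by simp
    qed
  qed
qed

text \<open>A unit eigenvector is a multiple of \<open>f z0\<close> by a factor whose modulus the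
  norm fixes; its phase disappears in the modulus of the overlap.\<close>

lemma overlap_eq:
  assumes eps: "1 + \<epsilon> = 1 / r0" and x: "outlier_eigenvector \<epsilon> Y x"
  shows "(cmod (herm_ip x (complex_of_real (1 / l2norm n u) \<cdot>\<^sub>v Matrix.vec n u)))\<^sup>2 =
     (cmod (\<Sum>i<n. cnj (u i) * f z0 i))\<^sup>2 / ((l2norm n u)\<^sup>2 * (l2norm n (f z0))\<^sup>2)"
proof -
  have ev: "eigenvector Y x (1 / z0)" and unit: "eucl_norm x = 1"
    using x unfolding outlier_eigenvector_def outlier_spectrum(2,3)[OF eps] by auto
  have xc: "x \<in> carrier_vec n" using ev Y_carrier by (auto simp: eigenvector_def)
  have mu: "1 / z0 \<noteq> 0" "cmod (1 / (1 / z0)) \<le> r0" using z0 by auto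
  obtain c where c: "c \<noteq> 0" "\<And>i. i < n \<Longrightarrow> x $ i = c * f z0 i"
    using eigenvector_shape(1)[OF ev mu] by auto
  have "1 = l2norm n (\<lambda>i. x $ i)"
    using unit xc by (simp add: eucl_norm_def l2norm_def L2_set_def)
  also have "\<dots> = l2norm n (\<lambda>i. c * f z0 i)" unfolding l2norm_def by (intro L2_set_cong refl) (use c in auto)
  finally have one: "cmod c * l2norm n (f z0) = 1" by (simp add: l2norm_scale)
  have "herm_ip x (complex_of_real (1 / l2norm n u) \<cdot>\<^sub>v Matrix.vec n u) =
      (\<Sum>i<n. complex_of_real (1 / l2norm n u) * u i * cnj (x $ i))"
    using xc by (simp add: herm_ip_def scalar_prod_def atLeast0LessThan)
  also have "\<dots> = complex_of_real (1 / l2norm n u) * cnj c * cnj (\<Sum>i<n. cnj (u i) * f z0 i)"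
    using c(2) by (simp add: sum_distrib_left mult_ac)
  finally have "cmod (herm_ip x (complex_of_real (1 / l2norm n u) \<cdot>\<^sub>v Matrix.vec n u)) =
     cmod c * cmod (\<Sum>i<n. cnj (u i) * f z0 i) / l2norm n u"
    using l2norm_nonneg[of n u] by (simp add: norm_mult norm_divide del: cnj_sum complex_cnj_mult)
  moreover have "cmod c = 1 / l2norm n (f z0)"
    using one by (metis mult_zero_right nonzero_eq_divide_eq zero_neq_one)
  ultimately show ?thesis by (simp add: power_divide power_mult_distrib mult.commute)
qed

end

text \<open>Meant for the unnormalised eigenvector x with N = |\<langle>u, x\<rangle>|^2, F =
  \<parallel>x\<parallel>^2, S = \<parallel>u\<parallel>^2 and D = S / (1 - |z0|^2). The overlap is
  N / (S F), and S / D = 1 - |z0|^2 is its approximate value; \<open>s0\<close> makes the constant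
  uniform.\<close>

lemma quotient_estimate:
  fixes N S F D \<eta> s0 :: real
  assumes S: "0 < s0" "s0 \<le> S" and D: "S \<le> D" and F: "S / 2 \<le> F" and \<eta>: "0 \<le> \<eta>"
    and N: "\<bar>N - S\<^sup>2\<bar> \<le> (2 * S + 1) * \<eta>" and FD: "\<bar>F - D\<bar> \<le> \<eta>"
  shows "\<bar>N / (S * F) - S / D\<bar> \<le> (6 / s0 + 2 / s0\<^sup>2) * \<eta>"
proof -
  have pos: "0 < S" "0 < F" "0 < D" using S D F by linarith+
  have e: "N / (S * F) - S / D = (N - S\<^sup>2) / (S * F) + S * (D - F) / (F * D)"
    using pos by (simp add: field_simps power2_eq_square)
  have "\<bar>(N - S\<^sup>2) / (S * F)\<bar> = \<bar>N - S\<^sup>2\<bar> / (S * F)" using pos by simp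
  also have "\<dots> \<le> (2 * S + 1) * \<eta> / (S * (S / 2))"
    by (rule frac_le[OF _ N]) (use pos F \<eta> in \<open>auto intro: mult_left_mono\<close>)
  finally have 1: "\<bar>(N - S\<^sup>2) / (S * F)\<bar> \<le> (2 * S + 1) * \<eta> / (S * (S / 2))" .
  have "\<bar>S * (D - F) / (F * D)\<bar> = S * \<bar>F - D\<bar> / (F * D)" using pos by (simp add: abs_mult abs_minus_commute)
  also have "\<dots> \<le> S * \<eta> / (S / 2 * S)"
  proof (rule frac_le)
    show "S * \<bar>F - D\<bar> \<le> S * \<eta>" using FD pos by (intro mult_left_mono) auto
    show "S / 2 * S \<le> F * D" using pos F D by (intro mult_mono) auto
  qed (use pos \<eta> in auto)
  finally have 2: "\<bar>S * (D - F) / (F * D)\<bar> \<le> S * \<eta> / (S / 2 * S)" .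
  have 3: "(2 * S + 1) * \<eta> / (S * (S / 2)) + S * \<eta> / (S / 2 * S) = (6 / S + 2 / S\<^sup>2) * \<eta>"
    using pos by (simp add: field_simps power2_eq_square)
  have 4: "(6 / S + 2 / S\<^sup>2) * \<eta> \<le> (6 / s0 + 2 / s0\<^sup>2) * \<eta>"
    using S \<eta> by (intro mult_right_mono add_mono divide_left_mono power_mono) auto
  show ?thesis unfolding e
    by (rule order_trans[OF abs_triangle_ineq order_trans[OF add_mono[OF 1 2] order_trans[OF eq_refl[OF 3] 4]]])
qed

section \<open>Norm of the outlier eigenvector and the overlap\<close>

context outlier_setting
begin

lemma resolvent_tail_norm:
  assumes z: "cmod z \<le> r0"
  shows "l2norm n (\<lambda>i. f z i - (\<Sum>k<m. z ^ k * mat_iter n X u k i)) \<le> M * (r0 / r) ^ m / (1 - r0 / r)"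
proof (rule LIMSEQ_le_const2)
  let ?F = "\<lambda>N i. \<Sum>k<N. z ^ k * mat_iter n X u k i"
  have "(\<lambda>N. ?F N i) \<longlonglongrightarrow> f z i" if "i < n" for i
    using resolvent_sums[OF z that] unfolding sums_def .
  then show "(\<lambda>N. l2norm n (\<lambda>i. ?F N i - ?F m i)) \<longlonglongrightarrow> l2norm n (\<lambda>i. f z i - ?F m i)"
    unfolding l2norm_def L2_set_def by (intro tendsto_intros) auto
  show "\<exists>N0. \<forall>N\<ge>N0. l2norm n (\<lambda>i. ?F N i - ?F m i) \<le> M * (r0 / r) ^ m / (1 - r0 / r)"
  proof (intro exI[of _ m] allI impI)
    fix N assume N: "m \<le> N"
    have eq: "?F N i - ?F m i = (\<Sum>k\<in>{m..<N}. z ^ k * mat_iter n X u k i)" for i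
    proof -
      have set: "{..<N} = {..<m} \<union> {m..<N}" using N by auto
      have "?F N i = ?F m i + (\<Sum>k\<in>{m..<N}. z ^ k * mat_iter n X u k i)"
        unfolding set by (rule sum.union_disjoint) auto
      then show ?thesis by simp
    qed
    have "l2norm n (\<lambda>i. ?F N i - ?F m i) \<le> (\<Sum>k\<in>{m..<N}. l2norm n (\<lambda>i. z ^ k * mat_iter n X u k i))"
      unfolding eq by (rule l2norm_sum) simp
    also have "\<dots> \<le> (\<Sum>k\<in>{m..<N}. M * (r0 / r) ^ k)"
    proof (rule sum_mono)
      fix k
      have "cmod z ^ k * l2norm n (mat_iter n X u k) \<le> r0 ^ k * (M / r ^ k)"
        using z r0 by (intro mult_mono iter_bound power_mono l2norm_nonneg) auto
      then show "l2norm n (\<lambda>i. z ^ k * mat_iter n X u k i) \<le> M * (r0 / r) ^ k"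
        by (simp add: l2norm_scale norm_power power_divide mult.commute)
    qed
    also have "\<dots> = (\<Sum>k<N - m. M * (r0 / r) ^ m * (r0 / r) ^ k)"
      by (rule sum.reindex_bij_witness[of _ "\<lambda>k. k + m" "\<lambda>k. k - m"]) (auto simp: power_add[symmetric])
    also have "\<dots> \<le> (\<Sum>k. M * (r0 / r) ^ m * (r0 / r) ^ k)"
      using rho M_nonneg by (intro sum_le_suminf summable_mult summable_geometric) auto
    also have "\<dots> = M * (r0 / r) ^ m / (1 - r0 / r)"
      using rho by (subst suminf_mult) (auto simp: suminf_geometric intro: summable_geometric)
    finally show "l2norm n (\<lambda>i. ?F N i - ?F m i) \<le> M * (r0 / r) ^ m / (1 - r0 / r)" .
  qed
qed

lemma resolvent_norm: "cmod z \<le> r0 \<Longrightarrow> l2norm n (f z) \<le> M / (1 - r0 / r)"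
  using resolvent_tail_norm[of z 0] by simp

text \<open>Almost orthogonal iterates of almost equal norm turn the squared norm of the series into
  \<open>S\<close> times the geometric series in |z|^2. The three errors are the Gram matrix up to
  order \<open>m\<close>, the tail of the resolvent and the tail of the geometric series.\<close>

lemma resolvent_norm_sq:
  assumes z: "cmod z \<le> r0"
    and \<theta>: "\<And>k l. k \<le> m \<Longrightarrow> l \<le> m \<Longrightarrow>
      cmod ((\<Sum>i<n. cnj (mat_iter n X u l i) * mat_iter n X u k i) - (if k = l then complex_of_real S else 0)) \<le> \<theta>"
    and S: "0 \<le> S"
  shows "\<bar>(l2norm n (f z))\<^sup>2 - S / (1 - (cmod z)\<^sup>2)\<bar> \<le>
    \<theta> * (real (m + 1))\<^sup>2 + 3 * M\<^sup>2 * (r0 / r) ^ (m + 1) / (1 - r0 / r)\<^sup>2 + S * (r0\<^sup>2) ^ (m + 1) / (1 - r0\<^sup>2)"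
proof -
  let ?F = "\<lambda>i. \<Sum>k<Suc m. z ^ k * mat_iter n X u k i" and ?t = "(cmod z)\<^sup>2" and ?\<rho> = "r0 / r"
  let ?a = "\<lambda>k l. \<Sum>i<n. cnj (mat_iter n X u l i) * mat_iter n X u k i"
  have r01: "r0 < 1" using r0 by simp
  have t: "0 \<le> ?t" "?t \<le> r0\<^sup>2" "r0\<^sup>2 < 1"
    using z r0 r01 by (auto simp: power_mono power_strict_mono abs_square_less_1)
  have tail: "l2norm n (\<lambda>i. f z i - ?F i) \<le> M * ?\<rho> ^ (m + 1) / (1 - ?\<rho>)"
    using resolvent_tail_norm[OF z, of "Suc m"] by simp
  have \<rho>m: "?\<rho> ^ (m + 1) \<le> 1" using rho by (intro power_le_one) auto
  have fF: "l2norm n (f z) \<le> l2norm n ?F + l2norm n (\<lambda>i. f z i - ?F i)"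
    using l2norm_triangle[of n ?F "\<lambda>i. f z i - ?F i"] by simp
  have Ff: "l2norm n ?F \<le> l2norm n (f z) + l2norm n (\<lambda>i. f z i - ?F i)"
  proof -
    have "l2norm n (\<lambda>i. - (f z i - ?F i)) = l2norm n (\<lambda>i. f z i - ?F i)" by (simp add: l2norm_def norm_minus_commute)
    then show ?thesis using l2norm_triangle[of n "f z" "\<lambda>i. - (f z i - ?F i)"] by simp
  qed
  have nf: "l2norm n (f z) \<le> M / (1 - ?\<rho>)" by (rule resolvent_norm[OF z])
  have T1: "M * ?\<rho> ^ (m + 1) / (1 - ?\<rho>) \<le> M / (1 - ?\<rho>)"
    using \<rho>m M_nonneg rho by (intro divide_right_mono mult_left_le) auto
  have "\<bar>(l2norm n (f z))\<^sup>2 - (l2norm n ?F)\<^sup>2\<bar> = \<bar>l2norm n (f z) - l2norm n ?F\<bar> * (l2norm n (f z) + l2norm n ?F)"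
    using l2norm_nonneg[of n "f z"] l2norm_nonneg[of n ?F] by (simp add: power2_eq_square square_diff_square_factored abs_mult)
  also have "\<dots> \<le> (M * ?\<rho> ^ (m + 1) / (1 - ?\<rho>)) * (3 * (M / (1 - ?\<rho>)))"
    using fF Ff tail nf T1 l2norm_nonneg[of n "f z"] l2norm_nonneg[of n ?F] by (intro mult_mono) auto
  also have "\<dots> = 3 * M\<^sup>2 * ?\<rho> ^ (m + 1) / (1 - ?\<rho>)\<^sup>2"
  proof -
    have "(a * p / d) * (3 * (a / d)) = 3 * a\<^sup>2 * p / d\<^sup>2" for a p d :: real by (simp add: power2_eq_square)
    then show ?thesis .
  qed
  finally have A: "\<bar>(l2norm n (f z))\<^sup>2 - (l2norm n ?F)\<^sup>2\<bar> \<le> 3 * M\<^sup>2 * ?\<rho> ^ (m + 1) / (1 - ?\<rho>)\<^sup>2" .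
  have "complex_of_real ((l2norm n ?F)\<^sup>2) = (\<Sum>i<n. ?F i * cnj (?F i))"
    unfolding l2norm_sq of_real_sum complex_norm_square ..
  also have "\<dots> = (\<Sum>i<n. \<Sum>k<Suc m. \<Sum>l<Suc m. (z ^ k * cnj (z ^ l)) * (cnj (mat_iter n X u l i) * mat_iter n X u k i))"
    unfolding cnj_sum sum_product by (intro sum.cong refl) simp
  also have "\<dots> = (\<Sum>k<Suc m. \<Sum>i<n. \<Sum>l<Suc m. (z ^ k * cnj (z ^ l)) * (cnj (mat_iter n X u l i) * mat_iter n X u k i))"
    by (rule sum.swap)
  also have "\<dots> = (\<Sum>k<Suc m. \<Sum>l<Suc m. \<Sum>i<n. (z ^ k * cnj (z ^ l)) * (cnj (mat_iter n X u l i) * mat_iter n X u k i))"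
    by (intro sum.cong refl sum.swap)
  also have "\<dots> = (\<Sum>k<Suc m. \<Sum>l<Suc m. (z ^ k * cnj (z ^ l)) * ?a k l)"
    by (simp only: sum_distrib_left)
  finally have Fa: "complex_of_real ((l2norm n ?F)\<^sup>2) = (\<Sum>k<Suc m. \<Sum>l<Suc m. (z ^ k * cnj (z ^ l)) * ?a k l)" .
  have "complex_of_real (S * (\<Sum>k<Suc m. ?t ^ k)) = (\<Sum>k<Suc m. \<Sum>l<Suc m. (z ^ k * cnj (z ^ l)) * (if k = l then complex_of_real S else 0))"
  proof -
    have "(\<Sum>l<Suc m. (z ^ k * cnj (z ^ l)) * (if k = l then complex_of_real S else 0)) = complex_of_real (S * ?t ^ k)" if "k < Suc m" for k
    proof -
      have "(\<Sum>l<Suc m. (z ^ k * cnj (z ^ l)) * (if k = l then complex_of_real S else 0)) =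
         (\<Sum>l<Suc m. if k = l then (z ^ k * cnj (z ^ k)) * complex_of_real S else 0)" by (intro sum.cong) auto
      also have "\<dots> = (z ^ k * cnj (z ^ k)) * complex_of_real S" using that by simp
      also have "z ^ k * cnj (z ^ k) = complex_of_real (?t ^ k)"
        unfolding complex_norm_square[symmetric] by (simp add: norm_power power_mult[symmetric] mult.commute)
      finally show ?thesis by (simp add: mult.commute)
    qed
    then show ?thesis unfolding sum_distrib_left of_real_sum by (intro sum.cong refl) auto
  qed
  then have "complex_of_real ((l2norm n ?F)\<^sup>2 - S * (\<Sum>k<Suc m. ?t ^ k)) =
      (\<Sum>k<Suc m. \<Sum>l<Suc m. (z ^ k * cnj (z ^ l)) * (?a k l - (if k = l then complex_of_real S else 0)))"
    unfolding of_real_diff Fa by (simp only: right_diff_distrib sum_subtractf)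
  from arg_cong[OF this, of cmod] have "\<bar>(l2norm n ?F)\<^sup>2 - S * (\<Sum>k<Suc m. ?t ^ k)\<bar> =
      cmod (\<Sum>k<Suc m. \<Sum>l<Suc m. (z ^ k * cnj (z ^ l)) * (?a k l - (if k = l then complex_of_real S else 0)))"
    unfolding norm_of_real .
  also have "\<dots> \<le> (\<Sum>k<Suc m. \<Sum>l<Suc m. \<theta>)"
  proof (intro sum_norm_le)
    fix k l assume kl: "k \<in> {..<Suc m}" "l \<in> {..<Suc m}"
    have "cmod z \<le> 1" using z r01 by simp
    then have "cmod (z ^ k * cnj (z ^ l)) \<le> 1 * 1"
      unfolding norm_mult complex_mod_cnj norm_power by (intro mult_mono power_le_one) auto
    then have "cmod (z ^ k * cnj (z ^ l)) * cmod (?a k l - (if k = l then complex_of_real S else 0)) \<le> 1 * \<theta>"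
      using \<theta>[of k l] kl by (intro mult_mono) auto
    then show "cmod ((z ^ k * cnj (z ^ l)) * (?a k l - (if k = l then complex_of_real S else 0))) \<le> \<theta>"
      by (simp only: norm_mult mult_1)
  qed
  also have "\<dots> = \<theta> * (real (m + 1))\<^sup>2" by (simp add: power2_eq_square)
  finally have B: "\<bar>(l2norm n ?F)\<^sup>2 - S * (\<Sum>k<Suc m. ?t ^ k)\<bar> \<le> \<theta> * (real (m + 1))\<^sup>2" .
  have "S * (\<Sum>k<Suc m. ?t ^ k) = S / (1 - ?t) - S * ?t ^ (m + 1) / (1 - ?t)"
    using t by (subst sum_gp_strict) (auto simp: diff_divide_distrib right_diff_distrib)
  moreover have "S * ?t ^ (m + 1) / (1 - ?t) \<le> S * (r0\<^sup>2) ^ (m + 1) / (1 - r0\<^sup>2)"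
    using t S z by (intro frac_le mult_left_mono power_mono) auto
  moreover have "0 \<le> S * ?t ^ (m + 1) / (1 - ?t)" using t S by simp
  ultimately have D: "\<bar>S * (\<Sum>k<Suc m. ?t ^ k) - S / (1 - ?t)\<bar> \<le> S * (r0\<^sup>2) ^ (m + 1) / (1 - r0\<^sup>2)" by linarith
  show ?thesis using A B D by linarith
qed

lemma overlap_estimate:
  defines "S \<equiv> (l2norm n u)\<^sup>2"
  assumes eps: "1 + \<epsilon> = 1 / r0" and x: "outlier_eigenvector \<epsilon> Y x"
    and s0: "0 < s0" "s0 \<le> S" and \<eta>: "\<eta> \<le> s0 / 2" "\<eta> \<le> 1"
    and d1: "(\<Sum>k. real (k + 2) * r0 ^ (k + 1) * cmod (mat_bilinear n X u u (k + 1))) \<le> \<eta>"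
    and d2: "\<bar>(l2norm n (f z0))\<^sup>2 - S / (1 - (cmod z0)\<^sup>2)\<bar> \<le> \<eta>"
  shows "\<bar>(cmod (herm_ip x (complex_of_real (1 / l2norm n u) \<cdot>\<^sub>v Matrix.vec n u)))\<^sup>2 - (1 - 1 / (cmod (b 0))\<^sup>2)\<bar>
    \<le> (6 / s0 + 2 / s0\<^sup>2 + 2) * \<eta>"
proof -
  let ?t = "(cmod z0)\<^sup>2" and ?c = "mat_bilinear n X u u"
  let ?D = "S / (1 - ?t)" and ?F = "(l2norm n (f z0))\<^sup>2" and ?N = "(cmod (\<Sum>i<n. cnj (u i) * f z0 i))\<^sup>2"
  have r01: "r0 < 1" using r0 by simp
  have t: "0 \<le> ?t" "?t < 1" using z0(1) r0 r01 by (auto simp: abs_square_less_1)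
  have S0: "0 < S" using s0 by simp
  have c0: "?c 0 = complex_of_real S"
    unfolding mat_bilinear_def S_def l2norm_sq of_real_sum complex_norm_square by (simp add: mult.commute)
  have cb: "cmod (?c k) \<le> l2norm n u * M / r ^ k" for k
  proof -
    have "cmod (?c k) \<le> l2norm n u * l2norm n (mat_iter n X u k)"
      unfolding mat_bilinear_def by (rule inner_le_l2norm)
    also have "\<dots> \<le> l2norm n u * (M / r ^ k)" by (intro mult_left_mono iter_bound l2norm_nonneg)
    finally show ?thesis by simp
  qed
  have sm: "summable (\<lambda>k. real (k + 2) * r0 ^ (k + 1) * cmod (?c (k + 1)))"
    by (rule weighted_sum_bound(1)[OF r0(1,2) cb _ r0(3), where m=0 and \<theta>=0]) auto
  have "(\<lambda>k. \<Sum>i<n. cnj (u i) * (z0 ^ k * mat_iter n X u k i)) sums (\<Sum>i<n. cnj (u i) * f z0 i)"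
    by (intro sums_sum sums_mult resolvent_sums[OF z0(1)]) auto
  then have "(\<lambda>k. z0 ^ k * ?c k) sums (\<Sum>i<n. cnj (u i) * f z0 i)"
    unfolding mat_bilinear_def by (simp add: sum_distrib_left mult_ac)
  then have "(\<lambda>k. z0 ^ (k + 1) * ?c (k + 1)) sums ((\<Sum>i<n. cnj (u i) * f z0 i) - (\<Sum>k<1. z0 ^ k * ?c k))"
    by (subst sums_iff_shift) simp
  then have sums: "(\<lambda>k. z0 ^ (k + 1) * ?c (k + 1)) sums ((\<Sum>i<n. cnj (u i) * f z0 i) - complex_of_real S)"
    by (simp add: c0)
  have bd: "norm (z0 ^ (k + 1) * ?c (k + 1)) \<le> real (k + 2) * r0 ^ (k + 1) * cmod (?c (k + 1))" for k
  proof -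
    have "cmod z0 ^ (k + 1) \<le> r0 ^ (k + 1)" using z0(1) by (intro power_mono) auto
    also have "\<dots> \<le> real (k + 2) * r0 ^ (k + 1)" using r0 by simp
    finally show ?thesis unfolding norm_mult norm_power by (simp add: mult_right_mono del: power_Suc)
  qed
  have dd: "cmod ((\<Sum>i<n. cnj (u i) * f z0 i) - complex_of_real S) \<le> \<eta>"
    using norm_sums_le[OF sums summable_sums[OF sm] bd] d1 by linarith
  have "\<bar>cmod (\<Sum>i<n. cnj (u i) * f z0 i) - S\<bar> \<le> \<eta>"
    using dd norm_triangle_ineq3[of "\<Sum>i<n. cnj (u i) * f z0 i" "complex_of_real S"] S0 by simp
  then obtain h where h: "cmod (\<Sum>i<n. cnj (u i) * f z0 i) = S + h" "\<bar>h\<bar> \<le> \<eta>"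
    by (metis add.commute diff_add_cancel)
  have N: "\<bar>?N - S\<^sup>2\<bar> \<le> (2 * S + 1) * \<eta>"
  proof -
    have "?N - S\<^sup>2 = h * (2 * S + h)" unfolding h(1) by (simp add: power2_eq_square algebra_simps)
    then have "\<bar>?N - S\<^sup>2\<bar> = \<bar>h\<bar> * \<bar>2 * S + h\<bar>" by (simp add: abs_mult)
    also have "\<dots> \<le> \<eta> * (2 * S + 1)" using h(2) \<eta>(2) S0 by (intro mult_mono) auto
    finally show ?thesis by (simp add: mult.commute)
  qed
  have D: "S \<le> ?D" using t S0 by (simp add: pos_le_divide_eq mult_left_le)
  have F: "S / 2 \<le> ?F" using d2 D \<eta>(1) s0(2) by linarith
  have "1 - ?t = S / ?D" using S0 t by simp
  then have A: "\<bar>?N / (S * ?F) - (1 - ?t)\<bar> \<le> (6 / s0 + 2 / s0\<^sup>2) * \<eta>"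
    using quotient_estimate[OF s0 D F eta(1) N d2] by simp
  \<comment> \<open>Replaces |z0| by 1 / |b 0|. Both are at most 1, so the difference of squares
    costs a factor 2.\<close>
  have B: "\<bar>(1 - ?t) - (1 - 1 / (cmod (b 0))\<^sup>2)\<bar> \<le> 2 * \<eta>"
  proof -
    let ?w = "cmod (1 / b 0)"
    have w: "?w \<le> 1" using ell_bounds eta(1) by (simp add: norm_divide)
    have "\<bar>(1 - ?t) - (1 - 1 / (cmod (b 0))\<^sup>2)\<bar> = \<bar>?w\<^sup>2 - ?t\<bar>" by (simp add: norm_divide power_divide)
    also have "\<dots> = \<bar>?w - cmod z0\<bar> * \<bar>?w + cmod z0\<bar>"
      by (simp only: power2_eq_square square_diff_square_factored abs_mult mult.commute)
    also have "\<bar>?w - cmod z0\<bar> \<le> \<eta>"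
      using norm_triangle_ineq3[of "1 / b 0" z0] z0_close by (simp add: norm_minus_commute)
    also have "\<bar>?w + cmod z0\<bar> \<le> 2" using w z0(1) r01 by simp
    finally show ?thesis using eta(1) by (simp add: mult_left_mono mult_right_mono mult.commute)
  qed
  have "(cmod (herm_ip x (complex_of_real (1 / l2norm n u) \<cdot>\<^sub>v Matrix.vec n u)))\<^sup>2 = ?N / (S * ?F)"
    unfolding overlap_eq[OF eps x] S_def ..
  then show ?thesis using A B by (simp add: distrib_right)
qed

end

section \<open>Measurability of the overlap\<close>

text \<open>Coefficients of the product of the factors 1 - z a_i for i < n, that is, elementary
  symmetric functions with signs. The recursion adds one root at a time and makes continuity in
  \<open>a\<close> immediate.\<close>

fun root_coeff :: "nat \<Rightarrow> (nat \<Rightarrow> complex) \<Rightarrow> nat \<Rightarrow> complex" where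
  "root_coeff 0 a k = (if k = 0 then 1 else 0)"
| "root_coeff (Suc n) a k = root_coeff n a k - a n * (if k = 0 then 0 else root_coeff n a (k - 1))"

lemma root_coeff_zero: "n < k \<Longrightarrow> root_coeff n a k = 0"
  by (induction n arbitrary: k) auto

lemma root_coeff_prod: "(\<Sum>k\<le>n. root_coeff n a k * z ^ k) = (\<Prod>i<n. 1 - z * a i)"
proof (induction n)
  case (Suc n)
  have "(\<Sum>k\<le>Suc n. root_coeff (Suc n) a k * z ^ k) =
      (\<Sum>k\<le>Suc n. root_coeff n a k * z ^ k) - a n * (\<Sum>k\<le>Suc n. (if k = 0 then 0 else root_coeff n a (k - 1)) * z ^ k)"
    by (simp only: root_coeff.simps left_diff_distrib sum_subtractf sum_distrib_left mult.assoc)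
  also have "(\<Sum>k\<le>Suc n. root_coeff n a k * z ^ k) = (\<Sum>k\<le>n. root_coeff n a k * z ^ k)"
    by (simp add: root_coeff_zero)
  also have "(\<Sum>k\<le>Suc n. (if k = 0 then 0 else root_coeff n a (k - 1)) * z ^ k) = z * (\<Sum>k\<le>n. root_coeff n a k * z ^ k)"
    by (subst sum.atMost_Suc_shift) (simp add: sum_distrib_left mult_ac)
  finally show ?case unfolding Suc.IH by (simp add: algebra_simps)
qed simp

lemma continuous_root_coeff: "continuous_on UNIV (root_coeff n)"
proof (rule continuous_on_coordinatewise_then_product)
  fix k
  show "continuous_on UNIV (\<lambda>a. root_coeff n a k)"
  proof (induction n arbitrary: k)
    case (Suc n)
    have "continuous_on UNIV (\<lambda>a :: nat \<Rightarrow> complex. a n)" by (rule continuous_on_product_coordinates)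
    then have "continuous_on UNIV (\<lambda>a. root_coeff n a k - a n * (if k = 0 then 0 else root_coeff n a (k - 1)))"
      using Suc.IH[of k] Suc.IH[of "k - 1"] by (cases "k = 0") (auto intro!: continuous_intros)
    then show ?case by simp
  qed simp
qed

text \<open>Coordinates from \<open>n\<close> on are fixed to 0, so that the box is a product of
  compact sets in the space of all sequences.\<close>

definition root_box :: "nat \<Rightarrow> real \<Rightarrow> (nat \<Rightarrow> complex) set" where
  "root_box n B = PiE UNIV (\<lambda>i. if i < n then cball 0 B else {0})"

lemma compact_root_box: "compact (root_box n B)"
proof -
  have "compactin (product_topology (\<lambda>i. euclidean) UNIV) (root_box n B)"
    unfolding root_box_def compactin_PiE by auto
  then show ?thesis unfolding euclidean_product_topology compactin_euclidean_iff .
qed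

text \<open>Sequences of elementary symmetric functions of \<open>n\<close> numbers at least \<open>j\<close> of which lie in \<open>D\<close>. For
  closed \<open>D\<close> this is a countable union of compact sets, so eigenvalue counts are measurable although no
  measurable choice of the eigenvalues is available.\<close>

definition root_set :: "nat \<Rightarrow> complex set \<Rightarrow> nat \<Rightarrow> (nat \<Rightarrow> complex) set" where
  "root_set n D j = (\<Union>B::nat. root_coeff n ` {a \<in> root_box n (real B). \<exists>I\<subseteq>{..<n}. card I = j \<and> (\<forall>i\<in>I. a i \<in> D)})"

lemma root_set_borel:
  assumes D: "closed D"
  shows "root_set n D j \<in> sets borel"
  unfolding root_set_def
proof (intro sets.countable_UN)
  show "range (\<lambda>B::nat. root_coeff n ` {a \<in> root_box n (real B). \<exists>I\<subseteq>{..<n}. card I = j \<and> (\<forall>i\<in>I. a i \<in> D)}) \<subseteq> sets borel"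
  proof (rule image_subsetI)
    fix B :: nat
    have fin: "finite {I. I \<subseteq> {..<n} \<and> card I = j}" by simp
    have cl: "closed {a :: nat \<Rightarrow> complex. a i \<in> D}" for i
    proof -
      have "{a :: nat \<Rightarrow> complex. a i \<in> D} = (\<lambda>a. a i) -` D" by auto
      then show ?thesis using closed_vimage[OF D continuous_on_product_coordinates] by simp
    qed
    have "{a \<in> root_box n (real B). \<exists>I\<subseteq>{..<n}. card I = j \<and> (\<forall>i\<in>I. a i \<in> D)} =
        root_box n (real B) \<inter> (\<Union>I\<in>{I. I \<subseteq> {..<n} \<and> card I = j}. \<Inter>i\<in>I. {a. a i \<in> D})" by auto
    moreover have "closed (\<Union>I\<in>{I. I \<subseteq> {..<n} \<and> card I = j}. \<Inter>i\<in>I. {a :: nat \<Rightarrow> complex. a i \<in> D})"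
      by (intro closed_UN fin ballI closed_INT cl)
    ultimately have "compact {a \<in> root_box n (real B). \<exists>I\<subseteq>{..<n}. card I = j \<and> (\<forall>i\<in>I. a i \<in> D)}"
      using compact_Int_closed[OF compact_root_box] by simp
    then have "compact (root_coeff n ` {a \<in> root_box n (real B). \<exists>I\<subseteq>{..<n}. card I = j \<and> (\<forall>i\<in>I. a i \<in> D)})"
      by (intro compact_continuous_image continuous_on_subset[OF continuous_root_coeff]) auto
    then show "root_coeff n ` {a \<in> root_box n (real B). \<exists>I\<subseteq>{..<n}. card I = j \<and> (\<forall>i\<in>I. a i \<in> D)} \<in> sets borel"
      by (intro borel_closed compact_imp_closed)
  qed
qed

lemma order_prod_linear:
  fixes n :: nat and a :: "nat \<Rightarrow> complex"
  shows "Polynomial.order z (\<Prod>i<n. [:- a i, 1 :: complex:]) = card {i. i < n \<and> a i = z}"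
proof (induction n)
  case (Suc n)
  have ne: "(\<Prod>i<n. [:- a i, 1:]) * [:- a n, 1:] \<noteq> 0" by (intro no_zero_divisors) (auto simp: prod_zero_iff)
  have "Polynomial.order z [:- a n, 1:] = (if a n = z then 1 else 0)"
  proof (cases "a n = z")
    case True
    then show ?thesis using order_power_n_n[of z 1] by simp
  next
    case False
    then show ?thesis by (simp add: order_0I)
  qed
  moreover have "{i. i < Suc n \<and> a i = z} = (if a n = z then insert n {i. i < n \<and> a i = z} else {i. i < n \<and> a i = z})"
    by (auto simp: less_Suc_eq)
  ultimately show ?case unfolding prod.lessThan_Suc order_mult[OF ne] Suc.IH by simp
qed simp

lemma eig_count_roots:
  assumes A: "(A :: complex mat) \<in> carrier_mat n n" and p: "char_poly A = (\<Prod>i<n. [:- a i, 1:])"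
  shows "eig_count A (spectrum A \<inter> D) = card {i. i < n \<and> a i \<in> D}"
proof -
  have sp: "spectrum A = a ` {..<n}"
    unfolding spectrum_root_char_poly[OF A] p poly_prod by (auto simp: prod_zero_iff image_iff)
  have fin: "finite (spectrum A \<inter> D)" unfolding sp by simp
  have "eig_count A (spectrum A \<inter> D) = (\<Sum>z\<in>spectrum A \<inter> D. card {i \<in> {i. i < n \<and> a i \<in> D}. a i = z})"
    unfolding eig_count_def p order_prod_linear by (intro sum.cong refl arg_cong[of _ _ card]) auto
  also have "\<dots> = card {i. i < n \<and> a i \<in> D}"
    using sum.group[of "{i. i < n \<and> a i \<in> D}" "spectrum A \<inter> D" a "\<lambda>_. 1 :: nat"] fin unfolding sp by fastforce
  finally show ?thesis .
qed

text \<open>The coefficients determine the characteristic polynomial: it equals \<mu>^n det (1 - X /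
  \<mu>) for \<mu> \<noteq> 0, and polynomials that agree off one point are equal. Hence any
  sequence with these coefficients lists the eigenvalues with multiplicity, and its members in
  \<open>D\<close> may be counted.\<close>

lemma det_coeff_root_set_iff:
  fixes X :: "nat \<times> nat \<Rightarrow> complex" and n :: nat
  defines "A \<equiv> Matrix.mat n n X"
  shows "det_coeff n X \<in> root_set n D j \<longleftrightarrow> j \<le> eig_count A (spectrum A \<inter> D)"
proof -
  have A: "A \<in> carrier_mat n n" by (simp add: A_def)
  have cp: "poly (char_poly A) \<mu> = \<mu> ^ n * Determinant.det (res_mat n X (1 / \<mu>))" if "\<mu> \<noteq> 0" for \<mu>
  proof -
    have "- (char_matrix A \<mu>) = \<mu> \<cdot>\<^sub>m res_mat n X (1 / \<mu>)"
      by (rule eq_matI) (use that in \<open>auto simp: char_matrix_def A_def res_mat_def field_simps\<close>)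
    then show ?thesis unfolding char_poly_matrix[OF A] by (simp add: res_mat_def)
  qed
  have roots: "char_poly A = (\<Prod>i<n. [:- a i, 1:])" if "det_coeff n X = root_coeff n a" for a
  proof -
    have "poly (char_poly A) \<mu> = poly (\<Prod>i<n. [:- a i, 1:]) \<mu>" if "\<mu> \<noteq> 0" for \<mu>
    proof -
      have "poly (char_poly A) \<mu> = (\<Prod>i<n. \<mu>) * (\<Prod>i<n. 1 - 1 / \<mu> * a i)"
        unfolding cp[OF that] det_res_mat \<open>det_coeff n X = root_coeff n a\<close> root_coeff_prod by simp
      also have "\<dots> = (\<Prod>i<n. \<mu> - a i)"
        unfolding prod.distrib[symmetric] by (intro prod.cong refl) (use that in \<open>simp add: field_simps\<close>)
      finally show ?thesis by (simp add: poly_prod)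
    qed
    then have "poly (char_poly A - (\<Prod>i<n. [:- a i, 1:])) \<mu> = 0" if "\<mu> \<in> - {0}" for \<mu> using that by simp
    then have "infinite {\<mu>. poly (char_poly A - (\<Prod>i<n. [:- a i, 1:])) \<mu> = 0}"
      using infinite_UNIV_char_0[where 'a=complex] by (metis (mono_tags, lifting) finite_compl finite.simps finite_subset mem_Collect_eq subsetI)
    then show ?thesis using poly_roots_finite by (metis eq_iff_diff_eq_0)
  qed
  show ?thesis
  proof
    assume "det_coeff n X \<in> root_set n D j"
    then obtain a I where a: "det_coeff n X = root_coeff n a" "I \<subseteq> {..<n}" "card I = j" "\<forall>i\<in>I. a i \<in> D"
      unfolding root_set_def by auto
    have "I \<subseteq> {i. i < n \<and> a i \<in> D}" using a by auto
    then have "card I \<le> card {i. i < n \<and> a i \<in> D}" by (intro card_mono) auto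
    then show "j \<le> eig_count A (spectrum A \<inter> D)" using a(3) eig_count_roots[OF A roots[OF a(1)]] by simp
  next
    assume j: "j \<le> eig_count A (spectrum A \<inter> D)"
    obtain as where as: "char_poly A = (\<Prod>a\<leftarrow>as. [:- a, 1:])" "length as = n"
      using char_poly_factorized[OF A] by blast
    define a where "a i = (if i < n then as ! i else 0)" for i
    have p: "char_poly A = (\<Prod>i<n. [:- a i, 1:])"
      unfolding as(1) prod.list_conv_set_nth by (simp add: as(2) a_def atLeast0LessThan)
    have "det_coeff n X k = root_coeff n a k" for k
    proof (cases "k \<le> n")
      case True
      have "(\<Sum>k\<le>n. det_coeff n X k * z ^ k) = (\<Sum>k\<le>n. root_coeff n a k * z ^ k)" for z
      proof (cases "z = 0")
        case True
        have "(\<Prod>i<n. 1 - z * a i) = 1" using True by simp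
        then show ?thesis unfolding root_coeff_prod det_res_mat[symmetric] using det_res_mat_0 True by simp
      next
        case False
        have "(1 / z) ^ n * Determinant.det (res_mat n X z) = (\<Prod>i<n. 1 / z - a i)"
          using cp[of "1 / z"] False unfolding p by (simp add: poly_prod)
        then have "(\<Prod>i<n. z) * (\<Prod>i<n. 1 / z - a i) = Determinant.det (res_mat n X z)"
          using False by (simp add: field_simps)
        moreover have "(\<Prod>i<n. z) * (\<Prod>i<n. 1 / z - a i) = (\<Prod>i<n. 1 - z * a i)"
          unfolding prod.distrib[symmetric] by (intro prod.cong refl) (use False in \<open>simp add: right_diff_distrib\<close>)
        ultimately show ?thesis unfolding root_coeff_prod det_res_mat by simp
      qed
      then show ?thesis using polyfun_eq_coeffs[of "det_coeff n X" n "root_coeff n a"] True by blast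
    next
      case False
      then show ?thesis using det_adj_coeff_zero(1)[of n k X] root_coeff_zero[of n k a] by simp
    qed
    then have eq: "det_coeff n X = root_coeff n a" by blast
    obtain I where I: "I \<subseteq> {i. i < n \<and> a i \<in> D}" "card I = j"
      using j unfolding eig_count_roots[OF A p] by (meson obtain_subset_with_card_n)
    obtain B :: nat where B: "(\<Sum>i<n. cmod (a i)) \<le> real B" using real_arch_simple by blast
    have "a \<in> root_box n (real B)"
    proof -
      have "cmod (a i) \<le> real B" if "i < n" for i
        using member_le_sum[of i "{..<n}" "\<lambda>i. cmod (a i)"] that B by simp
      then show ?thesis by (auto simp: root_box_def a_def)
    qed
    then have "a \<in> {a \<in> root_box n (real B). \<exists>I\<subseteq>{..<n}. card I = j \<and> (\<forall>i\<in>I. a i \<in> D)}" using I by auto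
    then show "det_coeff n X \<in> root_set n D j" unfolding root_set_def eq by blast
  qed
qed

lemma measurable_det_coeff:
  assumes "\<And>i j. i < n \<Longrightarrow> j < n \<Longrightarrow> (\<lambda>\<omega>. X \<omega> (i, j)) \<in> borel_measurable M"
  shows "(\<lambda>\<omega>. det_coeff n (X \<omega>)) \<in> borel_measurable M"
proof (rule measurable_coordinatewise_then_product)
  fix k
  have "(\<lambda>\<omega>. X \<omega> e) \<in> borel_measurable M" if te: "t \<in> det_index n k" "e \<in> graph_on (snd t) (fst t)" for t e
  proof -
    obtain S p where t: "t = (S, p)" "S \<subseteq> {..<n}" "p permutes S" using te(1) by (cases t) (auto simp: det_index_def)
    obtain i where i: "i \<in> S" "e = (i, p i)" using te(2) t by (auto simp: graph_on_def)
    then have "i < n" "p i < n" using t(2) permutes_in_image[OF t(3), of i] by auto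
    then show ?thesis using assms i(2) by simp
  qed
  then show "(\<lambda>\<omega>. det_coeff n (X \<omega>) k) \<in> borel_measurable M"
    unfolding det_coeff_def
    by (intro borel_measurable_sum borel_measurable_times borel_measurable_const borel_measurable_prod)
qed

lemma eig_count_event:
  assumes "\<And>i j. i < n \<Longrightarrow> j < n \<Longrightarrow> (\<lambda>\<omega>. X \<omega> (i, j)) \<in> borel_measurable M" and D: "closed D"
  shows "{\<omega> \<in> space M. j \<le> eig_count (Matrix.mat n n (X \<omega>)) (spectrum (Matrix.mat n n (X \<omega>)) \<inter> D)} \<in> sets M"
proof -
  have "{\<omega> \<in> space M. j \<le> eig_count (Matrix.mat n n (X \<omega>)) (spectrum (Matrix.mat n n (X \<omega>)) \<inter> D)} =
      (\<lambda>\<omega>. det_coeff n (X \<omega>)) -` root_set n D j \<inter> space M"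
    by (auto simp: det_coeff_root_set_iff)
  also have "\<dots> \<in> sets M"
  proof (rule measurable_sets[OF _ root_set_borel[OF D]])
    show "(\<lambda>\<omega>. det_coeff n (X \<omega>)) \<in> borel_measurable M" by (rule measurable_det_coeff) (rule assms(1))
  qed
  finally show ?thesis .
qed

text \<open>Replacing row i of \<open>C\<close> by the i-th unit vector gives a matrix of
  determinant \<open>cofactor C i i\<close>, and a kernel vector of \<open>C\<close> that vanishes
  at i is also in the kernel of this matrix.\<close>

lemma kernel_vector_zero:
  fixes C :: "complex mat"
  assumes C: "C \<in> carrier_mat n n" and i: "i < n" "cofactor C i i \<noteq> 0"
    and z: "z \<in> carrier_vec n" "C *\<^sub>v z = 0\<^sub>v n" "Matrix.vec_index z i = 0"
  shows "z = 0\<^sub>v n"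
proof -
  define D where "D = Matrix.mat n n (\<lambda>(r, s). if r = i then (if s = i then 1 else 0) else C $$ (r, s))"
  have D: "D \<in> carrier_mat n n" by (simp add: D_def)
  have del: "mat_delete D i i = mat_delete C i i"
    by (rule eq_matI) (use C i in \<open>auto simp: mat_delete_def D_def\<close>)
  have "Determinant.det D = (\<Sum>j<n. D $$ (i, j) * cofactor D i j)"
    by (rule laplace_expansion_row[OF D i(1)])
  also have "\<dots> = (\<Sum>j<n. if j = i then cofactor D i j else 0)"
    using i by (intro sum.cong) (auto simp: D_def)
  also have "\<dots> = cofactor C i i" using i by (simp add: cofactor_def del)
  finally have det: "Determinant.det D \<noteq> 0" using i by simp
  have "D *\<^sub>v z = 0\<^sub>v n"
  proof (rule eq_vecI)
    fix r assume "r < dim_vec (0\<^sub>v n :: complex Matrix.vec)"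
    then have r: "r < n" by simp
    show "Matrix.vec_index (D *\<^sub>v z) r = Matrix.vec_index (0\<^sub>v n) r"
    proof (cases "r = i")
      case True
      have "Matrix.vec_index (D *\<^sub>v z) r = (\<Sum>s<n. D $$ (r, s) * Matrix.vec_index z s)"
        using D z r by (simp add: scalar_prod_def atLeast0LessThan)
      also have "\<dots> = (\<Sum>s<n. 0)"
        using True z r by (intro sum.cong) (auto simp: D_def)
      finally show ?thesis using r by simp
    next
      case False
      have "Matrix.vec_index (D *\<^sub>v z) r = (\<Sum>s<n. D $$ (r, s) * Matrix.vec_index z s)"
        using D z r by (simp add: scalar_prod_def atLeast0LessThan)
      also have "\<dots> = (\<Sum>s<n. C $$ (r, s) * Matrix.vec_index z s)"
        using False r by (intro sum.cong) (auto simp: D_def)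
      also have "\<dots> = Matrix.vec_index (C *\<^sub>v z) r"
        using C z(1) r by (simp add: scalar_prod_def atLeast0LessThan)
      finally show ?thesis using z by simp
    qed
  qed (use D in simp)
  then show ?thesis using det z(1) det_0_iff_vec_prod_zero[OF D] by auto
qed

lemma kernel_vector_multiple:
  fixes C :: "complex mat"
  assumes C: "C \<in> carrier_mat n n" and i: "i < n" "cofactor C i i \<noteq> 0"
    and x: "x \<in> carrier_vec n" "C *\<^sub>v x = 0\<^sub>v n" "x \<noteq> 0\<^sub>v n"
    and y: "y \<in> carrier_vec n" "C *\<^sub>v y = 0\<^sub>v n"
  shows "\<exists>c. y = c \<cdot>\<^sub>v x"
proof -
  let ?a = "Matrix.vec_index x i" and ?b = "Matrix.vec_index y i"
  have a: "?a \<noteq> 0" using kernel_vector_zero[OF C i x(1,2)] x(3) by auto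
  \<comment> \<open>This combination of kernel vectors is chosen to vanish at i.\<close>
  define z where "z = y + (- (?b / ?a)) \<cdot>\<^sub>v x"
  have zc: "z \<in> carrier_vec n" using x y by (simp add: z_def)
  have "C *\<^sub>v z = C *\<^sub>v y + C *\<^sub>v ((- (?b / ?a)) \<cdot>\<^sub>v x)"
    unfolding z_def using C x y by (intro mult_add_distrib_mat_vec) auto
  also have "\<dots> = 0\<^sub>v n" using C x y by (subst mult_mat_vec[OF C x(1)]) (auto intro!: eq_vecI)
  finally have "C *\<^sub>v z = 0\<^sub>v n" .
  moreover have "Matrix.vec_index z i = 0" using a x y i by (simp add: z_def)
  ultimately have "z = 0\<^sub>v n" by (rule kernel_vector_zero[OF C i zc])
  have "y = (?b / ?a) \<cdot>\<^sub>v x"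
  proof (rule eq_vecI)
    fix k assume "k < dim_vec ((?b / ?a) \<cdot>\<^sub>v x)"
    then have k: "k < n" using x by simp
    have "Matrix.vec_index z k = 0" using \<open>z = 0\<^sub>v n\<close> k by simp
    then show "Matrix.vec_index y k = Matrix.vec_index ((?b / ?a) \<cdot>\<^sub>v x) k"
      using k x y by (simp add: z_def)
  qed (use x y in simp)
  then show ?thesis by blast
qed

text \<open>The derivative of the characteristic polynomial is the sum of the characteristic
  polynomials of the matrices with row and column i deleted. At a simple root it is non-zero, so one
  of the diagonal cofactors is.\<close>

lemma simple_root_cofactor:
  fixes A :: "complex mat"
  assumes A: "A \<in> carrier_mat n n" and ord: "Polynomial.order lam (char_poly A) = 1"
  shows "\<exists>i<n. cofactor (char_matrix A lam) i i \<noteq> 0"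
proof -
  have cp0: "char_poly A \<noteq> 0" using degree_monic_char_poly[OF A] by auto
  have root: "poly (char_poly A) lam = 0" using ord order_root[of "char_poly A" lam] by simp
  have "Polynomial.order lam (pderiv (char_poly A)) = 0" using order_pderiv[OF cp0 root] ord by simp
  moreover have "pderiv (char_poly A) \<noteq> 0"
  proof
    assume "pderiv (char_poly A) = 0"
    then have "degree (char_poly A) = 0" by (simp add: pderiv_eq_0_iff)
    then have "Polynomial.order lam (char_poly A) = 0" using order_degree[OF cp0, of lam] by simp
    then show False using ord by simp
  qed
  ultimately have "poly (pderiv (char_poly A)) lam \<noteq> 0" using order_root by blast
  then have "(\<Sum>i<n. poly (char_poly (mat_delete A i i)) lam) \<noteq> 0"
    unfolding pderiv_char_poly[OF A] poly_sum .
  then obtain i where i: "i < n" "poly (char_poly (mat_delete A i i)) lam \<noteq> 0"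
    by (meson lessThan_iff sum.neutral)
  have Ad: "mat_delete A i i \<in> carrier_mat (n - 1) (n - 1)" by (rule mat_delete_carrier[OF A])
  have "Determinant.det (- char_matrix (mat_delete A i i) lam) \<noteq> 0"
    using i(2) unfolding char_poly_matrix[OF Ad] .
  moreover have "char_matrix (mat_delete A i i) lam = mat_delete (char_matrix A lam) i i"
    by (rule eq_matI) (use A i in \<open>auto simp: char_matrix_def mat_delete_def\<close>)
  ultimately have "Determinant.det (mat_delete (char_matrix A lam) i i) \<noteq> 0"
    using det_0_negate[of "mat_delete (char_matrix A lam) i i" "n - 1"] char_matrix_closed[OF Ad] by metis
  then show ?thesis using i by (auto simp: cofactor_def)
qed

lemma herm_ip_sum: "y \<in> carrier_vec n \<Longrightarrow> x \<in> carrier_vec n \<Longrightarrow> herm_ip x y = (\<Sum>i<n. cnj (Matrix.vec_index x i) * Matrix.vec_index y i)"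
  by (simp add: herm_ip_def scalar_prod_def atLeast0LessThan mult.commute)

text \<open>At a simple eigenvalue the adjugate has rank one and its columns are multiples of the eigenvector.
  The overlap is therefore a rational function of the entries, whichever unit eigenvector is chosen.\<close>

lemma overlap_adjugate:
  fixes A :: "complex mat"
  assumes A: "A \<in> carrier_mat n n" and ord: "Polynomial.order lam (char_poly A) = 1"
    and x: "eigenvector A x lam" "eucl_norm x = 1" and w: "w \<in> carrier_vec n"
  defines "P \<equiv> \<lambda>i j. cofactor (char_matrix A lam) j i"
  shows "(cmod (herm_ip x w))\<^sup>2 =
    (\<Sum>j<n. (cmod (\<Sum>i<n. cnj (P i j) * Matrix.vec_index w i))\<^sup>2) / (\<Sum>j<n. \<Sum>i<n. (cmod (P i j))\<^sup>2)"
proof -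
  define C where "C = char_matrix A lam"
  have C: "C \<in> carrier_mat n n" using A by (simp add: C_def)
  obtain i where i: "i < n" "cofactor C i i \<noteq> 0" using simple_root_cofactor[OF A ord] unfolding C_def by blast
  have xk: "x \<in> carrier_vec n" "x \<noteq> 0\<^sub>v n" "C *\<^sub>v x = 0\<^sub>v n"
    using x(1) unfolding eigenvector_char_matrix[OF A] C_def by auto
  have det: "Determinant.det C = 0" using det_0_iff_vec_prod_zero[OF C] xk by blast
  have col: "C *\<^sub>v col (adj_mat C) j = 0\<^sub>v n" if "j < n" for j
  proof -
    have "C *\<^sub>v col (adj_mat C) j = col (C * adj_mat C) j"
      using that adj_mat(1)[OF C] by (intro col_mult2[symmetric, OF C]) auto
    also have "\<dots> = 0\<^sub>v n" unfolding adj_mat(2)[OF C] det by (rule eq_vecI) (use that in auto)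
    finally show ?thesis .
  qed
  have "\<exists>c. col (adj_mat C) j = c \<cdot>\<^sub>v x" if "j < n" for j
    by (rule kernel_vector_multiple[OF C i xk(1,3,2) _ col[OF that]]) (use adj_mat(1)[OF C] in auto)
  then obtain c where c: "\<And>j. j < n \<Longrightarrow> col (adj_mat C) j = c j \<cdot>\<^sub>v x" by metis
  have P: "P k j = c j * Matrix.vec_index x k" if "k < n" "j < n" for k j
  proof -
    have "P k j = Matrix.vec_index (col (adj_mat C) j) k"
      using that C unfolding P_def C_def[symmetric] adj_mat_def by simp
    then show ?thesis using c[OF that(2)] that xk by simp
  qed
  have norm1: "(\<Sum>k<n. (cmod (Matrix.vec_index x k))\<^sup>2) = 1"
    using x(2) xk(1) unfolding eucl_norm_def by simp
  have num: "(\<Sum>j<n. (cmod (\<Sum>k<n. cnj (P k j) * Matrix.vec_index w k))\<^sup>2) = (\<Sum>j<n. (cmod (c j))\<^sup>2) * (cmod (herm_ip x w))\<^sup>2"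
  proof -
    have "(cmod (\<Sum>k<n. cnj (P k j) * Matrix.vec_index w k))\<^sup>2 = (cmod (c j))\<^sup>2 * (cmod (herm_ip x w))\<^sup>2" if "j < n" for j
    proof -
      have "(\<Sum>k<n. cnj (P k j) * Matrix.vec_index w k) = cnj (c j) * herm_ip x w"
        unfolding herm_ip_sum[OF w xk(1)] sum_distrib_left using P that by (intro sum.cong) auto
      then show ?thesis by (simp add: norm_mult power_mult_distrib)
    qed
    then show ?thesis by (simp add: sum_distrib_right)
  qed
  have den: "(\<Sum>j<n. \<Sum>k<n. (cmod (P k j))\<^sup>2) = (\<Sum>j<n. (cmod (c j))\<^sup>2)"
  proof (rule sum.cong[OF refl])
    fix j assume "j \<in> {..<n}"
    then have "(\<Sum>k<n. (cmod (P k j))\<^sup>2) = (cmod (c j))\<^sup>2 * (\<Sum>k<n. (cmod (Matrix.vec_index x k))\<^sup>2)"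
      unfolding sum_distrib_left using P by (intro sum.cong) (auto simp: norm_mult power_mult_distrib)
    then show "(\<Sum>k<n. (cmod (P k j))\<^sup>2) = (cmod (c j))\<^sup>2" using norm1 by simp
  qed
  \<comment> \<open>The non-zero diagonal cofactor is \<open>c i\<close> times a coordinate of
    \<open>x\<close>; this makes the denominator positive.\<close>
  have "c i \<noteq> 0" using P[OF i(1) i(1)] i(2) unfolding P_def C_def[symmetric] by auto
  then have "0 < (\<Sum>j<n. (cmod (c j))\<^sup>2)" using i(1) by (intro sum_pos2[of _ i]) auto
  then show ?thesis unfolding num den by simp
qed

section \<open>Measurability of the outlier and of the overlap\<close>

lemma measurable_det:
  fixes Z :: "'a \<Rightarrow> nat \<Rightarrow> nat \<Rightarrow> complex"
  assumes "\<And>i j. i < m \<Longrightarrow> j < m \<Longrightarrow> (\<lambda>\<omega>. Z \<omega> i j) \<in> borel_measurable M"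
  shows "(\<lambda>\<omega>. Determinant.det (Matrix.mat m m (\<lambda>(i, j). Z \<omega> i j))) \<in> borel_measurable M"
proof -
  have "Determinant.det (Matrix.mat m m (\<lambda>(i, j). Z \<omega> i j)) =
      (\<Sum>p\<in>{p. p permutes {0..<m}}. signof p * (\<Prod>i = 0..<m. Z \<omega> i (p i)))" for \<omega>
    unfolding det_def'[OF mat_carrier]
  proof (intro sum.cong refl arg_cong2[of _ _ _ _ "(*)"] prod.cong)
    fix p i assume "p \<in> {p. p permutes {0..<m}}" "i \<in> {0..<m}"
    then have "p i \<in> {0..<m}" "i < m" using permutes_in_image[of p "{0..<m}" i] by auto
    then show "Matrix.mat m m (\<lambda>(i, j). Z \<omega> i j) $$ (i, p i) = Z \<omega> i (p i)" by simp
  qed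
  moreover have "(\<lambda>\<omega>. \<Sum>p\<in>{p. p permutes {0..<m}}. signof p * (\<Prod>i = 0..<m. Z \<omega> i (p i))) \<in> borel_measurable M"
  proof (intro borel_measurable_sum borel_measurable_times borel_measurable_const borel_measurable_prod)
    fix p i assume "p \<in> {p. p permutes {0..<m}}" "i \<in> {0..<m}"
    then have "p i \<in> {0..<m}" "i < m" using permutes_in_image[of p "{0..<m}" i] by auto
    then show "(\<lambda>\<omega>. Z \<omega> i (p i)) \<in> borel_measurable M" using assms by simp
  qed
  ultimately show ?thesis by simp
qed

lemma measurable_cofactor:
  fixes Z :: "'a \<Rightarrow> nat \<times> nat \<Rightarrow> complex"
  assumes Z: "\<And>i j. i < n \<Longrightarrow> j < n \<Longrightarrow> (\<lambda>\<omega>. Z \<omega> (i, j)) \<in> borel_measurable M"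
    and L: "L \<in> borel_measurable M"
  shows "(\<lambda>\<omega>. cofactor (char_matrix (Matrix.mat n n (Z \<omega>)) (L \<omega>)) p q) \<in> borel_measurable M"
proof -
  let ?i = "\<lambda>r s :: nat. if r < s then r else Suc r"
  have eq: "mat_delete (char_matrix (Matrix.mat n n (Z \<omega>)) (L \<omega>)) p q = Matrix.mat (n - 1) (n - 1)
      (\<lambda>(r, s). Z \<omega> (?i r p, ?i s q) - (if ?i r p = ?i s q then L \<omega> else 0))" for \<omega>
    by (rule eq_matI) (auto simp: mat_delete_def char_matrix_def)
  have "(\<lambda>\<omega>. Determinant.det (Matrix.mat (n - 1) (n - 1)
      (\<lambda>(r, s). Z \<omega> (?i r p, ?i s q) - (if ?i r p = ?i s q then L \<omega> else 0)))) \<in> borel_measurable M"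
  proof (rule measurable_det)
    fix r s assume "r < n - 1" "s < n - 1"
    then have "?i r p < n" "?i s q < n" by auto
    then have "(\<lambda>\<omega>. Z \<omega> (?i r p, ?i s q)) \<in> borel_measurable M" by (rule Z)
    moreover have "(\<lambda>\<omega>. if ?i r p = ?i s q then L \<omega> else 0) \<in> borel_measurable M" using L by simp
    ultimately show "(\<lambda>\<omega>. Z \<omega> (?i r p, ?i s q) - (if ?i r p = ?i s q then L \<omega> else 0)) \<in> borel_measurable M"
      by (rule borel_measurable_diff)
  qed
  then show ?thesis unfolding cofactor_def eq by (intro borel_measurable_times borel_measurable_const)
qed

text \<open>Every outer eigenvalue has multiplicity at least 1, so a total of 1 leaves a single,
  simple one. All other eigenvalues are smaller in modulus, which makes the description in
  \<open>lambda_max\<close> unique.\<close>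

lemma outer_spectrum_single:
  fixes A :: "complex mat"
  assumes A: "A \<in> carrier_mat n n" and one: "eig_count A (outer_spectrum \<epsilon> A) = 1"
  shows "outer_spectrum \<epsilon> A = {lambda_max A}" "Polynomial.order (lambda_max A) (char_poly A) = 1"
    "lambda_max A \<in> spectrum A" "1 + \<epsilon> \<le> cmod (lambda_max A)"
proof -
  have fin: "finite (outer_spectrum \<epsilon> A)" unfolding outer_spectrum_def using card_finite_spectrum(1)[OF A] by simp
  have cp0: "char_poly A \<noteq> 0" using degree_monic_char_poly[OF A] by auto
  have pos: "1 \<le> Polynomial.order z (char_poly A)" if "z \<in> outer_spectrum \<epsilon> A" for z
    using that cp0 unfolding outer_spectrum_def spectrum_root_char_poly[OF A] by (simp add: order_root Suc_le_eq)
  have "outer_spectrum \<epsilon> A \<noteq> {}" using one by (auto simp: eig_count_def)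
  then obtain z where z: "z \<in> outer_spectrum \<epsilon> A" by blast
  have sum1: "Polynomial.order z (char_poly A) + (\<Sum>w\<in>outer_spectrum \<epsilon> A - {z}. Polynomial.order w (char_poly A)) = 1"
    using one sum.remove[OF fin z, of "\<lambda>w. Polynomial.order w (char_poly A)"] by (simp add: eig_count_def)
  have o1: "Polynomial.order z (char_poly A) = 1" using sum1 pos[OF z] by linarith
  have "card (outer_spectrum \<epsilon> A - {z}) \<le> (\<Sum>w\<in>outer_spectrum \<epsilon> A - {z}. Polynomial.order w (char_poly A))"
    using sum_bounded_below[of "outer_spectrum \<epsilon> A - {z}" 1 "\<lambda>w. Polynomial.order w (char_poly A)"] pos by simp
  then have "card (outer_spectrum \<epsilon> A - {z}) = 0" using sum1 o1 by linarith
  then have "outer_spectrum \<epsilon> A - {z} = {}" using fin by (simp only: card_eq_0_iff finite_Diff) simp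
  then have single: "outer_spectrum \<epsilon> A = {z}" using z by blast
  have z': "z \<in> spectrum A" "1 + \<epsilon> \<le> cmod z" using z by (auto simp: outer_spectrum_def)
  have small: "cmod w < 1 + \<epsilon>" if "w \<in> spectrum A" "w \<noteq> z" for w
  proof (rule ccontr)
    assume "\<not> cmod w < 1 + \<epsilon>"
    then have "w \<in> outer_spectrum \<epsilon> A" using that by (simp add: outer_spectrum_def)
    then show False using single that by simp
  qed
  have "lambda_max A = z" unfolding lambda_max_def
  proof (rule the_equality)
    show "z \<in> spectrum A \<and> (\<forall>w\<in>spectrum A. w \<noteq> z \<longrightarrow> cmod w < cmod z)" using z' small by fastforce
  next
    fix y assume y: "y \<in> spectrum A \<and> (\<forall>w\<in>spectrum A. w \<noteq> y \<longrightarrow> cmod w < cmod y)"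
    show "y = z"
    proof (rule ccontr)
      assume "y \<noteq> z"
      then have "cmod z < cmod y" using y z' by auto
      then show False using small[of y] y \<open>y \<noteq> z\<close> z'(2) by linarith
    qed
  qed
  then show "outer_spectrum \<epsilon> A = {lambda_max A}" "Polynomial.order (lambda_max A) (char_poly A) = 1"
    "lambda_max A \<in> spectrum A" "1 + \<epsilon> \<le> cmod (lambda_max A)" using single o1 z' by auto
qed

lemma measurable_closedI:
  fixes f :: "'a \<Rightarrow> complex"
  assumes "\<And>D. closed D \<Longrightarrow> {\<omega> \<in> space M. f \<omega> \<in> D} \<in> sets M"
  shows "f \<in> borel_measurable M"
proof (rule borel_measurableI)
  fix S :: "complex set" assume "open S"
  then have "{\<omega> \<in> space M. f \<omega> \<in> - S} \<in> sets M" by (intro assms closed_Compl)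
  then have "space M - {\<omega> \<in> space M. f \<omega> \<in> - S} \<in> sets M" by (rule sets.compl_sets)
  moreover have "space M - {\<omega> \<in> space M. f \<omega> \<in> - S} = f -` S \<inter> space M" by auto
  ultimately show "f -` S \<inter> space M \<in> sets M" by simp
qed

text \<open>The eigenvector \<open>x\<close> may depend on \<omega> in a non-measurable way. On the
  event \<open>G\<close> of exactly one outer eigenvalue the adjugate formula expresses the overlap
  by the entries and the outlier; elsewhere the overlap is 0.\<close>

lemma measurable_outlier_overlap:
  fixes Z :: "'a \<Rightarrow> nat \<times> nat \<Rightarrow> complex"
  assumes Z: "\<And>i j. i < n \<Longrightarrow> j < n \<Longrightarrow> (\<lambda>\<omega>. Z \<omega> (i, j)) \<in> borel_measurable M"
    and w: "w \<in> carrier_vec n"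
    and x: "\<And>\<omega>. \<omega> \<in> space M \<Longrightarrow> outlier_eigenvector \<epsilon> (Matrix.mat n n (Z \<omega>)) (x \<omega>)"
  shows "(\<lambda>\<omega>. (cmod (herm_ip (x \<omega>) w))\<^sup>2) \<in> borel_measurable M"
proof -
  define Y where "Y \<omega> = Matrix.mat n n (Z \<omega>)" for \<omega>
  have Yc: "Y \<omega> \<in> carrier_mat n n" for \<omega> by (simp add: Y_def)
  define E where "E = {z :: complex. 1 + \<epsilon> \<le> cmod z}"
  have clE: "closed E" unfolding E_def by (intro closed_Collect_le continuous_intros)
  have outer: "outer_spectrum \<epsilon> A = spectrum A \<inter> E" for A by (auto simp: outer_spectrum_def E_def)
  define G where "G = {\<omega> \<in> space M. eig_count (Y \<omega>) (outer_spectrum \<epsilon> (Y \<omega>)) = 1}"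
  have ev: "{\<omega> \<in> space M. j \<le> eig_count (Y \<omega>) (spectrum (Y \<omega>) \<inter> D)} \<in> sets M" if "closed D" for j D
    unfolding Y_def by (rule eig_count_event) (use Z that in auto)
  have "G = {\<omega> \<in> space M. 1 \<le> eig_count (Y \<omega>) (spectrum (Y \<omega>) \<inter> E)} - {\<omega> \<in> space M. 2 \<le> eig_count (Y \<omega>) (spectrum (Y \<omega>) \<inter> E)}"
    unfolding G_def outer by auto
  then have G: "G \<in> sets M" using ev[OF clE] by simp
  have single: "outer_spectrum \<epsilon> (Y \<omega>) = {lambda_max (Y \<omega>)}" "Polynomial.order (lambda_max (Y \<omega>)) (char_poly (Y \<omega>)) = 1"
    if "\<omega> \<in> G" for \<omega>
    using outer_spectrum_single[OF Yc, of \<omega>] that by (auto simp: G_def)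
  \<comment> \<open>The value 0 off \<open>G\<close> is a default. On \<open>G\<close> the outlier
    lies in a closed set D exactly if some eigenvalue lies in E \<inter> D, and this is decided by a
    counting event.\<close>
  define L where "L \<omega> = (if \<omega> \<in> G then lambda_max (Y \<omega>) else 0)" for \<omega>
  have L: "L \<in> borel_measurable M"
  proof (rule measurable_closedI)
    fix D :: "complex set" assume D: "closed D"
    have iff: "1 \<le> eig_count (Y \<omega>) (spectrum (Y \<omega>) \<inter> (E \<inter> D)) \<longleftrightarrow> lambda_max (Y \<omega>) \<in> D" if "\<omega> \<in> G" for \<omega>
    proof -
      have "spectrum (Y \<omega>) \<inter> (E \<inter> D) = {lambda_max (Y \<omega>)} \<inter> D"
        using single(1)[OF that] unfolding outer by blast
      then show ?thesis using single(2)[OF that] by (cases "lambda_max (Y \<omega>) \<in> D") (auto simp: eig_count_def)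
    qed
    have GM: "\<omega> \<in> space M" if "\<omega> \<in> G" for \<omega> using that by (simp add: G_def)
    have "{\<omega> \<in> space M. L \<omega> \<in> D} = (G \<inter> {\<omega> \<in> space M. 1 \<le> eig_count (Y \<omega>) (spectrum (Y \<omega>) \<inter> (E \<inter> D))}) \<union> (if 0 \<in> D then space M - G else {})"
      using iff GM by (auto simp: L_def)
    moreover have "{\<omega> \<in> space M. 1 \<le> eig_count (Y \<omega>) (spectrum (Y \<omega>) \<inter> (E \<inter> D))} \<in> sets M"
      by (rule ev) (intro closed_Int clE D)
    ultimately show "{\<omega> \<in> space M. L \<omega> \<in> D} \<in> sets M" using G by auto
  qed
  define P where "P \<omega> i j = cofactor (char_matrix (Y \<omega>) (L \<omega>)) j i" for \<omega> i j
  have P: "(\<lambda>\<omega>. P \<omega> i j) \<in> borel_measurable M" for i j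
    unfolding P_def Y_def by (rule measurable_cofactor) (use Z L in auto)
  let ?F = "\<lambda>\<omega>. (\<Sum>j<n. (cmod (\<Sum>i<n. cnj (P \<omega> i j) * Matrix.vec_index w i))\<^sup>2) / (\<Sum>j<n. \<Sum>i<n. (cmod (P \<omega> i j))\<^sup>2)"
  have F: "?F \<in> borel_measurable M"
  proof -
    have "(\<lambda>\<omega>. cnj (P \<omega> i j)) \<in> borel_measurable M" for i j
      by (rule measurable_compose[OF P]) (intro borel_measurable_continuous_onI continuous_intros)
    note [measurable] = P this
    show ?thesis by measurable
  qed
  have "(\<lambda>\<omega>. if \<omega> \<in> G then ?F \<omega> else 0) \<in> borel_measurable M"
    by (rule measurable_If_set) (use F G sets.sets_into_space[OF G] in \<open>auto simp: Int_absorb2\<close>)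
  moreover have "(cmod (herm_ip (x \<omega>) w))\<^sup>2 = (if \<omega> \<in> G then ?F \<omega> else 0)" if "\<omega> \<in> space M" for \<omega>
  proof (cases "\<omega> \<in> G")
    case True
    then have "eigenvector (Y \<omega>) (x \<omega>) (lambda_max (Y \<omega>))" "eucl_norm (x \<omega>) = 1"
      using x[OF that] unfolding G_def outlier_eigenvector_def Y_def[symmetric] by auto
    from overlap_adjugate[OF Yc single(2)[OF True] this w] show ?thesis
      using True by (simp add: P_def L_def)
  next
    case False
    then have "x \<omega> = 0\<^sub>v n"
      using x[OF that] that Yc[of \<omega>] unfolding G_def outlier_eigenvector_def Y_def[symmetric] by auto
    then show ?thesis using False w by (simp add: herm_ip_def)
  qed
  ultimately show ?thesis by (subst measurable_cong) auto
qed

section \<open>Moments of the entries\<close>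

text \<open>If j is the integer part of |X| then |X|^k \<le> (j + 1)^k, and the tail bound makes the
  series of (j + 1)^k P(|X| \<ge> j) converge.\<close>

lemma (in prob_space) subgaussian_moment:
  fixes X :: "'a \<Rightarrow> complex"
  assumes X: "X \<in> borel_measurable M" and c: "0 < c"
    and tail: "\<And>t. 0 \<le> t \<Longrightarrow> measure M {\<omega> \<in> space M. t \<le> cmod (X \<omega>)} \<le> 2 * exp (- c * t\<^sup>2)"
  shows "integrable M (\<lambda>\<omega>. cmod (X \<omega>) ^ k)"
proof -
  define S where "S j = {\<omega> \<in> space M. real j \<le> cmod (X \<omega>)}" for j :: nat
  have S: "S j \<in> sets M" for j unfolding S_def using X by measurable
  have "(\<lambda>j. real (j + 1) ^ k * (2 * exp (- c * (real j)\<^sup>2))) \<in> O(\<lambda>j. 1 / real j ^ 2)"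
    using c by real_asymp
  then have sum: "summable (\<lambda>j. real (j + 1) ^ k * (2 * exp (- c * (real j)\<^sup>2)))"
    by (rule summable_comparison_test_bigo[rotated]) (use inverse_power_summable[of 2, where 'a=real] in \<open>simp add: divide_inverse norm_power\<close>)
  have single: "f j \<le> suminf f" for f :: "nat \<Rightarrow> ennreal" and j
    using sum_le_suminf[of f "{j}"] by auto
  have point: "ennreal (cmod (X \<omega>) ^ k) \<le> (\<Sum>j. ennreal (real (j + 1) ^ k) * indicator (S j) \<omega>)" if w: "\<omega> \<in> space M" for \<omega>
  proof -
    define j where "j = nat \<lfloor>cmod (X \<omega>)\<rfloor>"
    have j: "real j \<le> cmod (X \<omega>)" "cmod (X \<omega>) \<le> real (j + 1)" unfolding j_def by (simp, linarith)
    have "cmod (X \<omega>) ^ k \<le> real (j + 1) ^ k" using j by (intro power_mono) auto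
    then have "ennreal (cmod (X \<omega>) ^ k) \<le> ennreal (real (j + 1) ^ k) * indicator (S j) \<omega>"
      using j w by (simp add: S_def ennreal_leI)
    also have "\<dots> \<le> (\<Sum>j. ennreal (real (j + 1) ^ k) * indicator (S j) \<omega>)" by (rule single)
    finally show ?thesis .
  qed
  have "(\<integral>\<^sup>+\<omega>. ennreal (cmod (X \<omega>) ^ k) \<partial>M) \<le> (\<integral>\<^sup>+\<omega>. (\<Sum>j. ennreal (real (j + 1) ^ k) * indicator (S j) \<omega>) \<partial>M)"
    by (rule nn_integral_mono) (rule point)
  also have "\<dots> = (\<Sum>j. ennreal (real (j + 1) ^ k) * emeasure M (S j))"
    using S by (simp add: nn_integral_suminf nn_integral_cmult)
  also have "\<dots> \<le> (\<Sum>j. ennreal (real (j + 1) ^ k * (2 * exp (- c * (real j)\<^sup>2))))"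
  proof (intro suminf_le allI summableI)
    fix j
    have "real (j + 1) ^ k * measure M (S j) \<le> real (j + 1) ^ k * (2 * exp (- c * (real j)\<^sup>2))"
      unfolding S_def by (intro mult_left_mono tail) auto
    then have "ennreal (real (j + 1) ^ k * measure M (S j)) \<le> ennreal (real (j + 1) ^ k * (2 * exp (- c * (real j)\<^sup>2)))"
      by (rule ennreal_leI)
    then show "ennreal (real (j + 1) ^ k) * emeasure M (S j) \<le> ennreal (real (j + 1) ^ k * (2 * exp (- c * (real j)\<^sup>2)))"
      unfolding emeasure_eq_measure by (subst ennreal_mult[symmetric]) simp_all
  qed
  also have "\<dots> = ennreal (\<Sum>j. real (j + 1) ^ k * (2 * exp (- c * (real j)\<^sup>2)))"
    by (rule suminf_ennreal2[OF _ sum]) (intro mult_nonneg_nonneg zero_le_power of_nat_0_le_iff exp_ge_zero zero_le_numeral)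
  also have "\<dots> < \<infinity>" by (simp only: infinity_ennreal_def ennreal_less_top)
  finally have "(\<integral>\<^sup>+\<omega>. ennreal (cmod (X \<omega>) ^ k) \<partial>M) < \<infinity>" .
  then show ?thesis
    using X by (intro integrableI_bounded) (auto simp: norm_power)
qed

lemma integrable_mixed_moment:
  fixes X :: "'a \<Rightarrow> complex"
  assumes "X \<in> borel_measurable N" "integrable N (\<lambda>\<omega>. cmod (X \<omega>) ^ (a + b))"
  shows "integrable N (\<lambda>\<omega>. X \<omega> ^ a * cnj (X \<omega>) ^ b)"
proof (rule Bochner_Integration.integrable_bound[OF assms(2)])
  show "(\<lambda>\<omega>. X \<omega> ^ a * cnj (X \<omega>) ^ b) \<in> borel_measurable N"
    by (rule measurable_compose[OF assms(1)]) (intro borel_measurable_continuous_onI continuous_intros)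
qed (simp add: norm_mult norm_power power_add)

definition sparse_moment :: "'c measure \<Rightarrow> ('c \<Rightarrow> complex) \<Rightarrow> nat \<Rightarrow> nat \<Rightarrow> nat \<Rightarrow> nat \<Rightarrow> complex" where
  "sparse_moment N chi n K a b = of_real (1 / sqrt (real K)) ^ (a + b) *
    ((\<integral>z. z ^ a * cnj z ^ b \<partial>bernoulli_law (real K / real n)) * (\<integral>z. z ^ a * cnj z ^ b \<partial>distr N borel chi))"

text \<open>The maximum with 1 provides the condition \<open>1 \<le> mu k\<close>; at k = 2 the
  moment itself is 1.\<close>

definition abs_moment :: "'c measure \<Rightarrow> ('c \<Rightarrow> complex) \<Rightarrow> nat \<Rightarrow> real" where
  "abs_moment N chi k = max 1 (\<integral>\<omega>. cmod (chi \<omega>) ^ k \<partial>N)"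

lemma bernoulli_law_integral:
  fixes f :: "complex \<Rightarrow> complex"
  assumes p: "0 \<le> p" "p \<le> 1" and f: "f \<in> borel_measurable borel"
  shows "integrable (bernoulli_law p) f" "(\<integral>z. f z \<partial>bernoulli_law p) = of_real p * f 1 + of_real (1 - p) * f 0"
proof -
  show "integrable (bernoulli_law p) f" unfolding bernoulli_law_def
    using f by (subst integrable_distr_eq) (auto intro: integrable_measure_pmf_finite)
  have "(\<integral>z. f z \<partial>bernoulli_law p) = (\<integral>b. f (of_bool b) \<partial>measure_pmf (bernoulli_pmf p))"
    unfolding bernoulli_law_def using f by (subst integral_distr) auto
  also have "\<dots> = of_real p * f 1 + of_real (1 - p) * f 0"
    using p by (subst integral_measure_pmf[of UNIV]) (auto simp: UNIV_bool scaleR_conv_of_real)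
  finally show "(\<integral>z. f z \<partial>bernoulli_law p) = of_real p * f 1 + of_real (1 - p) * f 0" .
qed

lemma mixed_power_mult:
  "(of_real s * y * x) ^ a * cnj (of_real s * y * x) ^ b =
    of_real s ^ (a + b) * ((x ^ a * cnj x ^ b) * (y ^ a * cnj y ^ b))"
  by (simp add: power_mult_distrib power_add mult_ac)

text \<open>Independence factors the mixed moments over the entries: inside A, inside B and between
  the two matrices. As B takes the values 0 and 1, each of its positive powers has mean K / n; with
  the scaling 1 / sqrt K this gives 1 / (n sqrt K^(k - 2)) for moments of order k.\<close>

lemma sparse_moments_instance:
  fixes N :: "'c measure" and chi :: "'c \<Rightarrow> complex" and M :: "'a measure"
    and A B :: "nat \<Rightarrow> nat \<Rightarrow> 'a \<Rightarrow> complex"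
  assumes N: "prob_space N" and chi: "chi \<in> borel_measurable N"
    and chi_mean: "integral\<^sup>L N chi = 0" and chi_var: "integral\<^sup>L N (\<lambda>x. (cmod (chi x))\<^sup>2) = 1"
    and moments: "\<And>k. integrable N (\<lambda>\<omega>. cmod (chi \<omega>) ^ k)"
    and M: "prob_space M" and K: "1 \<le> K" "K \<le> n"
    and A: "iid_entries M n A (distr N borel chi)"
    and B: "iid_entries M n B (bernoulli_law (real K / real n))"
    and AB: "indep_matrices M n A B"
  shows "sparse_moments M n K (\<lambda>(i, j) \<omega>. of_real (1 / sqrt (real K)) * B i j \<omega> * A i j \<omega>)
    (sparse_moment N chi n K) (abs_moment N chi)"
proof -
  interpret prob_space M by (rule M)
  let ?I = "{..<n} \<times> {..<n}" and ?p = "real K / real n" and ?s = "1 / sqrt (real K)"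
  let ?x = "\<lambda>(i, j) \<omega>. of_real (1 / sqrt (real K)) * B i j \<omega> * A i j \<omega>"
  have n: "0 < n" using K by simp
  have p: "0 \<le> ?p" "?p \<le> 1" using K n by auto
  define A' where "A' e = A (fst e) (snd e)" for e
  define B' where "B' e = B (fst e) (snd e)" for e
  have xe: "?x e \<omega> = of_real ?s * B' e \<omega> * A' e \<omega>" for e \<omega> by (cases e) (simp add: A'_def B'_def)
  have iA: "indep_vars (\<lambda>_. borel) A' ?I" and dA: "\<And>e. e \<in> ?I \<Longrightarrow> distr M borel (A' e) = distr N borel chi"
    using A unfolding iid_entries_def A'_def by (auto simp: case_prod_beta')
  have iB: "indep_vars (\<lambda>_. borel) B' ?I" and dB: "\<And>e. e \<in> ?I \<Longrightarrow> distr M borel (B' e) = bernoulli_law ?p"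
    using B unfolding iid_entries_def B'_def by (auto simp: case_prod_beta')
  have mA: "A' e \<in> borel_measurable M" if "e \<in> ?I" for e using iA that by (auto simp: indep_vars_def)
  have mB: "B' e \<in> borel_measurable M" if "e \<in> ?I" for e using iB that by (auto simp: indep_vars_def)
  have AB': "indep_var (\<Pi>\<^sub>M p\<in>?I. borel) (\<lambda>\<omega>. \<lambda>e\<in>?I. A' e \<omega>) (\<Pi>\<^sub>M p\<in>?I. borel) (\<lambda>\<omega>. \<lambda>e\<in>?I. B' e \<omega>)"
    using AB unfolding indep_matrices_def A'_def B'_def by (simp add: case_prod_beta')
  define F where "F a b z = z ^ a * cnj z ^ b" for a b :: nat and z :: complex
  have Fm [measurable]: "F a b \<in> borel_measurable borel" for a b
    unfolding F_def by (intro borel_measurable_continuous_onI continuous_intros)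
  have FA: "integrable M (\<lambda>\<omega>. F a b (A' e \<omega>))"
    "(\<integral>\<omega>. F a b (A' e \<omega>) \<partial>M) = (\<integral>z. F a b z \<partial>distr N borel chi)" if "e \<in> ?I" for e a b
  proof -
    have "integrable (distr N borel chi) (F a b)"
      using chi integrable_mixed_moment[OF chi moments, of a b] by (subst integrable_distr_eq) (auto simp: F_def)
    then show "integrable M (\<lambda>\<omega>. F a b (A' e \<omega>))"
      using mA[OF that] unfolding dA[OF that, symmetric] by (subst (asm) integrable_distr_eq) auto
    show "(\<integral>\<omega>. F a b (A' e \<omega>) \<partial>M) = (\<integral>z. F a b z \<partial>distr N borel chi)"
      using mA[OF that] unfolding dA[OF that, symmetric] by (subst integral_distr) auto
  qed
  have FB: "integrable M (\<lambda>\<omega>. F a b (B' e \<omega>))"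
    "(\<integral>\<omega>. F a b (B' e \<omega>) \<partial>M) = (\<integral>z. F a b z \<partial>bernoulli_law ?p)" if "e \<in> ?I" for e a b
  proof -
    have "integrable (bernoulli_law ?p) (F a b)" by (rule bernoulli_law_integral(1)[OF p Fm])
    then show "integrable M (\<lambda>\<omega>. F a b (B' e \<omega>))"
      using mB[OF that] unfolding dB[OF that, symmetric] by (subst (asm) integrable_distr_eq) auto
    show "(\<integral>\<omega>. F a b (B' e \<omega>) \<partial>M) = (\<integral>z. F a b z \<partial>bernoulli_law ?p)"
      using mB[OF that] unfolding dB[OF that, symmetric] by (subst integral_distr) auto
  qed
  have monom: "integrable M (\<lambda>\<omega>. \<Prod>e\<in>J. ?x e \<omega> ^ a e * cnj (?x e \<omega>) ^ b e) \<and>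
      (\<integral>\<omega>. (\<Prod>e\<in>J. ?x e \<omega> ^ a e * cnj (?x e \<omega>) ^ b e) \<partial>M) = (\<Prod>e\<in>J. sparse_moment N chi n K (a e) (b e))"
    if J: "J \<subseteq> ?I" for J a b
  proof -
    have finJ: "finite J" using J by (rule finite_subset) simp
    have split: "(\<lambda>\<omega>. \<Prod>e\<in>J. ?x e \<omega> ^ a e * cnj (?x e \<omega>) ^ b e) =
        (\<lambda>\<omega>. (\<Prod>e\<in>J. of_real ?s ^ (a e + b e)) * ((\<Prod>e\<in>J. F (a e) (b e) (A' e \<omega>)) * (\<Prod>e\<in>J. F (a e) (b e) (B' e \<omega>))))"
      unfolding prod.distrib[symmetric] xe F_def mixed_power_mult ..
    have indA: "indep_vars (\<lambda>_. borel) (\<lambda>e \<omega>. F (a e) (b e) (A' e \<omega>)) J"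
      by (rule indep_vars_compose2[OF indep_vars_subset[OF iA J]]) simp
    have indB: "indep_vars (\<lambda>_. borel) (\<lambda>e \<omega>. F (a e) (b e) (B' e \<omega>)) J"
      by (rule indep_vars_compose2[OF indep_vars_subset[OF iB J]]) simp
    have intA: "integrable M (\<lambda>\<omega>. \<Prod>e\<in>J. F (a e) (b e) (A' e \<omega>))"
      "(\<integral>\<omega>. (\<Prod>e\<in>J. F (a e) (b e) (A' e \<omega>)) \<partial>M) = (\<Prod>e\<in>J. \<integral>z. F (a e) (b e) z \<partial>distr N borel chi)"
    proof -
      show "integrable M (\<lambda>\<omega>. \<Prod>e\<in>J. F (a e) (b e) (A' e \<omega>))"
        by (rule indep_vars_integrable[OF finJ indA]) (use FA J in auto)
      have "(\<integral>\<omega>. (\<Prod>e\<in>J. F (a e) (b e) (A' e \<omega>)) \<partial>M) = (\<Prod>e\<in>J. \<integral>\<omega>. F (a e) (b e) (A' e \<omega>) \<partial>M)"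
        by (rule indep_vars_lebesgue_integral[OF finJ indA]) (use FA J in auto)
      also have "\<dots> = (\<Prod>e\<in>J. \<integral>z. F (a e) (b e) z \<partial>distr N borel chi)"
        using FA(2) J by (intro prod.cong refl) blast
      finally show "(\<integral>\<omega>. (\<Prod>e\<in>J. F (a e) (b e) (A' e \<omega>)) \<partial>M) = (\<Prod>e\<in>J. \<integral>z. F (a e) (b e) z \<partial>distr N borel chi)" .
    qed
    have intB: "integrable M (\<lambda>\<omega>. \<Prod>e\<in>J. F (a e) (b e) (B' e \<omega>))"
      "(\<integral>\<omega>. (\<Prod>e\<in>J. F (a e) (b e) (B' e \<omega>)) \<partial>M) = (\<Prod>e\<in>J. \<integral>z. F (a e) (b e) z \<partial>bernoulli_law ?p)"
    proof -
      show "integrable M (\<lambda>\<omega>. \<Prod>e\<in>J. F (a e) (b e) (B' e \<omega>))"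
        by (rule indep_vars_integrable[OF finJ indB]) (use FB J in auto)
      have "(\<integral>\<omega>. (\<Prod>e\<in>J. F (a e) (b e) (B' e \<omega>)) \<partial>M) = (\<Prod>e\<in>J. \<integral>\<omega>. F (a e) (b e) (B' e \<omega>) \<partial>M)"
        by (rule indep_vars_lebesgue_integral[OF finJ indB]) (use FB J in auto)
      also have "\<dots> = (\<Prod>e\<in>J. \<integral>z. F (a e) (b e) z \<partial>bernoulli_law ?p)"
        using FB(2) J by (intro prod.cong refl) blast
      finally show "(\<integral>\<omega>. (\<Prod>e\<in>J. F (a e) (b e) (B' e \<omega>)) \<partial>M) = (\<Prod>e\<in>J. \<integral>z. F (a e) (b e) z \<partial>bernoulli_law ?p)" .
    qed
    have meas: "(\<lambda>f. \<Prod>e\<in>J. F (a e) (b e) (f e)) \<in> borel_measurable (\<Pi>\<^sub>M p\<in>?I. borel)"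
    proof (intro borel_measurable_prod)
      fix e assume "e \<in> J"
      then have "(\<lambda>f. f e) \<in> measurable (\<Pi>\<^sub>M p\<in>?I. borel) borel"
        using J by (intro measurable_component_singleton) auto
      then show "(\<lambda>f. F (a e) (b e) (f e)) \<in> borel_measurable (\<Pi>\<^sub>M p\<in>?I. borel)"
        by (rule measurable_compose) simp
    qed
    have rA: "(\<lambda>f. \<Prod>e\<in>J. F (a e) (b e) (f e)) \<circ> (\<lambda>\<omega>. \<lambda>e\<in>?I. A' e \<omega>) = (\<lambda>\<omega>. \<Prod>e\<in>J. F (a e) (b e) (A' e \<omega>))"
      using J by (intro ext) (simp add: comp_def, intro prod.cong, auto)
    have rB: "(\<lambda>f. \<Prod>e\<in>J. F (a e) (b e) (f e)) \<circ> (\<lambda>\<omega>. \<lambda>e\<in>?I. B' e \<omega>) = (\<lambda>\<omega>. \<Prod>e\<in>J. F (a e) (b e) (B' e \<omega>))"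
      using J by (intro ext) (simp add: comp_def, intro prod.cong, auto)
    have ind: "indep_var borel (\<lambda>\<omega>. \<Prod>e\<in>J. F (a e) (b e) (A' e \<omega>)) borel (\<lambda>\<omega>. \<Prod>e\<in>J. F (a e) (b e) (B' e \<omega>))"
      using indep_var_compose[OF AB' meas meas] unfolding rA rB .
    show ?thesis unfolding split
    proof
      show "integrable M (\<lambda>\<omega>. (\<Prod>e\<in>J. of_real ?s ^ (a e + b e)) * ((\<Prod>e\<in>J. F (a e) (b e) (A' e \<omega>)) * (\<Prod>e\<in>J. F (a e) (b e) (B' e \<omega>))))"
        by (intro integrable_mult_right indep_var_integrable[OF ind intA(1) intB(1)])
      have "(\<integral>\<omega>. (\<Prod>e\<in>J. of_real ?s ^ (a e + b e)) * ((\<Prod>e\<in>J. F (a e) (b e) (A' e \<omega>)) * (\<Prod>e\<in>J. F (a e) (b e) (B' e \<omega>))) \<partial>M) =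
          (\<Prod>e\<in>J. of_real ?s ^ (a e + b e)) * ((\<Prod>e\<in>J. \<integral>z. F (a e) (b e) z \<partial>distr N borel chi) * (\<Prod>e\<in>J. \<integral>z. F (a e) (b e) z \<partial>bernoulli_law ?p))"
        unfolding integral_mult_right_zero indep_var_lebesgue_integral[OF ind intA(1) intB(1)] intA(2) intB(2) ..
      also have "\<dots> = (\<Prod>e\<in>J. sparse_moment N chi n K (a e) (b e))"
        unfolding prod.distrib[symmetric] sparse_moment_def F_def by (intro prod.cong refl) simp
      finally show "(\<integral>\<omega>. (\<Prod>e\<in>J. of_real ?s ^ (a e + b e)) * ((\<Prod>e\<in>J. F (a e) (b e) (A' e \<omega>)) * (\<Prod>e\<in>J. F (a e) (b e) (B' e \<omega>))) \<partial>M) =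
          (\<Prod>e\<in>J. sparse_moment N chi n K (a e) (b e))" .
    qed
  qed
  have law_chi: "(\<integral>z. F a b z \<partial>distr N borel chi) = (\<integral>\<omega>. F a b (chi \<omega>) \<partial>N)" for a b
    using chi by (subst integral_distr) auto
  have law_B: "(\<integral>z. F a b z \<partial>bernoulli_law ?p) = of_real ?p" if "0 < a + b" for a b
  proof -
    have "F a b 0 = 0" "F a b 1 = 1" using that by (auto simp: F_def)
    then show ?thesis unfolding bernoulli_law_integral(2)[OF p Fm] by simp
  qed
  have m: "sparse_moment N chi n K a b = of_real ?s ^ (a + b) * (of_real ?p * (\<integral>\<omega>. F a b (chi \<omega>) \<partial>N))" if "0 < a + b" for a b
    using law_chi[of a b] law_B[OF that] by (simp add: sparse_moment_def F_def)
  have sq: "sqrt (real K) ^ 2 = real K" by simp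
  show ?thesis
  proof (intro sparse_moments.intro sparse_moments_axioms.intro M K)
    show "?x e \<in> borel_measurable M" if "e \<in> ?I" for e
    proof -
      have "(\<lambda>\<omega>. of_real ?s * B' e \<omega> * A' e \<omega>) \<in> borel_measurable M"
        using mA[OF that] mB[OF that] by (intro borel_measurable_times borel_measurable_const)
      then show ?thesis unfolding xe[symmetric] .
    qed
  next
    fix J :: "(nat \<times> nat) set" and a b :: "nat \<times> nat \<Rightarrow> nat"
    assume J: "J \<subseteq> ?I"
    show "integrable M (\<lambda>\<omega>. \<Prod>e\<in>J. ?x e \<omega> ^ a e * cnj (?x e \<omega>) ^ b e)" by (rule conjunct1[OF monom[OF J]])
    show "(\<integral>\<omega>. (\<Prod>e\<in>J. ?x e \<omega> ^ a e * cnj (?x e \<omega>) ^ b e) \<partial>M) = (\<Prod>e\<in>J. sparse_moment N chi n K (a e) (b e))"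
      by (rule conjunct2[OF monom[OF J]])
  next
    show "sparse_moment N chi n K 1 0 = 0" using m[of 1 0] chi_mean by (simp add: F_def)
    have "(\<integral>\<omega>. cnj (chi \<omega>) \<partial>N) = cnj (\<integral>\<omega>. chi \<omega> \<partial>N)" by (rule Bochner_Integration.integral_cnj)
    then show "sparse_moment N chi n K 0 1 = 0" using m[of 0 1] chi_mean by (simp add: F_def)
    have "F 1 1 (chi \<omega>) = of_real ((cmod (chi \<omega>))\<^sup>2)" for \<omega> by (simp add: F_def complex_norm_square[symmetric])
    then have "(\<integral>\<omega>. F 1 1 (chi \<omega>) \<partial>N) = of_real 1" unfolding chi_var[symmetric] by (simp only: integral_complex_of_real)
    then have "sparse_moment N chi n K 1 1 = of_real ?s ^ (1 + 1) * (of_real ?p * of_real 1)" using m[of 1 1] by (simp only:)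
    also have "\<dots> = of_real (?s ^ 2 * ?p)" by (simp only: of_real_mult of_real_power of_real_1 mult_1_right one_add_one)
    also have "?s ^ 2 * ?p = 1 / real n" using K sq by (simp add: power_divide)
    finally show "sparse_moment N chi n K 1 1 = 1 / of_nat n" by simp
    show "cmod (sparse_moment N chi n K a b) \<le> abs_moment N chi (a + b) / (real n * sqrt (real K) ^ (a + b - 2))"
      if ab: "2 \<le> a + b" for a b
    proof -
      have "cmod (\<integral>\<omega>. F a b (chi \<omega>) \<partial>N) \<le> (\<integral>\<omega>. cmod (F a b (chi \<omega>)) \<partial>N)" by (rule integral_norm_bound)
      also have "\<dots> = (\<integral>\<omega>. cmod (chi \<omega>) ^ (a + b) \<partial>N)"
        by (simp add: F_def norm_mult norm_power power_add)
      also have "\<dots> \<le> abs_moment N chi (a + b)" by (simp add: abs_moment_def)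
      finally have le: "cmod (\<integral>\<omega>. F a b (chi \<omega>) \<partial>N) \<le> abs_moment N chi (a + b)" .
      have "cmod (sparse_moment N chi n K a b) = ?s ^ (a + b) * ?p * cmod (\<integral>\<omega>. F a b (chi \<omega>) \<partial>N)"
      proof -
        have "0 < a + b" using ab by linarith
        moreover have "\<bar>?s\<bar> = ?s" "\<bar>?p\<bar> = ?p" by simp_all
        ultimately show ?thesis using m[of a b] by (simp only: norm_mult norm_power norm_of_real mult.assoc)
      qed
      also have "\<dots> \<le> ?s ^ (a + b) * ?p * abs_moment N chi (a + b)" using p by (intro mult_left_mono le) auto
      also have "?s ^ (a + b) * ?p = 1 / (real n * sqrt (real K) ^ (a + b - 2))"
      proof -
        have "a + b = (a + b - 2) + 2" using ab by linarith
        then have "sqrt (real K) ^ (a + b) = sqrt (real K) ^ ((a + b - 2) + 2)" by (rule arg_cong)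
        also have "\<dots> = sqrt (real K) ^ (a + b - 2) * real K" unfolding power_add sq ..
        finally have "sqrt (real K) ^ (a + b) = sqrt (real K) ^ (a + b - 2) * real K" .
        then show ?thesis using K by (simp add: power_divide)
      qed
      finally show ?thesis by simp
    qed
    show "1 \<le> abs_moment N chi k" for k by (simp add: abs_moment_def)
    show "abs_moment N chi 2 = 1" using chi_var by (simp add: abs_moment_def)
  qed
qed

section \<open>Convergence of the overlap\<close>

text \<open>All randomness is confined to the hypotheses. The determinant and trace sums keep the
  determinant away from 0 on the disc of radius \<open>r\<close>. Together with the adjugate sum
  this bounds the iterates, with \<open>M\<close> the adjugate bound divided by the lower bound of
  the determinant. The small bilinear forms and Gram entries then locate the outlier and its
  eigenvector.\<close>

lemma overlap_deterministic:
  fixes X :: "nat \<times> nat \<Rightarrow> complex" and u v :: "nat \<Rightarrow> complex" and C :: real and n :: nat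
  defines "S \<equiv> (l2norm n u)\<^sup>2"
  assumes r: "0 < r0" "r0 < r" "r < R" "R \<le> 1" and uC: "l2norm n u \<le> C" and vC: "l2norm n v \<le> C"
    and det: "(\<Sum>k\<le>n. cmod (det_coeff n X k) * R ^ k) \<le> M1"
    and trace: "(\<Sum>k<m1. cmod (mat_trace_power n X (Suc k)) * R ^ Suc k / real (Suc k)) \<le> T"
    and m1: "M1 * exp T * (r / R) ^ Suc m1 / (1 - r / R) \<le> 1 / 2"
    and adj: "(\<Sum>j\<le>n. r ^ j * l2norm n (adj_coeff n X u j)) \<le> M3"
    and M: "M = M3 / (exp (- T) / 2)"
    and bl: "\<And>k. 1 \<le> k \<Longrightarrow> k \<le> m \<Longrightarrow> cmod (mat_bilinear n X v u k) \<le> \<theta>"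
      "\<And>k. 1 \<le> k \<Longrightarrow> k \<le> m \<Longrightarrow> cmod (mat_bilinear n X u u k) \<le> \<theta>"
    and ip: "\<And>k l. 1 \<le> k \<Longrightarrow> k \<le> m \<Longrightarrow> 1 \<le> l \<Longrightarrow> l \<le> m \<Longrightarrow>
      cmod ((\<Sum>i<n. cnj (mat_iter n X u l i) * mat_iter n X u k i) - (if k = l then complex_of_real S else 0)) \<le> \<theta>"
    and \<theta>: "0 \<le> \<theta>"
    and e1: "\<theta> * (\<Sum>k<m. real (k + 2)) + C * M * (\<Sum>k. real (k + m + 2) * (r0 / r) ^ (k + m + 1)) \<le> \<eta>"
    and e2: "\<theta> * (real (m + 1))\<^sup>2 + 3 * M\<^sup>2 * (r0 / r) ^ (m + 1) / (1 - r0 / r)\<^sup>2 + C\<^sup>2 * (r0\<^sup>2) ^ (m + 1) / (1 - r0\<^sup>2) \<le> \<eta>"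
    and ell: "1 + \<eta> \<le> r0 * cmod (mat_bilinear n X v u 0)"
    and s0: "0 < s0" "s0 \<le> S" and \<eta>: "\<eta> \<le> s0 / 2" "\<eta> \<le> 1"
    and eps: "1 + \<epsilon> = 1 / r0"
    and x: "outlier_eigenvector \<epsilon> (Matrix.mat n n (\<lambda>(i, j). X (i, j) + u i * cnj (v j))) x"
  shows "\<bar>(cmod (herm_ip x (complex_of_real (1 / l2norm n u) \<cdot>\<^sub>v Matrix.vec n u)))\<^sup>2
      - (1 - 1 / (cmod (mat_bilinear n X v u 0))\<^sup>2)\<bar> \<le> (6 / s0 + 2 / s0\<^sup>2 + 2) * \<eta>"
proof -
  have C0: "0 \<le> C" using uC l2norm_nonneg[of n u] by linarith
  obtain as where as: "\<And>z. Determinant.det (res_mat n X z) = (\<Prod>a\<leftarrow>as. 1 - z * a)"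
      "\<And>k. mat_trace_power n X k = (\<Sum>a\<leftarrow>as. a ^ k)"
    using mat_trace_power_eigenvalues by blast
  have lower: "exp (- T) / 2 \<le> cmod (Determinant.det (res_mat n X z))" if "cmod z \<le> r" for z
    unfolding as(1)
  proof (rule reversed_char_poly_lower_bound[OF _ r(3) _ _ m1 that])
    show "0 < r" using r by linarith
    show "(\<Sum>k<m1. cmod (\<Sum>a\<leftarrow>as. a ^ Suc k) * R ^ Suc k / real (Suc k)) \<le> T"
      using trace unfolding as(2) .
    fix z assume z: "cmod z \<le> R"
    have "cmod (\<Prod>a\<leftarrow>as. 1 - z * a) = cmod (\<Sum>k\<le>n. det_coeff n X k * z ^ k)"
      unfolding as(1)[symmetric] det_res_mat ..
    also have "\<dots> \<le> (\<Sum>k\<le>n. cmod (det_coeff n X k) * R ^ k)"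
      by (intro sum_norm_le) (auto simp: norm_mult norm_power intro!: mult_left_mono power_mono z)
    finally show "cmod (\<Prod>a\<leftarrow>as. 1 - z * a) \<le> M1" using det by linarith
  qed
  have iter: "l2norm n (mat_iter n X u k) \<le> M / r ^ k" for k
    unfolding M by (rule mat_iter_norm_bound[OF _ _ lower adj]) (use r in auto)
  have rho: "0 \<le> r0 / r" "r0 / r < 1" using r by auto
  have bound: "cmod (mat_bilinear n X w u k) \<le> C * M / r ^ k" if "l2norm n w \<le> C" for w k
  proof -
    have "cmod (mat_bilinear n X w u k) \<le> l2norm n w * l2norm n (mat_iter n X u k)"
      unfolding mat_bilinear_def by (rule inner_le_l2norm)
    also have "\<dots> \<le> C * (M / r ^ k)" using that iter C0 by (intro mult_mono l2norm_nonneg) auto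
    finally show ?thesis by simp
  qed
  note weighted = order_trans[OF weighted_sum_bound(2)[OF r(1,2)] e1]
  have r1: "r \<le> 1" using r by linarith
  have d: "(\<Sum>k. real (k + 2) * r0 ^ (k + 1) * cmod (mat_bilinear n X v u (k + 1))) \<le> \<eta>"
    "(\<Sum>k. real (k + 2) * r0 ^ (k + 1) * cmod (mat_bilinear n X u u (k + 1))) \<le> \<eta>"
    by (rule weighted[OF bound[OF vC] bl(1) r1] weighted[OF bound[OF uC] bl(2) r1]; assumption)+
  have \<eta>0: "0 \<le> \<eta>"
  proof -
    have "0 \<le> \<theta> * (real (m + 1))\<^sup>2" using \<theta> by simp
    moreover have "0 \<le> 3 * M\<^sup>2 * (r0 / r) ^ (m + 1) / (1 - r0 / r)\<^sup>2"
      using zero_le_power[OF rho(1), of "m + 1"] by (intro divide_nonneg_nonneg mult_nonneg_nonneg zero_le_power2) simp_all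
    moreover have "0 \<le> C\<^sup>2 * (r0\<^sup>2) ^ (m + 1) / (1 - r0\<^sup>2)"
      using r power_le_one[of r0 2] by (intro divide_nonneg_nonneg mult_nonneg_nonneg) auto
    ultimately show ?thesis using e2 by linarith
  qed
  interpret outlier_setting n X u v r0 r M \<eta>
  proof
    show "0 < r0" "r0 < r" "r \<le> 1" using r r1 by auto
    show "Determinant.det (res_mat n X z) \<noteq> 0" if "cmod z \<le> r0" for z
    proof
      assume "Determinant.det (res_mat n X z) = 0"
      then have "exp (- T) / 2 \<le> 0" using lower[of z] that r by simp
      then show False using exp_gt_zero[of "- T"] by linarith
    qed
  qed (use iter \<eta>0 d ell in auto)
  have S0: "0 \<le> S" by (simp add: S_def)
  have SC: "S \<le> C\<^sup>2" unfolding S_def using uC by (intro power_mono l2norm_nonneg)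
  have cond: "cmod ((\<Sum>i<n. cnj (mat_iter n X u l i) * mat_iter n X u k i) - (if k = l then complex_of_real S else 0)) \<le> \<theta>"
    if kl: "k \<le> m" "l \<le> m" for k l
  proof -
    \<comment> \<open>Gram entries with an index 0 are bilinear forms with \<open>u\<close>, or
      their conjugates.\<close>
    have zero: "(\<Sum>i<n. cnj (mat_iter n X u 0 i) * mat_iter n X u k i) = mat_bilinear n X u u k" for k
      by (simp add: mat_bilinear_def)
    consider "1 \<le> k" "1 \<le> l" | "l = 0" "k = 0" | "l = 0" "1 \<le> k" | "k = 0" "1 \<le> l" by linarith
    then show ?thesis
    proof cases
      case 1 then show ?thesis using ip kl by blast
    next
      case 2
      have "(\<Sum>i<n. cnj (u i) * u i) = complex_of_real S"
        unfolding S_def l2norm_sq of_real_sum complex_norm_square by (simp add: mult.commute)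
      then show ?thesis using 2 \<theta> by simp
    next
      case 3 then show ?thesis using bl(2) kl zero by simp
    next
      case 4
      have "(\<Sum>i<n. cnj (mat_iter n X u l i) * u i) = cnj (mat_bilinear n X u u l)"
        by (simp add: mat_bilinear_def mult.commute)
      then show ?thesis using 4 bl(2) kl by simp
    qed
  qed
  have S_le: "S * (r0\<^sup>2) ^ (m + 1) / (1 - r0\<^sup>2) \<le> C\<^sup>2 * (r0\<^sup>2) ^ (m + 1) / (1 - r0\<^sup>2)"
    using r SC power_le_one[of r0 2] by (intro divide_right_mono mult_right_mono) auto
  have d2: "\<bar>(l2norm n (f z0))\<^sup>2 - S / (1 - (cmod z0)\<^sup>2)\<bar> \<le> \<eta>"
  proof -
    have "\<bar>(l2norm n (f z0))\<^sup>2 - S / (1 - (cmod z0)\<^sup>2)\<bar> \<le>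
        \<theta> * (real (m + 1))\<^sup>2 + 3 * M\<^sup>2 * (r0 / r) ^ (m + 1) / (1 - r0 / r)\<^sup>2 + S * (r0\<^sup>2) ^ (m + 1) / (1 - r0\<^sup>2)"
      by (rule resolvent_norm_sq[OF z0(1) _ S0]) (rule cond)
    then show ?thesis using e2 S_le by linarith
  qed
  show ?thesis
    by (rule overlap_estimate[OF eps x[folded Y_def] s0[unfolded S_def] \<eta> d(2) d2[unfolded S_def]])
qed

text \<open>From 2 f \<le> 1 + f^2; measurability of f is recovered from that of its square because
  f is nonnegative.\<close>

lemma (in prob_space) square_integrable_norm:
  fixes f :: "'a \<Rightarrow> real"
  assumes f: "integrable M (\<lambda>\<omega>. (f \<omega>)\<^sup>2)" "\<And>\<omega>. 0 \<le> f \<omega>"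
  shows "integrable M f" "expectation (\<lambda>\<omega>. (f \<omega>)\<^sup>2) \<le> c \<Longrightarrow> expectation f \<le> (1 + c) / 2"
proof -
  have le: "f \<omega> \<le> (1 + (f \<omega>)\<^sup>2) / 2" for \<omega> using sum_squares_bound[of 1 "f \<omega>"] by simp
  have int: "integrable M (\<lambda>\<omega>. (1 + (f \<omega>)\<^sup>2) / 2)" using f(1) by simp
  have [measurable]: "(\<lambda>\<omega>. (f \<omega>)\<^sup>2) \<in> borel_measurable M" using f(1) by simp
  have "(\<lambda>\<omega>. sqrt ((f \<omega>)\<^sup>2)) \<in> borel_measurable M" by measurable
  then have "f \<in> borel_measurable M" using f(2) by simp
  then show 1: "integrable M f"
    by (rule Bochner_Integration.integrable_bound[OF int]) (use le f(2) in auto)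
  have "expectation f \<le> expectation (\<lambda>\<omega>. (1 + (f \<omega>)\<^sup>2) / 2)" by (rule integral_mono[OF 1 int le])
  also have "\<dots> = (1 + expectation (\<lambda>\<omega>. (f \<omega>)\<^sup>2)) / 2" using f(1) by (simp add: prob_space)
  finally show "expectation f \<le> (1 + c) / 2" if "expectation (\<lambda>\<omega>. (f \<omega>)\<^sup>2) \<le> c" using that by simp
qed

lemma (in prob_space) markov_exceedance:
  fixes f :: "'a \<Rightarrow> real"
  assumes f: "integrable M f" "\<And>\<omega>. 0 \<le> f \<omega>" "expectation f \<le> e" and c: "0 < c"
  shows "{\<omega> \<in> space M. c < f \<omega>} \<in> events" "prob {\<omega> \<in> space M. c < f \<omega>} \<le> e / c"
proof -
  have m: "f \<in> borel_measurable M" using f(1) by simp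
  show S: "{\<omega> \<in> space M. c < f \<omega>} \<in> events" using m by measurable
  have "prob {\<omega> \<in> space M. c < f \<omega>} \<le> prob {\<omega> \<in> space M. f \<omega> \<ge> c}"
    using m by (intro finite_measure_mono) (auto, measurable)
  also have "\<dots> \<le> expectation f / c"
    using integral_Markov_inequality_measure[OF f(1), of "{}" c] f(2) c by simp
  also have "\<dots> \<le> e / c" using f(3) c by (intro divide_right_mono) auto
  finally show "prob {\<omega> \<in> space M. c < f \<omega>} \<le> e / c" .
qed

section \<open>Probability of the good event\<close>

context sparse_moments
begin

text \<open>Divided by sqrt K it bounds the expected sum of squares of all bilinear forms and
  centred Gram entries of order up to \<open>d\<close>. The extra term for \<open>k = l\<close> is
  the cost of centring.\<close>

definition fluctuation_const :: "real \<Rightarrow> nat \<Rightarrow> real" where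
  "fluctuation_const C d = (\<Sum>k\<in>{1..d}. 2 * walk_const (2 * (k + 1)) (2 * k) 4 C) +
    (\<Sum>k\<in>{1..d}. \<Sum>l\<in>{1..d}. walk_const (2 * (k + l + 2)) (2 * (k + l)) 4 C +
      (if k = l then 2 * C\<^sup>2 * (C\<^sup>2 * real ((k + 1)\<^sup>2) + walk_const (2 * k + 2) (2 * k) 2 C) else 0))"

abbreviation "bil w u k \<omega> \<equiv> mat_bilinear n (\<lambda>e. x e \<omega>) w u k"

abbreviation "gram u k l \<omega> \<equiv>
  (\<Sum>i<n. cnj (iter u l \<omega> i) * iter u k \<omega> i) - (if k = l then complex_of_real ((l2norm n u)\<^sup>2) else 0)"

text \<open>Markov's inequality for four nonnegative sums. The bounds for the determinant and
  adjugate sums are convergent series free of n, and the one for the traces is free of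
  \<open>m1\<close>. The last sum collects squares, hence the threshold \<theta>^2, and its bound is
  the only one that becomes small with K.\<close>

lemma good_event:
  fixes u v :: "nat \<Rightarrow> complex"
  assumes C: "1 \<le> C" "l2norm n u \<le> C" "l2norm n v \<le> C" and r: "0 < r" "r < 1" and R: "0 < R" "R < 1"
    and pos: "0 < M1" "0 < T" "0 < M3" "0 < \<theta>"
    and K_large: "\<And>k. 1 \<le> k \<Longrightarrow> k \<le> m1 \<Longrightarrow> walk_const (2 * k) (2 * k) 0 1 \<le> sqrt (real K)"
  shows "\<exists>G. G \<in> events \<and> prob (space M - G) \<le> (1 / (1 - R)) / M1 + (\<Sum>k. (2 * (real (Suc k))\<^sup>2 + 1) * R ^ Suc k) / T
      + (\<Sum>k. r ^ k * ((1 + real (k + 1) * C\<^sup>2) / 2)) / M3 + fluctuation_const C d / sqrt (real K) / \<theta>\<^sup>2 \<and>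
    (\<forall>\<omega>\<in>G. (\<Sum>k\<le>n. cmod (det_coeff n (\<lambda>e. x e \<omega>) k) * R ^ k) \<le> M1 \<and>
      (\<Sum>k<m1. cmod (mat_trace_power n (\<lambda>e. x e \<omega>) (Suc k)) * R ^ Suc k / real (Suc k)) \<le> T \<and>
      (\<Sum>j\<le>n. r ^ j * l2norm n (adj_coeff n (\<lambda>e. x e \<omega>) u j)) \<le> M3 \<and>
      (\<forall>k\<in>{1..d}. cmod (bil v u k \<omega>) \<le> \<theta> \<and> cmod (bil u u k \<omega>) \<le> \<theta>) \<and>
      (\<forall>k\<in>{1..d}. \<forall>l\<in>{1..d}. cmod (gram u k l \<omega>) \<le> \<theta>))"
proof -
  have uS: "(\<Sum>i<n. (cmod (u i))\<^sup>2) \<le> C\<^sup>2" "(\<Sum>i<n. (cmod (v i))\<^sup>2) \<le> C\<^sup>2"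
    unfolding l2norm_sq[symmetric] using C by (auto intro!: power_mono l2norm_nonneg)
  define F1 where "F1 \<omega> = (\<Sum>k\<le>n. cmod (det_coeff n (\<lambda>e. x e \<omega>) k) * R ^ k)" for \<omega>
  define F2 where "F2 \<omega> = (\<Sum>k<m1. cmod (mat_trace_power n (\<lambda>e. x e \<omega>) (Suc k)) * R ^ Suc k / real (Suc k))" for \<omega>
  define F3 where "F3 \<omega> = (\<Sum>j\<le>n. r ^ j * l2norm n (adj_coeff n (\<lambda>e. x e \<omega>) u j))" for \<omega>
  define F4 where "F4 \<omega> = (\<Sum>k\<in>{1..d}. (cmod (bil v u k \<omega>))\<^sup>2 + (cmod (bil u u k \<omega>))\<^sup>2) +
    (\<Sum>k\<in>{1..d}. \<Sum>l\<in>{1..d}. (cmod (gram u k l \<omega>))\<^sup>2)" for \<omega>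
  have F1: "integrable M F1" "expectation F1 \<le> 1 / (1 - R)"
  proof -
    note sq = square_integrable_norm[OF det_coeff_second_moment(1) norm_ge_zero]
    have one: "expectation (\<lambda>\<omega>. cmod (det_coeff n (\<lambda>e. x e \<omega>) k)) \<le> 1" for k
      using sq(2)[OF det_coeff_second_moment(2)] by simp
    show "integrable M F1" unfolding F1_def by (intro Bochner_Integration.integrable_sum integrable_mult_left sq(1))
    have "expectation F1 = (\<Sum>k\<le>n. expectation (\<lambda>\<omega>. cmod (det_coeff n (\<lambda>e. x e \<omega>) k)) * R ^ k)"
      unfolding F1_def by (subst Bochner_Integration.integral_sum) (auto intro!: sum.cong integrable_mult_left sq(1))
    also have "\<dots> \<le> (\<Sum>k\<le>n. 1 * R ^ k)" using R by (intro sum_mono mult_right_mono one) auto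
    also have "\<dots> \<le> (\<Sum>k. R ^ k)" using R by (simp only: mult_1_left) (intro sum_le_suminf summable_geometric, auto)
    also have "\<dots> = 1 / (1 - R)" using R by (intro suminf_geometric) auto
    finally show "expectation F1 \<le> 1 / (1 - R)" .
  qed
  have F2: "integrable M F2" "expectation F2 \<le> (\<Sum>k. (2 * (real (Suc k))\<^sup>2 + 1) * R ^ Suc k)"
  proof -
    let ?t = "\<lambda>k \<omega>. cmod (mat_trace_power n (\<lambda>e. x e \<omega>) (Suc k))"
    have sq: "integrable M (?t k)" "expectation (\<lambda>\<omega>. (?t k \<omega>)\<^sup>2) \<le> c \<Longrightarrow> expectation (?t k) \<le> (1 + c) / 2" for k c
      by (rule square_integrable_norm[OF trace_second_moment(1) norm_ge_zero]; simp)+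
    have one: "expectation (?t k) \<le> 2 * (real (Suc k))\<^sup>2 + 1" if "k < m1" for k
    proof -
      \<comment> \<open>\<open>K_large\<close> bounds the share of the non-leading closed walks by
        1, so that the polynomial count of the leading ones decides.\<close>
      have "walk_const (2 * Suc k) (2 * Suc k) 0 1 / sqrt (real K) \<le> 1"
        using K_large[of "Suc k"] that K by (subst divide_le_eq_1_pos) auto
      moreover have "expectation (?t k) \<le> (1 + (real ((2 * Suc k)\<^sup>2) + walk_const (2 * Suc k) (2 * Suc k) 0 1 / sqrt (real K))) / 2"
        by (rule sq(2)[OF trace_second_moment(2)]) simp
      ultimately have "expectation (?t k) \<le> (1 + (real ((2 * Suc k)\<^sup>2) + 1)) / 2"
        by (meson add_left_mono divide_right_mono order_trans zero_le_numeral)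
      also have "\<dots> = 2 * (real (Suc k))\<^sup>2 + 1" by (simp only: of_nat_power of_nat_mult power_mult_distrib) simp
      finally show ?thesis .
    qed
    show "integrable M F2" unfolding F2_def
      by (intro Bochner_Integration.integrable_sum integrable_divide_zero integrable_mult_left sq(1))
    have sm: "summable (\<lambda>k. (2 * (real (Suc k))\<^sup>2 + 1) * R ^ Suc k)"
    proof (rule summable_comparison_test_bigo[where g="\<lambda>k. ((R + 1) / 2) ^ k"])
      show "summable (\<lambda>k. norm (((R + 1) / 2) ^ k))" using R by simp
      show "(\<lambda>k. (2 * (real (Suc k))\<^sup>2 + 1) * R ^ Suc k) \<in> O(\<lambda>k. ((R + 1) / 2) ^ k)"
        using R by real_asymp
    qed
    have "expectation F2 = (\<Sum>k<m1. expectation (?t k) * R ^ Suc k / real (Suc k))"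
      unfolding F2_def by (subst Bochner_Integration.integral_sum) (auto intro!: sum.cong sq(1))
    also have "\<dots> \<le> (\<Sum>k<m1. (2 * (real (Suc k))\<^sup>2 + 1) * R ^ Suc k)"
    proof (rule sum_mono)
      fix k assume k: "k \<in> {..<m1}"
      have "expectation (?t k) * R ^ Suc k / real (Suc k) \<le> expectation (?t k) * R ^ Suc k / 1"
        using R by (intro divide_left_mono mult_nonneg_nonneg integral_nonneg_AE) auto
      also have "\<dots> \<le> (2 * (real (Suc k))\<^sup>2 + 1) * R ^ Suc k"
        using R k one[of k] by (simp only: div_by_1) (intro mult_right_mono, auto)
      finally show "expectation (?t k) * R ^ Suc k / real (Suc k) \<le> (2 * (real (Suc k))\<^sup>2 + 1) * R ^ Suc k" .
    qed
    also have "\<dots> \<le> (\<Sum>k. (2 * (real (Suc k))\<^sup>2 + 1) * R ^ Suc k)"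
      using R by (intro sum_le_suminf sm) auto
    finally show "expectation F2 \<le> (\<Sum>k. (2 * (real (Suc k))\<^sup>2 + 1) * R ^ Suc k)" .
  qed
  have F3: "integrable M F3" "expectation F3 \<le> (\<Sum>k. r ^ k * ((1 + real (k + 1) * C\<^sup>2) / 2))"
  proof -
    let ?w = "\<lambda>k \<omega>. l2norm n (adj_coeff n (\<lambda>e. x e \<omega>) u k)"
    have int2: "integrable M (\<lambda>\<omega>. (?w k \<omega>)\<^sup>2)" for k
      unfolding l2norm_sq by (intro Bochner_Integration.integrable_sum adj_coeff_second_moment(1)) simp
    note sq = square_integrable_norm[OF int2 l2norm_nonneg]
    have one: "expectation (?w k) \<le> (1 + real (k + 1) * C\<^sup>2) / 2" for k
    proof -
      have "expectation (\<lambda>\<omega>. (?w k \<omega>)\<^sup>2) = (\<Sum>i<n. expectation (\<lambda>\<omega>. (cmod (adj_coeff n (\<lambda>e. x e \<omega>) u k i))\<^sup>2))"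
        unfolding l2norm_sq by (intro Bochner_Integration.integral_sum adj_coeff_second_moment(1)) simp
      also have "\<dots> \<le> real (k + 1) * (\<Sum>i<n. (cmod (u i))\<^sup>2)" by (rule adj_coeff_second_moment(2))
      also have "\<dots> \<le> real (k + 1) * C\<^sup>2" using uS by (intro mult_left_mono) auto
      finally show ?thesis by (rule sq(2))
    qed
    show "integrable M F3" unfolding F3_def by (intro Bochner_Integration.integrable_sum integrable_mult_right sq(1))
    have sm: "summable (\<lambda>k. r ^ k * ((1 + real (k + 1) * C\<^sup>2) / 2))"
    proof (rule summable_comparison_test_bigo[where g="\<lambda>k. ((r + 1) / 2) ^ k"])
      show "summable (\<lambda>k. norm (((r + 1) / 2) ^ k))" using r by simp
      have "(\<lambda>k. r ^ k * (real k + 2)) \<in> O(\<lambda>k. ((r + 1) / 2) ^ k)" using r by real_asymp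
      moreover have "(\<lambda>k. r ^ k * ((1 + real (k + 1) * C\<^sup>2) / 2)) \<in> O(\<lambda>k. r ^ k * (real k + 2))"
      proof (rule bigoI[of _ "1 + C\<^sup>2"], intro always_eventually allI)
        fix k
        have "(1 + real (k + 1) * C\<^sup>2) / 2 \<le> (1 + C\<^sup>2) * (real k + 2)" by (simp add: field_simps)
        then have "r ^ k * ((1 + real (k + 1) * C\<^sup>2) / 2) \<le> r ^ k * ((1 + C\<^sup>2) * (real k + 2))"
          using r by (intro mult_left_mono) auto
        then show "norm (r ^ k * ((1 + real (k + 1) * C\<^sup>2) / 2)) \<le> (1 + C\<^sup>2) * norm (r ^ k * (real k + 2))"
          using r by (simp add: abs_mult mult_ac)
      qed
      ultimately show "(\<lambda>k. r ^ k * ((1 + real (k + 1) * C\<^sup>2) / 2)) \<in> O(\<lambda>k. ((r + 1) / 2) ^ k)"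
        by (rule landau_o.big_trans[rotated])
    qed
    have "expectation F3 = (\<Sum>k\<le>n. r ^ k * expectation (?w k))"
      unfolding F3_def by (subst Bochner_Integration.integral_sum) (auto intro!: sum.cong integrable_mult_right sq(1))
    also have "\<dots> \<le> (\<Sum>k\<le>n. r ^ k * ((1 + real (k + 1) * C\<^sup>2) / 2))" using r by (intro sum_mono mult_left_mono one) auto
    also have "\<dots> \<le> (\<Sum>k. r ^ k * ((1 + real (k + 1) * C\<^sup>2) / 2))" using r by (intro sum_le_suminf sm) auto
    finally show "expectation F3 \<le> (\<Sum>k. r ^ k * ((1 + real (k + 1) * C\<^sup>2) / 2))" .
  qed
  have F4: "integrable M F4" "expectation F4 \<le> fluctuation_const C d / sqrt (real K)"
  proof -
    have b: "integrable M (\<lambda>\<omega>. (cmod (bil w u k \<omega>))\<^sup>2)"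
      "expectation (\<lambda>\<omega>. (cmod (bil w u k \<omega>))\<^sup>2) \<le> walk_const (2 * (k + 1)) (2 * k) 4 C / sqrt (real K)"
      if "k \<in> {1..d}" "(\<Sum>i<n. (cmod (w i))\<^sup>2) \<le> C\<^sup>2" for k w
      unfolding mat_bilinear_def using bilinear_second_moment[of k C u w] that C(1) uS(1) by auto
    have g: "integrable M (\<lambda>\<omega>. (cmod (gram u k l \<omega>))\<^sup>2)"
      "expectation (\<lambda>\<omega>. (cmod (gram u k l \<omega>))\<^sup>2) \<le> (walk_const (2 * (k + l + 2)) (2 * (k + l)) 4 C +
        (if k = l then 2 * C\<^sup>2 * (C\<^sup>2 * real ((k + 1)\<^sup>2) + walk_const (2 * k + 2) (2 * k) 2 C) else 0)) / sqrt (real K)"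
      if "k \<in> {1..d}" "l \<in> {1..d}" for k l
    proof (atomize (full), cases "k = l")
      case True
      then show "integrable M (\<lambda>\<omega>. (cmod (gram u k l \<omega>))\<^sup>2) \<and>
        expectation (\<lambda>\<omega>. (cmod (gram u k l \<omega>))\<^sup>2) \<le> (walk_const (2 * (k + l + 2)) (2 * (k + l)) 4 C +
        (if k = l then 2 * C\<^sup>2 * (C\<^sup>2 * real ((k + 1)\<^sup>2) + walk_const (2 * k + 2) (2 * k) 2 C) else 0)) / sqrt (real K)"
        using norm_sq_variance[of k C u] that C(1) uS(1) unfolding l2norm_sq by simp
    next
      case False
      then show "integrable M (\<lambda>\<omega>. (cmod (gram u k l \<omega>))\<^sup>2) \<and>
        expectation (\<lambda>\<omega>. (cmod (gram u k l \<omega>))\<^sup>2) \<le> (walk_const (2 * (k + l + 2)) (2 * (k + l)) 4 C +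
        (if k = l then 2 * C\<^sup>2 * (C\<^sup>2 * real ((k + 1)\<^sup>2) + walk_const (2 * k + 2) (2 * k) 2 C) else 0)) / sqrt (real K)"
        using inner_second_moment[of k l C u] that C(1) uS(1) by simp
    qed
    show "integrable M F4" unfolding F4_def
      by (intro Bochner_Integration.integrable_add Bochner_Integration.integrable_sum b g uS) auto
    have "expectation F4 = (\<Sum>k\<in>{1..d}. expectation (\<lambda>\<omega>. (cmod (bil v u k \<omega>))\<^sup>2) + expectation (\<lambda>\<omega>. (cmod (bil u u k \<omega>))\<^sup>2)) +
        (\<Sum>k\<in>{1..d}. \<Sum>l\<in>{1..d}. expectation (\<lambda>\<omega>. (cmod (gram u k l \<omega>))\<^sup>2))"
    proof -
      have "expectation F4 = expectation (\<lambda>\<omega>. \<Sum>k\<in>{1..d}. (cmod (bil v u k \<omega>))\<^sup>2 + (cmod (bil u u k \<omega>))\<^sup>2) +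
          expectation (\<lambda>\<omega>. \<Sum>k\<in>{1..d}. \<Sum>l\<in>{1..d}. (cmod (gram u k l \<omega>))\<^sup>2)"
        unfolding F4_def by (intro Bochner_Integration.integral_add Bochner_Integration.integrable_add Bochner_Integration.integrable_sum b g uS) auto
      also have "expectation (\<lambda>\<omega>. \<Sum>k\<in>{1..d}. (cmod (bil v u k \<omega>))\<^sup>2 + (cmod (bil u u k \<omega>))\<^sup>2) =
          (\<Sum>k\<in>{1..d}. expectation (\<lambda>\<omega>. (cmod (bil v u k \<omega>))\<^sup>2 + (cmod (bil u u k \<omega>))\<^sup>2))"
        by (intro Bochner_Integration.integral_sum Bochner_Integration.integrable_add b uS)
      also have "\<dots> = (\<Sum>k\<in>{1..d}. expectation (\<lambda>\<omega>. (cmod (bil v u k \<omega>))\<^sup>2) + expectation (\<lambda>\<omega>. (cmod (bil u u k \<omega>))\<^sup>2))"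
        by (intro sum.cong refl Bochner_Integration.integral_add b uS)
      also have "expectation (\<lambda>\<omega>. \<Sum>k\<in>{1..d}. \<Sum>l\<in>{1..d}. (cmod (gram u k l \<omega>))\<^sup>2) =
          (\<Sum>k\<in>{1..d}. expectation (\<lambda>\<omega>. \<Sum>l\<in>{1..d}. (cmod (gram u k l \<omega>))\<^sup>2))"
        by (intro Bochner_Integration.integral_sum Bochner_Integration.integrable_sum g)
      also have "\<dots> = (\<Sum>k\<in>{1..d}. \<Sum>l\<in>{1..d}. expectation (\<lambda>\<omega>. (cmod (gram u k l \<omega>))\<^sup>2))"
        by (intro sum.cong refl Bochner_Integration.integral_sum g)
      finally show ?thesis .
    qed
    also have "\<dots> \<le> (\<Sum>k\<in>{1..d}. walk_const (2 * (k + 1)) (2 * k) 4 C / sqrt (real K) + walk_const (2 * (k + 1)) (2 * k) 4 C / sqrt (real K)) +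
        (\<Sum>k\<in>{1..d}. \<Sum>l\<in>{1..d}. (walk_const (2 * (k + l + 2)) (2 * (k + l)) 4 C +
        (if k = l then 2 * C\<^sup>2 * (C\<^sup>2 * real ((k + 1)\<^sup>2) + walk_const (2 * k + 2) (2 * k) 2 C) else 0)) / sqrt (real K))"
      by (intro add_mono sum_mono b g uS)
    also have "\<dots> = fluctuation_const C d / sqrt (real K)"
      unfolding fluctuation_const_def add_divide_distrib[of "sum _ _"] sum_divide_distrib mult_2 add_divide_distrib[of "walk_const _ _ _ _" "walk_const _ _ _ _"] ..
    finally show "expectation F4 \<le> fluctuation_const C d / sqrt (real K)" .
  qed
  have n1: "0 \<le> F1 \<omega>" for \<omega> unfolding F1_def using R by (intro sum_nonneg) auto
  have n2: "0 \<le> F2 \<omega>" for \<omega> unfolding F2_def using R by (intro sum_nonneg) auto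
  have n3: "0 \<le> F3 \<omega>" for \<omega> unfolding F3_def using r by (intro sum_nonneg mult_nonneg_nonneg l2norm_nonneg) auto
  have n4: "0 \<le> F4 \<omega>" for \<omega> unfolding F4_def by (intro add_nonneg_nonneg sum_nonneg) auto
  have th2: "0 < \<theta>\<^sup>2" using pos by simp
  note E1 = markov_exceedance[OF F1(1) n1 F1(2) pos(1)]
  note E2 = markov_exceedance[OF F2(1) n2 F2(2) pos(2)]
  note E3 = markov_exceedance[OF F3(1) n3 F3(2) pos(3)]
  note E4 = markov_exceedance[OF F4(1) n4 F4(2) th2]
  let ?B1 = "{\<omega> \<in> space M. M1 < F1 \<omega>}" and ?B2 = "{\<omega> \<in> space M. T < F2 \<omega>}"
    and ?B3 = "{\<omega> \<in> space M. M3 < F3 \<omega>}" and ?B4 = "{\<omega> \<in> space M. \<theta>\<^sup>2 < F4 \<omega>}"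
  let ?G = "space M - (?B1 \<union> ?B2 \<union> (?B3 \<union> ?B4))"
  have "space M - ?G = ?B1 \<union> ?B2 \<union> (?B3 \<union> ?B4)" by auto
  then have "prob (space M - ?G) \<le> (prob ?B1 + prob ?B2) + (prob ?B3 + prob ?B4)"
    using measure_Un_le[OF sets.Un[OF E1(1) E2(1)] sets.Un[OF E3(1) E4(1)]] measure_Un_le[OF E1(1) E2(1)]
      measure_Un_le[OF E3(1) E4(1)] by simp
  then have pr: "prob (space M - ?G) \<le> (1 / (1 - R)) / M1 + (\<Sum>k. (2 * (real (Suc k))\<^sup>2 + 1) * R ^ Suc k) / T
      + (\<Sum>k. r ^ k * ((1 + real (k + 1) * C\<^sup>2) / 2)) / M3 + fluctuation_const C d / sqrt (real K) / \<theta>\<^sup>2"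
    using E1(2) E2(2) E3(2) E4(2) by linarith
  have G: "?G \<in> events" using E1(1) E2(1) E3(1) E4(1) by (intro sets.Diff sets.Un sets.top)
  have good: "(\<forall>k\<in>{1..d}. cmod (bil v u k \<omega>) \<le> \<theta> \<and> cmod (bil u u k \<omega>) \<le> \<theta>) \<and>
      (\<forall>k\<in>{1..d}. \<forall>l\<in>{1..d}. cmod (gram u k l \<omega>) \<le> \<theta>)" if F: "F4 \<omega> \<le> \<theta>\<^sup>2" for \<omega>
  proof (intro conjI ballI)
    let ?A = "\<Sum>k\<in>{1..d}. (cmod (bil v u k \<omega>))\<^sup>2 + (cmod (bil u u k \<omega>))\<^sup>2"
      and ?B = "\<Sum>k\<in>{1..d}. \<Sum>l\<in>{1..d}. (cmod (gram u k l \<omega>))\<^sup>2"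
    have AB: "0 \<le> ?A" "0 \<le> ?B" by (intro sum_nonneg add_nonneg_nonneg zero_le_power2)+
    fix k assume k: "k \<in> {1..d}"
    have "(cmod (bil v u k \<omega>))\<^sup>2 + (cmod (bil u u k \<omega>))\<^sup>2 \<le> ?A"
      by (rule member_le_sum[OF k]) auto
    then have "(cmod (bil v u k \<omega>))\<^sup>2 + (cmod (bil u u k \<omega>))\<^sup>2 \<le> \<theta>\<^sup>2" using F AB unfolding F4_def by linarith
    then have "(cmod (bil v u k \<omega>))\<^sup>2 \<le> \<theta>\<^sup>2" "(cmod (bil u u k \<omega>))\<^sup>2 \<le> \<theta>\<^sup>2"
      using zero_le_power2[of "cmod (bil v u k \<omega>)"] zero_le_power2[of "cmod (bil u u k \<omega>)"] by linarith+
    then show "cmod (bil v u k \<omega>) \<le> \<theta>" "cmod (bil u u k \<omega>) \<le> \<theta>" using pos(4) by (auto intro: power2_le_imp_le)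
    fix l assume l: "l \<in> {1..d}"
    have "(cmod (gram u k l \<omega>))\<^sup>2 \<le> (\<Sum>l\<in>{1..d}. (cmod (gram u k l \<omega>))\<^sup>2)" by (rule member_le_sum[OF l]) auto
    also have "\<dots> \<le> ?B" by (rule member_le_sum[OF k]) (auto intro: sum_nonneg)
    also have "\<dots> \<le> \<theta>\<^sup>2" using F AB unfolding F4_def by linarith
    finally show "cmod (gram u k l \<omega>) \<le> \<theta>" by (rule power2_le_imp_le[OF _ less_imp_le[OF pos(4)]])
  qed
  show ?thesis
  proof (intro exI[of _ ?G] conjI G pr ballI)
    fix \<omega> assume "\<omega> \<in> ?G"
    then have le: "F1 \<omega> \<le> M1" "F2 \<omega> \<le> T" "F3 \<omega> \<le> M3" "F4 \<omega> \<le> \<theta>\<^sup>2" by auto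
    show "(\<Sum>k\<le>n. cmod (det_coeff n (\<lambda>e. x e \<omega>) k) * R ^ k) \<le> M1" using le(1) unfolding F1_def .
    show "(\<Sum>k<m1. cmod (mat_trace_power n (\<lambda>e. x e \<omega>) (Suc k)) * R ^ Suc k / real (Suc k)) \<le> T" using le(2) unfolding F2_def .
    show "(\<Sum>j\<le>n. r ^ j * l2norm n (adj_coeff n (\<lambda>e. x e \<omega>) u j)) \<le> M3" using le(3) unfolding F3_def .
    fix k assume k: "k \<in> {1..d}"
    show "cmod (bil v u k \<omega>) \<le> \<theta>" by (rule conjunct1[OF bspec[OF conjunct1[OF good[OF le(4)]] k]])
    show "cmod (bil u u k \<omega>) \<le> \<theta>" by (rule conjunct2[OF bspec[OF conjunct1[OF good[OF le(4)]] k]])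
    fix l assume l: "l \<in> {1..d}"
    show "cmod (gram u k l \<omega>) \<le> \<theta>" by (rule bspec[OF bspec[OF conjunct2[OF good[OF le(4)]] k] l])
  qed
qed

lemma overlap_probability:
  fixes u v :: "nat \<Rightarrow> complex" and w :: "'a \<Rightarrow> complex Matrix.vec"
  assumes C: "1 \<le> C" "l2norm n u \<le> C" "l2norm n v \<le> C" and r: "0 < r0" "r0 < r" "r < R" "R < 1"
    and pos: "0 < M1" "0 < T" "0 < M3" "0 < \<theta>"
    and K_large: "\<And>k. 1 \<le> k \<Longrightarrow> k \<le> m1 \<Longrightarrow> walk_const (2 * k) (2 * k) 0 1 \<le> sqrt (real K)"
    and m1: "M1 * exp T * (r / R) ^ Suc m1 / (1 - r / R) \<le> 1 / 2"
    and L: "L = M3 / (exp (- T) / 2)"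
    and e1: "\<theta> * (\<Sum>k<d. real (k + 2)) + C * L * (\<Sum>k. real (k + d + 2) * (r0 / r) ^ (k + d + 1)) \<le> \<eta>"
    and e2: "\<theta> * (real (d + 1))\<^sup>2 + 3 * L\<^sup>2 * (r0 / r) ^ (d + 1) / (1 - r0 / r)\<^sup>2 + C\<^sup>2 * (r0\<^sup>2) ^ (d + 1) / (1 - r0\<^sup>2) \<le> \<eta>"
    and ell: "1 + \<eta> \<le> r0 * cmod (\<Sum>i<n. cnj (v i) * u i)"
    and s0: "0 < s0" "s0 \<le> (l2norm n u)\<^sup>2" and \<eta>: "\<eta> \<le> s0 / 2" "\<eta> \<le> 1"
    and eps: "1 + \<epsilon> = 1 / r0"
    and w: "\<And>\<omega>. \<omega> \<in> space M \<Longrightarrow> outlier_eigenvector \<epsilon> (Matrix.mat n n (\<lambda>(i, j). x (i, j) \<omega> + u i * cnj (v j))) (w \<omega>)"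
    and \<delta>: "(6 / s0 + 2 / s0\<^sup>2 + 2) * \<eta> \<le> \<delta>"
  shows "prob {\<omega> \<in> space M. \<delta> < \<bar>(cmod (herm_ip (w \<omega>) (complex_of_real (1 / l2norm n u) \<cdot>\<^sub>v Matrix.vec n u)))\<^sup>2
      - (1 - 1 / (cmod (\<Sum>i<n. cnj (v i) * u i))\<^sup>2)\<bar>}
    \<le> (1 / (1 - R)) / M1 + (\<Sum>k. (2 * (real (Suc k))\<^sup>2 + 1) * R ^ Suc k) / T
      + (\<Sum>k. r ^ k * ((1 + real (k + 1) * C\<^sup>2) / 2)) / M3 + fluctuation_const C d / sqrt (real K) / \<theta>\<^sup>2"
    (is "prob ?B \<le> ?bound")
proof -
  have r': "0 < r" "r < 1" "0 < R" using r by linarith+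
  obtain G where G': "G \<in> events \<and> prob (space M - G) \<le> ?bound \<and>
    (\<forall>\<omega>\<in>G. (\<Sum>k\<le>n. cmod (det_coeff n (\<lambda>e. x e \<omega>) k) * R ^ k) \<le> M1 \<and>
      (\<Sum>k<m1. cmod (mat_trace_power n (\<lambda>e. x e \<omega>) (Suc k)) * R ^ Suc k / real (Suc k)) \<le> T \<and>
      (\<Sum>j\<le>n. r ^ j * l2norm n (adj_coeff n (\<lambda>e. x e \<omega>) u j)) \<le> M3 \<and>
      (\<forall>k\<in>{1..d}. cmod (bil v u k \<omega>) \<le> \<theta> \<and> cmod (bil u u k \<omega>) \<le> \<theta>) \<and>
      (\<forall>k\<in>{1..d}. \<forall>l\<in>{1..d}. cmod (gram u k l \<omega>) \<le> \<theta>))"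
    using good_event[where ?m1.0=m1 and d=d, OF C r'(1,2,3) r(4) pos K_large] by (rule exE)
  note G = conjunct1[OF G'] conjunct1[OF conjunct2[OF G']]
  have b0: "bil v u 0 \<omega> = (\<Sum>i<n. cnj (v i) * u i)" for \<omega> by (simp add: mat_bilinear_def)
  have "?B \<subseteq> space M - G"
  proof
    fix \<omega> assume B: "\<omega> \<in> ?B"
    then have sp: "\<omega> \<in> space M" by simp
    have "\<omega> \<notin> G"
    proof
      assume g: "\<omega> \<in> G"
      note h = bspec[OF conjunct2[OF conjunct2[OF G']] g]
      note h2 = conjunct2[OF h] and h3 = conjunct2[OF conjunct2[OF h]]
      note h4 = conjunct2[OF h3]
      have bl: "cmod (bil v u k \<omega>) \<le> \<theta>" "cmod (bil u u k \<omega>) \<le> \<theta>" if "1 \<le> k" "k \<le> d" for k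
        using bspec[OF conjunct1[OF h4], of k] that by simp_all
      have ip: "cmod (gram u k l \<omega>) \<le> \<theta>" if "1 \<le> k" "k \<le> d" "1 \<le> l" "l \<le> d" for k l
        by (rule bspec[OF bspec[OF conjunct2[OF h4]]]) (use that in simp_all)
      have "\<bar>(cmod (herm_ip (w \<omega>) (complex_of_real (1 / l2norm n u) \<cdot>\<^sub>v Matrix.vec n u)))\<^sup>2
          - (1 - 1 / (cmod (bil v u 0 \<omega>))\<^sup>2)\<bar> \<le> (6 / s0 + 2 / s0\<^sup>2 + 2) * \<eta>"
      proof (rule overlap_deterministic[OF r(1,2,3) _ C(2,3) conjunct1[OF h] conjunct1[OF h2] m1 conjunct1[OF h3] L bl ip _ e1 e2 _ s0 \<eta> eps w[OF sp]])
        show "R \<le> 1" "0 \<le> \<theta>" using r pos by auto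
        show "1 + \<eta> \<le> r0 * cmod (bil v u 0 \<omega>)" unfolding b0 by (rule ell)
      qed
      then show False using B \<delta> unfolding b0 by simp
    qed
    then show "\<omega> \<in> space M - G" using sp by simp
  qed
  then have "prob ?B \<le> prob (space M - G)" using G(1) by (intro finite_measure_mono) auto
  then show ?thesis using G(2) by linarith
qed

end

lemma truncation_level:
  fixes \<rho> t A B D \<eta> :: real
  assumes \<rho>: "0 \<le> \<rho>" "\<rho> < 1" and t: "0 \<le> t" "t < 1" and \<eta>: "0 < \<eta>" and AB: "0 \<le> A"
  shows "\<exists>d. A * (\<Sum>k. real (k + d + 2) * \<rho> ^ (k + d + 1)) \<le> \<eta> \<and> B * \<rho> ^ (d + 1) + D * t ^ (d + 1) \<le> \<eta>"
proof -
  let ?g = "\<lambda>k. real (k + 2) * \<rho> ^ (k + 1)"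
  have g: "summable ?g" by (rule summable_linear_geometric[OF \<rho>])
  have "0 < \<eta> / (A + 1)" using \<eta> AB by simp
  then obtain N where N: "\<And>d. N \<le> d \<Longrightarrow> norm (\<Sum>k. ?g (k + d)) < \<eta> / (A + 1)"
    using suminf_exist_split[OF _ g] by blast
  have "(\<lambda>d. B * \<rho> ^ (d + 1) + D * t ^ (d + 1)) \<longlonglongrightarrow> B * 0 + D * 0"
    using \<rho> t by (intro tendsto_intros LIMSEQ_ignore_initial_segment LIMSEQ_power_zero) auto
  then have "\<forall>\<^sub>F d in sequentially. B * \<rho> ^ (d + 1) + D * t ^ (d + 1) < \<eta>"
    using \<eta> by (intro order_tendstoD(2)[of _ 0]) simp_all
  then obtain N' where N': "\<And>d. N' \<le> d \<Longrightarrow> B * \<rho> ^ (d + 1) + D * t ^ (d + 1) < \<eta>"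
    unfolding eventually_sequentially by blast
  let ?d = "max N N'"
  have "A * (\<Sum>k. ?g (k + ?d)) \<le> A * (\<eta> / (A + 1))"
    using N[of ?d] AB by (intro mult_left_mono) auto
  also have "\<dots> \<le> \<eta>" using AB \<eta> by (simp add: field_simps)
  finally have "A * (\<Sum>k. real (k + ?d + 2) * \<rho> ^ (k + ?d + 1)) \<le> \<eta>" .
  moreover have "B * \<rho> ^ (?d + 1) + D * t ^ (?d + 1) \<le> \<eta>" using N'[of ?d] by simp
  ultimately show ?thesis by blast
qed

lemma eucl_norm_l2norm: "u \<in> carrier_vec n \<Longrightarrow> eucl_norm u = l2norm n (Matrix.vec_index u)"
  by (simp add: eucl_norm_def l2norm_def L2_set_def)

theorem theorem1p6:
  fixes N :: "'c measure" and chi :: "'c \<Rightarrow> complex"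
    and M :: "nat \<Rightarrow> 'a measure"
    and A :: "nat \<Rightarrow> nat \<Rightarrow> nat \<Rightarrow> 'a \<Rightarrow> complex"
    and B :: "nat \<Rightarrow> nat \<Rightarrow> nat \<Rightarrow> 'a \<Rightarrow> complex"
    and K :: "nat \<Rightarrow> nat"
    and u v :: "nat \<Rightarrow> complex Matrix.vec"
    and X Y :: "nat \<Rightarrow> 'a \<Rightarrow> complex mat"
    and u' :: "nat \<Rightarrow> 'a \<Rightarrow> complex Matrix.vec"
    and C C' \<epsilon> :: real
  assumes N: "prob_space N"
    and chi: "chi \<in> borel_measurable N"
    and chi_mean: "integrable N chi" "integral\<^sup>L N chi = 0"
    and chi_var: "integrable N (\<lambda>x. (cmod (chi x))\<^sup>2)" "integral\<^sup>L N (\<lambda>x. (cmod (chi x))\<^sup>2) = 1"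
    and M: "\<And>n. n \<ge> 1 \<Longrightarrow> prob_space (M n)"
    and A_iid: "\<And>n. n \<ge> 1 \<Longrightarrow> iid_entries (M n) n (A n) (distr N borel chi)"
    and K: "\<And>n. n \<ge> 1 \<Longrightarrow> 1 \<le> K n \<and> K n \<le> n"
    and B_iid: "\<And>n. n \<ge> 1 \<Longrightarrow> iid_entries (M n) n (B n) (bernoulli_law (real (K n) / real n))"
    and AB_indep: "\<And>n. n \<ge> 1 \<Longrightarrow> indep_matrices (M n) n (A n) (B n)"
    and X: "\<And>n \<omega>. X n \<omega> = sparse_mat n (K n) (\<lambda>i j. B n i j \<omega>) (\<lambda>i j. A n i j \<omega>)"
    and uv: "\<And>n. n \<ge> 1 \<Longrightarrow> u n \<in> carrier_vec n \<and> v n \<in> carrier_vec n"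
    and Y: "\<And>n \<omega>. Y n \<omega> = X n \<omega> + rank_one_mat n (u n) (v n)"
    and K_lim: "filterlim K at_top sequentially"
      "(\<lambda>n. ln (real n) ^ 9 / real (K n)) \<longlonglongrightarrow> 0"
    and C: "C > 0" "\<And>n. n \<ge> 1 \<Longrightarrow> eucl_norm (u n) + eucl_norm (v n) \<le> C"
    and liminf_gt: "liminf (\<lambda>n. ereal (cmod (herm_ip (v n) (u n)))) > 1"
    and C': "C' > 0" "\<And>n t. n \<ge> 1 \<Longrightarrow> t \<ge> 0 \<Longrightarrow>
        measure (M n) {\<omega> \<in> space (M n). cmod (A n 0 0 \<omega>) \<ge> t} \<le> 2 * exp (- C' * t\<^sup>2)"
    and eps: "\<epsilon> > 0"
      "ereal \<epsilon> < (liminf (\<lambda>n. ereal (cmod (herm_ip (v n) (u n)))) - 1) / 2"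
    and u': "\<And>n \<omega>. n \<ge> 1 \<Longrightarrow> \<omega> \<in> space (M n) \<Longrightarrow> outlier_eigenvector \<epsilon> (Y n \<omega>) (u' n \<omega>)"
  shows "tendsto_in_probability M
    (\<lambda>n \<omega>. (cmod (herm_ip (u' n \<omega>) (complex_of_real (1 / eucl_norm (u n)) \<cdot>\<^sub>v u n)))\<^sup>2
            - (1 - 1 / (cmod (herm_ip (u n) (v n)))\<^sup>2)) 0"
proof -
  define x where "x n = (\<lambda>(i, j) \<omega>. of_real (1 / sqrt (real (K n))) * B n i j \<omega> * A n i j \<omega>)" for n
  define us where "us n = Matrix.vec_index (u n)" for n
  define vs where "vs n = Matrix.vec_index (v n)" for n
  have Y': "Y n \<omega> = Matrix.mat n n (\<lambda>(i, j). x n (i, j) \<omega> + us n i * cnj (vs n j))" for n \<omega>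
    unfolding Y X sparse_mat_def rank_one_mat_def x_def us_def vs_def by (rule eq_matI) auto

  have moments: "integrable N (\<lambda>\<omega>. cmod (chi \<omega>) ^ k)" for k
  proof (rule prob_space.subgaussian_moment[OF N chi C'(1)])
    fix t :: real assume t: "0 \<le> t"
    \<comment> \<open>The tail bound is stated for entries of the matrices; these have the law of
      \<open>chi\<close>, so the case n = 1 transfers it.\<close>
    have "distr (M 1) borel (A 1 0 0) = distr N borel chi" and "A 1 0 0 \<in> borel_measurable (M 1)"
      using A_iid[of 1] M[of 1] by (auto simp: iid_entries_def prob_space.indep_vars_def)
    moreover have "{z :: complex. t \<le> cmod z} \<in> sets borel" by (intro borel_closed closed_Collect_le continuous_intros)
    ultimately have "measure N {\<omega> \<in> space N. t \<le> cmod (chi \<omega>)} = measure (M 1) {\<omega> \<in> space (M 1). t \<le> cmod (A 1 0 0 \<omega>)}"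
      using chi measure_distr[of chi N borel "{z. t \<le> cmod z}"] measure_distr[of "A 1 0 0" "M 1" borel "{z. t \<le> cmod z}"]
      by (simp add: vimage_def Int_def conj_commute)
    then show "measure N {\<omega> \<in> space N. t \<le> cmod (chi \<omega>)} \<le> 2 * exp (- C' * t\<^sup>2)"
      using C'(2)[of 1 t] t by simp
  qed
  have sm: "sparse_moments (M n) n (K n) (x n) (sparse_moment N chi n (K n)) (abs_moment N chi)" if "1 \<le> n" for n
    unfolding x_def
    by (rule sparse_moments_instance[OF N chi chi_mean(2) chi_var(2) moments M[OF that] conjunct1[OF K[OF that]] conjunct2[OF K[OF that]]
        A_iid[OF that] B_iid[OF that] AB_indep[OF that]])

  let ?Z = "\<lambda>n \<omega>. (cmod (herm_ip (u' n \<omega>) (complex_of_real (1 / eucl_norm (u n)) \<cdot>\<^sub>v u n)))\<^sup>2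
            - (1 - 1 / (cmod (herm_ip (u n) (v n)))\<^sup>2)"
  have measurable: "?Z n \<in> borel_measurable (M n)" if n: "1 \<le> n" for n
  proof -
    have "(\<lambda>\<omega>. (cmod (herm_ip (u' n \<omega>) (complex_of_real (1 / eucl_norm (u n)) \<cdot>\<^sub>v u n)))\<^sup>2) \<in> borel_measurable (M n)"
    proof (rule measurable_outlier_overlap[where Z="\<lambda>\<omega> (i, j). x n (i, j) \<omega> + us n i * cnj (vs n j)" and n=n and \<epsilon>=\<epsilon>])
      show "(\<lambda>\<omega>. case (i, j) of (i, j) \<Rightarrow> x n (i, j) \<omega> + us n i * cnj (vs n j)) \<in> borel_measurable (M n)" if "i < n" "j < n" for i j
        using sparse_moments.x_meas[OF sm[OF n], of "(i, j)"] that by simp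
      show "complex_of_real (1 / eucl_norm (u n)) \<cdot>\<^sub>v u n \<in> carrier_vec n" using uv[OF n] by simp
      show "outlier_eigenvector \<epsilon> (Matrix.mat n n (\<lambda>(i, j). x n (i, j) \<omega> + us n i * cnj (vs n j))) (u' n \<omega>)" if "\<omega> \<in> space (M n)" for \<omega>
        using u'[OF n that] unfolding Y' .
    qed
    then show ?thesis by (intro borel_measurable_diff borel_measurable_const)
  qed

  \<comment> \<open>The reciprocals of the numbers of modulus at least 1 + \<epsilon> fill the
    punctured disc of radius \<open>r0\<close>. The radii \<open>r\<close> and \<open>R\<close>
    divide the interval from \<open>r0\<close> to 1 evenly and leave room for the lower bound on the
    determinant and for the convergence of the resolvent.\<close>
  define r0 where "r0 = 1 / (1 + \<epsilon>)"
  define r where "r = (2 * r0 + 1) / 3"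
  define R where "R = (r0 + 2) / 3"
  have "0 < r0" "r0 < 1" using eps(1) by (auto simp: r0_def)
  then have r: "0 < r0" "r0 < r" "r < R" "R < 1" by (auto simp: r_def R_def)
  have eps0: "1 + \<epsilon> = 1 / r0" using eps(1) by (simp add: r0_def)
  define C1 where "C1 = max 1 C"
  have C1: "1 \<le> C1" "C \<le> C1" by (auto simp: C1_def)
  \<comment> \<open>Lower bound for \<parallel>u\<parallel>^2, as eventually 1 \<le> |\<langle>v,
    u\<rangle>| \<le> C1 \<parallel>u\<parallel>.\<close>
  define s0 where "s0 = 1 / C1\<^sup>2"
  have s0: "0 < s0" using C1 by (simp add: s0_def)
  define \<kappa> where "\<kappa> = 6 / s0 + 2 / s0\<^sup>2 + 2"
  have \<kappa>: "0 < \<kappa>" unfolding \<kappa>_def using s0 by (intro add_nonneg_pos add_nonneg_nonneg) auto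

  have "ereal (1 + 2 * \<epsilon>) < liminf (\<lambda>n. ereal (cmod (herm_ip (v n) (u n))))"
    using eps(2) liminf_gt by (cases "liminf (\<lambda>n. ereal (cmod (herm_ip (v n) (u n))))") (auto simp: one_ereal_def)
  then have "\<forall>\<^sub>F n in sequentially. ereal (1 + 2 * \<epsilon>) < ereal (cmod (herm_ip (v n) (u n)))"
    by (rule less_LiminfD)
  then have ell_ev: "\<forall>\<^sub>F n in sequentially. 1 + 2 * \<epsilon> < cmod (herm_ip (v n) (u n))" by simp
  have ip: "herm_ip (v n) (u n) = (\<Sum>i<n. cnj (vs n i) * us n i)"
    "cmod (herm_ip (u n) (v n)) = cmod (\<Sum>i<n. cnj (vs n i) * us n i)" if "1 \<le> n" for n
  proof -
    have c: "u n \<in> carrier_vec n" "v n \<in> carrier_vec n" using uv[OF that] by auto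
    show "herm_ip (v n) (u n) = (\<Sum>i<n. cnj (vs n i) * us n i)"
      unfolding herm_ip_sum[OF c] us_def vs_def ..
    have cnj: "herm_ip (u n) (v n) = cnj (\<Sum>i<n. cnj (vs n i) * us n i)"
      unfolding herm_ip_sum[OF c(2,1)] us_def vs_def by (simp add: mult.commute)
    show "cmod (herm_ip (u n) (v n)) = cmod (\<Sum>i<n. cnj (vs n i) * us n i)" unfolding cnj by (rule complex_mod_cnj)
  qed
  have norms: "l2norm n (us n) \<le> C1" "l2norm n (vs n) \<le> C1" "eucl_norm (u n) = l2norm n (us n)" if "1 \<le> n" for n
    using C(2)[OF that] uv[OF that] C1(2) l2norm_nonneg[of n "us n"] l2norm_nonneg[of n "vs n"]
    unfolding us_def vs_def by (auto simp: eucl_norm_l2norm[of _ n])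
  have u_vec: "Matrix.vec n (us n) = u n" if "1 \<le> n" for n
    using uv[OF that] by (auto simp: us_def intro!: eq_vecI)
  have sqrtK: "filterlim (\<lambda>n. sqrt (real (K n))) at_top sequentially"
    by (intro filterlim_compose[OF sqrt_at_top] filterlim_compose[OF filterlim_real_sequentially] K_lim(1))

  have "(\<lambda>n. measure (M n) {\<omega> \<in> space (M n). dist (?Z n \<omega>) 0 > \<delta>}) \<longlonglongrightarrow> 0" if \<delta>: "0 < \<delta>" for \<delta>
  proof (rule order_tendstoI)
    fix a :: real assume "a < 0"
    then show "\<forall>\<^sub>F n in sequentially. a < measure (M n) {\<omega> \<in> space (M n). dist (?Z n \<omega>) 0 > \<delta>}"
      by (intro always_eventually allI) (meson less_le_trans measure_nonneg)
  next
    fix a :: real assume a: "0 < a"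
    \<comment> \<open>Four error probabilities of at most a / 5 each stay below a.\<close>
    define p where "p = a / 5"
    have p: "0 < p" using a by (simp add: p_def)
    \<comment> \<open>The bounds 1 and s0 / 2 come from the overlap estimate, \<epsilon> / (1 +
      \<epsilon>) = r0 (1 + 2 \<epsilon>) - 1 is the slack in the fixed point argument, and \<delta>
      / \<kappa> makes the final deviation at most \<delta>.\<close>
    define \<eta> where "\<eta> = min (min 1 (s0 / 2)) (min (\<epsilon> / (1 + \<epsilon>)) (\<delta> / \<kappa>))"
    have \<eta>: "0 < \<eta>" "\<eta> \<le> 1" "\<eta> \<le> s0 / 2" "\<eta> \<le> \<epsilon> / (1 + \<epsilon>)" "\<eta> \<le> \<delta> / \<kappa>"
    proof -
      show "0 < \<eta>" unfolding \<eta>_def using s0 eps(1) \<delta> \<kappa> by simp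
    qed (unfold \<eta>_def, linarith+)
    have \<eta>\<delta>: "(6 / s0 + 2 / s0\<^sup>2 + 2) * \<eta> \<le> \<delta>"
      using \<eta>(5) \<kappa> unfolding \<kappa>_def[symmetric] by (simp add: field_simps)
    \<comment> \<open>Expectations divided by the allowed probability; the absolute values and the
      added 1 below give positive thresholds without inspecting the series. The later choices depend
      on these: \<open>m1\<close> on \<open>M1\<close> and \<open>T\<close>, \<open>d\<close> on
      \<open>L\<close>, \<theta> on \<open>d\<close>, and n comes last.\<close>
    define M1 where "M1 = 1 / (1 - R) / p"
    define TE where "TE = (\<Sum>k. (2 * (real (Suc k))\<^sup>2 + 1) * R ^ Suc k)"
    define T where "T = (\<bar>TE\<bar> + 1) / p"
    define ME where "ME = (\<Sum>k. r ^ k * ((1 + real (k + 1) * C1\<^sup>2) / 2))"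
    define M3 where "M3 = (\<bar>ME\<bar> + 1) / p"
    have pos: "0 < M1" "0 < T" "0 < M3" using r p by (auto simp: M1_def T_def M3_def)
    have probs: "1 / (1 - R) / M1 \<le> p" "TE / T \<le> p" "ME / M3 \<le> p"
    proof -
      show "1 / (1 - R) / M1 \<le> p" using r p by (simp add: M1_def)
      have quot: "y / ((\<bar>y\<bar> + 1) / p) \<le> p" for y :: real
      proof -
        have "y / ((\<bar>y\<bar> + 1) / p) = p * (y / (\<bar>y\<bar> + 1))" by simp
        also have "\<dots> \<le> p * 1" using p by (intro mult_left_mono) (auto simp: divide_le_eq_1)
        finally show ?thesis by simp
      qed
      show "TE / T \<le> p" "ME / M3 \<le> p" unfolding T_def M3_def by (rule quot)+
    qed
    have "(\<lambda>k. M1 * exp T * (r / R) ^ Suc k / (1 - r / R)) \<longlonglongrightarrow> M1 * exp T * 0 / (1 - r / R)"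
      using r by (intro tendsto_intros LIMSEQ_Suc LIMSEQ_power_zero) auto
    then have "\<forall>\<^sub>F k in sequentially. M1 * exp T * (r / R) ^ Suc k / (1 - r / R) < 1 / 2"
      by (intro order_tendstoD(2)[of _ 0]) simp_all
    then obtain m1 where m1: "M1 * exp T * (r / R) ^ Suc m1 / (1 - r / R) \<le> 1 / 2"
      unfolding eventually_sequentially by (meson less_imp_le order_refl)
    define L where "L = M3 / (exp (- T) / 2)"
    have L: "0 < L" using pos by (simp add: L_def)
    obtain d where d: "C1 * L * (\<Sum>k. real (k + d + 2) * (r0 / r) ^ (k + d + 1)) \<le> \<eta> / 2"
      "3 * L\<^sup>2 / (1 - r0 / r)\<^sup>2 * (r0 / r) ^ (d + 1) + C1\<^sup>2 / (1 - r0\<^sup>2) * (r0\<^sup>2) ^ (d + 1) \<le> \<eta> / 2"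
    proof -
      have "r0\<^sup>2 < 1" using r by (simp add: abs_square_less_1)
      then show ?thesis using truncation_level[of "r0 / r" "r0\<^sup>2" "\<eta> / 2" "C1 * L" "3 * L\<^sup>2 / (1 - r0 / r)\<^sup>2" "C1\<^sup>2 / (1 - r0\<^sup>2)"]
        that r \<eta>(1) C1 L by auto
    qed
    \<comment> \<open>\<open>W\<close> exceeds both quantities that get multiplied by \<theta>, so
      one choice of \<theta> makes each product at most \<eta> / 2; the other half is covered by
      \<open>d\<close>.\<close>
    define W where "W = 1 + (\<Sum>k<d. real (k + 2)) + (real (d + 1))\<^sup>2"
    have W: "0 \<le> (\<Sum>k<d. real (k + 2))" "0 \<le> (real (d + 1))\<^sup>2" by (intro sum_nonneg of_nat_0_le_iff zero_le_power2)+
    then have W0: "0 < W" unfolding W_def by linarith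
    define \<theta> where "\<theta> = \<eta> / 2 / W"
    have \<theta>: "0 < \<theta>" using \<eta>(1) W0 by (simp add: \<theta>_def)
    have \<theta>W: "\<theta> * y \<le> \<eta> / 2" if "y \<le> W" for y
    proof -
      have "\<theta> * y \<le> \<theta> * W" using that \<theta> by (intro mult_left_mono) auto
      also have "\<dots> = \<eta> / 2" using W0 by (simp add: \<theta>_def)
      finally show ?thesis .
    qed
    have e1: "\<theta> * (\<Sum>k<d. real (k + 2)) + C1 * L * (\<Sum>k. real (k + d + 2) * (r0 / r) ^ (k + d + 1)) \<le> \<eta>"
      using \<theta>W[of "\<Sum>k<d. real (k + 2)"] W d(1) unfolding W_def by linarith
    have e2: "\<theta> * (real (d + 1))\<^sup>2 + 3 * L\<^sup>2 * (r0 / r) ^ (d + 1) / (1 - r0 / r)\<^sup>2 + C1\<^sup>2 * (r0\<^sup>2) ^ (d + 1) / (1 - r0\<^sup>2) \<le> \<eta>"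
      using \<theta>W[of "(real (d + 1))\<^sup>2"] W d(2) unfolding W_def times_divide_eq_left by linarith
    let ?mu = "abs_moment N chi"
    let ?F = "sparse_moments.fluctuation_const ?mu C1 d"
    have "\<forall>\<^sub>F n in sequentially. sparse_moments.walk_const ?mu (2 * k) (2 * k) 0 1 \<le> sqrt (real (K n))" for k
      using sqrtK unfolding filterlim_at_top by blast
    then have K_ev: "\<forall>\<^sub>F n in sequentially. \<forall>k\<in>{1..m1}. sparse_moments.walk_const ?mu (2 * k) (2 * k) 0 1 \<le> sqrt (real (K n))"
      by (intro eventually_ball_finite) auto
    have "\<forall>\<^sub>F n in sequentially. ?F / (p * \<theta>\<^sup>2) \<le> sqrt (real (K n))"
      using sqrtK unfolding filterlim_at_top by blast
    with ell_ev K_ev eventually_ge_at_top[of 1]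
    show "\<forall>\<^sub>F n in sequentially. measure (M n) {\<omega> \<in> space (M n). dist (?Z n \<omega>) 0 > \<delta>} < a"
    proof eventually_elim
      case (elim n)
      then have n: "1 \<le> n" by simp
      interpret sparse_moments "M n" n "K n" "x n" "sparse_moment N chi n (K n)" ?mu by (rule sm[OF n])
      let ?l = "cmod (\<Sum>i<n. cnj (vs n i) * us n i)"
      have l: "1 + 2 * \<epsilon> < ?l" using elim(1) unfolding ip(1)[OF n] .
      have ell: "1 + \<eta> \<le> r0 * ?l"
      proof -
        have "1 + \<eta> \<le> 1 + \<epsilon> / (1 + \<epsilon>)" using \<eta>(4) by simp
        also have "\<dots> = r0 * (1 + 2 * \<epsilon>)" using eps(1) by (simp add: r0_def field_simps)
        also have "\<dots> \<le> r0 * ?l" using l r by (intro mult_left_mono) auto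
        finally show ?thesis .
      qed
      have s0u: "s0 \<le> (l2norm n (us n))\<^sup>2"
      proof -
        have "1 \<le> ?l" using l eps(1) by linarith
        also have "\<dots> \<le> l2norm n (vs n) * l2norm n (us n)" by (rule inner_le_l2norm)
        also have "\<dots> \<le> C1 * l2norm n (us n)" using norms[OF n] by (intro mult_right_mono l2norm_nonneg)
        finally have "1 / C1 \<le> l2norm n (us n)" using C1 by (simp add: field_simps)
        then have "(1 / C1)\<^sup>2 \<le> (l2norm n (us n))\<^sup>2" using C1 by (intro power_mono) auto
        then show ?thesis by (simp add: s0_def power_divide)
      qed
      have Kn: "0 < sqrt (real (K n))" using K(1) by simp
      have fluct: "?F / sqrt (real (K n)) / \<theta>\<^sup>2 \<le> p"
        using elim(4) p \<theta> Kn by (simp add: field_simps)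
      have "measure (M n) {\<omega> \<in> space (M n). dist (?Z n \<omega>) 0 > \<delta>} = prob {\<omega> \<in> space (M n). \<delta> <
          \<bar>(cmod (herm_ip (u' n \<omega>) (complex_of_real (1 / l2norm n (us n)) \<cdot>\<^sub>v Matrix.vec n (us n))))\<^sup>2 - (1 - 1 / ?l\<^sup>2)\<bar>}"
        unfolding dist_real_def u_vec[OF n] norms(3)[OF n] ip(2)[OF n] by simp
      also have "\<dots> \<le> 1 / (1 - R) / M1 + TE / T + ME / M3 + ?F / sqrt (real (K n)) / \<theta>\<^sup>2"
        unfolding TE_def ME_def
      proof (rule overlap_probability[OF C1(1) norms(1,2)[OF n] r pos \<theta> _ m1 L_def e1 e2 ell s0 s0u \<eta>(3,2) eps0 _ \<eta>\<delta>])
        show "walk_const (2 * k) (2 * k) 0 1 \<le> sqrt (real (K n))" if "1 \<le> k" "k \<le> m1" for k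
          using elim(2) that by simp
        show "outlier_eigenvector \<epsilon> (Matrix.mat n n (\<lambda>(i, j). x n (i, j) \<omega> + us n i * cnj (vs n j))) (u' n \<omega>)"
          if "\<omega> \<in> space (M n)" for \<omega> using u'[OF n that] unfolding Y' .
      qed
      also have "\<dots> \<le> p + p + p + p" by (intro add_mono probs fluct)
      also have "\<dots> < a" using a by (simp add: p_def)
      finally show ?case .
    qed
  qed
  then show ?thesis unfolding tendsto_in_probability_def using measurable by blast
qed

end
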